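(* Let $m_2\ge m_1\ge 2$ be integers and let $d=m_1+m_2$. Then one has the following. (1) The set $A(\tilde{L}(m_1,m_2))$ is smooth, irreducible of dimension $d+4$. (2) $\tau(\tilde{L}(m_1,m_2))=(d-1)^2-m_1m_2+1.$ (3) The function $mdr$ is constant on $A(\tilde{L}(m_1,m_2))$ and takes the value $m_1$. (4) The intersection $FA(d) \cap A(\tilde{L}(m_1,m_2))$ is empty, where $FA(d)\subset A(d)$ is the set of free arrangements of $d$ lines.
   Context: $S=\mathbb{C}[x,y,z]$, $S_m$ its degree $m$ part. $A(d)\subset\mathbb{P}(S_d)$ is the space of arrangements $\mathcal{A}:f=0$ of $d$ distinct lines in the complex projective plane ($f$ a product of $d$ pairwise non-proportional linear forms). For an intersection lattice $L$, $A(L)\subset A(d)$ is the set of arrangements with intersection lattice isomorphic to $L$. $\tilde{L}(m_1,m_2)$ is the lattice of an arrangement obtained by the generic intersection of two pencils of $m_1$, respectively $m_2$, lines: a corresponding arrangement has $d=m_1+m_2$ lines, $m_1m_2$ double points (each line of the first pencil meeting each line of the second in a double point), one point of multiplicity $m_1$ and one point of multiplicity $m_2$. $\tau(L)=\sum_p(m_p-1)^2$, sum over the multiple points $p$ of $L$, of multiplicity $m_p\ge2$. $AR(f)$ is the graded $S$-module of triples $(a,b,c)\in S^3$ with $af_x+bf_y+cf_z=0$; $mdr(f)$ is the smallest $r\ge0$ such that $AR(f)$ contains a nonzero triple with entries in $S_r$. The arrangement $f=0$ is free if $AR(f)\cong S(-d_1)\oplus S(-d_2)$ for some integers $0\le d_1\le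 d_2$. *)

theory Defs
  imports "HOL-Analysis.Analysis" "HOL-Library.Poly_Mapping"
begin

section \<open>Polynomials\<close>

type_synonym 'v mpoly = "('v \<Rightarrow>\<^sub>0 nat) \<Rightarrow>\<^sub>0 complex"

text \<open>The ring \<open>S = \<complex>[x, y, z]\<close>; the three variables are indexed by the three-element type \<open>3\<close>.\<close>
type_synonym S = "3 mpoly"

definition pscale :: "complex \<Rightarrow> ('v \<Rightarrow>\<^sub>0 complex) \<Rightarrow> ('v \<Rightarrow>\<^sub>0 complex)" where
  "pscale c f = Poly_Mapping.map ((*) c) f"

lemma lookup_pscale: "Poly_Mapping.lookup (pscale c f) v = c * Poly_Mapping.lookup f v"
  by (simp add: pscale_def map.rep_eq when_def)

lemma vector_space_pscale: "vector_space pscale"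
  by unfold_locales
    (auto intro!: poly_mapping_eqI simp: lookup_pscale lookup_add algebra_simps)

definition mdeg :: "('v \<Rightarrow>\<^sub>0 nat) \<Rightarrow> nat" where
  "mdeg m = (\<Sum>i\<in>Poly_Mapping.keys m. Poly_Mapping.lookup m i)"

text \<open>Homogeneous polynomials of degree \<open>r\<close>, including \<open>0\<close>; on type \<open>S\<close> this is \<open>S\<^sub>r\<close>.\<close>
definition homog :: "nat \<Rightarrow> 'v mpoly set" where
  "homog r = {F. \<forall>m\<in>Poly_Mapping.keys F. mdeg m = r}"

definition eval_mpoly :: "'v mpoly \<Rightarrow> ('v \<Rightarrow> complex) \<Rightarrow> complex" where
  "eval_mpoly F a = (\<Sum>m\<in>Poly_Mapping.keys F. Poly_Mapping.lookup F m *
      (\<Prod>i\<in>Poly_Mapping.keys m. a i ^ Poly_Mapping.lookup m i))"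

definition pderiv_mpoly :: "'v \<Rightarrow> 'v mpoly \<Rightarrow> 'v mpoly" where
  "pderiv_mpoly i F = (\<Sum>m\<in>Poly_Mapping.keys F.
      Poly_Mapping.single (m - Poly_Mapping.single i 1)
        (of_nat (Poly_Mapping.lookup m i) * Poly_Mapping.lookup F m))"


section \<open>Projective spaces and the Zariski topology\<close>

text \<open>
  A vector with coordinates indexed by \<open>'v\<close> is a finitely supported function \<open>'v \<Rightarrow>\<^sub>0 complex\<close>.
  For a linear subspace \<open>W\<close> of such vectors, a point of \<open>\<P>(W)\<close> is a one-dimensional subspace,
  given as a set of vectors. Polynomial functions on \<open>W\<close> are elements of \<open>'v mpoly\<close>.
  Below \<open>W = S\<^sub>d = homog d\<close>, whose coordinates are the coefficients of a ternary form, so that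
  \<open>'v\<close> is the type of monomials of \<open>S\<close> (coefficients in degrees other than \<open>d\<close> vanish on \<open>W\<close>).
\<close>

definition proj_pt :: "('v \<Rightarrow>\<^sub>0 complex) \<Rightarrow> ('v \<Rightarrow>\<^sub>0 complex) set" where
  "proj_pt f = {pscale c f | c. True}"

definition basic_open ::
    "('v \<Rightarrow>\<^sub>0 complex) set \<Rightarrow> 'v mpoly \<Rightarrow> ('v \<Rightarrow>\<^sub>0 complex) set set" where
  "basic_open W F = proj_pt ` {f\<in>W. f \<noteq> 0 \<and> eval_mpoly F (Poly_Mapping.lookup f) \<noteq> 0}"

definition zariski :: "('v \<Rightarrow>\<^sub>0 complex) set \<Rightarrow> ('v \<Rightarrow>\<^sub>0 complex) set topology" where
  "zariski W = topology_generated_by {basic_open W F | F r. F \<in> homog r}"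

definition irreducible_in :: "'a topology \<Rightarrow> 'a set \<Rightarrow> bool" where
  "irreducible_in T Z \<longleftrightarrow> Z \<subseteq> topspace T \<and> Z \<noteq> {} \<and>
     (\<forall>A B. closedin T A \<and> closedin T B \<and> Z \<subseteq> A \<union> B \<longrightarrow> Z \<subseteq> A \<or> Z \<subseteq> B)"

definition locally_closed_in :: "'a topology \<Rightarrow> 'a set \<Rightarrow> bool" where
  "locally_closed_in T X \<longleftrightarrow> (\<exists>U C. openin T U \<and> closedin T C \<and> X = U \<inter> C)"

definition irred_closed_chain :: "'a topology \<Rightarrow> nat \<Rightarrow> (nat \<Rightarrow> 'a set) \<Rightarrow> bool" where
  "irred_closed_chain T n Z \<longleftrightarrow>
     (\<forall>i\<le>n. closedin T (Z i) \<and> irreducible_in T (Z i)) \<and> (\<forall>i<n. Z i \<subset> Z (Suc i))"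

definition krull_dim :: "'a topology \<Rightarrow> enat" where
  "krull_dim T = Sup {enat n | n. \<exists>Z. irred_closed_chain T n Z}"

text \<open>For a variety and a closed point \<open>p\<close> this is the Krull dimension of the local ring at \<open>p\<close>.\<close>
definition local_dim :: "'a topology \<Rightarrow> 'a \<Rightarrow> enat" where
  "local_dim T p = Sup {enat n | n. \<exists>Z. irred_closed_chain T n Z \<and> p \<in> Z 0}"

text \<open>
  The affine cone over the embedded projective tangent space of \<open>X \<subseteq> \<P>(W)\<close> at the point \<open>[f]\<close>:
  the common kernel in \<open>W\<close> of the differentials at \<open>f\<close> of all forms vanishing on \<open>X\<close>.
  Its dimension is one more than that of the Zariski tangent space.
\<close>
definition tangent_cone_space ::
    "('v \<Rightarrow>\<^sub>0 complex) set \<Rightarrow> ('v \<Rightarrow>\<^sub>0 complex) set set \<Rightarrow> ('v \<Rightarrow>\<^sub>0 complex) \<Rightarrow> ('v \<Rightarrow>\<^sub>0 complex) set" where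
  "tangent_cone_space W X f = {v\<in>W. \<forall>r. \<forall>F\<in>homog r.
      (\<forall>g. proj_pt g \<in> X \<longrightarrow> eval_mpoly F (Poly_Mapping.lookup g) = 0) \<longrightarrow>
      (\<Sum>i\<in>Poly_Mapping.keys v.
         eval_mpoly (pderiv_mpoly i F) (Poly_Mapping.lookup f) * Poly_Mapping.lookup v i) = 0}"

text \<open>
  Smooth (reduced) quasi-projective variety, possibly reducible: at every point the Zariski
  tangent space has the dimension of the local ring.
\<close>
definition smooth_subvariety ::
    "('v \<Rightarrow>\<^sub>0 complex) set \<Rightarrow> ('v \<Rightarrow>\<^sub>0 complex) set set \<Rightarrow> bool" where
  "smooth_subvariety W X \<longleftrightarrow> locally_closed_in (zariski W) X \<and>
     (\<forall>f. proj_pt f \<in> X \<longrightarrow>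
        enat (vector_space.dim pscale (tangent_cone_space W X f))
          = local_dim (subtopology (zariski W) X) (proj_pt f) + 1)"


section \<open>Line arrangements and intersection lattices\<close>

text \<open>
  Lines of \<open>\<P>\<^sup>2\<close> are represented by the corresponding planes through the origin of \<open>\<complex>\<^sup>3\<close>,
  points of \<open>\<P>\<^sup>2\<close> by nonzero vectors.
\<close>
definition line_of :: "S \<Rightarrow> (complex^3) set" where
  "line_of l = {v. eval_mpoly l (($) v) = 0}"

definition is_line :: "(complex^3) set \<Rightarrow> bool" where
  "is_line H \<longleftrightarrow> (\<exists>l\<in>homog 1. l \<noteq> 0 \<and> H = line_of l)"

text \<open>Defining polynomials of arrangements of \<open>d\<close> distinct lines.\<close>
definition arrangement_poly :: "nat \<Rightarrow> S \<Rightarrow> bool" where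
  "arrangement_poly d f \<longleftrightarrow> (\<exists>l :: nat \<Rightarrow> S.
      (\<forall>i<d. l i \<in> homog 1 \<and> l i \<noteq> 0) \<and>
      (\<forall>i<d. \<forall>j<d. i \<noteq> j \<longrightarrow> (\<nexists>c. l i = pscale c (l j))) \<and>
      f = (\<Prod>i<d. l i))"

definition lines :: "S \<Rightarrow> (complex^3) set set" where
  "lines f = line_of ` {l \<in> homog 1. l \<noteq> 0 \<and> l dvd f}"

text \<open>
  All intersections of subfamilies, ordered by reverse inclusion. The empty intersection \<open>UNIV\<close>
  is the least element; \<open>{0}\<close> represents the empty subset of \<open>\<P>\<^sup>2\<close>.
\<close>
definition intersection_lattice :: "'a set set \<Rightarrow> 'a set rel" where
  "intersection_lattice \<A> = {(\<Inter>\<B>, \<Inter>\<C>) | \<B> \<C>. \<B> \<subseteq> \<A> \<and> \<C> \<subseteq> \<A> \<and> \<Inter>\<C> \<subseteq> \<Inter>\<B>}"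

definition lattice_iso :: "'a rel \<Rightarrow> 'b rel \<Rightarrow> bool" where
  "lattice_iso L M \<longleftrightarrow> (\<exists>\<phi>. bij_betw \<phi> (Field L) (Field M) \<and>
     (\<forall>x\<in>Field L. \<forall>y\<in>Field L. (x, y) \<in> L \<longleftrightarrow> (\<phi> x, \<phi> y) \<in> M))"

text \<open>The set \<open>A(L)\<close>, inside \<open>A(d) = proj_pt ` {f. arrangement_poly d f} \<subseteq> \<P>(S\<^sub>d)\<close>.\<close>
definition arr_space_lattice :: "nat \<Rightarrow> 'a rel \<Rightarrow> S set set" where
  "arr_space_lattice d L =
     proj_pt ` {f. arrangement_poly d f \<and> lattice_iso (intersection_lattice (lines f)) L}"

definition lat_rank :: "'a rel \<Rightarrow> 'a \<Rightarrow> nat" where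
  "lat_rank L x = Max (card ` {C \<in> Chains L. C \<subseteq> underS L x})"

text \<open>The lines of \<open>L\<close> are its elements of rank 1, the multiple points those of rank 2.\<close>
definition lat_mult :: "'a rel \<Rightarrow> 'a \<Rightarrow> nat" where
  "lat_mult L p = card {a \<in> Field L. lat_rank L a = 1 \<and> (a, p) \<in> L}"

definition tau :: "'a rel \<Rightarrow> nat" where
  "tau L = (\<Sum>p\<in>{p \<in> Field L. lat_rank L p = 2}. (lat_mult L p - 1)\<^sup>2)"

text \<open>
  Generic intersection of a pencil \<open>\<P>\<close> of \<open>m1\<close> lines through \<open>p\<close> and a pencil \<open>\<Q>\<close> of \<open>m2\<close> lines
  through \<open>q\<close>: \<open>p\<close> and \<open>q\<close> have multiplicity exactly \<open>m1\<close> and \<open>m2\<close>, and a line of \<open>\<P>\<close> meets a line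
  of \<open>\<Q>\<close> in a point lying on no third line.
\<close>
definition generic_two_pencils :: "nat \<Rightarrow> nat \<Rightarrow> (complex^3) set set \<Rightarrow> bool" where
  "generic_two_pencils m1 m2 \<A> \<longleftrightarrow> (\<exists>\<P> \<Q> p q.
      \<A> = \<P> \<union> \<Q> \<and> \<P> \<inter> \<Q> = {} \<and> finite \<A> \<and> (\<forall>H\<in>\<A>. is_line H) \<and>
      card \<P> = m1 \<and> card \<Q> = m2 \<and> p \<noteq> 0 \<and> q \<noteq> 0 \<and>
      {H\<in>\<A>. p \<in> H} = \<P> \<and> {H\<in>\<A>. q \<in> H} = \<Q> \<and>
      (\<forall>H\<in>\<P>. \<forall>K\<in>\<Q>. {M\<in>\<A>. H \<inter> K \<subseteq> M} = {H, K}))"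

text \<open>
  Such arrangements exist and all have isomorphic lattices (for \<open>m1, m2 \<ge> 2\<close>), so the choice of
  the representative is immaterial.
\<close>
definition L_tilde :: "nat \<Rightarrow> nat \<Rightarrow> (complex^3) set rel" where
  "L_tilde m1 m2 = intersection_lattice (SOME \<A>. generic_two_pencils m1 m2 \<A>)"


section \<open>Jacobian syzygies and freeness\<close>

definition AR :: "S \<Rightarrow> (S^3) set" where
  "AR f = {a. (\<Sum>i\<in>UNIV. a $ i * pderiv_mpoly i f) = 0}"

definition mdr :: "S \<Rightarrow> nat" where
  "mdr f = (LEAST r. \<exists>a\<in>AR f. a \<noteq> 0 \<and> (\<forall>i. a $ i \<in> homog r))"

text \<open>The graded piece \<open>S(-e)\<^sub>k = S\<^bsub>k-e\<^esub>\<close>.\<close>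
definition shifted_homog :: "nat \<Rightarrow> nat \<Rightarrow> S set" where
  "shifted_homog e k = (if e \<le> k then homog (k - e) else {0})"

text \<open>
  An isomorphism \<open>S(-d1) \<oplus> S(-d2) \<cong> AR f\<close> of graded modules; a bijective degree-preserving
  homomorphism has a degree-preserving inverse.
\<close>
definition free_arrangement :: "S \<Rightarrow> bool" where
  "free_arrangement f \<longleftrightarrow> (\<exists>d1 d2. d1 \<le> d2 \<and>
     (\<exists>\<phi> :: S^2 \<Rightarrow> S^3. module_hom (*s) (*s) \<phi> \<and> bij_betw \<phi> UNIV (AR f) \<and>
        (\<forall>k u. u $ 1 \<in> shifted_homog d1 k \<and> u $ 2 \<in> shifted_homog d2 k \<longrightarrow>
           (\<forall>i. \<phi> u $ i \<in> homog k))))"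

definition free_arr_space :: "nat \<Rightarrow> S set set" where
  "free_arr_space d = proj_pt ` {f. arrangement_poly d f \<and> free_arrangement f}"

end

theory Submission
  imports Defs "Jordan_Normal_Form.Determinant" "HOL-Computational_Algebra.Fundamental_Theorem_Algebra"
begin

no_notation vec_index (infixl "$" 100)
hide_const (open) Module.smult

text \<open>
  A member of the family is a tuple \<open>L\<close> of \<open>d\<close> nonzero vectors (the lines) whose first \<open>m\<close> entries pass through
  one point and whose other entries pass through another one, without further coincidences: this is \<open>gt m d L\<close>.
  Its equation is the product \<open>fm d L\<close> of the linear forms, and \<open>XX m d\<close> is the set of these equations in
  projective space. An isomorphism of intersection lattices is induced by a bijection between the lines which preserves
  incidences (\<open>bij_if_lattice_iso\<close>), so \<open>XX m d\<close> is the set to be studied (\<open>arr_space_eq_XX\<close>).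

  Two tuples are joined by a polynomial curve with generic general point; hence a product of two forms that vanishes on
  \<open>XX m d\<close> has a factor that vanishes there (\<open>XX_prime\<close>), which is irreducibility. The dimension is at least
  \<open>d + 4\<close> because the members can be forced successively through points in general position
  (\<open>chain_through_point\<close>); it is at most \<open>d + 4\<close> because a chain of irreducible closed sets gives
  algebraically independent forms (\<open>chain_independent\<close>), whereas a dense part of \<open>XX m d\<close> is the image of a
  polynomial map in \<open>d + 4\<close> variables. That the set is locally closed follows by eliminating the lines from their
  equations: they are recovered from the roots of the restrictions of the form to two fixed lines of the plane.

  In affine coordinates adapted to the two pencils the equation is \<open>C A(x) B(y)\<close>. A Jacobian syzygy is then
  \<open>(x c + \<alpha> A, y c + \<beta> B, c)\<close> with \<open>c = - (\<alpha> A' + \<beta> B') / d\<close>, so that only the degrees of the cofactors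
  \<open>\<alpha>\<close>, \<open>\<beta>\<close> have to be controlled; the least degree is \<open>m\<close>, the smaller number of lines,
  attained by \<open>\<theta>1\<close> with cofactors \<open>(1, 0)\<close>. Let \<open>\<theta>2\<close>, \<open>\<theta>3\<close> be the syzygies with cofactors
  \<open>(0, 1)\<close> and \<open>(y^(n - 1), x^(m - 1))\<close>, where \<open>n = d - m\<close>. In terms of the linear forms with
  \<open>x = a / w\<close>, \<open>y = b / w\<close> there is a relation \<open>w \<theta>3 = b^(n - 1) \<theta>1 + a^(m - 1) \<theta>2\<close>. In a free module it would force the coordinates of
  \<open>\<theta>1\<close> into the ideal generated by \<open>a^(m - 1)\<close> and \<open>w\<close>, making \<open>\<theta>1\<close> a combination of
  syzygies of smaller degree, of which there are none (\<open>not_free\<close>).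

  The space of syzygies of given degree has the same dimension for all members. Thus the rank of the Jacobian operator
  is constant, and its minors of larger size are forms vanishing on the family; their differentials say that a syzygy
  extends to first order along each tangent vector (\<open>tangent_syzygy\<close>). For \<open>\<theta>1\<close> and \<open>\<theta>2\<close> this confines
  the Newton polygon of a tangent vector and makes it vanish at the double points, so that \<open>d + 5\<close> coordinates
  determine it (\<open>Phi_injective\<close>). Conversely \<open>d + 5\<close> explicit deformations of the lines are independent
  (\<open>ee_independent\<close>), and the family is smooth.
\<close>

lemmas vec_ext = Finite_Cartesian_Product.vec_eq_iff

section \<open>Substitution homomorphisms\<close>

abbreviation "lk \<equiv> Poly_Mapping.lookup"
abbreviation "kys == Poly_Mapping.keys"
abbreviation "sg \<equiv> Poly_Mapping.single"

definition chom :: "(complex => 'r::comm_ring_1) => bool" where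
  "chom C \<longleftrightarrow> C 1 = 1 & (ALL x y. C (x + y) = C x + C y) & (ALL x y. C (x * y) = C x * C y)"

definition pmon :: "('v => 'r::comm_ring_1) => ('v \<Rightarrow>\<^sub>0 nat) => 'r" where
  "pmon a m = (\<Prod>i\<in>kys m. a i ^ lk m i)"

definition subst :: "(complex => 'r::comm_ring_1) => ('v => 'r) => 'v mpoly => 'r" where
  "subst C a F = (\<Sum>m\<in>kys F. C (lk F m) * pmon a m)"

lemma eval_mpoly_subst: "eval_mpoly F a = subst (\<lambda>c. c) a F"
  by (simp add: eval_mpoly_def subst_def pmon_def)

lemma chom_id: "chom (\<lambda>c. c)"
  by (simp add: chom_def)

lemma chom_simps:
  assumes "chom C"
  shows "C 0 = 0" "C 1 = 1" "C (x + y) = C x + C y" "C (x * y) = C x * C y"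
    "C (- x) = - C x" "C (x - y) = C x - C y" "C (of_nat n) = of_nat n"
    "C (sum f A) = (\<Sum>i\<in>A. C (f i))"
proof -
  have ad: "C (x + y) = C x + C y" for x y using assms by (simp add: chom_def)
  show z: "C 0 = 0" using ad[of 0 0] by simp
  show o: "C 1 = 1" using assms by (simp add: chom_def)
  show "C (x + y) = C x + C y" by (rule ad)
  show "C (x * y) = C x * C y" using assms by (simp add: chom_def)
  show m: "C (- x) = - C x" for x using ad[of x "-x"] z by (simp add: eq_neg_iff_add_eq_0 add.commute)
  show "C (x - y) = C x - C y" using ad[of x "-y"] m[of y] by simp
  show "C (of_nat n) = of_nat n" by (induction n) (simp_all add: z o ad)
  show "C (sum f A) = (\<Sum>i\<in>A. C (f i))"
    by (induction A rule: infinite_finite_induct) (simp_all add: z ad)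
qed

lemma pmon_superset:
  assumes "finite A" "kys m \<subseteq> A"
  shows "pmon a m = (\<Prod>i\<in>A. a i ^ lk m i)"
  unfolding pmon_def
  by (rule prod.mono_neutral_left) (use assms in \<open>auto simp: in_keys_iff\<close>)

lemma pmon_0 [simp]: "pmon a 0 = 1"
  by (simp add: pmon_def)

lemma pmon_add: "pmon a (m + n) = pmon a m * pmon a n"
proof -
  let ?A = "kys m \<union> kys n"
  have "pmon a (m + n) = (\<Prod>i\<in>?A. a i ^ lk (m + n) i)"
    by (rule pmon_superset) (simp_all add: keys_add)
  also have "\<dots> = (\<Prod>i\<in>?A. a i ^ lk m i) * (\<Prod>i\<in>?A. a i ^ lk n i)"
    by (simp add: lookup_add power_add prod.distrib)
  also have "\<dots> = pmon a m * pmon a n"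
    by (subst (1 2) pmon_superset[of ?A]) simp_all
  finally show ?thesis .
qed

lemma pmon_single [simp]: "pmon a (sg i k) = a i ^ k"
  by (subst pmon_superset[of "{i}"]) (auto simp: lookup_single)

lemma subst_superset:
  assumes "chom C" "finite A" "kys F \<subseteq> A"
  shows "subst C a F = (\<Sum>m\<in>A. C (lk F m) * pmon a m)"
  unfolding subst_def
  by (rule sum.mono_neutral_left)
     (use assms in \<open>auto simp: in_keys_iff chom_simps[OF assms(1)]\<close>)

lemma subst_0 [simp]: "subst C a 0 = 0"
  by (simp add: subst_def)

lemma subst_add:
  assumes "chom C"
  shows "subst C a (F + G) = subst C a F + subst C a G"
proof -
  let ?A = "kys F \<union> kys G"
  have "subst C a (F + G) = (\<Sum>m\<in>?A. C (lk (F + G) m) * pmon a m)"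
    by (rule subst_superset) (simp_all add: assms keys_add)
  also have "\<dots> = (\<Sum>m\<in>?A. C (lk F m) * pmon a m) + (\<Sum>m\<in>?A. C (lk G m) * pmon a m)"
    by (simp add: lookup_add chom_simps[OF assms] distrib_right sum.distrib)
  also have "\<dots> = subst C a F + subst C a G"
    by (subst (1 2) subst_superset[OF assms, of ?A]) simp_all
  finally show ?thesis .
qed

lemma subst_sum:
  assumes "chom C"
  shows "subst C a (\<Sum>i\<in>I. F i) = (\<Sum>i\<in>I. subst C a (F i))"
  by (induction I rule: infinite_finite_induct) (simp_all add: subst_add[OF assms])

lemma subst_single:
  assumes "chom C"
  shows "subst C a (sg m c) = C c * pmon a m"
  by (subst subst_superset[OF assms, of "{m}"]) (auto simp: lookup_single)

lemma poly_mapping_decompose: "(F::'k \<Rightarrow>\<^sub>0 'a::comm_monoid_add) = (\<Sum>m\<in>kys F. sg m (lk F m))"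
proof (rule poly_mapping_eqI)
  fix k
  have "lk (\<Sum>m\<in>kys F. sg m (lk F m)) k = (\<Sum>m\<in>kys F. if m = k then lk F m else 0)"
    unfolding lookup_sum by (rule sum.cong) (auto simp: lookup_single when_def)
  also have "\<dots> = lk F k"
    by (simp add: sum.delta in_keys_iff)
  finally show "lk F k = lk (\<Sum>m\<in>kys F. sg m (lk F m)) k" by simp
qed

lemma subst_mult:
  assumes "chom C"
  shows "subst C a (F * G) = subst C a F * subst C a G"
proof -
  have "F * G = (\<Sum>m\<in>kys F. \<Sum>n\<in>kys G. sg (m + n) (lk F m * lk G n))"
    by (subst (1) poly_mapping_decompose[of F], subst (1) poly_mapping_decompose[of G])
       (simp add: sum_product mult_single)
  then show ?thesis
    by (simp add: subst_sum[OF assms] subst_single[OF assms] chom_simps[OF assms] pmon_add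
        subst_def[of C a F] subst_def[of C a G] sum_product mult.assoc mult.left_commute)
qed

lemma subst_1: "chom C ==> subst C a 1 = 1"
  using subst_single[of C a 0 1] by (simp add: chom_simps)

lemma subst_prod: "chom C ==> subst C a (\<Prod>i\<in>I. F i) = (\<Prod>i\<in>I. subst C a (F i))"
  by (induction I rule: infinite_finite_induct) (simp_all add: subst_mult subst_1)

lemma subst_power: "chom C ==> subst C a (F ^ n) = subst C a F ^ n"
  by (induction n) (simp_all add: subst_mult subst_1)

lemma pscale_conv_mult: "pscale c F = sg 0 c * (F::'v mpoly)"
  unfolding pscale_def by (rule mult_map_scale_conv_mult)

lemma subst_pscale: "chom C ==> subst C a (pscale c F) = C c * subst C a F"
  by (simp add: pscale_conv_mult subst_mult subst_single)

lemma subst_uminus: "chom C ==> subst C a (- F) = - subst C a F"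
  using subst_add[of C a F "-F"] by (simp add: eq_neg_iff_add_eq_0 add.commute)

lemma subst_diff: "chom C ==> subst C a (F - G) = subst C a F - subst C a G"
  using subst_add[of C a F "-G"] by (simp add: subst_uminus)

lemma subst_comp:
  fixes a :: "'v => 'r::comm_ring_1" and h :: "'r => 's::comm_ring_1"
  assumes "chom C" "chom C'" and h: "h 0 = 0" "!!x y. h (x + y) = h x + h y" "!!x y. h (x * y) = h x * h y" "h 1 = 1"
    and "!!c. h (C c) = C' c"
  shows "h (subst C a F) = subst C' (\<lambda>i. h (a i)) F"
proof -
  have hpw: "h (x ^ n) = h x ^ n" for x n by (induction n) (simp_all add: h)
  have hm: "h (pmon a m) = pmon (\<lambda>i. h (a i)) m" for m
  proof -
    have "h (prod g A) = (\<Prod>i\<in>A. h (g i))" for g and A :: "'v set"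
      by (induction A rule: infinite_finite_induct) (simp_all add: h)
    then show ?thesis by (simp add: pmon_def hpw)
  qed
  have hs': "h (sum g A) = (\<Sum>i\<in>A. h (g i))" for g and A :: "('v \<Rightarrow>\<^sub>0 nat) set"
    by (induction A rule: infinite_finite_induct) (simp_all add: h)
  show ?thesis
    unfolding subst_def by (simp add: hs' h hm assms)
qed

lemma chom_S: "chom (sg 0 :: complex => 'v mpoly)"
  by (simp add: chom_def single_add mult_single)

lemma chom_poly: "chom (\<lambda>c. [:c:])"
  by (simp add: chom_def one_pCons)

lemma chom_poly2: "chom (\<lambda>c. [:[:c:]:])"
  by (simp add: chom_def one_pCons)

lemma poly_subst_pCons:
  "poly (subst (\<lambda>c. [:c:]) q F) t = eval_mpoly F (\<lambda>i. poly (q i) t)"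
  unfolding eval_mpoly_subst
  by (rule subst_comp[where h="\<lambda>p. poly p t"]) (simp_all add: chom_poly chom_id)

lemmas eval_simps =
  subst_add[OF chom_id, folded eval_mpoly_subst] subst_mult[OF chom_id, folded eval_mpoly_subst]
  subst_sum[OF chom_id, folded eval_mpoly_subst] subst_prod[OF chom_id, folded eval_mpoly_subst]
  subst_power[OF chom_id, folded eval_mpoly_subst] subst_single[OF chom_id, folded eval_mpoly_subst]
  subst_1[OF chom_id, folded eval_mpoly_subst] subst_pscale[OF chom_id, folded eval_mpoly_subst]
  subst_uminus[OF chom_id, folded eval_mpoly_subst] subst_diff[OF chom_id, folded eval_mpoly_subst]
  subst_0[of "\<lambda>c. c", folded eval_mpoly_subst]

section \<open>Derivations\<close>

lemma mdeg_superset: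
  assumes "finite A" "kys m \<subseteq> A"
  shows "mdeg m = (\<Sum>i\<in>A. lk m i)"
  unfolding mdeg_def
  by (rule sum.mono_neutral_left) (use assms in \<open>auto simp: in_keys_iff\<close>)

lemma mdeg_add: "mdeg (m + n) = mdeg m + mdeg n"
proof -
  let ?A = "kys m \<union> kys n"
  have "mdeg (m + n) = (\<Sum>i\<in>?A. lk (m + n) i)"
    by (rule mdeg_superset) (simp_all add: keys_add)
  also have "\<dots> = mdeg m + mdeg n"
    by (subst (1 2) mdeg_superset[of ?A]) (simp_all add: lookup_add sum.distrib)
  finally show ?thesis .
qed

lemma mdeg_0 [simp]: "mdeg 0 = 0" by (simp add: mdeg_def)

lemma mdeg_single [simp]: "mdeg (sg i k) = k"
  by (subst mdeg_superset[of "{i}"]) (auto simp: lookup_single)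

lemma mdeg_eq_0_iff: "mdeg m = 0 \<longleftrightarrow> m = 0"
  by (auto simp: mdeg_def in_keys_iff intro!: poly_mapping_eqI)

lemma exponent_split:
  assumes "lk m j ~= (0::nat)"
  shows "m = (m - sg j 1) + sg j 1"
proof (rule poly_mapping_eqI)
  fix k show "lk m k = lk (m - sg j 1 + sg j 1) k"
    using assms by (cases "k = j") (simp_all add: lookup_add lookup_minus lookup_single when_def)
qed

lemma exponent_induct [case_names zero step]:
  assumes "P 0" "!!m j. P m ==> P (m + sg j (1::nat))"
  shows "P m"
proof (induction "mdeg m" arbitrary: m)
  case 0
  then show ?case using assms(1) by (simp add: mdeg_eq_0_iff)
next
  case (Suc n)
  then have "m ~= 0" by auto
  then obtain j where j: "lk m j ~= 0" by (metis lookup_zero poly_mapping_eqI)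
  note s = exponent_split[OF j]
  have "mdeg m = mdeg (m - sg j 1) + 1" by (subst s) (simp add: mdeg_add)
  then have "n = mdeg (m - sg j 1)" using Suc(2) by simp
  then have "P (m - sg j 1)" by (rule Suc(1))
  then show ?case using assms(2) s by metis
qed

lemma derivation_mon:
  fixes a :: "'v => 'r::comm_ring_1"
  assumes D: "!!x y. D (x + y) = D x + D y" "!!x y. D (x * y) = D x * y + x * D y"
    and I: "finite I" "!!i. i \<notin> I ==> D (a i) = 0"
  shows "D (pmon a m) = (\<Sum>i\<in>I. of_nat (lk m i) * pmon a (m - sg i 1) * D (a i))"
proof (induction m rule: exponent_induct)
  case zero
  have "D 1 = 0" using D(2)[of 1 1] by simp
  then show ?case by simp
next
  case (step m j)
  have e: "of_nat (lk (m + sg j 1) i) * pmon a (m + sg j 1 - sg i 1) * D (a i)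
      = of_nat (lk m i) * pmon a (m - sg i 1) * D (a i) * a j + (if i = j then pmon a m * D (a j) else 0)" for i
  proof (cases "i = j")
    case True
    have 1: "m + sg j 1 - sg j 1 = m" by simp
    have 2: "of_nat (lk m j) * pmon a (m - sg j 1) * a j = of_nat (lk m j) * pmon a m"
    proof (cases "lk m j = 0")
      case False
      have "pmon a m = pmon a (m - sg j 1 + sg j 1)" using exponent_split[OF False] by simp
      also have "\<dots> = pmon a (m - sg j 1) * a j" by (simp add: pmon_add)
      finally show ?thesis by (simp add: mult.assoc)
    qed simp
    then show ?thesis using True 1
      by (simp add: lookup_add lookup_single algebra_simps)
         (metis (no_types, opaque_lifting) mult.assoc mult.commute)
  next
    case False
    show ?thesis
    proof (cases "lk m i = 0")
      case True
      then show ?thesis using False by (simp add: lookup_add lookup_single)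
    next
      case n: False
      have "m + sg j 1 - sg i 1 = (m - sg i 1) + sg j 1"
        by (rule poly_mapping_eqI) (use n False in \<open>auto simp: lookup_add lookup_minus lookup_single when_def\<close>)
      then show ?thesis using False by (simp add: pmon_add lookup_add lookup_single mult_ac)
    qed
  qed
  have "D (pmon a (m + sg j 1)) = D (pmon a m) * a j + pmon a m * D (a j)"
    by (simp add: pmon_add D)
  also have "pmon a m * D (a j) = (\<Sum>i\<in>I. if i = j then pmon a m * D (a j) else 0)"
    using I by (cases "j \<in> I") simp_all
  finally show ?case unfolding e sum.distrib step by (simp add: sum_distrib_right)
qed

text \<open>The chain rule: a derivation applied to a polynomial expression. It serves for derivatives in the affine
  coordinates, for Euler's relation, and for tangents of polynomial curves of forms.\<close>
lemma derivation_subst: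
  fixes a :: "'v => 'r::comm_ring_1"
  assumes C: "chom C"
    and D: "!!x y. D (x + y) = D x + D y" "!!x y. D (x * y) = D x * y + x * D y" "!!c. D (C c) = 0"
    and I: "finite I" "!!i. i \<notin> I ==> D (a i) = 0"
  shows "D (subst C a F) = (\<Sum>i\<in>I. subst C a (pderiv_mpoly i F) * D (a i))"
proof -
  have D0: "D 0 = 0" using D(1)[of 0 0] by simp
  have Ds: "D (sum g A) = (\<Sum>i\<in>A. D (g i))" for g and A :: "('v \<Rightarrow>\<^sub>0 nat) set"
    by (induction A rule: infinite_finite_induct) (simp_all add: D D0)
  have "D (subst C a F) = (\<Sum>m\<in>kys F. C (lk F m) * D (pmon a m))"
    unfolding subst_def by (simp add: Ds D)
  also have "\<dots> = (\<Sum>m\<in>kys F. \<Sum>i\<in>I. C (lk F m) * (of_nat (lk m i) * pmon a (m - sg i 1) * D (a i)))"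
    by (simp add: derivation_mon[of D I a, OF D(1,2) I] sum_distrib_left)
  also have "\<dots> = (\<Sum>i\<in>I. \<Sum>m\<in>kys F. C (lk F m) * (of_nat (lk m i) * pmon a (m - sg i 1) * D (a i)))"
    by (rule sum.swap)
  also have "\<dots> = (\<Sum>i\<in>I. subst C a (pderiv_mpoly i F) * D (a i))"
    by (simp add: pderiv_mpoly_def subst_sum[OF C] subst_single[OF C] chom_simps[OF C]
        sum_distrib_left sum_distrib_right mult_ac)
  finally show ?thesis .
qed

lemma pderiv_mpoly_add: "pderiv_mpoly i (F + G) = pderiv_mpoly i F + pderiv_mpoly i G"
  and pderiv_mpoly_mult: "pderiv_mpoly i (F * G) = pderiv_mpoly i F * G + F * pderiv_mpoly i G"
proof -
  have sup: "pderiv_mpoly i F = (\<Sum>m\<in>A. sg (m - sg i 1) (of_nat (lk m i) * lk F m))"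
    if "finite A" "kys F \<subseteq> A" for A F
    unfolding pderiv_mpoly_def
    by (rule sum.mono_neutral_left) (use that in \<open>auto simp: in_keys_iff\<close>)
  have add: "pderiv_mpoly i (F + G) = pderiv_mpoly i F + pderiv_mpoly i G" for F G
  proof -
    let ?A = "kys F \<union> kys G"
    show ?thesis
      by (subst (1 2 3) sup[of ?A])
         (simp_all add: keys_add lookup_add distrib_left single_add sum.distrib)
  qed
  show "pderiv_mpoly i (F + G) = pderiv_mpoly i F + pderiv_mpoly i G" by (rule add)
  have pd0: "pderiv_mpoly i 0 = 0" by (simp add: pderiv_mpoly_def)
  have psum: "pderiv_mpoly i (sum g A) = (\<Sum>k\<in>A. pderiv_mpoly i (g k))" for g and A :: "('a \<Rightarrow>\<^sub>0 nat) set"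
    by (induction A rule: infinite_finite_induct) (simp_all add: pd0 add)
  have psg: "pderiv_mpoly i (sg m c) = sg (m - sg i 1) (of_nat (lk m i) * c)" for m c
    by (subst sup[of "{m}"]) (auto simp: lookup_single)
  have leib: "pderiv_mpoly i (sg m c * sg n e) = pderiv_mpoly i (sg m c) * sg n e + sg m c * pderiv_mpoly i (sg n e)" for m n c e
  proof -
    have 1: "sg (m - sg i 1 + n) (of_nat (lk m i) * c * e) = sg (m + n - sg i 1) (of_nat (lk m i) * c * e)" for m n c e
    proof (cases "lk m i = 0")
      case False
      have "m - sg i 1 + n = m + n - sg i 1"
        by (rule poly_mapping_eqI) (use False in \<open>auto simp: lookup_add lookup_minus lookup_single when_def\<close>)
      then show ?thesis by simp
    qed simp
    have 2: "sg (m + (n - sg i 1)) (c * (of_nat (lk n i) * e)) = sg (m + n - sg i 1) (c * (of_nat (lk n i) * e))"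
      using 1[of n m e c] by (simp add: add.commute mult_ac)
    have one': "sg (m - sg i 1 + n) (of_nat (lk m i) * c * e) = sg (m + n - sg i 1) (of_nat (lk m i) * c * e)"
      by (rule 1)
    have "pderiv_mpoly i (sg m c) * sg n e + sg m c * pderiv_mpoly i (sg n e)
       = sg (m - sg i 1 + n) (of_nat (lk m i) * c * e) + sg (m + (n - sg i 1)) (c * (of_nat (lk n i) * e))"
      by (simp only: psg mult_single)
    also have "\<dots> = sg (m + n - sg i 1) (of_nat (lk m i) * c * e + c * (of_nat (lk n i) * e))"
      by (simp only: one' 2 single_add)
    also have "of_nat (lk m i) * c * e + c * (of_nat (lk n i) * e) = of_nat (lk (m + n) i) * (c * e)"
      by (simp add: lookup_add algebra_simps)
    finally show ?thesis by (simp only: mult_single psg)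
  qed
  have "pderiv_mpoly i ((\<Sum>m\<in>A. sg m (c m)) * (\<Sum>n\<in>B. sg n (e n)))
      = pderiv_mpoly i (\<Sum>m\<in>A. sg m (c m)) * (\<Sum>n\<in>B. sg n (e n))
        + (\<Sum>m\<in>A. sg m (c m)) * pderiv_mpoly i (\<Sum>n\<in>B. sg n (e n))" for A B c e
    by (simp only: sum_product psum leib sum.distrib)
  from this[of "\<lambda>m. lk F m" "kys F" "\<lambda>m. lk G m" "kys G"]
  show "pderiv_mpoly i (F * G) = pderiv_mpoly i F * G + F * pderiv_mpoly i G"
    by (simp only: poly_mapping_decompose[symmetric])
qed

section \<open>Homogeneous polynomials and linear forms\<close>

lemma homog_0 [simp]: "0 \<in> homog r"
  by (simp add: homog_def)

lemma homog_lookup: "F \<in> homog r ==> mdeg m ~= r ==> lk F m = 0"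
  by (auto simp: homog_def in_keys_iff)

lemma homogI: "(!!m. lk F m ~= 0 ==> mdeg m = r) ==> F \<in> homog r"
  by (auto simp: homog_def in_keys_iff)

lemma homog_add: "F \<in> homog r ==> G \<in> homog r ==> F + G \<in> homog r"
  using keys_add[of F G] by (auto simp: homog_def)

lemma homog_uminus: "F \<in> homog r ==> - F \<in> homog r"
  by (auto simp: homog_def in_keys_iff)

lemma homog_diff: "F \<in> homog r ==> G \<in> homog r ==> F - G \<in> homog r"
  using homog_add[of F r "-G"] homog_uminus[of G r] by simp

lemma homog_sum: "(!!i. i \<in> A ==> F i \<in> homog r) ==> (\<Sum>i\<in>A. F i) \<in> homog r"
  by (induction A rule: infinite_finite_induct) (auto intro: homog_add)

lemma homog_mult: "F \<in> homog r ==> G \<in> homog s ==> F * G \<in> homog (r + s)"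
  using keys_mult[of F G] by (fastforce simp: homog_def mdeg_add)

lemma homog_single: "mdeg m = r ==> sg m c \<in> homog r"
  by (auto simp: homog_def)

lemma homog_1: "1 \<in> homog 0"
  by (auto simp: homog_def)

lemma homog_pscale: "F \<in> homog r ==> pscale c F \<in> homog r"
  by (rule homogI) (auto simp: lookup_pscale dest: homog_lookup)

lemma homog_prod: "(!!i. i \<in> A ==> F i \<in> homog (r i)) ==> (\<Prod>i\<in>A. F i) \<in> homog (\<Sum>i\<in>A. r i)"
  by (induction A rule: infinite_finite_induct) (auto intro: homog_mult homog_1)

lemma homog_power: "F \<in> homog r ==> F ^ n \<in> homog (n * r)"
  by (induction n) (auto intro: homog_mult homog_1)

lemma homog_pderiv:
  assumes "F \<in> homog r"
  shows "pderiv_mpoly i F \<in> homog (r - 1)"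
  unfolding pderiv_mpoly_def
proof (rule homog_sum)
  fix m assume "m \<in> kys F"
  then have m: "mdeg m = r" using assms by (auto simp: homog_def)
  show "sg (m - sg i 1) (of_nat (lk m i) * lk F m) \<in> homog (r - 1)"
  proof (cases "lk m i = 0")
    case False
    have "mdeg m = mdeg (m - sg i 1) + 1"
      by (subst exponent_split[OF False]) (simp add: mdeg_add)
    then show ?thesis using m by (intro homog_single) simp
  qed simp
qed

lemma lookup_mult_var:
  "lk (F * sg (sg i 1) c) m = (if lk m i = 0 then 0 else lk F (m - sg i 1) * c)"
    for F :: "'v mpoly"
proof -
  have "F * sg (sg i 1) c = (\<Sum>k\<in>kys F. sg (k + sg i 1) (lk F k * c))"
    by (subst (1) poly_mapping_decompose[of F]) (simp add: sum_distrib_right mult_single)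
  then have 1: "lk (F * sg (sg i 1) c) m = (\<Sum>k\<in>kys F. if k + sg i 1 = m then lk F k * c else 0)"
    by (simp add: lookup_sum lookup_single when_def)
  show ?thesis
  proof (cases "lk m i = 0")
    case True
    have "k + sg i 1 ~= m" for k
      using True by (metis add_is_0 lookup_add lookup_single_eq one_neq_zero)
    then show ?thesis using 1 True by simp
  next
    case False
    have "k + sg i 1 = m \<longleftrightarrow> k = m - sg i 1" for k
      using exponent_split[OF False] by (metis add_diff_cancel_right')
    then have "lk (F * sg (sg i 1) c) m = (\<Sum>k\<in>kys F. if k = m - sg i 1 then lk F k * c else 0)"
      using 1 by simp
    also have "\<dots> = lk F (m - sg i 1) * c"
      by (simp add: sum.delta in_keys_iff)
    finally show ?thesis using False by simp
  qed
qed

definition lin :: "complex^3 => S" where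
  "lin v = (\<Sum>i\<in>UNIV. sg (sg i 1) (v $ i))"

definition dot :: "complex^3 => complex^3 => complex" where
  "dot v u = v $ 1 * u $ 1 + v $ 2 * u $ 2 + v $ 3 * u $ 3"

definition cr :: "complex^3 => complex^3 => complex^3" where
  "cr u v = vector [u $ 2 * v $ 3 - u $ 3 * v $ 2, u $ 3 * v $ 1 - u $ 1 * v $ 3, u $ 1 * v $ 2 - u $ 2 * v $ 1]"

definition tri :: "complex^3 => complex^3 => complex^3 => complex" where
  "tri u v w = dot (cr u v) w"

lemma cr_nth [simp]:
  "cr u v $ 1 = u $ 2 * v $ 3 - u $ 3 * v $ 2"
  "cr u v $ 2 = u $ 3 * v $ 1 - u $ 1 * v $ 3"
  "cr u v $ 3 = u $ 1 * v $ 2 - u $ 2 * v $ 1"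
  by (simp_all add: cr_def)

lemma vec3_eq_iff: "(u::complex^3) = v \<longleftrightarrow> u $ 1 = v $ 1 & u $ 2 = v $ 2 & u $ 3 = v $ 3"
  by (simp add: vec_ext forall_3)

lemma tri_expand: "tri u v w = (u $ 2 * v $ 3 - u $ 3 * v $ 2) * w $ 1
   + (u $ 3 * v $ 1 - u $ 1 * v $ 3) * w $ 2 + (u $ 1 * v $ 2 - u $ 2 * v $ 1) * w $ 3"
  by (simp add: tri_def dot_def)

lemma lin_add: "lin (u + v) = lin u + lin v"
  by (simp add: lin_def single_add sum.distrib)

lemma lin_0 [simp]: "lin 0 = 0"
  by (simp add: lin_def)

lemma lin_scale: "lin (c *s v) = pscale c (lin v)"
  by (simp add: lin_def pscale_conv_mult sum_distrib_left mult_single)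

lemma subst_lin: "chom C ==> subst C a (lin v) = C (v $ 1) * a 1 + C (v $ 2) * a 2 + C (v $ 3) * a 3"
  by (simp add: lin_def subst_add subst_single sum_3)

lemma eval_lin: "eval_mpoly (lin v) (($) u) = dot v u"
  by (simp add: eval_mpoly_subst subst_lin chom_id dot_def)

lemma homog_lin: "lin v \<in> homog 1"
  unfolding lin_def by (intro homog_sum homog_single) simp

lemma single_inj_key: "sg x (Suc 0) = sg i (Suc 0) ==> x = i"
  by (metis lookup_single_eq lookup_single_not_eq nat.distinct(1))

lemma lookup_lin: "lk (lin v) (sg i 1) = v $ i"
proof -
  have "lk (lin v) (sg i 1) = (\<Sum>j\<in>UNIV. if j = i then v $ j else 0)"
    unfolding lin_def lookup_sum
    by (rule sum.cong) (auto simp: lookup_single when_def dest!: single_inj_key)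
  then show ?thesis by simp
qed

lemma lin_eq_iff: "lin u = lin v \<longleftrightarrow> u = v"
  by (metis lookup_lin vec_ext)

lemma lin_eq_0_iff [simp]: "lin v = 0 \<longleftrightarrow> v = 0"
  using lin_eq_iff[of v 0] by simp

lemma homog_1_lin:
  assumes "l \<in> homog 1"
  obtains v where "l = lin v"
proof
  show "l = lin (\<chi> i. lk l (sg i 1))"
  proof (rule poly_mapping_eqI)
    fix m
    show "lk l m = lk (lin (\<chi> i. lk l (sg i 1))) m"
    proof (cases "mdeg m = 1")
      case False
      then show ?thesis using assms homog_lin homog_lookup by metis
    next
      case True
      then have "m ~= 0" by auto
      then obtain j where j: "lk m j ~= 0" by (metis lookup_zero poly_mapping_eqI)
      have "mdeg m = mdeg (m - sg j 1) + 1"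
        by (subst exponent_split[OF j]) (simp add: mdeg_add)
      then have "m - sg j 1 = 0" using True by (simp add: mdeg_eq_0_iff)
      then have "m = sg j 1" using exponent_split[OF j] by simp
      then show ?thesis using lookup_lin by simp
    qed
  qed
qed

lemma homog_prod_lin: "finite A ==> (\<Prod>i\<in>A. lin (L i)) \<in> homog (card A)"
  using homog_prod[of A "\<lambda>i. lin (L i)" "\<lambda>_. 1"] homog_lin by simp

lemma lookup_mult_lin:
  "lk (F * lin v) m = (\<Sum>i\<in>UNIV. if lk m i = 0 then 0 else lk F (m - sg i 1) * v $ i)"
  unfolding lin_def sum_distrib_left lookup_sum
  by (rule sum.cong) (simp_all only: lookup_mult_var)

lemma lookup_prod_lin_graded:
  fixes L :: "'p => 'i => complex^3" and Q :: "nat => ('p => complex) => bool"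
  assumes z: "!!n. Q n (\<lambda>_. 0)" and o: "Q 0 (\<lambda>_. 1)"
    and ad: "!!n f g. Q n f ==> Q n g ==> Q n (\<lambda>y. f y + g y)"
    and mu: "!!n f g. Q n f ==> Q 1 g ==> Q (Suc n) (\<lambda>y. f y * g y)"
    and L: "!!i j. i \<in> A ==> Q 1 (\<lambda>y. L y i $ j)" and fin: "finite A"
  shows "Q (card A) (\<lambda>y. lk (\<Prod>i\<in>A. lin (L y i)) m)"
  using fin L
proof (induction A arbitrary: m)
  case empty
  then show ?case using z[of 0] o by (cases "m = 0") (simp_all add: lookup_one when_def)
next
  case (insert a A)
  let ?h = "\<lambda>i y. if lk m i = 0 then 0 else lk (\<Prod>i\<in>A. lin (L y i)) (m - sg i 1) * L y a $ i"
  have IH: "Q (card A) (\<lambda>y. lk (\<Prod>i\<in>A. lin (L y i)) m)" for m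
    using insert.prems by (intro insert.IH) auto
  have La: "Q 1 (\<lambda>y. L y a $ j)" for j using insert.prems by auto
  have s: "Q (Suc (card A)) (\<lambda>y. \<Sum>i\<in>B. ?h i y)" for B :: "3 set"
  proof (induction B rule: infinite_finite_induct)
    case (insert x F)
    have "Q (card A) (\<lambda>y. lk (\<Prod>i\<in>A. lin (L y i)) (m - sg x 1))"
      by (rule IH)
    then have "Q (Suc (card A)) (?h x)"
      using mu[OF _ La] z by (cases "lk m x = 0") auto
    then show ?case using insert ad by auto
  qed (simp_all add: z)
  have e: "lk (\<Prod>i\<in>insert a A. lin (L y i)) m = (\<Sum>i\<in>UNIV. ?h i y)" for y
    using insert by (simp add: mult.commute[of "lin (L y a)"] lookup_mult_lin)
  show ?case using s[of UNIV] unfolding e card_insert_disjoint[OF insert(1,2)] .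
qed

subsection \<open>Vanishing as a polynomial versus as a function\<close>

lemma inj_on_radix:
  fixes N :: nat
  assumes "a1 < N" "a2 < N" "a3 < N" "b1 < N" "b2 < N" "b3 < N"
    and "a1 + N * a2 + N^2 * a3 = b1 + N * b2 + N^2 * b3"
  shows "a1 = b1 & a2 = b2 & a3 = b3"
proof -
  have e: "a1 + N * (a2 + N * a3) = b1 + N * (b2 + N * b3)"
    using assms(7) by (simp add: power2_eq_square algebra_simps)
  have 1: "a1 = b1" using arg_cong[OF e, of "\<lambda>x. x mod N"] assms by simp
  then have e2: "a2 + N * a3 = b2 + N * b3" using e assms by simp
  have 2: "a2 = b2" using arg_cong[OF e2, of "\<lambda>x. x mod N"] assms by simp
  then show ?thesis using 1 e2 assms by simp
qed

text \<open>Distinct bounded exponents stay distinct after the substitution \<open>x = t, y = t^N, z = t^(N^2)\<close>, which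
  reduces the claim to polynomials in one variable.\<close>
lemma eval_zero_imp_zero:
  fixes F :: S
  assumes "!!u. eval_mpoly F (($) u) = 0"
  shows "F = 0"
proof (rule ccontr)
  assume "F ~= 0"
  then obtain m0 where m0: "lk F m0 ~= 0" by (metis lookup_zero poly_mapping_eqI)
  let ?K = "kys F"
  define N where "N = Suc (Max (mdeg ` ?K))"
  have le: "lk m i < N" if "m \<in> ?K" for m i
  proof -
    have "lk m i <= mdeg m"
    proof (cases "lk m i = 0")
      case False
      then show ?thesis unfolding mdeg_def by (intro member_le_sum) (auto simp: in_keys_iff)
    qed simp
    also have "\<dots> <= Max (mdeg ` ?K)" using that by (intro Max_ge) auto
    finally show ?thesis by (simp add: N_def)
  qed
  define code where "code m = lk m 1 + N * lk m 2 + N^2 * lk m 3" for m :: "3 \<Rightarrow>\<^sub>0 nat"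
  have inj: "m = m'" if "m \<in> ?K" "m' \<in> ?K" "code m = code m'" for m m'
    using inj_on_radix[OF le[OF that(1)] le[OF that(1)] le[OF that(1)] le[OF that(2)] le[OF that(2)] le[OF that(2)]
        that(3)[unfolded code_def]]
    by (intro poly_mapping_eqI) (metis (no_types) exhaust_3)
  define p where "p = (\<Sum>m\<in>?K. monom (lk F m) (code m))"
  have "poly p t = 0" for t
  proof -
    have "pmon (($) (vector [t, t^N, t^(N^2)])) m = t ^ code m" for m :: "3 \<Rightarrow>\<^sub>0 nat"
    proof -
      have "pmon (($) (vector [t, t^N, t^(N^2)])) m = (\<Prod>i\<in>UNIV. vector [t, t^N, t^(N^2)] $ i ^ lk m i)"
        by (rule pmon_superset) simp_all
      also have "\<dots> = t ^ lk m 1 * (t ^ N) ^ lk m 2 * (t ^ (N^2)) ^ lk m 3"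
        unfolding UNIV_3 by (simp add: vector_3 mult.assoc)
      also have "\<dots> = t ^ code m"
        by (simp only: code_def power_add power_mult)
      finally show ?thesis .
    qed
    then have "eval_mpoly F (($) (vector [t, t^N, t^(N^2)])) = (\<Sum>m\<in>?K. lk F m * t ^ code m)"
      by (simp add: eval_mpoly_subst subst_def)
    then show ?thesis using assms by (simp add: p_def poly_sum poly_monom)
  qed
  then have "p = 0" using poly_all_0_iff_0 by blast
  then have "coeff p (code m0) = 0" by simp
  moreover have "coeff p (code m0) = (\<Sum>m\<in>?K. if m = m0 then lk F m else 0)"
    unfolding p_def coeff_sum
    by (rule sum.cong) (use inj m0 in \<open>auto simp: in_keys_iff\<close>)
  ultimately show False using m0 by (simp add: in_keys_iff)
qed

subsection \<open>Linear algebra of three-vectors\<close>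

lemma tri_cyc: "tri u v w = tri v w u"
  and tri_swap: "tri u v w = - tri v u w"
  by (simp_all add: tri_expand algebra_simps)

lemma tri_same [simp]: "tri u u w = 0" "tri u w u = 0" "tri w u u = 0"
  by (simp_all add: tri_expand algebra_simps)

lemma cr_zero_iff: "cr u v = 0 \<longleftrightarrow> (ALL w. tri u v w = 0)"
proof
  assume a: "ALL w. tri u v w = 0"
  show "cr u v = 0"
    using a[rule_format, of "vector [1,0,0]"] a[rule_format, of "vector [0,1,0]"] a[rule_format, of "vector [0,0,1]"]
    by (simp add: tri_def dot_def vec3_eq_iff)
qed (simp add: tri_def dot_def)

lemma proportional_if_cr:
  assumes "u ~= 0" "cr u v = 0"
  obtains c where "v = c *s u"
proof -
  have e: "u $ 2 * v $ 3 = u $ 3 * v $ 2" "u $ 3 * v $ 1 = u $ 1 * v $ 3" "u $ 1 * v $ 2 = u $ 2 * v $ 1"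
    using assms(2) by (simp_all add: vec3_eq_iff)
  consider "u $ 1 ~= 0" | "u $ 2 ~= 0" | "u $ 3 ~= 0" using assms(1) by (auto simp: vec3_eq_iff)
  then show thesis
  proof cases
    case 1 then show thesis using e by (intro that[of "v $ 1 / u $ 1"]) (auto simp: vec3_eq_iff field_simps)
  next
    case 2 then show thesis using e by (intro that[of "v $ 2 / u $ 2"]) (auto simp: vec3_eq_iff field_simps)
  next
    case 3 then show thesis using e by (intro that[of "v $ 3 / u $ 3"]) (auto simp: vec3_eq_iff field_simps)
  qed
qed

lemma cramer3: "tri u v e *s w = tri w v e *s u + tri u w e *s v + tri u v w *s e"
  by (simp add: vec3_eq_iff tri_expand algebra_simps)

lemma span_if_tri:
  assumes "cr u v ~= 0" "tri u v w = 0"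
  obtains \<alpha> \<beta> where "w = \<alpha> *s u + \<beta> *s v"
proof -
  obtain e where e: "tri u v e ~= 0" using assms(1) cr_zero_iff by blast
  have "tri u v e *s w = tri w v e *s u + tri u w e *s v"
    using cramer3[of u v e w] assms(2) by simp
  then have "w = (tri w v e / tri u v e) *s u + (tri u w e / tri u v e) *s v"
    using e by (simp add: vec3_eq_iff field_simps)
  then show thesis by (rule that)
qed

definition dual_basis where
  "dual_basis a b w c d e \<longleftrightarrow> dot a c = 1 & dot a d = 0 & dot a e = 0 &
     dot b c = 0 & dot b d = 1 & dot b e = 0 & dot w c = 0 & dot w d = 0 & dot w e = 1"

lemma dual_basis_exists:
  assumes "tri a b w ~= 0"
  obtains c d e where "dual_basis a b w c d e"
proof
  let ?k = "1 / tri a b w"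
  show "dual_basis a b w (?k *s cr b w) (?k *s cr w a) (?k *s cr a b)"
    unfolding dual_basis_def using assms
    by (simp add: dot_def divide_simps) (simp add: tri_expand algebra_simps)
qed

lemma dual_basis_tri: "dual_basis a b w c d e ==> tri a b w * tri c d e = 1"
proof -
  assume "dual_basis a b w c d e"
  moreover have "tri a b w * tri c d e = dot a c * (dot b d * dot w e - dot b e * dot w d)
     - dot a d * (dot b c * dot w e - dot b e * dot w c) + dot a e * (dot b c * dot w d - dot b d * dot w c)"
    by (simp add: tri_expand dot_def algebra_simps)
  ultimately show ?thesis by (simp add: dual_basis_def)
qed

lemma dual_basis_expand:
  assumes "dual_basis a b w c d e"
  shows "u = dot a u *s c + dot b u *s d + dot w u *s e"
    "v = dot v c *s a + dot v d *s b + dot v e *s w"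
proof -
  have n: "tri c d e ~= 0" "tri a b w ~= 0" using dual_basis_tri[OF assms] by auto
  obtain x y z where u: "u = x *s c + y *s d + z *s e"
  proof
    show "u = (tri u d e / tri c d e) *s c + (tri c u e / tri c d e) *s d + (tri c d u / tri c d e) *s e"
      using cramer3[of c d e u] n by (simp add: vec3_eq_iff field_simps)
  qed
  have lr: "dot p (x *s c + y *s d + z *s e) = x * dot p c + y * dot p d + z * dot p e" for p
    by (simp add: dot_def algebra_simps)
  show "u = dot a u *s c + dot b u *s d + dot w u *s e"
    using assms u lr by (simp add: dual_basis_def)
  obtain x y z where v: "v = x *s a + y *s b + z *s w"
  proof
    show "v = (tri v b w / tri a b w) *s a + (tri a v w / tri a b w) *s b + (tri a b v / tri a b w) *s w"
      using cramer3[of a b w v] n by (simp add: vec3_eq_iff field_simps)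
  qed
  have "dot (x *s a + y *s b + z *s w) p = x * dot a p + y * dot b p + z * dot w p" for p
    by (simp add: dot_def algebra_simps)
  then show "v = dot v c *s a + dot v d *s b + dot v e *s w"
    using assms v by (simp add: dual_basis_def)
qed

subsection \<open>Linear factors of products of linear forms\<close>

lemma dot_add_scale: "dot v (x + t *s y) = dot v x + t * dot v y"
  by (simp add: dot_def algebra_simps)

lemma eval_prod_lin: "eval_mpoly (\<Prod>i\<in>A. lin (L i)) (($) u) = (\<Prod>i\<in>A. dot (L i) u)"
  by (simp add: eval_simps eval_lin)

lemma plane_basis:
  assumes "v ~= 0"
  obtains u1 u2 where "dot v u1 = 0" "dot v u2 = 0" "cr u1 u2 ~= 0"
    "!!w. dot w u1 = 0 ==> dot w u2 = 0 ==> cr v w = 0"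
proof -
  obtain p where p: "dot v p ~= 0"
  proof -
    have "v $ 1 ~= 0 \<or> v $ 2 ~= 0 \<or> v $ 3 ~= 0" using assms by (auto simp: vec3_eq_iff)
    then show ?thesis using that[of "vector [1,0,0]"] that[of "vector [0,1,0]"] that[of "vector [0,0,1]"]
      by (auto simp: dot_def)
  qed
  have "EX a. cr v a ~= 0"
  proof (rule ccontr)
    assume "\<not> ?thesis"
    then have "cr v (vector [1,0,0]) = 0" "cr v (vector [0,1,0]) = 0" by auto
    then show False using assms by (auto simp: vec3_eq_iff)
  qed
  then obtain a where "cr v a ~= 0" by blast
  then obtain b where "tri v a b ~= 0" using cr_zero_iff by blast
  then obtain c d e where D: "dual_basis v a b c d e" by (rule dual_basis_exists)
  show thesis
  proof (rule that[of d e])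
    show "dot v d = 0" "dot v e = 0" using D by (simp_all add: dual_basis_def)
    show "cr d e ~= 0" using dual_basis_tri[OF D] cr_zero_iff[of d e] tri_cyc[of d e c] tri_cyc[of c d e] by auto
    fix w assume "dot w d = 0" "dot w e = 0"
    then have w: "w = dot w c *s v" using dual_basis_expand(2)[OF D, of w] by (simp add: vec3_eq_iff)
    show "cr v w = 0" by (subst w) (simp add: vec3_eq_iff)
  qed
qed

lemma lin_dvd_prod_lin:
  assumes "finite A" "v ~= 0" "!!i. i \<in> A ==> L i ~= 0" "lin v dvd (\<Prod>i\<in>A. lin (L i))"
  obtains i where "i \<in> A" "cr v (L i) = 0"
proof (rule ccontr)
  assume no: "\<not> thesis"
  obtain u1 u2 where u: "dot v u1 = 0" "dot v u2 = 0"
    "!!w. dot w u1 = 0 ==> dot w u2 = 0 ==> cr v w = 0"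
    using plane_basis[OF assms(2)] by metis
  obtain g where g: "(\<Prod>i\<in>A. lin (L i)) = lin v * g" using assms(4) by (auto elim: dvdE)
  let ?p = "\<Prod>i\<in>A. [:dot (L i) u1, dot (L i) u2:]"
  have "poly ?p t = 0" for t
  proof -
    have "poly ?p t = (\<Prod>i\<in>A. dot (L i) (u1 + t *s u2))"
      by (simp add: poly_prod dot_add_scale)
    also have "\<dots> = eval_mpoly (lin v * g) (($) (u1 + t *s u2))"
      by (simp only: g[symmetric] eval_prod_lin)
    also have "\<dots> = 0" using u by (simp add: eval_simps eval_lin dot_add_scale)
    finally show ?thesis .
  qed
  then have "?p = 0" using poly_all_0_iff_0 by blast
  then obtain i where "i \<in> A" "dot (L i) u1 = 0" "dot (L i) u2 = 0"
    using assms(1) by (auto simp: prod_zero_iff)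
  then show False using no that u(3) by blast
qed

section \<open>The Zariski topology in terms of forms\<close>

abbreviation fev :: "'v mpoly => ('v \<Rightarrow>\<^sub>0 complex) => complex" where
  "fev F f \<equiv> eval_mpoly F (lk f)"

definition cone_set :: "('v \<Rightarrow>\<^sub>0 complex) set => bool" where
  "cone_set W \<longleftrightarrow> (ALL c. \<forall>f\<in>W. pscale c f \<in> W)"

definition proj_space :: "('v \<Rightarrow>\<^sub>0 complex) set => ('v \<Rightarrow>\<^sub>0 complex) set set" where
  "proj_space W = proj_pt ` {f\<in>W. f ~= 0}"

definition vanish :: "'v mpoly => ('v \<Rightarrow>\<^sub>0 complex) set set => bool" where
  "vanish F A \<longleftrightarrow> (ALL g. proj_pt g \<in> A --> fev F g = 0)"

lemma cone_homog: "cone_set (homog d :: 'v mpoly set)"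
  by (simp add: cone_set_def homog_pscale)

lemma pscale_1 [simp]: "pscale 1 f = f"
  by (rule poly_mapping_eqI) (simp add: lookup_pscale)

lemma pscale_pscale [simp]: "pscale a (pscale b f) = pscale (a * b) f"
  by (rule poly_mapping_eqI) (simp add: lookup_pscale)

lemma pscale_0 [simp]: "pscale 0 f = 0" "pscale c 0 = 0"
  by (rule poly_mapping_eqI, simp add: lookup_pscale)+

lemma pscale_eq_0_iff [simp]: "pscale c f = 0 \<longleftrightarrow> c = 0 \<or> f = 0"
  by (auto simp: poly_mapping_eq_iff fun_eq_iff lookup_pscale)

lemma proj_pt_self: "f \<in> proj_pt f"
  unfolding proj_pt_def by (rule CollectI, rule exI[of _ 1]) simp

lemma proj_pt_scale: "c ~= 0 ==> proj_pt (pscale c f) = proj_pt f"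
  unfolding proj_pt_def
  apply auto
  by (metis divide_self_if nonzero_eq_divide_eq pscale_1 pscale_pscale mult.commute times_divide_eq_right)

lemma proj_pt_eqD:
  assumes "proj_pt g = proj_pt f" "f ~= 0"
  obtains c where "c ~= 0" "g = pscale c f"
proof -
  have "g \<in> proj_pt f" using proj_pt_self[of g] assms by simp
  then obtain c where c: "g = pscale c f" by (auto simp: proj_pt_def)
  have "c ~= 0"
  proof
    assume "c = 0"
    then have "proj_pt f = {0}" using c assms(1)[symmetric] by (simp add: proj_pt_def)
    then show False using proj_pt_self[of f] assms(2) by simp
  qed
  then show thesis using c that by blast
qed

lemma eval_homog_scale:
  assumes "F \<in> homog r"
  shows "eval_mpoly F (\<lambda>i. c * a i) = c ^ r * eval_mpoly F a"
proof -
  have "pmon (\<lambda>i. c * a i) m = c ^ mdeg m * pmon a m" for m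
    by (simp add: pmon_def mdeg_def power_mult_distrib prod.distrib power_sum)
  then show ?thesis
    using assms unfolding eval_mpoly_subst subst_def sum_distrib_left
    by (intro sum.cong) (auto simp: homog_def)
qed

lemma fev_pscale: "F \<in> homog r ==> fev F (pscale c f) = c ^ r * fev F f"
  using eval_homog_scale[of F r c "lk f"] by (simp add: lookup_pscale[abs_def])

lemma proj_space_mem: "cone_set W ==> proj_pt f \<in> proj_space W \<longleftrightarrow> f \<in> W & f ~= 0"
proof
  assume W: "cone_set W" and "proj_pt f \<in> proj_space W"
  then obtain g where g: "proj_pt f = proj_pt g" "g \<in> W" "g ~= 0" by (auto simp: proj_space_def)
  obtain c where "c ~= 0" "f = pscale c g" using proj_pt_eqD[OF g(1,3)] .
  then show "f \<in> W & f ~= 0" using W g by (auto simp: cone_set_def)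
qed (auto simp: proj_space_def)

lemma basic_open_mem:
  assumes "cone_set W" "F \<in> homog r"
  shows "proj_pt f \<in> basic_open W F \<longleftrightarrow> f \<in> W & f ~= 0 & fev F f ~= 0"
proof
  assume "proj_pt f \<in> basic_open W F"
  then obtain g where g: "proj_pt f = proj_pt g" "g \<in> W" "g ~= 0" "fev F g ~= 0"
    by (auto simp: basic_open_def)
  obtain c where "c ~= 0" "f = pscale c g" using proj_pt_eqD[OF g(1,3)] .
  then show "f \<in> W & f ~= 0 & fev F f ~= 0"
    using assms g by (auto simp: cone_set_def fev_pscale)
qed (auto simp: basic_open_def)

lemma basic_open_sub: "basic_open W F \<subseteq> proj_space W"
  by (auto simp: basic_open_def proj_space_def)

lemma proj_space_ex: "x \<in> proj_space W ==> EX f. x = proj_pt f & f \<in> W & f ~= 0"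
  by (auto simp: proj_space_def)

lemma openin_zariski:
  assumes W: "cone_set W"
  shows "openin (zariski W) U \<longleftrightarrow> U \<subseteq> proj_space W &
    (ALL f. proj_pt f \<in> U --> (EX r. \<exists>F\<in>homog r. fev F f ~= 0 & basic_open W F \<subseteq> U))" (is "_ \<longleftrightarrow> ?R U")
proof
  assume "openin (zariski W) U"
  then have "generate_topology_on {basic_open W F | F r. F \<in> homog r} U"
    by (simp add: zariski_def openin_topology_generated_by)
  then show "?R U"
  proof (induction rule: generate_topology_on.induct)
    case Empty
    then show ?case by simp
  next
    case (Int a b)
    show ?case
    proof (intro conjI allI impI)
      show "a \<inter> b \<subseteq> proj_space W" using Int by auto
      fix f assume f: "proj_pt f \<in> a \<inter> b"
      then obtain r F s G where F: "F \<in> homog r" "fev F f ~= 0" "basic_open W F \<subseteq> a"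
        and G: "G \<in> homog s" "fev G f ~= 0" "basic_open W G \<subseteq> b" using Int by blast
      have "basic_open W (F * G) \<subseteq> a \<inter> b"
        using F(3) G(3) by (force simp: basic_open_def eval_simps)
      then show "EX r. \<exists>F\<in>homog r. fev F f ~= 0 & basic_open W F \<subseteq> a \<inter> b"
        using homog_mult[OF F(1) G(1)] F(2) G(2) by (metis eval_simps(2) mult_eq_0_iff)
    qed
  next
    case (UN K)
    then show ?case by (meson Sup_least UnionE Union_upper order_trans)
  next
    case (Basis s)
    then obtain F r where F: "s = basic_open W F" "F \<in> homog r" by blast
    then show ?case using basic_open_sub basic_open_mem[OF W F(2)] by blast
  qed
next
  assume R: "?R U"
  have op: "openin (zariski W) (basic_open W F)" if "F \<in> homog r" for F r
    unfolding zariski_def openin_topology_generated_by_iff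
    by (rule generate_topology_on.Basis) (use that in blast)
  have "U = \<Union>{basic_open W F |F r. F \<in> homog r & basic_open W F \<subseteq> U}" (is "_ = ?V")
  proof (intro equalityI subsetI)
    fix x assume x: "x \<in> U"
    then have "x \<in> proj_space W" using R by blast
    then obtain f where f: "x = proj_pt f" "f \<in> W" "f ~= 0" using proj_space_ex[of x W] by blast
    have "EX r. \<exists>F\<in>homog r. fev F f ~= 0 & basic_open W F \<subseteq> U" using R x f(1) by simp
    then obtain r F where F: "F \<in> homog r" "fev F f ~= 0" "basic_open W F \<subseteq> U" by blast
    then have "x \<in> basic_open W F" using f basic_open_mem[OF W F(1)] by simp
    then show "x \<in> ?V" using F by blast
  qed auto
  moreover have "openin (zariski W) ?V" using op by (intro openin_Union) auto
  ultimately show "openin (zariski W) U" by simp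
qed

lemma openin_basic: "cone_set W ==> F \<in> homog r ==> openin (zariski W) (basic_open W F)"
  unfolding zariski_def openin_topology_generated_by_iff
  by (rule generate_topology_on.Basis) blast

lemma topspace_zariski: "cone_set W ==> topspace (zariski W) = proj_space W"
proof -
  assume W: "cone_set W"
  have "openin (zariski W) (basic_open W 1)" by (rule openin_basic[OF W homog_1])
  moreover have "basic_open W 1 = proj_space W"
    by (auto simp: basic_open_def proj_space_def eval_simps)
  moreover have "topspace (zariski W) \<subseteq> proj_space W"
    using openin_zariski[OF W, of "topspace (zariski W)"] by simp
  ultimately show ?thesis by (metis openin_subset subset_antisym)
qed

lemma closedin_sub_zariski:
  assumes W: "cone_set W" and X: "X \<subseteq> proj_space W"
  shows "closedin (subtopology (zariski W) X) A \<longleftrightarrow> A \<subseteq> X &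
    (ALL f. proj_pt f \<in> X --> proj_pt f \<notin> A --> (EX r. \<exists>F\<in>homog r. fev F f ~= 0 & vanish F A))"
    (is "_ \<longleftrightarrow> ?R")
proof
  assume "closedin (subtopology (zariski W) X) A"
  then obtain B where B: "closedin (zariski W) B" "A = B \<inter> X" by (auto simp: closedin_subtopology)
  show ?R
  proof (intro conjI allI impI)
    show "A \<subseteq> X" using B by auto
    fix f assume f: "proj_pt f \<in> X" "proj_pt f \<notin> A"
    have "openin (zariski W) (proj_space W - B)"
      using B(1) by (simp add: closedin_def topspace_zariski[OF W])
    moreover have "proj_pt f \<in> proj_space W - B" using f B(2) X by auto
    ultimately obtain r F where F: "F \<in> homog r" "fev F f ~= 0" "basic_open W F \<subseteq> proj_space W - B"
      using openin_zariski[OF W] by metis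
    have "vanish F A"
      unfolding vanish_def
    proof (intro allI impI, rule ccontr)
      fix g assume g: "proj_pt g \<in> A" "fev F g ~= 0"
      then have "g \<in> W" "g ~= 0" using B X proj_space_mem[OF W] by auto
      then have "proj_pt g \<in> basic_open W F" using g basic_open_mem[OF W F(1)] by simp
      then show False using F(3) g B by auto
    qed
    then show "EX r. \<exists>F\<in>homog r. fev F f ~= 0 & vanish F A" using F by blast
  qed
next
  assume R: ?R
  let ?V = "\<Union>{basic_open W F |F r. F \<in> homog r & vanish F A}"
  have op: "openin (zariski W) ?V" using openin_basic[OF W] by (intro openin_Union) auto
  have sub: "?V \<subseteq> proj_space W" using basic_open_sub by blast
  have cl: "closedin (zariski W) (proj_space W - ?V)"
    unfolding closedin_def topspace_zariski[OF W] using op sub by (simp add: double_diff)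
  have "A = (proj_space W - ?V) \<inter> X"
  proof (intro equalityI subsetI)
    fix x assume x: "x \<in> A"
    then have "x \<in> proj_space W" using R X by blast
    then obtain f where f: "x = proj_pt f" "f \<in> W" "f ~= 0" using proj_space_ex[of x W] by blast
    have "x \<notin> basic_open W F" if "F \<in> homog r" "vanish F A" for F r
      using that x basic_open_mem[OF W that(1), of f] f by (auto simp: vanish_def)
    then have "x \<notin> ?V" by blast
    then show "x \<in> (proj_space W - ?V) \<inter> X" using x R X by blast
  next
    fix x assume x: "x \<in> (proj_space W - ?V) \<inter> X"
    then have "x \<in> proj_space W" by blast
    then obtain f where f: "x = proj_pt f" "f \<in> W" "f ~= 0" using proj_space_ex[of x W] by blast
    show "x \<in> A"
    proof (rule ccontr)
      assume "x \<notin> A"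
      then have "EX r. \<exists>F\<in>homog r. fev F f ~= 0 & vanish F A" using R x f(1) by simp
      then obtain r F where F: "F \<in> homog r" "fev F f ~= 0" "vanish F A" by blast
      then have "x \<in> basic_open W F" using f basic_open_mem[OF W F(1)] by simp
      then show False using x F by blast
    qed
  qed
  then show "closedin (subtopology (zariski W) X) A"
    using cl by (auto simp: closedin_subtopology)
qed

definition prime_on :: "('v \<Rightarrow>\<^sub>0 complex) set set => bool" where
  "prime_on A \<longleftrightarrow> (ALL r s. \<forall>F\<in>homog r. \<forall>G\<in>homog s. vanish (F * G) A --> vanish F A \<or> vanish G A)"

lemma zariski_as_subtopology:
  "cone_set W ==> subtopology (zariski W) (proj_space W) = zariski W"
  by (metis subtopology_topspace topspace_zariski)

lemma irreducible_in_sub_zariski: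
  assumes W: "cone_set W" and X: "X \<subseteq> proj_space W" and A: "A \<subseteq> X"
  shows "irreducible_in (subtopology (zariski W) X) A \<longleftrightarrow> A ~= {} & prime_on A"
proof -
  let ?T = "subtopology (zariski W) X"
  have ts: "topspace ?T = X" using X by (simp add: topspace_zariski[OF W] inf.absorb2)
  note cl = closedin_sub_zariski[OF W X]
  show ?thesis
  proof
    assume I: "irreducible_in ?T A"
    show "A ~= {} & prime_on A"
      unfolding prime_on_def
    proof (intro conjI allI ballI impI)
      show "A ~= {}" using I by (simp add: irreducible_in_def)
      fix r s F G assume F: "F \<in> homog r" and G: "G \<in> homog s" and v: "vanish (F * G) A"
      define Z where "Z H = {x\<in>X. ALL f. x = proj_pt f --> fev H f = 0}" for H
      have Zc: "closedin ?T (Z H)" if "H \<in> homog k" for H k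
        unfolding cl
      proof (intro conjI allI impI)
        show "Z H \<subseteq> X" by (auto simp: Z_def)
        fix f assume f: "proj_pt f \<in> X" "proj_pt f \<notin> Z H"
        then obtain g where g: "proj_pt f = proj_pt g" "fev H g ~= 0" by (auto simp: Z_def)
        have "f ~= 0" using f X proj_space_mem[OF W] by auto
        then obtain c where "c ~= 0" "g = pscale c f" using proj_pt_eqD[OF g(1)[symmetric]] by blast
        then have "fev H f ~= 0" using g that by (auto simp: fev_pscale)
        moreover have "vanish H (Z H)" by (auto simp: vanish_def Z_def)
        ultimately show "EX r. \<exists>F\<in>homog r. fev F f ~= 0 & vanish F (Z H)" using that by blast
      qed
      have "A \<subseteq> Z F \<union> Z G"
      proof
        fix x assume x: "x \<in> A"
        show "x \<in> Z F \<union> Z G"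
        proof (rule ccontr)
          assume "x \<notin> Z F \<union> Z G"
          then obtain f g where f: "x = proj_pt f" "fev F f ~= 0" and g: "x = proj_pt g" "fev G g ~= 0"
            using x A by (auto simp: Z_def)
          have "f ~= 0" using f x A X proj_space_mem[OF W] by auto
          then obtain c where "c ~= 0" "g = pscale c f" using proj_pt_eqD[of g f] f g by metis
          then have "fev G f ~= 0" using g G by (auto simp: fev_pscale)
          then show False using f x v by (auto simp: vanish_def eval_simps)
        qed
      qed
      then have "A \<subseteq> Z F \<or> A \<subseteq> Z G" using I Zc[OF F] Zc[OF G] by (auto simp: irreducible_in_def)
      then show "vanish F A \<or> vanish G A" by (auto simp: vanish_def Z_def)
    qed
  next
    assume P: "A ~= {} & prime_on A"
    show "irreducible_in ?T A"
      unfolding irreducible_in_def ts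
    proof (intro conjI allI impI)
      show "A \<subseteq> X" "A ~= {}" using A P by auto
      fix B C assume BC: "closedin ?T B & closedin ?T C & A \<subseteq> B \<union> C"
      show "A \<subseteq> B \<or> A \<subseteq> C"
      proof (rule ccontr)
        assume "\<not> ?thesis"
        then obtain x y where xy: "x \<in> A" "x \<notin> B" "y \<in> A" "y \<notin> C" by blast
        then have "x \<in> proj_space W" "y \<in> proj_space W" using A X by blast+
        then obtain f g where fg: "x = proj_pt f" "y = proj_pt g" using proj_space_ex[of x W] proj_space_ex[of y W] by blast
        obtain r F where F: "F \<in> homog r" "fev F f ~= 0" "vanish F B"
          using BC xy fg A unfolding cl by blast
        obtain s G where G: "G \<in> homog s" "fev G g ~= 0" "vanish G C"
          using BC xy fg A unfolding cl by blast
        have "vanish (F * G) A" using F(3) G(3) BC by (auto simp: vanish_def eval_simps)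
        then have "vanish F A \<or> vanish G A" using P F(1) G(1) by (auto simp: prime_on_def)
        then show False using F(2) G(2) xy fg by (auto simp: vanish_def)
      qed
    qed
  qed
qed

definition zclosure :: "('v \<Rightarrow>\<^sub>0 complex) set set => ('v \<Rightarrow>\<^sub>0 complex) set set => ('v \<Rightarrow>\<^sub>0 complex) set set" where
  "zclosure X A = {x\<in>X. ALL r. \<forall>F\<in>homog r. vanish F A --> vanish F {x}}"

lemma subset_zclosure: "A \<subseteq> X ==> A \<subseteq> zclosure X A"
  by (auto simp: zclosure_def vanish_def)

lemma vanish_zclosure: "F \<in> homog r ==> A \<subseteq> X ==> vanish F (zclosure X A) \<longleftrightarrow> vanish F A"
  using subset_zclosure[of A X] by (auto simp: zclosure_def vanish_def)

lemma closedin_zclosure: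
  assumes W: "cone_set W" and X: "X \<subseteq> proj_space W" and A: "A \<subseteq> X"
  shows "closedin (subtopology (zariski W) X) (zclosure X A)"
  unfolding closedin_sub_zariski[OF W X]
proof (intro conjI allI impI)
  show "zclosure X A \<subseteq> X" by (auto simp: zclosure_def)
  fix f assume f: "proj_pt f \<in> X" "proj_pt f \<notin> zclosure X A"
  then obtain r F g where F: "F \<in> homog r" "vanish F A" "proj_pt g = proj_pt f" "fev F g ~= 0"
    by (auto simp: zclosure_def vanish_def)
  have "f ~= 0" using f X proj_space_mem[OF W] by auto
  then obtain c where "c ~= 0" "g = pscale c f" using proj_pt_eqD[OF F(3)] by blast
  then have "fev F f ~= 0" using F by (auto simp: fev_pscale)
  then show "EX r. \<exists>F\<in>homog r. fev F f ~= 0 & vanish F (zclosure X A)"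
    using F vanish_zclosure[OF F(1) A] by blast
qed

lemma prime_on_zclosure: "A \<subseteq> X ==> prime_on A ==> prime_on (zclosure X A)"
  unfolding prime_on_def by (metis homog_mult vanish_zclosure)

subsection \<open>Polynomial curves\<close>

definition pfun :: "(complex => complex) => bool" where
  "pfun g \<longleftrightarrow> (EX q. ALL t. g t = poly q t)"

lemma pfun_const [simp]: "pfun (\<lambda>t. c)"
  unfolding pfun_def by (rule exI[of _ "[:c:]"]) simp

lemma pfun_id [simp]: "pfun (\<lambda>t. t)"
  unfolding pfun_def by (rule exI[of _ "[:0,1:]"]) simp

lemma pfun_add: "pfun f ==> pfun g ==> pfun (\<lambda>t. f t + g t)"
  unfolding pfun_def by (metis poly_add)

lemma pfun_diff: "pfun f ==> pfun g ==> pfun (\<lambda>t. f t - g t)"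
  unfolding pfun_def by (metis poly_diff)

lemma pfun_mult: "pfun f ==> pfun g ==> pfun (\<lambda>t. f t * g t)"
  unfolding pfun_def by (metis poly_mult)

lemmas pfun_intros = pfun_const pfun_id pfun_add pfun_diff pfun_mult

lemma pfun_prod: "(!!i. i \<in> A ==> pfun (f i)) ==> pfun (\<lambda>t. \<Prod>i\<in>A. f i t)"
  by (induction A rule: infinite_finite_induct) (auto intro: pfun_mult)

lemma pfun_finite_zeros:
  assumes "pfun g" "g s ~= 0"
  shows "finite {t. g t = 0}"
proof -
  obtain q where q: "!!t. g t = poly q t" using assms(1) by (auto simp: pfun_def)
  then have "q ~= 0" using assms(2) by auto
  then show ?thesis using q poly_roots_finite by simp
qed

lemma pfun_cofinite_zero:
  assumes "pfun g" "finite {t. g t ~= 0}"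
  shows "g t = 0"
proof (rule ccontr)
  assume "g t ~= 0"
  then have "finite {t. g t = 0}" by (rule pfun_finite_zeros[OF assms(1)])
  then have "finite ({t. g t ~= 0} \<union> {t. g t = 0})" using assms(2) by blast
  moreover have "{t. g t ~= 0} \<union> {t. g t = 0} = UNIV" by auto
  ultimately show False using infinite_UNIV_char_0[where 'a=complex] by simp
qed

definition pcurve :: "(complex => ('v \<Rightarrow>\<^sub>0 complex)) => bool" where
  "pcurve \<gamma> \<longleftrightarrow> (ALL m. pfun (\<lambda>t. lk (\<gamma> t) m))"

lemma pfun_fev: "pcurve \<gamma> ==> pfun (\<lambda>t. fev F (\<gamma> t))"
proof -
  assume "pcurve \<gamma>"
  then have "ALL m. EX q. ALL t. lk (\<gamma> t) m = poly q t" by (auto simp: pcurve_def pfun_def)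
  then obtain q where q: "!!m t. lk (\<gamma> t) m = poly (q m) t" by metis
  show ?thesis
    unfolding pfun_def
    by (rule exI[of _ "subst (\<lambda>c. [:c:]) q F"]) (simp add: poly_subst_pCons q[symmetric])
qed

text \<open>Join a point where one factor is nonzero to a point where the other one is: along the curve both factors are
  nonzero polynomials in the parameter, and so is their product.\<close>
lemma prime_on_curves:
  assumes curve: "!!f g. f \<in> S ==> g \<in> S ==> \<exists>\<gamma>. pcurve \<gamma> & proj_pt (\<gamma> 0) = proj_pt f &
      proj_pt (\<gamma> 1) = proj_pt g & finite {t. \<gamma> t \<notin> S}"
    and nz: "0 \<notin> S"
  shows "prime_on (proj_pt ` S)"
  unfolding prime_on_def
proof (intro allI ballI impI, rule ccontr)
  fix r s F G assume F: "F \<in> homog r" and G: "G \<in> homog s" and v: "vanish (F * G) (proj_pt ` S)"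
    and no: "\<not> (vanish F (proj_pt ` S) \<or> vanish G (proj_pt ` S))"
  have val: "fev H f' ~= 0" if "fev H f ~= 0" and pp: "proj_pt f = proj_pt f'" and fS: "f' \<in> S \<or> f \<in> S" and "H \<in> homog k" for H f f' k
  proof -
    consider "f' ~= 0" | "f ~= 0" using fS nz by metis
    then show ?thesis
    proof cases
      case 1
      then obtain c where "c ~= 0" "f = pscale c f'" using proj_pt_eqD[OF pp] by blast
      then show ?thesis using that by (auto simp: fev_pscale)
    next
      case 2
      then obtain c where "c ~= 0" "f' = pscale c f" using proj_pt_eqD[OF pp[symmetric]] by blast
      then show ?thesis using that by (auto simp: fev_pscale)
    qed
  qed
  from no obtain f0 g0 where "proj_pt f0 \<in> proj_pt ` S" "fev F f0 ~= 0" "proj_pt g0 \<in> proj_pt ` S" "fev G g0 ~= 0"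
    by (auto simp: vanish_def)
  then obtain f g where f: "f \<in> S" "proj_pt f0 = proj_pt f" and g: "g \<in> S" "proj_pt g0 = proj_pt g" by auto
  obtain \<gamma> where \<gamma>: "pcurve \<gamma>" "proj_pt (\<gamma> 0) = proj_pt f" "proj_pt (\<gamma> 1) = proj_pt g" "finite {t. \<gamma> t \<notin> S}"
    using curve[OF f(1) g(1)] by blast
  have "fev F f ~= 0" using val[OF \<open>fev F f0 ~= 0\<close> f(2) _ F] f by blast
  then have F0: "fev F (\<gamma> 0) ~= 0" using val[OF _ \<gamma>(2)[symmetric] _ F] f by blast
  have "fev G g ~= 0" using val[OF \<open>fev G g0 ~= 0\<close> g(2) _ G] g by blast
  then have G1: "fev G (\<gamma> 1) ~= 0" using val[OF _ \<gamma>(3)[symmetric] _ G] g by blast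
  have z: "finite {t. fev F (\<gamma> t) = 0}" "finite {t. fev G (\<gamma> t) = 0}"
    using pfun_finite_zeros[OF pfun_fev[OF \<gamma>(1)] F0] pfun_finite_zeros[OF pfun_fev[OF \<gamma>(1)] G1] by auto
  have "UNIV \<subseteq> {t. \<gamma> t \<notin> S} \<union> {t. fev F (\<gamma> t) = 0} \<union> {t. fev G (\<gamma> t) = 0}"
  proof
    fix t
    show "t \<in> {t. \<gamma> t \<notin> S} \<union> {t. fev F (\<gamma> t) = 0} \<union> {t. fev G (\<gamma> t) = 0}"
    proof (cases "\<gamma> t \<in> S")
      case True
      then have "fev (F * G) (\<gamma> t) = 0" using v by (auto simp: vanish_def)
      then show ?thesis by (simp add: eval_simps)
    qed simp
  qed
  then have "finite (UNIV :: complex set)" using z \<gamma>(4) by (meson finite_UnI finite_subset)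
  then show False using infinite_UNIV_char_0 by blast
qed

section \<open>Chains of irreducible closed sets give algebraically independent forms\<close>

lemma chain_forms:
  assumes W: "cone_set W" and X: "X \<subseteq> proj_space W"
    and ch: "irred_closed_chain (subtopology (zariski W) X) n Z"
  obtains G0 G D where "G0 \<in> homog 1" "\<not> vanish G0 (Z 0)"
    "!!i. i < n ==> G i \<in> homog (D i) & vanish (G i) (Z i) & \<not> vanish (G i) (Z (Suc i))"
    "!!i. i <= n ==> prime_on (Z i)" "!!i. i < n ==> Z i \<subseteq> Z (Suc i)"
proof -
  have cl: "closedin (subtopology (zariski W) X) (Z i)" "irreducible_in (subtopology (zariski W) X) (Z i)" if "i <= n" for i
    using ch that by (auto simp: irred_closed_chain_def)
  have sub: "Z i \<subseteq> X" if "i <= n" for i using cl(1)[OF that] closedin_sub_zariski[OF W X] by blast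
  have pr: "Z i ~= {}" "prime_on (Z i)" if "i <= n" for i
    using cl(2)[OF that] irreducible_in_sub_zariski[OF W X sub[OF that]] by auto
  have st: "Z i \<subset> Z (Suc i)" if "i < n" for i using ch that by (auto simp: irred_closed_chain_def)
  obtain x where x: "x \<in> Z 0" using pr(1)[of 0] by auto
  then have "x \<in> proj_space W" using sub[of 0] X by blast
  then obtain f where f: "x = proj_pt f" "f \<in> W" "f ~= 0" using proj_space_ex[of x W] by blast
  then obtain m where m: "lk f m ~= 0" by (metis lookup_zero poly_mapping_eqI)
  have "EX G D. \<forall>i<n. G i \<in> homog (D i) & vanish (G i) (Z i) & \<not> vanish (G i) (Z (Suc i))"
  proof -
    have "EX G D. G \<in> homog D & vanish G (Z i) & \<not> vanish G (Z (Suc i))" if "i < n" for i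
    proof -
      obtain y where y: "y \<in> Z (Suc i)" "y \<notin> Z i" using st[OF \<open>i < n\<close>] by blast
      then have "y \<in> proj_space W" using sub[of "Suc i"] that X by auto
      then obtain g where g: "y = proj_pt g" using proj_space_ex[of y W] by blast
      have "proj_pt g \<in> X" using y g sub[of "Suc i"] that by auto
      then obtain r F where "F \<in> homog r" "fev F g ~= 0" "vanish F (Z i)"
        using cl(1)[OF less_imp_le[OF \<open>i < n\<close>]] y(2) g unfolding closedin_sub_zariski[OF W X] by blast
      then show ?thesis using y g by (auto simp: vanish_def)
    qed
    then show ?thesis by metis
  qed
  then obtain G D where G: "\<forall>i<n. G i \<in> homog (D i) & vanish (G i) (Z i) & \<not> vanish (G i) (Z (Suc i))" by blast
  show thesis
  proof (rule that[of "sg (sg m 1) 1" G D])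
    show "sg (sg m 1) 1 \<in> homog 1" by (rule homog_single) simp
    show "\<not> vanish (sg (sg m 1) 1) (Z 0)"
      using x f m by (auto simp: vanish_def eval_simps)
    show "Z i \<subseteq> Z (Suc i)" if "i < n" for i using st[OF that] by blast
  qed (use G pr in auto)
qed

definition ebox :: "nat => nat => (nat => nat) set" where
  "ebox n E = PiE {..<n} (\<lambda>_. {..E})"

lemma ebox_0: "ebox 0 E = {\<lambda>_. undefined}"
  by (simp add: ebox_def)

lemma finite_ebox [simp]: "finite (ebox n E)"
  by (simp add: ebox_def finite_PiE)

lemma card_ebox: "card (ebox n E) = (E + 1) ^ n"
  by (simp add: ebox_def card_PiE)

lemma sum_ebox_Suc: "(\<Sum>e\<in>ebox (Suc n) E. h e) = (\<Sum>k\<le>E. \<Sum>e\<in>ebox n E. h (e(n := k)))"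
proof -
  have "ebox (Suc n) E = (\<lambda>(y, g). g(n := y)) ` ({..E} \<times> ebox n E)"
    by (simp add: ebox_def lessThan_Suc PiE_insert_eq)
  moreover have "inj_on (\<lambda>(y, g). g(n := y)) ({..E} \<times> ebox n E)"
    unfolding ebox_def by (rule inj_combinator) simp
  ultimately show ?thesis
    by (simp add: sum.reindex sum.cartesian_product case_prod_unfold)
qed

definition hform :: "'v mpoly => (nat => 'v mpoly) => (nat => nat) => nat => nat => nat => ((nat => nat) => complex) => 'v mpoly" where
  "hform G0 G D E n R c = (\<Sum>e\<in>ebox n E. sg 0 (c e) * ((\<Prod>i<n. G i ^ e i) * G0 ^ (R - (\<Sum>i<n. e i * D i))))"

lemma hform_Suc:
  "hform G0 G D E (Suc n) R c = (\<Sum>k\<le>E. G n ^ k * hform G0 G D E n (R - k * D n) (\<lambda>e. c (e(n := k))))"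
proof -
  have 1: "(\<Prod>i<Suc n. G i ^ (e(n := k)) i) = G n ^ k * (\<Prod>i<n. G i ^ e i)" for e k
    by (simp add: mult.commute)
  have 2: "(\<Sum>i<Suc n. (e(n := k)) i * D i) = k * D n + (\<Sum>i<n. e i * D i)" for e k
    by simp
  show ?thesis
    unfolding hform_def sum_ebox_Suc 1 2 sum_distrib_left diff_diff_left
    by (simp add: mult_ac)
qed

lemma hform_homog:
  assumes "G0 \<in> homog 1" "!!i. i < n ==> G i \<in> homog (D i)" "E * (\<Sum>i<n. D i) <= R"
  shows "hform G0 G D E n R c \<in> homog R"
  unfolding hform_def
proof (rule homog_sum)
  fix e assume e: "e \<in> ebox n E"
  have le: "(\<Sum>i<n. e i * D i) <= R"
  proof -
    have "(\<Sum>i<n. e i * D i) <= (\<Sum>i<n. E * D i)"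
      using e by (intro sum_mono mult_right_mono) (auto simp: ebox_def PiE_iff)
    then show ?thesis using assms(3) by (simp add: sum_distrib_left)
  qed
  have 1: "(\<Prod>i<n. G i ^ e i) \<in> homog (\<Sum>i<n. e i * D i)"
    by (rule homog_prod) (auto intro: homog_power assms)
  have 2: "G0 ^ k \<in> homog k" for k using homog_power[OF assms(1), of k] by simp
  have "sg 0 (c e) * ((\<Prod>i<n. G i ^ e i) * G0 ^ (R - (\<Sum>i<n. e i * D i)))
     \<in> homog (0 + ((\<Sum>i<n. e i * D i) + (R - (\<Sum>i<n. e i * D i))))"
    by (intro homog_mult 1 2 homog_single) simp
  then show "sg 0 (c e) * ((\<Prod>i<n. G i ^ e i) * G0 ^ (R - (\<Sum>i<n. e i * D i))) \<in> homog R"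
    using le by simp
qed

lemma hform_zero: "(!!e. e \<in> ebox n E ==> c e = 0) ==> hform G0 G D E n R c = 0"
  by (simp add: hform_def)

lemma prime_on_power:
  assumes "prime_on Z" "F \<in> homog r" "G \<in> homog s" "vanish (F ^ k * G) Z" "\<not> vanish F Z"
  shows "vanish G Z"
  using assms(4)
proof (induction k)
  case (Suc k)
  have "vanish (F * (F ^ k * G)) Z" using Suc.prems by (simp add: mult.assoc)
  moreover have "F ^ k * G \<in> homog (k * r + s)" by (intro homog_mult homog_power assms)
  ultimately have "vanish (F ^ k * G) Z" using assms by (auto simp: prime_on_def)
  then show ?case by (rule Suc.IH)
qed simp

text \<open>Evaluate a relation on the smaller set \<open>Z (n - 1)\<close>, where the last form vanishes: by induction the coefficients
  free of that form vanish. Since \<open>Z n\<close> is prime and the form is nonzero on it, a power of the form can be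
  cancelled, and the argument repeats.\<close>
lemma chain_independent:
  assumes G0: "G0 \<in> homog 1" "\<not> vanish G0 (Z 0)"
    and G: "!!i. i < n ==> G i \<in> homog (D i) & vanish (G i) (Z i) & \<not> vanish (G i) (Z (Suc i))"
    and P: "!!i. i <= n ==> prime_on (Z i)" and sub: "!!i. i < n ==> Z i \<subseteq> Z (Suc i)"
    and R: "E * (\<Sum>i<n. D i) <= R" and v: "vanish (hform G0 G D E n R c) (Z n)" and e: "e \<in> ebox n E"
  shows "c e = 0"
  using G P sub R v e
proof (induction n arbitrary: R c e)
  case 0
  then have "vanish (sg 0 (c e) * G0 ^ R) (Z 0)"
    by (simp add: hform_def ebox_0)
  moreover obtain g where "proj_pt g \<in> Z 0" "fev G0 g ~= 0" using G0(2) by (auto simp: vanish_def)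
  ultimately show ?case by (auto simp: vanish_def eval_simps)
next
  case (Suc n)
  define H where "H k = hform G0 G D E n (R - k * D n) (\<lambda>e. c (e(n := k)))" for k
  have Rk: "E * (\<Sum>i<n. D i) <= R - k * D n" if "k <= E" for k
  proof -
    have "k * D n <= E * D n" using that by (rule mult_right_mono) simp
    moreover have "E * D n + E * (\<Sum>i<n. D i) <= R" using Suc.prems(4) by (simp add: algebra_simps)
    ultimately show ?thesis by linarith
  qed
  have RD: "k * D n <= R" if "k <= E" for k
  proof -
    have "k * D n <= E * D n" using that by (rule mult_right_mono) simp
    moreover have "E * D n + E * (\<Sum>i<n. D i) <= R" using Suc.prems(4) by (simp add: algebra_simps)
    ultimately show ?thesis by linarith
  qed
  have Hh: "H k \<in> homog (R - k * D n)" if "k <= E" for k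
    unfolding H_def by (rule hform_homog) (use G0 Suc.prems(1) Rk[OF that] in auto)
  have Gn: "G n \<in> homog (D n)" "vanish (G n) (Z n)" "\<not> vanish (G n) (Z (Suc n))"
    using Suc.prems(1)[of n] by auto
  have main: "\<forall>e\<in>ebox n E. c (e(n := k)) = 0" if "k <= E" for k
    using that
  proof (induction k rule: less_induct)
    case (less k)
    have z: "H j = 0" if "j < k" for j
      unfolding H_def by (rule hform_zero) (use less.IH[OF that] less.prems that in \<open>simp del: fun_upd_apply\<close>)
    define Q where "Q = (\<Sum>j\<in>{k..E}. G n ^ (j - k) * H j)"
    have "hform G0 G D E (Suc n) R c = (\<Sum>j\<le>E. G n ^ j * H j)"
      unfolding hform_Suc H_def ..
    also have "\<dots> = (\<Sum>j\<in>{k..E}. G n ^ j * H j)"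
      by (rule sum.mono_neutral_right) (auto simp: z)
    also have "\<dots> = G n ^ k * Q"
      unfolding Q_def sum_distrib_left
      by (rule sum.cong) (auto simp: mult.assoc[symmetric] power_add[symmetric])
    finally have eq: "hform G0 G D E (Suc n) R c = G n ^ k * Q" .
    have Qh: "Q \<in> homog (R - k * D n)"
      unfolding Q_def
    proof (rule homog_sum)
      fix j assume j: "j \<in> {k..E}"
      have "G n ^ (j - k) * H j \<in> homog ((j - k) * D n + (R - j * D n))"
        using j by (intro homog_mult homog_power Gn Hh) auto
      moreover have "(j - k) * D n + (R - j * D n) = R - k * D n"
      proof -
        have "j * D n = (j - k) * D n + k * D n" using j by (metis add_mult_distrib le_add_diff_inverse2 atLeastAtMost_iff)
        then show ?thesis using RD[of j] j by auto
      qed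
      ultimately show "G n ^ (j - k) * H j \<in> homog (R - k * D n)" by simp
    qed
    have "vanish (G n ^ k * Q) (Z (Suc n))" using Suc.prems(5) eq by simp
    then have vQ: "vanish Q (Z (Suc n))"
      using prime_on_power[OF Suc.prems(2) Gn(1) Qh _ Gn(3)] by blast
    have "vanish (H k) (Z n)"
      unfolding vanish_def
    proof (intro allI impI)
      fix g assume g: "proj_pt g \<in> Z n"
      then have "fev Q g = 0" using vQ Suc.prems(3)[of n] by (auto simp: vanish_def)
      moreover have "fev (G n) g = 0" using Gn(2) g by (auto simp: vanish_def)
      moreover have "fev Q g = (\<Sum>j\<in>{k..E}. fev (G n) g ^ (j - k) * fev (H j) g)"
        by (simp add: Q_def eval_simps)
      moreover have "\<dots> = (\<Sum>j\<in>{k..E}. if j = k then fev (H k) g else 0)"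
        by (rule sum.cong) (use \<open>fev (G n) g = 0\<close> in auto)
      ultimately show "fev (H k) g = 0" using less(2) by simp
    qed
    then have vH: "vanish (hform G0 G D E n (R - k * D n) (\<lambda>e. c (e(n := k)))) (Z n)" by (simp add: H_def)
    show ?case
    proof
      fix e assume e: "e \<in> ebox n E"
      show "c (e(n := k)) = 0"
        by (rule Suc.IH[OF _ _ _ Rk[OF less(2)] vH e]) (use Suc.prems(1-3) in auto)
    qed
  qed
  have en: "e n <= E" using Suc.prems(6) by (auto simp: ebox_def PiE_iff)
  have "restrict e {..<n} \<in> ebox n E" using Suc.prems(6) by (auto simp: ebox_def PiE_iff)
  then have "c ((restrict e {..<n})(n := e n)) = 0" using main[OF en] by blast
  moreover have "(restrict e {..<n})(n := e n) = e"
    using Suc.prems(6) by (intro ext) (auto simp: ebox_def PiE_iff extensional_def)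
  ultimately show ?case by simp
qed

section \<open>Two pencils of lines\<close>

definition bs :: "nat => nat => nat" where "bs m i = (if i < m then 0 else m)"
definition ob :: "nat => nat => nat" where "ob m i = (if i < m then m else 0)"

definition pen :: "nat => nat => (nat => complex^3) => bool" where
  "pen m d L \<longleftrightarrow> (\<forall>i<d. tri (L (bs m i)) (L (bs m i + 1)) (L i) = 0)"

definition nvp :: "nat => nat => (nat => complex^3) => complex" where
  "nvp m d L = (\<Prod>i<d. tri (L (ob m i)) (L (ob m i + 1)) (L i)) *
     (\<Prod>i<d. \<Prod>j<d. if i ~= j & bs m i = bs m j then tri (L i) (L j) (L (ob m i)) else 1)"

text \<open>The nonvanishing of \<open>nvp\<close>, a polynomial in the entries, is the genericity of the two pencils \<open>pen\<close>:
  no line lies in both, and the lines of each are distinct. As an open condition it persists along curves.\<close>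
definition gt :: "nat => nat => (nat => complex^3) => bool" where
  "gt m d L \<longleftrightarrow> pen m d L & nvp m d L ~= 0"

definition fm :: "nat => (nat => complex^3) => S" where
  "fm d L = (\<Prod>i<d. lin (L i))"

definition XX :: "nat => nat => S set set" where
  "XX m d = proj_pt ` fm d ` {L. gt m d L}"

lemma nvp_nz: "nvp m d L ~= 0 \<longleftrightarrow> (\<forall>i<d. tri (L (ob m i)) (L (ob m i + 1)) (L i) ~= 0) &
   (\<forall>i<d. \<forall>j<d. i ~= j --> bs m i = bs m j --> tri (L i) (L j) (L (ob m i)) ~= 0)"
  unfolding nvp_def mult_eq_0_iff by (auto simp: prod_zero_iff)

lemma vscale_mult: "a *s (b *s (v::complex^3)) = (a * b) *s v"
  by (simp add: vec3_eq_iff)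

lemma tri_scale: "tri (a *s u) (b *s v) (c *s w) = a * b * c * tri u v w"
  by (simp add: tri_expand algebra_simps)

lemma dot_scale: "dot (c *s v) u = c * dot v u" "dot v (c *s u) = c * dot v u"
  by (simp_all add: dot_def algebra_simps)

lemma dot_add: "dot (u + v) w = dot u w + dot v w"
  by (simp add: dot_def algebra_simps)

lemma dot_diff: "dot (u - v) w = dot u w - dot v w"
  by (simp add: dot_def algebra_simps)

lemma tri_lincomb: "tri u v (\<alpha> *s u + \<beta> *s v) = 0"
  by (simp add: tri_expand algebra_simps)

lemma tri_lincomb_diff: "tri u v (\<alpha> *s u - \<beta> *s v) = 0"
  by (simp add: tri_expand algebra_simps)

lemma gt_facts:
  assumes "gt m d L" "2 <= m" "m + 2 <= d"
  shows gt_nz: "i < d ==> L i ~= 0"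
    and gt_cr: "i < d ==> j < d ==> i ~= j ==> cr (L i) (L j) ~= 0"
    and gt_tri: "i < d ==> tri (L (ob m i)) (L (ob m i + 1)) (L i) ~= 0"
    and gt_pen: "i < d ==> tri (L (bs m i)) (L (bs m i + 1)) (L i) = 0"
    and gt_sep: "i < d ==> j < d ==> i ~= j ==> bs m i = bs m j ==> tri (L i) (L j) (L (ob m i)) ~= 0"
proof -
  have nv: "nvp m d L ~= 0" and pe: "pen m d L" using assms by (auto simp: gt_def)
  show t: "tri (L (ob m i)) (L (ob m i + 1)) (L i) ~= 0" if "i < d" for i
    using nv that unfolding nvp_nz by blast
  show p: "tri (L (bs m i)) (L (bs m i + 1)) (L i) = 0" if "i < d" for i
    using pe that unfolding pen_def by blast
  show s: "tri (L i) (L j) (L (ob m i)) ~= 0" if "i < d" "j < d" "i ~= j" "bs m i = bs m j" for i j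
    using nv that unfolding nvp_nz by blast
  show nz: "L i ~= 0" if "i < d" for i
    using t[OF that] by (auto simp: tri_expand)
  show "cr (L i) (L j) ~= 0" if ij: "i < d" "j < d" "i ~= j" for i j
  proof (cases "bs m i = bs m j")
    case True
    then show ?thesis using s[OF ij True] cr_zero_iff by blast
  next
    case False
    show ?thesis
    proof
      assume c: "cr (L i) (L j) = 0"
      then obtain k where k: "L j = k *s L i" using proportional_if_cr[OF nz[OF ij(1)]] by blast
      have "bs m i = ob m j" using False ij assms by (auto simp: bs_def ob_def split: if_splits)
      then have "tri (L (ob m j)) (L (ob m j + 1)) (L i) = 0" using p[OF ij(1)] by simp
      then have "tri (L (ob m j)) (L (ob m j + 1)) (L j) = 0"
        unfolding k using tri_scale[of 1 _ 1 _ k "L i"] by simp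
      then show False using t[OF ij(2)] by simp
    qed
  qed
qed

lemma gt_span:
  assumes "gt m d L" "2 <= m" "m + 2 <= d" "i < d"
  obtains u v where "L i = u *s L (bs m i) + v *s L (bs m i + 1)"
proof -
  have "cr (L (bs m i)) (L (bs m i + 1)) ~= 0"
    by (rule gt_cr[OF assms(1-3)]) (use assms in \<open>auto simp: bs_def\<close>)
  then show thesis using span_if_tri gt_pen[OF assms(1-4)] that by blast
qed

lemma gt_rescale:
  assumes "gt m d L" "2 <= m" "m + 2 <= d" "!!i. i < d ==> c i ~= 0 & L' i = c i *s L i"
  shows "gt m d L'"
proof -
  have l: "bs m i < d" "bs m i + 1 < d" "ob m i < d" "ob m i + 1 < d" for i
    using assms by (auto simp: bs_def ob_def)
  show ?thesis
    unfolding gt_def nvp_nz pen_def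
    using assms(4) l gt_tri[OF assms(1-3)] gt_pen[OF assms(1-3)] gt_sep[OF assms(1-3)]
    by (simp add: tri_scale)
qed

lemma fm_rescale:
  assumes "!!i. i < d ==> L' i = c i *s L i"
  shows "fm d L' = pscale (\<Prod>i<d. c i) (fm d L)"
proof -
  have 1: "(\<Prod>i<d. sg 0 (c i)) = (sg 0 (\<Prod>i<d. c i) :: S)"
    by (induction d) (simp_all add: mult_single)
  have "fm d L' = (\<Prod>i<d. sg 0 (c i) * lin (L i))"
    unfolding fm_def by (rule prod.cong) (auto simp: assms lin_scale pscale_conv_mult)
  then show ?thesis by (simp add: prod.distrib 1 pscale_conv_mult fm_def)
qed

lemma fm_homog: "fm d L \<in> homog d"
  using homog_prod_lin[of "{..<d}" L] by (simp add: fm_def)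

lemma fm_nz: "gt m d L ==> 2 <= m ==> m + 2 <= d ==> fm d L ~= 0"
  using gt_nz[of m d L] by (simp add: fm_def prod_zero_iff)

lemma fm_cong: "(!!i. i < d ==> L i = L' i) ==> fm d L = fm d L'"
  unfolding fm_def by (rule prod.cong) auto

lemma eval_fm: "eval_mpoly (fm d L) (($) u) = (\<Prod>i<d. dot (L i) u)"
  by (simp add: fm_def eval_prod_lin)

subsection \<open>Polynomial curves of tuples\<close>

definition vcurve :: "nat => (complex => nat => complex^3) => bool" where
  "vcurve d \<Lambda> \<longleftrightarrow> (\<forall>i<d. ALL j. pfun (\<lambda>t. \<Lambda> t i $ j))"

lemma pcurve_fm: "vcurve d \<Lambda> ==> pcurve (\<lambda>t. fm d (\<Lambda> t))"
  unfolding pcurve_def fm_def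
  by (intro allI lookup_prod_lin_graded[where Q="\<lambda>_. pfun"])
     (auto simp: vcurve_def intro: pfun_intros)

lemma pfun_dot: "(!!j. pfun (\<lambda>t. u t $ j)) ==> (!!j. pfun (\<lambda>t. v t $ j)) ==> pfun (\<lambda>t. dot (u t) (v t))"
  unfolding dot_def by (intro pfun_add pfun_mult)

lemma pfun_tri: "(!!j. pfun (\<lambda>t. u t $ j)) ==> (!!j. pfun (\<lambda>t. v t $ j)) ==> (!!j. pfun (\<lambda>t. w t $ j))
  ==> pfun (\<lambda>t. tri (u t) (v t) (w t))"
  unfolding tri_expand by (intro pfun_add pfun_mult pfun_diff)

lemma pfun_nvp:
  assumes "vcurve d \<Lambda>" "2 <= m" "m + 2 <= d"
  shows "pfun (\<lambda>t. nvp m d (\<Lambda> t))"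
proof -
  have v: "pfun (\<lambda>t. \<Lambda> t i $ j)" if "i < d" for i j using assms that by (auto simp: vcurve_def)
  have l: "ob m i < d" "ob m i + 1 < d" for i using assms by (auto simp: ob_def)
  show ?thesis
    unfolding nvp_def
  proof (intro pfun_mult pfun_prod)
    fix i assume "i \<in> {..<d}"
    then show "pfun (\<lambda>t. tri (\<Lambda> t (ob m i)) (\<Lambda> t (ob m i + 1)) (\<Lambda> t i))"
      using v l by (intro pfun_tri) auto
    fix j assume "j \<in> {..<d}"
    then show "pfun (\<lambda>t. if i ~= j & bs m i = bs m j then tri (\<Lambda> t i) (\<Lambda> t j) (\<Lambda> t (ob m i)) else 1)"
      using v l \<open>i \<in> {..<d}\<close> by (cases "i ~= j & bs m i = bs m j") (auto intro!: pfun_tri)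
  qed
qed

lemma finite_not_gt:
  assumes "vcurve d \<Lambda>" "2 <= m" "m + 2 <= d" "!!t. pen m d (\<Lambda> t)" "gt m d (\<Lambda> s)"
  shows "finite {t. \<not> gt m d (\<Lambda> t)}"
proof -
  have "finite {t. nvp m d (\<Lambda> t) = 0}"
    by (rule pfun_finite_zeros[OF pfun_nvp[OF assms(1-3)]]) (use assms(5) in \<open>auto simp: gt_def\<close>)
  then show ?thesis by (rule rev_finite_subset) (use assms(4) in \<open>auto simp: gt_def\<close>)
qed

text \<open>The constrained families: line \<open>i\<close> passes through the points of \<open>E i\<close>.\<close>
definition mainl :: "nat => nat => bool" where
  "mainl m i \<longleftrightarrow> i = bs m i \<or> i = bs m i + 1"

definition YY :: "nat => nat => (nat => (complex^3) set) => (nat => complex^3) set" where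
  "YY m d E = {L. gt m d L & (\<forall>i<d. \<forall>e\<in>E i. dot (L i) e = 0) &
      (\<forall>i<d. \<not> mainl m i --> (\<forall>e\<in>E i. dot (L (bs m i)) e ~= 0))}"

lemma bs_bs [simp]: "0 < m ==> bs m (bs m i) = bs m i" "2 <= m ==> bs m (Suc (bs m i)) = bs m i"
  by (auto simp: bs_def)

lemma mainl_bs [simp]: "2 <= m ==> mainl m (bs m i)" "2 <= m ==> mainl m (Suc (bs m i))"
  by (auto simp: mainl_def)

text \<open>The line of the pencil spanned by \<open>u\<close>, \<open>v\<close> through the point \<open>e\<close>.\<close>
definition thru :: "complex^3 => complex^3 => complex^3 => complex^3" where
  "thru e u v = dot v e *s u - dot u e *s v"

lemma dot_thru: "dot (thru e u v) e = 0"
  by (simp add: thru_def dot_diff dot_scale)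

lemma thru_rescale:
  assumes "gt m d L" "2 <= m" "m + 2 <= d" "i < d" "dot (L i) e = 0" "dot (L (bs m i)) e ~= 0"
  obtains c where "c ~= 0" "thru e (L (bs m i)) (L (bs m i + 1)) = c *s L i"
proof -
  obtain u v where uv: "L i = u *s L (bs m i) + v *s L (bs m i + 1)"
    using gt_span[OF assms(1-4)] .
  let ?x = "dot (L (bs m i)) e" and ?y = "dot (L (bs m i + 1)) e"
  have 0: "u * ?x + v * ?y = 0" using assms(5) unfolding uv by (simp add: dot_add dot_scale)
  have "v ~= 0"
  proof
    assume "v = 0"
    then have "u = 0" using 0 assms(6) by simp
    then show False using gt_nz[OF assms(1-4)] uv \<open>v = 0\<close> by (simp add: vec3_eq_iff)
  qed
  have u: "u = - v * ?y / ?x" using 0 assms(6) by (simp add: field_simps add_eq_0_iff2)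
  show thesis
  proof (rule that[of "- ?x / v"])
    show "- ?x / v ~= 0" using assms(6) \<open>v ~= 0\<close> by simp
    show "thru e (L (bs m i)) (L (bs m i + 1)) = (- ?x / v) *s L i"
      unfolding uv u thru_def using assms(6) \<open>v ~= 0\<close>
      by (simp add: vec3_eq_iff field_simps)
  qed
qed

lemma YY_connected:
  assumes m: "2 <= m" "m + 2 <= d"
    and E: "!!i. i < d ==> \<not> mainl m i ==> E i = {} \<or> (EX e. E i = {e})"
    and L: "L \<in> YY m d E" and L': "L' \<in> YY m d E"
  obtains \<Lambda> c c' where "vcurve d \<Lambda>" "!!i. i < d ==> c i ~= 0 & \<Lambda> 0 i = c i *s L i"
    "!!i. i < d ==> c' i ~= 0 & \<Lambda> 1 i = c' i *s L' i" "finite {t. \<Lambda> t \<notin> YY m d E}"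
proof -
  have g: "gt m d L" "gt m d L'" using L L' by (auto simp: YY_def)
  have "EX u v. L i = u *s L (bs m i) + v *s L (bs m i + 1)" if "i < d" for i
    using gt_span[OF g(1) m that] by metis
  then obtain u v where uv: "!!i. i < d ==> L i = u i *s L (bs m i) + v i *s L (bs m i + 1)" by metis
  have "EX u v. L' i = u *s L' (bs m i) + v *s L' (bs m i + 1)" if "i < d" for i
    using gt_span[OF g(2) m that] by metis
  then obtain u' v' where uv': "!!i. i < d ==> L' i = u' i *s L' (bs m i) + v' i *s L' (bs m i + 1)" by metis
  define M where "M t i = (1 - t) *s L i + t *s L' i" for t i
  define \<Lambda> where "\<Lambda> t i = (if mainl m i then M t i
     else if E i = {} then ((1 - t) * u i + t * u' i) *s M t (bs m i) + ((1 - t) * v i + t * v' i) *s M t (bs m i + 1)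
     else thru (SOME e. e \<in> E i) (M t (bs m i)) (M t (bs m i + 1)))" for t i
  have M01: "M 0 i = L i" "M 1 i = L' i" for i by (simp_all add: M_def)
  have pM: "pfun (\<lambda>t. M t i $ j)" for i j
    by (simp add: M_def) (intro pfun_intros)
  have lb: "bs m i < d" "bs m i + 1 < d" for i using m by (auto simp: bs_def)
  have vc: "vcurve d \<Lambda>"
    unfolding vcurve_def
  proof (intro allI impI)
    fix i j assume "i < d"
    show "pfun (\<lambda>t. \<Lambda> t i $ j)"
      using pM unfolding \<Lambda>_def thru_def
      by (cases "mainl m i"; cases "E i = {}") (auto intro!: pfun_intros pfun_dot simp del: One_nat_def)
  qed
  have Lb: "\<Lambda> t (bs m i) = M t (bs m i)" "\<Lambda> t (bs m i + 1) = M t (bs m i + 1)" for t i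
    using m by (simp_all add: \<Lambda>_def)
  have pe: "pen m d (\<Lambda> t)" for t
    unfolding pen_def Lb
  proof (intro allI impI)
    fix i assume "i < d"
    show "tri (M t (bs m i)) (M t (bs m i + 1)) (\<Lambda> t i) = 0"
    proof (cases "mainl m i")
      case True
      then have "\<Lambda> t i = M t i" by (simp add: \<Lambda>_def)
      moreover have "i = bs m i \<or> i = bs m i + 1" using True by (simp add: mainl_def)
      ultimately show ?thesis by (metis tri_same)
    next
      case False
      show ?thesis
      proof (cases "E i = {}")
        case True
        then have "\<Lambda> t i = ((1 - t) * u i + t * u' i) *s M t (bs m i) + ((1 - t) * v i + t * v' i) *s M t (bs m i + 1)"
          using False by (simp add: \<Lambda>_def)
        then show ?thesis by (simp only: tri_lincomb)
      next
        case ne: False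
        then have "\<Lambda> t i = thru (SOME e. e \<in> E i) (M t (bs m i)) (M t (bs m i + 1))"
          using False by (simp add: \<Lambda>_def)
        then show ?thesis by (simp only: thru_def tri_lincomb_diff)
      qed
    qed
  qed
  have ends: "EX c. c ~= 0 & \<Lambda> s i = c *s K i"
    if i: "i < d" and s: "s = 0 & K = L \<or> s = 1 & K = L'" for i s K
  proof -
    have K: "K \<in> YY m d E" "gt m d K" and MK: "!!i. M s i = K i" using s L L' g M01 by auto
    consider "mainl m i" | "\<not> mainl m i" "E i = {}" | e where "\<not> mainl m i" "E i = {e}"
      using E[OF i] by blast
    then show ?thesis
    proof cases
      case 1
      then show ?thesis using MK by (intro exI[of _ 1]) (simp add: \<Lambda>_def)
    next
      case 2
      then show ?thesis using s uv[OF i] uv'[OF i] by (intro exI[of _ 1]) (auto simp: \<Lambda>_def M01)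
    next
      case 3
      have "dot (K i) e = 0" "dot (K (bs m i)) e ~= 0" using K(1) 3 i by (auto simp: YY_def)
      then obtain c where "c ~= 0" "thru e (K (bs m i)) (K (bs m i + 1)) = c *s K i"
        using thru_rescale[OF K(2) m i] by metis
      then show ?thesis using 3 by (auto simp: \<Lambda>_def MK)
    qed
  qed
  have e0: "ALL i. EX c. i < d --> c ~= 0 & \<Lambda> 0 i = c *s L i" using ends[of _ 0 L] by blast
  have e1: "ALL i. EX c. i < d --> c ~= 0 & \<Lambda> 1 i = c *s L' i" using ends[of _ 1 L'] by blast
  obtain c where c: "!!i. i < d ==> c i ~= 0 & \<Lambda> 0 i = c i *s L i" using choice[OF e0] by blast
  obtain c' where c': "!!i. i < d ==> c' i ~= 0 & \<Lambda> 1 i = c' i *s L' i" using choice[OF e1] by blast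
  have "gt m d (\<Lambda> 0)" by (rule gt_rescale[OF g(1) m c])
  then have fg: "finite {t. \<not> gt m d (\<Lambda> t)}" by (rule finite_not_gt[OF vc m pe])
  have fb: "finite {t. \<not> mainl m i & (\<exists>e\<in>E i. dot (\<Lambda> t (bs m i)) e = 0)}" if i: "i < d" for i
  proof -
    consider "mainl m i \<or> E i = {}" | e where "\<not> mainl m i" "E i = {e}" using E[OF i] by blast
    then show ?thesis
    proof cases
      case 2
      have "dot (L (bs m i)) e ~= 0" using L 2 i by (auto simp: YY_def)
      then have "dot (\<Lambda> 0 (bs m i)) e ~= 0" using Lb M01 by simp
      moreover have "pfun (\<lambda>t. dot (\<Lambda> t (bs m i)) e)"
        using vc lb by (intro pfun_dot) (auto simp: vcurve_def)
      ultimately have "finite {t. dot (\<Lambda> t (bs m i)) e = 0}" by (intro pfun_finite_zeros)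
      then show ?thesis using 2 by simp
    qed auto
  qed
  have cons: "dot (\<Lambda> t i) e = 0" if i: "i < d" "e \<in> E i" for t i e
  proof (cases "mainl m i")
    case True
    have "dot (L i) e = 0" "dot (L' i) e = 0" using L L' i by (auto simp: YY_def)
    then show ?thesis using True by (simp add: \<Lambda>_def M_def dot_add dot_diff dot_scale)
  next
    case False
    then obtain e' where e': "E i = {e'}" using E[OF i(1)] i(2) by blast
    then have "e' = e" using i by simp
    then show ?thesis using False e' by (simp add: \<Lambda>_def dot_thru)
  qed
  have "{t. \<Lambda> t \<notin> YY m d E} \<subseteq> {t. \<not> gt m d (\<Lambda> t)} \<union> (\<Union>i<d. {t. \<not> mainl m i & (\<exists>e\<in>E i. dot (\<Lambda> t (bs m i)) e = 0)})"
    using cons by (auto simp: YY_def)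
  then have "finite {t. \<Lambda> t \<notin> YY m d E}" by (rule finite_subset) (use fg fb in auto)
  then show thesis using that[OF vc c c'] by blast
qed

lemma YY_prime:
  assumes m: "2 <= m" "m + 2 <= d"
    and E: "!!i. i < d ==> \<not> mainl m i ==> E i = {} \<or> (EX e. E i = {e})"
  shows "prime_on (proj_pt ` fm d ` YY m d E)"
proof (rule prime_on_curves)
  show "0 \<notin> fm d ` YY m d E" using fm_nz m by (auto simp: YY_def)
  fix f g assume "f \<in> fm d ` YY m d E" "g \<in> fm d ` YY m d E"
  then obtain L L' where L: "f = fm d L" "L \<in> YY m d E" and L': "g = fm d L'" "L' \<in> YY m d E" by blast
  obtain \<Lambda> c c' where A: "vcurve d \<Lambda>" "!!i. i < d ==> c i ~= 0 & \<Lambda> 0 i = c i *s L i"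
    "!!i. i < d ==> c' i ~= 0 & \<Lambda> 1 i = c' i *s L' i" "finite {t. \<Lambda> t \<notin> YY m d E}"
    using YY_connected[OF m E L(2) L'(2)] by metis
  have "fm d (\<Lambda> 0) = pscale (\<Prod>i<d. c i) f" "fm d (\<Lambda> 1) = pscale (\<Prod>i<d. c' i) g"
    unfolding L L' by (rule fm_rescale, use A in blast)+
  moreover have "(\<Prod>i<d. c i) ~= 0" "(\<Prod>i<d. c' i) ~= 0" using A by auto
  ultimately have "proj_pt (fm d (\<Lambda> 0)) = proj_pt f" "proj_pt (fm d (\<Lambda> 1)) = proj_pt g"
    by (simp_all add: proj_pt_scale)
  moreover have "finite {t. fm d (\<Lambda> t) \<notin> fm d ` YY m d E}"
    using A(4) by (rule rev_finite_subset) auto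
  ultimately show "\<exists>\<gamma>. pcurve \<gamma> & proj_pt (\<gamma> 0) = proj_pt f & proj_pt (\<gamma> 1) = proj_pt g &
      finite {t. \<gamma> t \<notin> fm d ` YY m d E}"
    using pcurve_fm[OF A(1)] by blast
qed

lemma YY_empty: "YY m d (\<lambda>_. {}) = {L. gt m d L}"
  by (simp add: YY_def)

lemma XX_sub: "2 <= m ==> m + 2 <= d ==> XX m d \<subseteq> proj_space (homog d)"
  unfolding XX_def proj_space_def using fm_homog fm_nz by auto

lemma XX_prime: "2 <= m ==> m + 2 <= d ==> prime_on (XX m d)"
  using YY_prime[of m d "\<lambda>_. {}"] by (simp add: YY_empty XX_def)

lemma XX_mem:
  assumes m: "2 <= m" "m + 2 <= d"
  shows "proj_pt f \<in> XX m d \<longleftrightarrow> (EX L. gt m d L & f = fm d L)"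
proof
  assume "proj_pt f \<in> XX m d"
  then obtain L where L: "gt m d L" "proj_pt f = proj_pt (fm d L)" by (auto simp: XX_def)
  obtain c where c: "c ~= 0" "f = pscale c (fm d L)" using proj_pt_eqD[OF L(2) fm_nz[OF L(1) m]] .
  define k where "k i = (if i = 0 then c else 1)" for i :: nat
  define L' where "L' i = k i *s L i" for i
  have "gt m d L'" by (rule gt_rescale[OF L(1) m, of k]) (auto simp: L'_def k_def c)
  moreover have "fm d L' = pscale (\<Prod>i<d. k i) (fm d L)" by (rule fm_rescale) (simp add: L'_def)
  moreover have "(\<Prod>i<d. k i) = c" using m by (simp add: k_def prod.delta)
  ultimately show "EX L. gt m d L & f = fm d L" using c by metis
qed (auto simp: XX_def)

lemma avoid_finite:
  assumes "finite (B :: complex set)" obtains t where "t \<notin> B"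
  using ex_new_if_finite[OF infinite_UNIV_char_0 assms] by blast

section \<open>A chain of irreducible closed sets through every point\<close>

lemma finite_mdeg: "finite {m :: 3 \<Rightarrow>\<^sub>0 nat. mdeg m = d}"
proof -
  have "{m :: 3 \<Rightarrow>\<^sub>0 nat. mdeg m = d} \<subseteq> (\<lambda>(i, j, k). sg 1 i + sg 2 j + sg 3 k) ` ({..d} \<times> {..d} \<times> {..d})"
  proof
    fix m :: "3 \<Rightarrow>\<^sub>0 nat" assume "m \<in> {m. mdeg m = d}"
    then have "lk m 1 + lk m 2 + lk m 3 = d" by (simp add: mdeg_superset[of UNIV] sum_3)
    moreover have "m = sg 1 (lk m 1) + sg 2 (lk m 2) + sg 3 (lk m 3)"
    proof (rule poly_mapping_eqI)
      fix k :: 3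
      show "lk m k = lk (sg 1 (lk m 1) + sg 2 (lk m 2) + sg 3 (lk m 3)) k"
        using exhaust_3[of k] by (elim disjE) (simp_all add: lookup_add lookup_single)
    qed
    ultimately show "m \<in> (\<lambda>(i, j, k). sg 1 i + sg 2 j + sg 3 k) ` ({..d} \<times> {..d} \<times> {..d})"
      by (intro image_eqI[of _ _ "(lk m 1, lk m 2, lk m 3)"]) auto
  qed
  then show ?thesis by (rule finite_subset) simp
qed

definition linform :: "nat => ((3 \<Rightarrow>\<^sub>0 nat) => complex) => (3 \<Rightarrow>\<^sub>0 nat) mpoly" where
  "linform d \<xi> = (\<Sum>m\<in>{m. mdeg m = d}. sg (sg m 1) (\<xi> m))"

lemma linform_homog: "linform d \<xi> \<in> homog 1"
  unfolding linform_def by (intro homog_sum homog_single) simp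

lemma fev_linform: "fev (linform d \<xi>) f = (\<Sum>m\<in>{m. mdeg m = d}. \<xi> m * lk f m)"
  by (simp add: linform_def eval_simps)

lemma homog_sum_monomials:
  assumes "f \<in> homog d" "!!m. h m 0 = 0"
  shows "(\<Sum>m\<in>kys f. h m (lk f m)) = (\<Sum>m\<in>{m :: 3 \<Rightarrow>\<^sub>0 nat. mdeg m = d}. h m (lk f m))"
  by (rule sum.mono_neutral_left)
     (use assms in \<open>auto simp: finite_mdeg homog_def in_keys_iff\<close>)

lemma fev_linform_eval:
  assumes "f \<in> homog d"
  shows "fev (linform d (pmon (($) u))) f = eval_mpoly f (($) u)"
proof -
  have "eval_mpoly f (($) u) = (\<Sum>m\<in>{m. mdeg m = d}. lk f m * pmon (($) u) m)"
    unfolding eval_mpoly_subst subst_def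
    by (rule homog_sum_monomials[OF assms, of "\<lambda>m c. c * pmon (($) u) m"]) simp
  then show ?thesis by (simp add: fev_linform mult.commute)
qed

lemma points_on_line:
  assumes "finite A" "v ~= 0" "!!j. j \<in> A ==> cr v (L j) ~= 0"
  obtains e e' where "dot v e = 0" "dot v e' = 0" "cr e e' ~= 0"
    "!!j. j \<in> A ==> dot (L j) e ~= 0 & dot (L j) e' ~= 0"
proof -
  obtain u1 u2 where u: "dot v u1 = 0" "dot v u2 = 0" "cr u1 u2 ~= 0"
    "!!w. dot w u1 = 0 ==> dot w u2 = 0 ==> cr v w = 0"
    using plane_basis[OF assms(2)] by metis
  have f: "finite {t. dot (L j) (u1 + t *s u2) = 0}" if "j \<in> A" for j
  proof -
    have p: "pfun (\<lambda>t. dot (L j) (u1 + t *s u2))"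
      unfolding dot_add_scale by (intro pfun_intros)
    have "dot (L j) u1 ~= 0 \<or> dot (L j) u2 ~= 0" using u(4) assms(3)[OF that] by blast
    then have "dot (L j) (u1 + 0 *s u2) ~= 0 \<or> dot (L j) (u1 + 1 *s u2) ~= 0"
      unfolding dot_add_scale by auto
    then show ?thesis using pfun_finite_zeros[OF p] by blast
  qed
  let ?B = "\<Union>j\<in>A. {t. dot (L j) (u1 + t *s u2) = 0}"
  have fB: "finite ?B" using f assms(1) by blast
  obtain s where s: "s \<notin> ?B" using ex_new_if_finite[OF infinite_UNIV_char_0 fB] by blast
  have "finite (insert s ?B)" using fB by simp
  then obtain t where t: "t \<notin> insert s ?B" using ex_new_if_finite[OF infinite_UNIV_char_0] by blast
  have c: "cr (u1 + s *s u2) (u1 + t *s u2) = (t - s) *s cr u1 u2"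
    by (simp add: vec3_eq_iff algebra_simps)
  show thesis
  proof (rule that[of "u1 + s *s u2" "u1 + t *s u2"])
    show "cr (u1 + s *s u2) (u1 + t *s u2) ~= 0"
      unfolding c using t u(3) by (auto simp: vec3_eq_iff)
  qed (use s t u in \<open>auto simp: dot_add_scale\<close>)
qed

text \<open>Rebuilding a tuple from its four main lines and one point on each other line.\<close>
definition rebuild :: "nat => (nat => complex^3) => (nat => complex^3) => nat => complex^3" where
  "rebuild m e M i = (if mainl m i then M i else thru (e i) (M (bs m i)) (M (bs m i + 1)))"

lemma rebuild_main: "2 <= m ==> rebuild m e M (bs m i) = M (bs m i)"
  "2 <= m ==> rebuild m e M (bs m i + 1) = M (bs m i + 1)"
  by (simp_all add: rebuild_def)

lemma pen_rebuild: "2 <= m ==> pen m d (rebuild m e M)"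
  unfolding pen_def
proof (intro allI impI)
  fix i assume m: "2 <= m"
  show "tri (rebuild m e M (bs m i)) (rebuild m e M (bs m i + 1)) (rebuild m e M i) = 0"
  proof (cases "mainl m i")
    case True
    then show ?thesis by (metis mainl_def tri_same)
  next
    case False
    then have "rebuild m e M i = thru (e i) (M (bs m i)) (M (bs m i + 1))" by (simp add: rebuild_def)
    then show ?thesis using m by (simp only: rebuild_main thru_def tri_lincomb_diff)
  qed
qed

lemma vcurve_rebuild:
  assumes "2 <= m" "m + 2 <= d" "vcurve d M"
  shows "vcurve d (\<lambda>t. rebuild m e (M t))"
  unfolding vcurve_def
proof (intro allI impI)
  fix i j assume "i < d"
  have lb: "bs m i < d" "bs m i + 1 < d" using assms by (auto simp: bs_def)
  have p: "pfun (\<lambda>t. M t k $ j)" if "k < d" for k j using assms(3) that by (auto simp: vcurve_def)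
  show "pfun (\<lambda>t. rebuild m e (M t) i $ j)"
    using p[OF \<open>i < d\<close>] p[OF lb(1)] p[OF lb(2)] unfolding rebuild_def thru_def
    by (cases "mainl m i") (auto intro!: pfun_intros pfun_dot simp del: One_nat_def)
qed

locale pointed_tuple =
  fixes m d :: nat and L e e' :: "nat => complex^3"
  assumes m: "2 <= m" "m + 2 <= d" and g: "gt m d L"
    and e: "!!i. i < d ==> dot (L i) (e i) = 0" "!!i. i < d ==> dot (L i) (e' i) = 0"
      "!!i. i < d ==> cr (e i) (e' i) ~= 0"
      "!!i j. i < d ==> j < d ==> i ~= j ==> dot (L j) (e i) ~= 0 & dot (L j) (e' i) ~= 0"
begin

definition mi :: "nat => nat" where
  "mi r = (if r = 0 then 0 else if r = 1 then 1 else if r = 2 then m else m + 1)"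

definition cline :: "nat => nat" where "cline k = (if k < d then k else mi (k - d))"
definition cpoint :: "nat => complex^3" where "cpoint k = (if k < d then e k else e' (mi (k - d)))"

definition EE :: "nat => nat => (complex^3) set" where
  "EE j i = {cpoint k | k. j <= k & k < d + 4 & cline k = i}"

lemma mi_lt: "mi r < d"
  using m by (auto simp: mi_def)

lemma mi_inj:
  assumes "mi r = mi r'" "r < 4" "r' < 4"
  shows "r = r'"
proof -
  have "r = 0 \<or> r = 1 \<or> r = 2 \<or> r = 3" "r' = 0 \<or> r' = 1 \<or> r' = 2 \<or> r' = 3" using assms by linarith+
  then show ?thesis using assms(1) m by (elim disjE) (simp_all add: mi_def)
qed

lemma main_mi: "mainl m (mi r)"
  using m by (auto simp: mi_def mainl_def bs_def)

lemma cline_lt: "cline k < d"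
  using mi_lt by (auto simp: cline_def)

lemma cpoint_on: "dot (L (cline k)) (cpoint k) = 0"
  using e(1,2) mi_lt by (auto simp: cline_def cpoint_def)

lemma cpoint_off: "i < d ==> i ~= cline k ==> dot (L i) (cpoint k) ~= 0"
  using e(4) mi_lt by (auto simp: cline_def cpoint_def)

lemma EE_nonmain: "i < d ==> \<not> mainl m i ==> EE j i = (if j <= i then {e i} else {})"
  using main_mi by (auto simp: EE_def cline_def cpoint_def split: if_splits)

lemma EE_anti: "EE (Suc j) i \<subseteq> EE j i"
  by (force simp: EE_def)

lemma mem_YY: "L \<in> YY m d (EE j)"
  unfolding YY_def
proof (intro CollectI conjI allI impI ballI g)
  fix i x assume "i < d" "x \<in> EE j i"
  then show "dot (L i) x = 0" using cpoint_on by (auto simp: EE_def)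
  assume nm: "\<not> mainl m i"
  have "x = e i" using EE_nonmain[OF \<open>i < d\<close> nm] \<open>x \<in> EE j i\<close> by (auto split: if_splits)
  moreover have "bs m i < d" using m by (auto simp: bs_def)
  moreover have "bs m i ~= i" using nm by (auto simp: mainl_def)
  ultimately show "dot (L (bs m i)) x ~= 0" using e(4)[OF \<open>i < d\<close>, of "bs m i"] by auto
qed

lemma EE_other:
  assumes "j < d + 4" "x \<in> EE (Suc j) (cline j)" "mainl m (cline j)"
  shows "cr (cpoint j) x ~= 0"
proof -
  obtain k where k: "x = cpoint k" "Suc j <= k" "k < d + 4" "cline k = cline j" using assms(2) by (auto simp: EE_def)
  have "j < d & d <= k"
  proof (rule ccontr)
    assume n: "\<not> ?thesis"
    show False
    proof (cases "j < d")
      case True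
      then show False using n k by (auto simp: cline_def)
    next
      case False
      then have "mi (k - d) = mi (j - d)" using k by (auto simp: cline_def)
      then have "k - d = j - d" using mi_inj k False assms(1) by auto
      then show False using k False by auto
    qed
  qed
  then have "cpoint j = e j" "x = e' j" "j < d" using k by (auto simp: cpoint_def cline_def)
  then show ?thesis using e(3) by simp
qed

lemma EE_single:
  assumes "j < d + 4" "x \<in> EE (Suc j) (cline j)" "y \<in> EE (Suc j) (cline j)" "mainl m (cline j)"
  shows "x = y"
proof -
  have *: "d <= k & x = e' (cline j)" if k: "x = cpoint k" "Suc j <= k" "k < d + 4" "cline k = cline j" for x k
  proof -
    have "d <= k"
    proof (rule ccontr)
      assume "\<not> d <= k"
      then show False using k by (auto simp: cline_def)
    qed
    then show ?thesis using k by (auto simp: cpoint_def cline_def split: if_splits)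
  qed
  obtain k where k: "x = cpoint k" "Suc j <= k" "k < d + 4" "cline k = cline j" using assms(2) unfolding EE_def by blast
  obtain l where l: "y = cpoint l" "Suc j <= l" "l < d + 4" "cline l = cline j" using assms(3) unfolding EE_def by blast
  show ?thesis using *[OF k] *[OF l] by simp
qed

lemma release:
  assumes j: "j < d + 4"
  obtains L' where "L' \<in> YY m d (EE (Suc j))" "eval_mpoly (fm d L') (($) (cpoint j)) ~= 0"
proof -
  let ?i = "cline j" and ?x = "cpoint j"
  have il: "?i < d" by (rule cline_lt)
  obtain M where M: "dot M ?x ~= 0" "mainl m ?i ==> (\<forall>y\<in>EE (Suc j) ?i. dot M y = 0)"
    "\<not> mainl m ?i ==> M = L (bs m ?i)"
  proof (cases "mainl m ?i")
    case False
    have "bs m ?i < d" "bs m ?i ~= ?i" using m False by (auto simp: bs_def mainl_def)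
    then show thesis using that[of "L (bs m ?i)"] cpoint_off False by simp
  next
    case True
    show thesis
    proof (cases "EE (Suc j) ?i = {}")
      case e: True
      have "L (ob m ?i) ~= 0" using gt_nz[OF g m] m by (simp add: ob_def)
      have "ob m ?i < d" "ob m ?i ~= ?i" using m by (auto simp: ob_def)
      then show thesis using that[of "L (ob m ?i)"] cpoint_off True e by simp
    next
      case False
      then obtain y where y: "y \<in> EE (Suc j) ?i" by blast
      then have "cr ?x y ~= 0" using EE_other[OF j _ True] by blast
      then obtain z where z: "tri ?x y z ~= 0" using cr_zero_iff by blast
      have "dot (cr y z) ?x ~= 0" using z tri_cyc[of ?x y z] by (simp add: tri_def)
      moreover have "dot (cr y z) y = 0" unfolding tri_def[symmetric] by simp
      ultimately show thesis using that[of "cr y z"] EE_single[OF j _ y True] True by metis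
    qed
  qed
  define N where "N t = L(?i := L ?i + t *s M)" for t
  define \<Lambda> where "\<Lambda> t = (if mainl m ?i then rebuild m e (N t) else N t)" for t
  have vN: "vcurve d N"
    unfolding vcurve_def
  proof (intro allI impI)
    fix i k show "pfun (\<lambda>t. N t i $ k)"
      by (cases "i = ?i") (auto simp: N_def intro!: pfun_intros)
  qed
  have vc: "vcurve d \<Lambda>"
    using vN vcurve_rebuild[OF m vN] by (cases "mainl m ?i") (simp_all add: \<Lambda>_def[abs_def])
  have N0: "N 0 = L" by (auto simp: N_def)
  have lb: "bs m i < d" "bs m i + 1 < d" for i using m by (auto simp: bs_def)
  have "EX c. c ~= 0 & \<Lambda> 0 i = c *s L i" if i: "i < d" for i
  proof (cases "mainl m ?i & \<not> mainl m i")
    case True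
    have "bs m i ~= i" using True by (auto simp: mainl_def)
    then have "dot (L (bs m i)) (e i) ~= 0" using e(4)[OF i lb(1)[of i]] by auto
    then obtain c where "c ~= 0" "thru (e i) (L (bs m i)) (L (bs m i + 1)) = c *s L i"
      using thru_rescale[OF g m i e(1)[OF i]] by metis
    then show ?thesis using True by (auto simp: \<Lambda>_def rebuild_def N0)
  next
    case False
    then show ?thesis by (intro exI[of _ 1]) (auto simp: \<Lambda>_def rebuild_def N0)
  qed
  then have "ALL i. EX c. i < d --> c ~= 0 & \<Lambda> 0 i = c *s L i" by blast
  from choice[OF this] obtain c where c: "!!i. i < d ==> c i ~= 0 & \<Lambda> 0 i = c i *s L i" by blast
  have pe: "pen m d (\<Lambda> t)" for t
  proof (cases "mainl m ?i")
    case True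
    then show ?thesis using pen_rebuild m by (simp add: \<Lambda>_def)
  next
    case False
    have nb: "bs m i ~= ?i" "bs m i + 1 ~= ?i" for i
      using False m mainl_bs[of m i] by (metis Suc_eq_plus1)+
    show ?thesis
      unfolding pen_def
    proof (intro allI impI)
      fix i assume i: "i < d"
      show "tri (\<Lambda> t (bs m i)) (\<Lambda> t (bs m i + 1)) (\<Lambda> t i) = 0"
      proof (cases "i = ?i")
        case True
        have "tri (L (bs m i)) (L (bs m i + 1)) (L i + t *s L (bs m i)) = tri (L (bs m i)) (L (bs m i + 1)) (L i)"
          by (simp add: tri_expand algebra_simps)
        then show ?thesis using True False nb gt_pen[OF g m i] M(3) by (simp add: \<Lambda>_def N_def)
      next
        case ne: False
        then show ?thesis using False nb gt_pen[OF g m i] by (simp add: \<Lambda>_def N_def)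
      qed
    qed
  qed
  have "gt m d (\<Lambda> 0)" by (rule gt_rescale[OF g m c])
  then have fg: "finite {t. \<not> gt m d (\<Lambda> t)}" by (rule finite_not_gt[OF vc m pe])
  have pd: "pfun (\<lambda>t. dot (\<Lambda> t i) y)" if "i < d" for i y
    using vc that by (intro pfun_dot) (auto simp: vcurve_def)
  have fb: "finite {t. dot (\<Lambda> t (bs m i)) (e i) = 0}" if i: "i < d" "\<not> mainl m i" for i
  proof -
    have "bs m i ~= i" using i by (auto simp: mainl_def)
    then have "dot (L (bs m i)) (e i) ~= 0" using e(4)[OF i(1) lb(1)[of i]] by auto
    then have "dot (\<Lambda> 0 (bs m i)) (e i) ~= 0" using c[OF lb(1)[of i]] by (simp add: dot_scale)
    then show ?thesis using pfun_finite_zeros[OF pd[OF lb(1)]] by blast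
  qed
  have fx: "finite {t. dot (\<Lambda> t i) ?x = 0}" if i: "i < d" for i
  proof (cases "i = ?i")
    case True
    have "\<Lambda> t ?i = L ?i + t *s M" for t
      by (auto simp: \<Lambda>_def N_def rebuild_def)
    then have "dot (\<Lambda> 1 i) ?x ~= 0" using True M(1) cpoint_on[of j] by (simp add: dot_add dot_scale)
    then show ?thesis using pfun_finite_zeros[OF pd[OF i]] by blast
  next
    case False
    then have "dot (\<Lambda> 0 i) ?x ~= 0" using cpoint_off[OF i, of j] c[OF i] by (simp add: dot_scale)
    then show ?thesis using pfun_finite_zeros[OF pd[OF i]] by blast
  qed
  let ?B = "{t. \<not> gt m d (\<Lambda> t)} \<union> (\<Union>i\<in>{i. i < d & \<not> mainl m i}. {t. dot (\<Lambda> t (bs m i)) (e i) = 0})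
     \<union> (\<Union>i<d. {t. dot (\<Lambda> t i) ?x = 0})"
  have "finite ?B" using fg fb fx by auto
  then obtain t where t: "t \<notin> ?B" by (rule avoid_finite)
  have cons: "dot (\<Lambda> t i) y = 0" if i: "i < d" and y: "y \<in> EE (Suc j) i" for i y
  proof (cases "mainl m i")
    case True
    obtain k where "y = cpoint k" "cline k = i" using y unfolding EE_def by blast
    then have Ly: "dot (L i) y = 0" using cpoint_on[of k] by simp
    show ?thesis
    proof (cases "i = ?i")
      case eq: True
      then have "\<Lambda> t i = L i + t *s M" using True by (simp add: \<Lambda>_def N_def rebuild_def)
      moreover have "dot M y = 0" using M(2) True eq y by simp
      ultimately show ?thesis using Ly by (simp add: dot_add dot_scale)
    next
      case False
      then have "\<Lambda> t i = L i" using True by (simp add: \<Lambda>_def N_def rebuild_def)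
      then show ?thesis using Ly by simp
    qed
  next
    case nm: False
    have ye: "y = e i" "Suc j <= i" using EE_nonmain[OF i nm, of "Suc j"] y by (auto split: if_splits)
    show ?thesis
    proof (cases "mainl m ?i")
      case True
      then show ?thesis using nm ye by (simp add: \<Lambda>_def rebuild_def dot_thru)
    next
      case False
      have "j < d" using i ye by simp
      then have "?i = j" by (simp add: cline_def)
      then have "\<Lambda> t i = L i" using ye False by (simp add: \<Lambda>_def N_def)
      then show ?thesis using e(1)[OF i] ye by simp
    qed
  qed
  have "\<Lambda> t \<in> YY m d (EE (Suc j))"
    unfolding YY_def
  proof (intro CollectI conjI allI impI ballI)
    show "gt m d (\<Lambda> t)" using t by auto
    fix i y assume i: "i < d" and y: "y \<in> EE (Suc j) i"
    show "dot (\<Lambda> t i) y = 0" by (rule cons[OF i y])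
    assume nm: "\<not> mainl m i"
    have "y = e i" using EE_nonmain[OF i nm, of "Suc j"] y by (auto split: if_splits)
    then show "dot (\<Lambda> t (bs m i)) y ~= 0" using t i nm by auto
  qed
  moreover have "eval_mpoly (fm d (\<Lambda> t)) (($) ?x) ~= 0" using t by (simp add: eval_fm)
  ultimately show thesis by (rule that)
qed

lemma YY_sub: "YY m d E \<subseteq> {L. gt m d L}"
  by (auto simp: YY_def)

lemma lower_chain:
  "EX Z. irred_closed_chain (subtopology (zariski (homog d)) (XX m d)) (d + 4) Z & proj_pt (fm d L) \<in> Z 0"
proof (intro exI conjI)
  define A where "A j = proj_pt ` fm d ` YY m d (EE j)" for j
  let ?Z = "\<lambda>j. zclosure (XX m d) (A j)"
  have AX: "A j \<subseteq> XX m d" for j unfolding A_def XX_def using YY_sub by blast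
  have memA: "proj_pt (fm d L) \<in> A j" for j unfolding A_def using mem_YY by blast
  then show "proj_pt (fm d L) \<in> ?Z 0" using subset_zclosure[OF AX] by blast
  have pr: "prime_on (A j)" for j
    unfolding A_def by (rule YY_prime[OF m]) (use EE_nonmain in auto)
  note W = cone_homog[of d]
  note X = XX_sub[OF m]
  show "irred_closed_chain (subtopology (zariski (homog d)) (XX m d)) (d + 4) ?Z"
    unfolding irred_closed_chain_def
  proof (intro conjI allI impI)
    fix i
    show "closedin (subtopology (zariski (homog d)) (XX m d)) (?Z i)"
      by (rule closedin_zclosure[OF W X AX])
    have "?Z i \<subseteq> XX m d" by (auto simp: zclosure_def)
    moreover have "?Z i ~= {}" using memA subset_zclosure[OF AX] by blast
    ultimately show "irreducible_in (subtopology (zariski (homog d)) (XX m d)) (?Z i)"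
      using irreducible_in_sub_zariski[OF W X] prime_on_zclosure[OF AX pr] by blast
  next
    fix j assume j: "j < d + 4"
    have mono: "A j \<subseteq> A (Suc j)"
    proof -
      have "YY m d (EE j) \<subseteq> YY m d (EE (Suc j))" using EE_anti unfolding YY_def by blast
      then show ?thesis unfolding A_def by blast
    qed
    have sub: "?Z j \<subseteq> ?Z (Suc j)"
      unfolding zclosure_def using mono by (auto simp: vanish_def subset_iff)
    let ?F = "linform d (pmon (($) (cpoint j)))"
    have "vanish ?F (A j)"
      unfolding vanish_def
    proof (intro allI impI)
      fix f assume f: "proj_pt f \<in> A j"
      then obtain K where K: "K \<in> YY m d (EE j)" "proj_pt f = proj_pt (fm d K)" by (auto simp: A_def)
      have gK: "gt m d K" using K by (auto simp: YY_def)
      obtain c where c: "f = pscale c (fm d K)" using proj_pt_eqD[OF K(2) fm_nz[OF gK m]] by metis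
      have "cpoint j \<in> EE j (cline j)" using j by (auto simp: EE_def)
      then have "dot (K (cline j)) (cpoint j) = 0" using K(1) cline_lt by (auto simp: YY_def)
      then have "eval_mpoly (fm d K) (($) (cpoint j)) = 0"
        using cline_lt by (auto simp: eval_fm prod_zero_iff)
      then show "fev ?F f = 0"
        unfolding c fev_pscale[OF linform_homog] fev_linform_eval[OF fm_homog] by simp
    qed
    then have v: "vanish ?F (?Z j)" using vanish_zclosure[OF linform_homog AX] by blast
    obtain K where K: "K \<in> YY m d (EE (Suc j))" "eval_mpoly (fm d K) (($) (cpoint j)) ~= 0"
      using release[OF j] .
    have "proj_pt (fm d K) \<in> ?Z (Suc j)" using K(1) subset_zclosure[OF AX[of "Suc j"]] by (auto simp: A_def)
    moreover have "proj_pt (fm d K) \<notin> ?Z j"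
      using v K(2) fev_linform_eval[OF fm_homog[of d K]] by (auto simp: vanish_def)
    ultimately show "?Z j \<subset> ?Z (Suc j)" using sub by blast
  qed
qed

end

lemma chain_through_point:
  assumes m: "2 <= m" "m + 2 <= d" and g: "gt m d L"
  obtains Z where "irred_closed_chain (subtopology (zariski (homog d)) (XX m d)) (d + 4) Z" "proj_pt (fm d L) \<in> Z 0"
proof -
  define P where "P i x y \<longleftrightarrow> dot (L i) x = 0 & dot (L i) y = 0 & cr x y ~= 0 &
      (\<forall>j<d. j ~= i --> dot (L j) x ~= 0 & dot (L j) y ~= 0)" for i x y
  have ex: "EX x y. P i x y" if i: "i < d" for i
  proof -
    have "cr (L i) (L j) ~= 0" if "j \<in> {..<d} - {i}" for j
      by (rule gt_cr[OF g m i]) (use that in simp_all)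
    then obtain x y where "dot (L i) x = 0" "dot (L i) y = 0" "cr x y ~= 0"
      "!!j. j \<in> {..<d} - {i} ==> dot (L j) x ~= 0 & dot (L j) y ~= 0"
      using points_on_line[of "{..<d} - {i}" "L i" L, OF _ gt_nz[OF g m i]] by (metis finite_Diff finite_lessThan)
    then have "P i x y" by (simp add: P_def)
    then show ?thesis by blast
  qed
  define x where "x i = (SOME x. EX y. P i x y)" for i
  define y where "y i = (SOME y. P i (x i) y)" for i
  have "EX y. P i (x i) y" if "i < d" for i unfolding x_def by (rule someI_ex[OF ex[OF that]])
  then have P: "P i (x i) (y i)" if "i < d" for i unfolding y_def using that by (blast intro: someI_ex)
  have "pointed_tuple m d L x y"
    by (rule pointed_tuple.intro) (use m g P in \<open>simp_all add: P_def\<close>)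
  then show thesis using pointed_tuple.lower_chain that by blast
qed

section \<open>Upper bound for chains by counting polynomials\<close>

text \<open>Gaussian elimination of one coordinate at a time.\<close>
lemma linear_dependence:
  fixes v :: "'i => 'x => complex"
  assumes "finite I" "finite B" "card B < card I"
  shows "EX c. (\<exists>i\<in>I. c i ~= 0) & (\<forall>x\<in>B. (\<Sum>i\<in>I. c i * v i x) = 0)"
  using assms(2,1,3)
proof (induction B arbitrary: I v rule: finite_induct)
  case empty
  then obtain i where "i \<in> I" by fastforce
  then show ?case by (intro exI[of _ "\<lambda>_. 1"]) auto
next
  case (insert b B)
  show ?case
  proof (cases "\<forall>i\<in>I. v i b = 0")
    case True
    have "card B < card I" using insert by simp
    from insert.IH[OF insert.prems(1) this, of v] True show ?thesis by auto
  next
    case False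
    then obtain i0 where i0: "i0 \<in> I" "v i0 b ~= 0" by blast
    let ?I = "I - {i0}"
    have "finite ?I" "card B < card ?I" using insert i0 by auto
    from insert.IH[OF this, of "\<lambda>i x. v i x - v i b / v i0 b * v i0 x"] obtain c where
      c: "\<exists>i\<in>?I. c i ~= 0" "\<forall>x\<in>B. (\<Sum>i\<in>?I. c i * (v i x - v i b / v i0 b * v i0 x)) = 0" by blast
    define c' where "c' i = (if i = i0 then - (\<Sum>i\<in>?I. c i * v i b) / v i0 b else c i)" for i
    have s: "(\<Sum>i\<in>I. c' i * v i x) = (\<Sum>i\<in>?I. c i * v i x) - (\<Sum>i\<in>?I. c i * v i b) / v i0 b * v i0 x" for x
      using insert.prems(1) i0 by (simp add: sum.remove[of I i0] c'_def)
    have "(\<Sum>i\<in>I. c' i * v i x) = 0" if "x \<in> insert b B" for x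
    proof (cases "x = b")
      case True
      then show ?thesis using i0 by (simp add: s)
    next
      case False
      then have "(\<Sum>i\<in>?I. c i * (v i x - v i b / v i0 b * v i0 x)) = 0" using c that by simp
      then show ?thesis unfolding s
        by (simp add: right_diff_distrib sum_subtractf sum_distrib_right sum_divide_distrib mult.assoc)
    qed
    moreover have "\<exists>i\<in>I. c' i ~= 0" using c(1) by (auto simp: c'_def)
    ultimately show ?thesis by blast
  qed
qed

definition bpol :: "nat => nat => ((nat => complex) => complex) => bool" where
  "bpol N K g \<longleftrightarrow> (EX c. ALL y. g y = (\<Sum>e\<in>ebox N K. c e * (\<Prod>i<N. y i ^ e i)))"

lemma bpol_0: "bpol N K (\<lambda>_. 0)"
  unfolding bpol_def by (rule exI[of _ "\<lambda>_. 0"]) simp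

lemma bpol_add: "bpol N K f ==> bpol N K g ==> bpol N K (\<lambda>y. f y + g y)"
  unfolding bpol_def
proof (elim exE)
  fix c c' assume "ALL y. f y = (\<Sum>e\<in>ebox N K. c e * (\<Prod>i<N. y i ^ e i))" "ALL y. g y = (\<Sum>e\<in>ebox N K. c' e * (\<Prod>i<N. y i ^ e i))"
  then show "EX c. ALL y. f y + g y = (\<Sum>e\<in>ebox N K. c e * (\<Prod>i<N. y i ^ e i))"
    by (intro exI[of _ "\<lambda>e. c e + c' e"]) (simp add: sum.distrib distrib_right)
qed

lemma bpol_scale: "bpol N K f ==> bpol N K (\<lambda>y. a * f y)"
  unfolding bpol_def
proof (elim exE)
  fix c assume "ALL y. f y = (\<Sum>e\<in>ebox N K. c e * (\<Prod>i<N. y i ^ e i))"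
  then show "EX c. ALL y. a * f y = (\<Sum>e\<in>ebox N K. c e * (\<Prod>i<N. y i ^ e i))"
    by (intro exI[of _ "\<lambda>e. a * c e"]) (simp add: sum_distrib_left mult.assoc)
qed

lemma bpol_sum: "(!!i. i \<in> A ==> bpol N K (f i)) ==> bpol N K (\<lambda>y. \<Sum>i\<in>A. f i y)"
  by (induction A rule: infinite_finite_induct) (auto intro: bpol_0 bpol_add)

lemma bpol_monomial:
  assumes "!!i. i < N ==> a i <= K"
  shows "bpol N K (\<lambda>y. \<Prod>i<N. y i ^ a i)"
  unfolding bpol_def
proof (rule exI[of _ "\<lambda>e. if e = restrict a {..<N} then 1 else 0"], intro allI)
  fix y :: "nat => complex"
  have "restrict a {..<N} \<in> ebox N K" using assms by (auto simp: ebox_def)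
  then have "(\<Sum>e\<in>ebox N K. (if e = restrict a {..<N} then 1 else 0) * (\<Prod>i<N. y i ^ e i))
     = (\<Prod>i<N. y i ^ restrict a {..<N} i)"
    by (simp add: if_distrib[of "\<lambda>x. x * _"] cong: if_cong)
  then show "(\<Prod>i<N. y i ^ a i) = (\<Sum>e\<in>ebox N K. (if e = restrict a {..<N} then 1 else 0) * (\<Prod>i<N. y i ^ e i))"
    by simp
qed

lemma bpol_mult: "bpol N K f ==> bpol N K' g ==> bpol N (K + K') (\<lambda>y. f y * g y)"
proof -
  assume "bpol N K f" "bpol N K' g"
  then obtain c c' where c: "!!y. f y = (\<Sum>e\<in>ebox N K. c e * (\<Prod>i<N. y i ^ e i))"
    "!!y. g y = (\<Sum>e\<in>ebox N K'. c' e * (\<Prod>i<N. y i ^ e i))" unfolding bpol_def by blast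
  have e: "f y * g y = (\<Sum>e\<in>ebox N K. \<Sum>e'\<in>ebox N K'. (c e * c' e') * (\<Prod>i<N. y i ^ (e i + e' i)))" for y
    unfolding c sum_product by (simp add: power_add prod.distrib mult_ac)
  show ?thesis
    unfolding e
  proof (intro bpol_sum bpol_scale bpol_monomial)
    fix e e' i assume "e \<in> ebox N K" "e' \<in> ebox N K'" "i < N"
    then have "e i <= K" "e' i <= K'" by (auto simp: ebox_def PiE_iff)
    then show "e i + e' i <= K + K'" by simp
  qed
qed

lemma bpol_1: "bpol N K (\<lambda>_. 1)"
  using bpol_monomial[of N "\<lambda>_. 0" K] by simp

lemma bpol_const: "bpol N K (\<lambda>_. c)"
  using bpol_scale[OF bpol_1, of N K c] by simp

lemma bpol_var2:
  assumes "i < N" "j < N" "i ~= j"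
  shows "bpol N 1 (\<lambda>y. y i)" "bpol N 1 (\<lambda>y. y i * y j)"
proof -
  have "(\<Prod>k<N. y k ^ (if k = i then 1 else 0)) = y i" for y :: "nat => complex"
    using assms by (simp add: if_distrib[of "\<lambda>e. _ ^ e"] prod.delta cong: if_cong)
  then show "bpol N 1 (\<lambda>y. y i)"
    using bpol_monomial[of N "\<lambda>k. if k = i then 1 else 0" 1] by simp
  have "(\<Prod>k<N. y k ^ (if k = i \<or> k = j then 1 else 0)) = y i * y j" for y :: "nat => complex"
  proof -
    have "(\<Prod>k<N. y k ^ (if k = i \<or> k = j then 1 else 0)) = (\<Prod>k\<in>{i, j}. y k ^ (if k = i \<or> k = j then 1 else 0))"
      by (rule prod.mono_neutral_right) (use assms in auto)
    then show ?thesis using assms(3) by simp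
  qed
  then show "bpol N 1 (\<lambda>y. y i * y j)"
    using bpol_monomial[of N "\<lambda>k. if k = i \<or> k = j then 1 else 0" 1] by simp
qed

lemma bpol_fev:
  assumes F: "F \<in> homog r" and \<gamma>: "!!m. bpol N K (\<lambda>y. lk (\<gamma> y) m)"
  shows "bpol N (r * K) (\<lambda>y. fev F (\<gamma> y))"
proof -
  have "bpol N (mdeg n * K) (\<lambda>y. pmon (lk (\<gamma> y)) n)" for n
  proof (induction n rule: exponent_induct)
    case zero
    then show ?case using bpol_1 by simp
  next
    case (step n j)
    then show ?case using bpol_mult[OF step \<gamma>[of j]] by (simp add: mdeg_add pmon_add add.commute)
  qed
  then show ?thesis
    unfolding eval_mpoly_subst subst_def
    using F by (intro bpol_sum bpol_scale) (auto simp: homog_def)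
qed

lemma bpol_dependence:
  assumes "finite I" "(K + 1) ^ N < card I" "!!i. i \<in> I ==> bpol N K (g i)"
  shows "EX c. (\<exists>i\<in>I. c i ~= 0) & (ALL y. (\<Sum>i\<in>I. c i * g i y) = 0)"
proof -
  have "ALL i. EX c. i \<in> I --> (ALL y. g i y = (\<Sum>e\<in>ebox N K. c e * (\<Prod>i<N. y i ^ e i)))"
    using assms(3) unfolding bpol_def by blast
  from choice[OF this] obtain v where v: "!!i y. i \<in> I ==> g i y = (\<Sum>e\<in>ebox N K. v i e * (\<Prod>i<N. y i ^ e i))" by blast
  obtain c where c: "\<exists>i\<in>I. c i ~= 0" "\<forall>x\<in>ebox N K. (\<Sum>i\<in>I. c i * v i x) = 0"
    using linear_dependence[OF assms(1) finite_ebox, of N K v] assms(2) by (auto simp: card_ebox)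
  have "(\<Sum>i\<in>I. c i * g i y) = 0" for y
  proof -
    have "(\<Sum>i\<in>I. c i * g i y) = (\<Sum>i\<in>I. \<Sum>e\<in>ebox N K. c i * v i e * (\<Prod>i<N. y i ^ e i))"
      by (simp add: v sum_distrib_left mult.assoc)
    also have "\<dots> = (\<Sum>e\<in>ebox N K. (\<Sum>i\<in>I. c i * v i e) * (\<Prod>i<N. y i ^ e i))"
      by (subst sum.swap) (simp add: sum_distrib_right)
    also have "\<dots> = 0" using c(2) by simp
    finally show ?thesis .
  qed
  then show ?thesis using c(1) by blast
qed

subsection \<open>A dense polynomial parametrisation with \<open>d + 4\<close> parameters\<close>

text \<open>Both pencils contain the line \<open>(y 3, y 1, 1)\<close> and are spanned by it together with \<open>(1, y 0, 0)\<close>,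
  respectively \<open>(y 2, 1, 0)\<close>; each further parameter is the position of one line in its pencil.\<close>
definition PL :: "nat => (nat => complex) => nat => complex^3" where
  "PL m y i = (if i < m then vector [1 + y (4 + i) * y 3, y 0 + y (4 + i) * y 1, y (4 + i)]
     else vector [y 2 + y (4 + i) * y 3, 1 + y (4 + i) * y 1, y (4 + i)])"

lemma PL_nth: "PL m y i $ 1 = (if i < m then 1 else y 2) + y (4 + i) * y 3"
  "PL m y i $ 2 = (if i < m then y 0 else 1) + y (4 + i) * y 1" "PL m y i $ 3 = y (4 + i)"
  by (simp_all add: PL_def)

lemma bpol_PL: "bpol (d + 4) d (\<lambda>y. lk (fm d (PL m y)) n)"
proof -
  have "bpol (d + 4) 1 (\<lambda>y. PL m y i $ j)" if i: "i < d" for i j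
  proof -
    have v: "bpol (d + 4) 1 (\<lambda>y. y 0)" "bpol (d + 4) 1 (\<lambda>y. y 2)" "bpol (d + 4) 1 (\<lambda>y. y (4 + i))"
      "bpol (d + 4) 1 (\<lambda>y. y (4 + i) * y 3)" "bpol (d + 4) 1 (\<lambda>y. y (4 + i) * y 1)"
      using i bpol_var2(1)[of 0 "d + 4" 1] bpol_var2(1)[of 2 "d + 4" 1] bpol_var2(1)[of "4 + i" "d + 4" 1]
       bpol_var2(2)[of "4 + i" "d + 4" 3] bpol_var2(2)[of "4 + i" "d + 4" 1] by auto
    show ?thesis
      using exhaust_3[of j] v by (cases "i < m") (auto simp: PL_nth intro!: bpol_add bpol_const)
  qed
  then have "bpol (d + 4) (card {..<d}) (\<lambda>y. lk (\<Prod>i\<in>{..<d}. lin (PL m y i)) n)"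
    by (intro lookup_prod_lin_graded[where Q="bpol (d + 4)"])
       (auto intro: bpol_0 bpol_1 bpol_add bpol_mult[where K'=1, simplified])
  then show ?thesis by (simp add: fm_def)
qed

definition axis_w :: "nat => (nat => complex^3) => complex^3" where
  "axis_w m L = cr (cr (L 0) (L 1)) (cr (L m) (L (m + 1)))"

definition flat :: "complex^3 => complex^3 => complex^3" where
  "flat w u = w $ 3 *s u - u $ 3 *s w"

lemma coplanar:
  assumes "n ~= 0" "dot n x = 0" "dot n y = 0" "dot n z = 0"
  shows "tri x y z = 0"
proof (rule ccontr)
  assume "tri x y z ~= 0"
  then obtain p q r where D: "dual_basis x y z p q r" by (rule dual_basis_exists)
  have "dot x n = 0" "dot y n = 0" "dot z n = 0" using assms by (simp_all add: dot_def mult.commute)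
  then have "n = 0" using dual_basis_expand(1)[OF D, of n] by (simp add: vec3_eq_iff)
  then show False using assms(1) by simp
qed

lemma dot_cr [simp]: "dot n (cr n k) = 0" "dot n (cr k n) = 0"
  by (simp_all add: dot_def algebra_simps)

lemma dot_flat: "dot n (flat w u) = w $ 3 * dot n u - u $ 3 * dot n w"
  by (simp add: dot_def flat_def algebra_simps)

lemma flat_nth: "flat w u $ 1 = w $ 3 * u $ 1 - u $ 3 * w $ 1" "flat w u $ 2 = w $ 3 * u $ 2 - u $ 3 * w $ 2"
  "flat w u $ 3 = 0"
  by (simp_all add: flat_def)

lemma pencil_normal:
  assumes n: "n ~= 0" "dot n w = 0" "dot n u = 0" "dot n l = 0" and w: "w $ 3 ~= 0"
    and u: "flat w u $ 1 ~= 0 \<or> flat w u $ 2 ~= 0" and k: "dot k w = 0" "dot k l ~= 0"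
  shows "\<exists>\<alpha> \<sigma>. \<alpha> ~= 0 & l = \<alpha> *s flat w u + \<sigma> *s w"
proof -
  have "dot n (flat w u) = 0" using n by (simp add: dot_flat)
  then have "tri (flat w u) w l = 0" using coplanar n by blast
  moreover have "cr (flat w u) w ~= 0" using w u by (auto simp: vec3_eq_iff flat_nth(3))
  ultimately obtain \<alpha> \<sigma> where l: "l = \<alpha> *s flat w u + \<sigma> *s w" using span_if_tri by blast
  have "\<alpha> ~= 0"
  proof
    assume "\<alpha> = 0"
    moreover have "dot k l = \<alpha> * dot k (flat w u) + \<sigma> * dot k w"
      by (simp add: l dot_def algebra_simps)
    ultimately have "dot k l = 0" using k(1) by simp
    then show False using k by simp
  qed
  then show ?thesis using l by blast
qed

definition generic_pos :: "nat => (nat => complex^3) => complex" where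
  "generic_pos m L = axis_w m L $ 3 * flat (axis_w m L) (L 0) $ 1 * flat (axis_w m L) (L m) $ 2"

lemma normal_form:
  assumes m: "2 <= m" "m + 2 <= d" and g: "gt m d L" and k: "generic_pos m L ~= 0"
  obtains y c where "c ~= 0" "fm d L = pscale c (fm d (PL m y))"
proof -
  define w where "w = axis_w m L"
  define a where "a = flat w (L 0)"
  define b where "b = flat w (L m)"
  have nz: "w $ 3 ~= 0" "a $ 1 ~= 0" "b $ 2 ~= 0" using k by (auto simp: generic_pos_def a_def b_def w_def)
  let ?n = "cr (L 0) (L 1)" and ?n' = "cr (L m) (L (m + 1))"
  have n: "?n ~= 0" "?n' ~= 0" using gt_cr[OF g m] m by auto
  have nw: "dot ?n w = 0" "dot ?n' w = 0" by (simp_all add: w_def axis_w_def del: cr_nth)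
  have "\<exists>\<alpha> \<sigma>. \<alpha> ~= 0 & L i = \<alpha> *s (if i < m then a else b) + \<sigma> *s w" if i: "i < d" for i
  proof (cases "i < m")
    case True
    have 1: "dot ?n (L i) = 0" using gt_pen[OF g m i] True by (simp add: bs_def tri_def)
    have 2: "dot ?n' (L i) ~= 0" using gt_tri[OF g m i] True by (simp add: ob_def tri_def)
    have 3: "dot ?n (L 0) = 0" unfolding tri_def[symmetric] by simp
    show ?thesis
      using pencil_normal[OF n(1) nw(1) 3 1 nz(1) disjI1[OF nz(2)[unfolded a_def]] nw(2) 2] True
      unfolding a_def by simp
  next
    case False
    have 1: "dot ?n' (L i) = 0" using gt_pen[OF g m i] False by (simp add: bs_def tri_def)
    have 2: "dot ?n (L i) ~= 0" using gt_tri[OF g m i] False by (simp add: ob_def tri_def)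
    have 3: "dot ?n' (L m) = 0" unfolding tri_def[symmetric] by simp
    show ?thesis
      using pencil_normal[OF n(2) nw(2) 3 1 nz(1) disjI2[OF nz(3)[unfolded b_def]] nw(1) 2] False
      unfolding b_def by simp
  qed
  then have "ALL i. EX p. i < d --> fst p ~= 0 & L i = fst p *s (if i < m then a else b) + snd p *s w" by auto
  from choice[OF this] obtain p where p: "!!i. i < d ==> fst (p i) ~= 0 &
     L i = fst (p i) *s (if i < m then a else b) + snd (p i) *s w" by blast
  define c where "c i = fst (p i) * (if i < m then a $ 1 else b $ 2)" for i
  define y where "y j = (if j = 0 then a $ 2 / a $ 1 else if j = 1 then w $ 2 / w $ 3
    else if j = 2 then b $ 1 / b $ 2 else if j = 3 then w $ 1 / w $ 3
    else snd (p (j - 4)) * w $ 3 / c (j - 4))" for j :: nat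
  have y4: "y (4 + i) = snd (p i) * w $ 3 / c i" for i by (simp add: y_def)
  have cn: "c i ~= 0" if "i < d" for i using p[OF that] nz by (simp add: c_def)
  have e: "L i = c i *s PL m y i" if i: "i < d" for i
  proof -
    have a3: "a $ 3 = 0" "b $ 3 = 0" by (simp_all add: a_def b_def flat_nth)
    have Li: "L i = fst (p i) *s (if i < m then a else b) + snd (p i) *s w" and f: "fst (p i) ~= 0" using p[OF i] by auto
    have s: "c i * y (4 + i) = snd (p i) * w $ 3" using cn[OF i] by (simp add: y4)
    have y: "y 0 = a $ 2 / a $ 1" "y 1 = w $ 2 / w $ 3" "y 2 = b $ 1 / b $ 2" "y 3 = w $ 1 / w $ 3"
      by (simp_all add: y_def)
    show ?thesis
    proof (cases "i < m")
      case True
      have "c i * (1 + y (4 + i) * y 3) = c i + snd (p i) * w $ 3 * y 3"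
        "c i * (y 0 + y (4 + i) * y 1) = c i * y 0 + snd (p i) * w $ 3 * y 1"
        by (simp_all add: distrib_left mult.assoc[symmetric] s)
      then show ?thesis
        unfolding vec3_eq_iff using True nz a3 s f
        by (subst (1 2 3) Li) (simp add: PL_nth y(1,4) y(2)[simplified] c_def)
    next
      case False
      have "c i * (y 2 + y (4 + i) * y 3) = c i * y 2 + snd (p i) * w $ 3 * y 3"
        "c i * (1 + y (4 + i) * y 1) = c i + snd (p i) * w $ 3 * y 1"
        by (simp_all add: distrib_left mult.assoc[symmetric] s)
      then show ?thesis
        unfolding vec3_eq_iff using False nz a3 s f
        by (subst (1 2 3) Li) (simp add: PL_nth y(3,4) y(2)[simplified] c_def)
    qed
  qed
  have "fm d L = pscale (\<Prod>i<d. c i) (fm d (PL m y))" by (rule fm_rescale) (rule e)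
  moreover have "(\<Prod>i<d. c i) ~= 0" using cn by simp
  ultimately show thesis using that by blast
qed

definition std_par :: "nat => complex" where
  "std_par j = (if j < 4 then 0 else of_nat (j - 4))"

lemma PL_std: "PL m std_par i = (if i < m then vector [1, 0, of_nat i] else vector [0, 1, of_nat i])"
  by (simp add: PL_def std_par_def)

lemma gt_std: "2 <= m ==> m + 2 <= d ==> gt m d (PL m std_par)"
  unfolding gt_def pen_def nvp_nz
  by (auto simp: PL_std bs_def ob_def tri_expand)

lemma generic_pos_scale:
  assumes "2 <= m" and e: "L' 0 = c0 *s L 0" "L' 1 = c1 *s L 1" "L' m = c2 *s L m" "L' (m + 1) = c3 *s L (m + 1)"
  shows "generic_pos m L' = (c0 * c1 * c2 * c3) ^ 3 * c0 * c2 * generic_pos m L"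
proof -
  have w: "axis_w m L' = (c0 * c1 * c2 * c3) *s axis_w m L"
    unfolding axis_w_def e by (simp add: vec3_eq_iff algebra_simps)
  have f: "flat (k *s w) (c *s u) = (k * c) *s flat w u" for k c w u
    by (simp add: flat_def vec3_eq_iff algebra_simps)
  show ?thesis unfolding generic_pos_def w e f by (simp add: power3_eq_cube algebra_simps)
qed

lemma generic_pos_std: "2 <= m ==> generic_pos m (PL m std_par) ~= 0"
  by (simp add: generic_pos_def axis_w_def flat_nth PL_std)

lemma gt_connected:
  assumes m: "2 <= m" "m + 2 <= d" and g: "gt m d L" "gt m d L'"
  shows "\<exists>\<Lambda> c c'. vcurve d \<Lambda> & (\<forall>i<d. c i ~= 0 & \<Lambda> 0 i = c i *s L i) &
    (\<forall>i<d. c' i ~= 0 & \<Lambda> 1 i = c' i *s L' i) & finite {t. \<not> gt m d (\<Lambda> t)}"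
proof (rule YY_connected[of m d "\<lambda>_. {}" L L'])
  show "L \<in> YY m d (\<lambda>_. {})" "L' \<in> YY m d (\<lambda>_. {})" using g by (simp_all add: YY_empty)
  fix \<Lambda> :: "complex => nat => complex^3" and c c' :: "nat => complex"
  assume "vcurve d \<Lambda>" "!!i. i < d ==> c i ~= 0 & \<Lambda> 0 i = c i *s L i"
    "!!i. i < d ==> c' i ~= 0 & \<Lambda> 1 i = c' i *s L' i" "finite {t. \<Lambda> t \<notin> YY m d (\<lambda>_. {})}"
  then show ?thesis by (intro exI[of _ \<Lambda>] exI[of _ c] exI[of _ c']) (simp add: YY_empty)
qed (use m in auto)

text \<open>A member in general position to the coordinates is a multiple of a parametrised one (\<open>normal_form\<close>), and every
  other member lies on a polynomial curve whose general point is in general position.\<close>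
lemma dense_parametrisation:
  assumes m: "2 <= m" "m + 2 <= d" and F: "F \<in> homog r" and z: "!!y. fev F (fm d (PL m y)) = 0"
  shows "vanish F (XX m d)"
  unfolding vanish_def XX_mem[OF m]
proof (intro allI impI, elim exE conjE)
  fix f L assume g: "gt m d L" and f: "f = fm d L"
  obtain \<Lambda> c c' where A: "vcurve d \<Lambda>" "!!i. i < d ==> c i ~= 0 & \<Lambda> 0 i = c i *s L i"
    "!!i. i < d ==> c' i ~= 0 & \<Lambda> 1 i = c' i *s PL m std_par i" "finite {t. \<not> gt m d (\<Lambda> t)}"
    using gt_connected[OF m g gt_std[OF m]] by metis
  have v: "pfun (\<lambda>t. \<Lambda> t i $ j)" if "i < d" for i j using A(1) that by (auto simp: vcurve_def)
  have pc: "pfun (\<lambda>t. cr (u t) (u' t) $ j)" if "!!j. pfun (\<lambda>t. u t $ j)" "!!j. pfun (\<lambda>t. u' t $ j)" for u u' j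
    using exhaust_3[of j] that by (auto intro!: pfun_intros)
  have pf: "pfun (\<lambda>t. flat (u t) (u' t) $ j)" if "!!j. pfun (\<lambda>t. u t $ j)" "!!j. pfun (\<lambda>t. u' t $ j)" for u u' j
    unfolding flat_def using that by (auto intro!: pfun_intros)
  have pw: "pfun (\<lambda>t. axis_w m (\<Lambda> t) $ j)" for j
    unfolding axis_w_def using v m by (intro pc) auto
  have pk: "pfun (\<lambda>t. generic_pos m (\<Lambda> t))"
    unfolding generic_pos_def using v m pw by (intro pfun_mult pf) auto
  have c1: "c' 0 ~= 0 & \<Lambda> 1 0 = c' 0 *s PL m std_par 0" "c' 1 ~= 0 & \<Lambda> 1 1 = c' 1 *s PL m std_par 1"
    "c' m ~= 0 & \<Lambda> 1 m = c' m *s PL m std_par m" "c' (m + 1) ~= 0 & \<Lambda> 1 (m + 1) = c' (m + 1) *s PL m std_par (m + 1)"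
    by (rule A(3), use m in simp)+
  have "generic_pos m (\<Lambda> 1) = (c' 0 * c' 1 * c' m * c' (m + 1)) ^ 3 * c' 0 * c' m * generic_pos m (PL m std_par)"
    by (rule generic_pos_scale[OF m(1)]) (use c1 in blast)+
  then have "generic_pos m (\<Lambda> 1) ~= 0" using c1 generic_pos_std[OF m(1)] by simp
  then have fk: "finite {t. generic_pos m (\<Lambda> t) = 0}" by (rule pfun_finite_zeros[OF pk])
  have z': "fev F (fm d (\<Lambda> t)) = 0" if gk: "gt m d (\<Lambda> t)" "generic_pos m (\<Lambda> t) ~= 0" for t
  proof -
    obtain y c where "fm d (\<Lambda> t) = pscale c (fm d (PL m y))" using normal_form[OF m gk] by metis
    then show ?thesis using z by (simp add: fev_pscale[OF F])
  qed
  have "finite {t. fev F (fm d (\<Lambda> t)) ~= 0}"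
    by (rule finite_subset[of _ "{t. \<not> gt m d (\<Lambda> t)} \<union> {t. generic_pos m (\<Lambda> t) = 0}"])
       (use z' A(4) fk in auto)
  then have 0: "fev F (fm d (\<Lambda> 0)) = 0" by (rule pfun_cofinite_zero[OF pfun_fev[OF pcurve_fm[OF A(1)]]])
  have "fm d (\<Lambda> 0) = pscale (\<Prod>i<d. c i) f" unfolding f by (rule fm_rescale, use A(2) in blast)
  then have "(\<Prod>i<d. c i) ^ r * fev F f = 0" using 0 by (simp add: fev_pscale[OF F])
  moreover have "(\<Prod>i<d. c i) ~= 0" using A(2) by auto
  ultimately show "fev F f = 0" by simp
qed

text \<open>A chain of length \<open>n\<close> gives \<open>E^n\<close> independent monomials in forms, of degree linear in \<open>E\<close>; the
  parametrisation turns them into polynomials in \<open>d + 4\<close> variables of such degree, a space of dimension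
  \<open>O(E^(d + 4))\<close>.\<close>
lemma chain_upper_bound:
  assumes m: "2 <= m" "m + 2 <= d"
    and ch: "irred_closed_chain (subtopology (zariski (homog d)) (XX m d)) n Z"
  shows "n <= d + 4"
proof (rule ccontr)
  assume n: "\<not> n <= d + 4"
  let ?N = "d + 4"
  note W = cone_homog[of d] and X = XX_sub[OF m]
  obtain G0 G D where G0: "G0 \<in> homog 1" "\<not> vanish G0 (Z 0)"
    and G: "!!i. i < n ==> G i \<in> homog (D i) & vanish (G i) (Z i) & \<not> vanish (G i) (Z (Suc i))"
    and P: "!!i. i <= n ==> prime_on (Z i)" and sub: "!!i. i < n ==> Z i \<subseteq> Z (Suc i)"
    using chain_forms[OF W X ch] by metis
  define k where "k = (\<Sum>i<n. D i) * d + 1"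
  define E where "E = k ^ ?N"
  define R where "R = E * (\<Sum>i<n. D i)"
  define h where "h e = hform G0 G D E n R (\<lambda>e'. if e' = e then 1 else 0)" for e
  have hh: "h e \<in> homog R" for e
    unfolding h_def by (rule hform_homog) (use G0 G in \<open>auto simp: R_def\<close>)
  have count: "(R * d + 1) ^ ?N < card (ebox n E)"
  proof -
    have "R * d + 1 <= (E + 1) * k" by (simp add: R_def k_def algebra_simps)
    then have "(R * d + 1) ^ ?N <= ((E + 1) * k) ^ ?N" by (rule power_mono) simp
    also have "\<dots> = (E + 1) ^ ?N * E" by (simp only: power_mult_distrib) (simp only: E_def)
    also have "\<dots> < (E + 1) ^ ?N * (E + 1)" by simp
    also have "\<dots> = (E + 1) ^ Suc ?N" by (simp only: power_Suc mult.commute)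
    also have "\<dots> <= (E + 1) ^ n" by (rule power_increasing) (use n in auto)
    finally show ?thesis by (simp add: card_ebox)
  qed
  have b: "bpol ?N (R * d) (\<lambda>y. fev (h e) (fm d (PL m y)))" for e
    by (rule bpol_fev[OF hh]) (rule bpol_PL)
  obtain c where c: "\<exists>e\<in>ebox n E. c e ~= 0" "!!y. (\<Sum>e\<in>ebox n E. c e * fev (h e) (fm d (PL m y))) = 0"
    using bpol_dependence[OF finite_ebox count, of "\<lambda>e y. fev (h e) (fm d (PL m y))"] b by blast
  define H where "H = hform G0 G D E n R c"
  have Hf: "fev H f = (\<Sum>e\<in>ebox n E. c e * fev (h e) f)" for f
  proof -
    have "fev (h e) f = fev ((\<Prod>i<n. G i ^ e i) * G0 ^ (R - (\<Sum>i<n. e i * D i))) f" if "e \<in> ebox n E" for e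
    proof -
      show ?thesis using that
        by (simp add: h_def hform_def eval_simps if_distrib[of "\<lambda>x. x * _"] cong: if_cong)
    qed
    then show ?thesis unfolding H_def hform_def by (simp add: eval_simps)
  qed
  have "H \<in> homog R" unfolding H_def by (rule hform_homog) (use G0 G in \<open>auto simp: R_def\<close>)
  then have "vanish H (XX m d)"
    by (rule dense_parametrisation[OF m]) (simp add: Hf c(2))
  moreover have "Z n \<subseteq> XX m d"
    using ch closedin_sub_zariski[OF W X] by (auto simp: irred_closed_chain_def)
  ultimately have "vanish H (Z n)" by (auto simp: vanish_def)
  then have "c e = 0" if "e \<in> ebox n E" for e
    using chain_independent[OF G0 G P sub, where E=E and R=R and c=c and e=e] that by (simp add: H_def R_def)
  then show False using c(1) by blast
qed

lemma XX_dimension: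
  assumes m: "2 <= m" "m + 2 <= d"
  shows "krull_dim (subtopology (zariski (homog d)) (XX m d)) = enat (d + 4)"
    and "x \<in> XX m d ==> local_dim (subtopology (zariski (homog d)) (XX m d)) x = enat (d + 4)"
proof -
  let ?T = "subtopology (zariski (homog d)) (XX m d)"
  have loc: "local_dim ?T x = enat (d + 4)" if x: "x \<in> XX m d" for x
    unfolding local_dim_def
  proof (rule antisym)
    show "Sup {enat n |n. EX Z. irred_closed_chain ?T n Z & x \<in> Z 0} <= enat (d + 4)"
      by (rule Sup_least) (use chain_upper_bound[OF m] in auto)
    obtain L where L: "gt m d L" "x = proj_pt (fm d L)" using x by (auto simp: XX_def)
    show "enat (d + 4) <= Sup {enat n |n. EX Z. irred_closed_chain ?T n Z & x \<in> Z 0}"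
      by (rule Sup_upper) (use chain_through_point[OF m L(1)] L(2) in blast)
  qed
  then show "x \<in> XX m d ==> local_dim ?T x = enat (d + 4)" .
  show "krull_dim ?T = enat (d + 4)"
    unfolding krull_dim_def
  proof (rule antisym)
    show "Sup {enat n |n. EX Z. irred_closed_chain ?T n Z} <= enat (d + 4)"
      by (rule Sup_least) (use chain_upper_bound[OF m] in auto)
    show "enat (d + 4) <= Sup {enat n |n. EX Z. irred_closed_chain ?T n Z}"
      by (rule Sup_upper) (use chain_through_point[OF m gt_std[OF m]] in blast)
  qed
qed


section \<open>Symmetric functions of roots\<close>

lemma newton_identity:
  fixes z :: "'i => complex"
  assumes "finite J"
  defines "P \<equiv> (\<Prod>j\<in>J. [:1, z j:])"
  shows "of_nat (k + 1) * coeff P (k + 1) = (\<Sum>i\<le>k. (-1) ^ i * coeff P (k - i) * (\<Sum>j\<in>J. z j ^ (i + 1)))"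
proof -
  have step: "coeff (\<Prod>l\<in>J - {j}. [:1, z l:]) k = (\<Sum>i\<le>k. (- z j) ^ i * coeff P (k - i))" if j: "j \<in> J" for j k
  proof -
    let ?R = "\<Prod>l\<in>J - {j}. [:1, z l:]"
    have PR: "P = [:1, z j:] * ?R" unfolding P_def by (rule prod.remove[OF assms(1) j])
    show ?thesis
    proof (induction k)
      case 0
      then show ?case by (simp add: PR)
    next
      case (Suc k)
      have "coeff P (Suc k) = coeff ?R (Suc k) + z j * coeff ?R k" by (simp add: PR)
      then have "coeff ?R (Suc k) = coeff P (Suc k) + (- z j) * (\<Sum>i\<le>k. (- z j) ^ i * coeff P (k - i))"
        using Suc by simp
      also have "\<dots> = (\<Sum>i\<le>Suc k. (- z j) ^ i * coeff P (Suc k - i))"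
        by (simp add: sum.atMost_Suc_shift sum_distrib_left mult.assoc del: sum.atMost_Suc)
      finally show ?case .
    qed
  qed
  have "of_nat (k + 1) * coeff P (k + 1) = coeff (pderiv P) k" by (simp add: coeff_pderiv)
  also have "pderiv P = (\<Sum>j\<in>J. (\<Prod>l\<in>J - {j}. [:1, z l:]) * [:z j:])"
    unfolding P_def pderiv_prod by (simp add: pderiv_pCons)
  also have "coeff \<dots> k = (\<Sum>j\<in>J. z j * (\<Sum>i\<le>k. (- z j) ^ i * coeff P (k - i)))"
    by (simp add: coeff_sum step)
  also have "\<dots> = (\<Sum>i\<le>k. (-1) ^ i * coeff P (k - i) * (\<Sum>j\<in>J. z j ^ (i + 1)))"
    by (simp add: sum_distrib_left)
       (subst sum.swap, intro sum.cong refl, simp add: power_minus[of "z _"] mult_ac)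
  finally show ?thesis .
qed

lemma coeff_prod_1z_0: "coeff (\<Prod>j\<in>J. [:1, z j:]) 0 = (1 :: complex)"
  by (simp add: poly_0_coeff_0[symmetric] poly_prod)

lemma coeff_prod_1z_card:
  assumes "finite J"
  shows "coeff (\<Prod>j\<in>J. [:1, z j:]) (card J) = (\<Prod>j\<in>J. z j :: complex)"
    and "degree (\<Prod>j\<in>J. [:1, z j:]) <= card J"
proof -
  have d: "degree (\<Prod>j\<in>J. [:1, z j:]) <= card J" if "finite J" for J
  proof -
    have "degree (\<Prod>j\<in>J. [:1, z j:]) <= (\<Sum>j\<in>J. degree [:1, z j:])" by (rule degree_prod_sum_le[OF that, unfolded o_def])
    also have "\<dots> <= (\<Sum>j\<in>J. 1)" by (rule sum_mono) simp
    finally show ?thesis by simp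
  qed
  then show "degree (\<Prod>j\<in>J. [:1, z j:]) <= card J" using assms .
  show "coeff (\<Prod>j\<in>J. [:1, z j:]) (card J) = (\<Prod>j\<in>J. z j)"
    using assms
  proof (induction J)
    case (insert j J)
    have "coeff (\<Prod>j\<in>J. [:1, z j:]) (Suc (card J)) = 0"
      by (rule coeff_eq_0) (use d[OF insert(1)] in simp)
    then show ?case using insert by simp
  qed simp
qed

text \<open>Rings of functions, closed under the two conversions between elementary symmetric
  functions and power sums.\<close>
definition fring :: "(('s => complex) => bool) => bool" where
  "fring R \<longleftrightarrow> (ALL c. R (\<lambda>_. c)) & (ALL f g. R f --> R g --> R (\<lambda>s. f s + g s)) & (ALL f g. R f --> R g --> R (\<lambda>s. f s * g s))"

lemma fringD:
  assumes "fring R"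
  shows "R (\<lambda>_. c)" "R f ==> R g ==> R (\<lambda>s. f s + g s)" "R f ==> R g ==> R (\<lambda>s. f s * g s)"
    "R f ==> R g ==> R (\<lambda>s. f s - g s)" "R f ==> R (\<lambda>s. f s ^ k)"
    "(!!i. i \<in> A ==> R (F i)) ==> R (\<lambda>s. \<Sum>i\<in>A. F i s)"
    "(!!i. i \<in> A ==> R (F i)) ==> R (\<lambda>s. \<Prod>i\<in>A. F i s)"
proof -
  have c: "R (\<lambda>_. c)" for c using assms by (auto simp: fring_def)
  have a: "R (\<lambda>s. f s + g s)" if "R f" "R g" for f g using assms that by (auto simp: fring_def)
  have m: "R (\<lambda>s. f s * g s)" if "R f" "R g" for f g using assms that by (auto simp: fring_def)
  show "R (\<lambda>_. c)" by (rule c)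
  show "R f ==> R g ==> R (\<lambda>s. f s + g s)" by (rule a)
  show "R f ==> R g ==> R (\<lambda>s. f s * g s)" by (rule m)
  show "R f ==> R g ==> R (\<lambda>s. f s - g s)" using a[of f "\<lambda>s. (-1) * g s"] m[OF c, of g "-1"] by simp
  show "R f ==> R (\<lambda>s. f s ^ k)" by (induction k) (auto intro: c m)
  show "(!!i. i \<in> A ==> R (F i)) ==> R (\<lambda>s. \<Sum>i\<in>A. F i s)"
    by (induction A rule: infinite_finite_induct) (auto intro: c a)
  show "(!!i. i \<in> A ==> R (F i)) ==> R (\<lambda>s. \<Prod>i\<in>A. F i s)"
    by (induction A rule: infinite_finite_induct) (auto intro: c m)
qed

lemma power_sums_in_ring:
  assumes R: "fring R" and J: "finite J" and e: "!!k. R (\<lambda>s. coeff (\<Prod>j\<in>J. [:1, z s j:]) k)"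
  shows "R (\<lambda>s. \<Sum>j\<in>J. z s j ^ k)"
proof (induction k rule: less_induct)
  case (less k)
  note r = fringD[OF R]
  show ?case
  proof (cases k)
    case 0
    then show ?thesis by (simp add: r(1))
  next
    case (Suc n)
    let ?e = "\<lambda>s k. coeff (\<Prod>j\<in>J. [:1, z s j:]) k"
    let ?p = "\<lambda>s k. \<Sum>j\<in>J. z s j ^ k"
    have eq: "?p s k = (-1) ^ n * (of_nat (n + 1) * ?e s (n + 1) - (\<Sum>i<n. (-1) ^ i * ?e s (n - i) * ?p s (i + 1)))" for s
    proof -
      have "of_nat (n + 1) * ?e s (n + 1) = (\<Sum>i\<le>n. (-1) ^ i * ?e s (n - i) * ?p s (i + 1))"
        by (rule newton_identity[OF J])
      also have "\<dots> = (\<Sum>i<n. (-1) ^ i * ?e s (n - i) * ?p s (i + 1)) + (-1) ^ n * ?p s k"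
        by (simp add: lessThan_Suc_atMost[symmetric] coeff_prod_1z_0 Suc)
      finally have "(-1) ^ n * ?p s k = of_nat (n + 1) * ?e s (n + 1) - (\<Sum>i<n. (-1) ^ i * ?e s (n - i) * ?p s (i + 1))"
        by simp
      then have "(-1) ^ n * ((-1) ^ n * ?p s k) = (-1) ^ n * (of_nat (n + 1) * ?e s (n + 1) - (\<Sum>i<n. (-1) ^ i * ?e s (n - i) * ?p s (i + 1)))"
        by (rule arg_cong)
      then show ?thesis by (simp add: mult.assoc[symmetric] power_mult_distrib[symmetric])
    qed
    show ?thesis
      unfolding eq by (intro r e less) (use Suc in auto)
  qed
qed

lemma product_in_ring:
  assumes R: "fring R" and J: "finite J" and p: "!!k. R (\<lambda>s. \<Sum>j\<in>J. z s j ^ k)"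
  shows "R (\<lambda>s. \<Prod>j\<in>J. z s j)"
proof -
  note r = fringD[OF R]
  have "R (\<lambda>s. coeff (\<Prod>j\<in>J. [:1, z s j:]) k)" for k
  proof (induction k rule: less_induct)
    case (less k)
    show ?case
    proof (cases k)
      case 0
      then show ?thesis by (simp add: coeff_prod_1z_0 r(1))
    next
      case (Suc n)
      have eq: "coeff (\<Prod>j\<in>J. [:1, z s j:]) k = (1 / of_nat (n + 1)) *
         (\<Sum>i\<le>n. (-1) ^ i * coeff (\<Prod>j\<in>J. [:1, z s j:]) (n - i) * (\<Sum>j\<in>J. z s j ^ (i + 1)))" for s
      proof -
        have "of_nat (n + 1) ~= (0 :: complex)" by (simp only: of_nat_eq_0_iff)
        then show ?thesis by (subst newton_identity[OF J, symmetric]) (simp add: Suc del: of_nat_add of_nat_Suc)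
      qed
      show ?thesis
        unfolding eq by (intro r p less) (use Suc in auto)
    qed
  qed
  from this[of "card J"] show ?thesis by (simp only: coeff_prod_1z_card(1)[OF J])
qed

lemma factor_at_1:
  assumes "degree p <= d" "poly p 0 = (1::complex)"
  shows "\<exists>\<alpha>. p = (\<Prod>j<d. [:1, \<alpha> j:])"
  using assms
proof (induction d arbitrary: p)
  case 0
  then obtain c where "p = [:c:]" by (meson degree_eq_zeroE le_zero_eq)
  then show ?case using 0 by (auto simp: one_pCons)
next
  case (Suc d)
  show ?case
  proof (cases "degree p = 0")
    case True
    from Suc.IH[of p] True Suc.prems obtain \<alpha> where a: "p = (\<Prod>j<d. [:1, \<alpha> j:])" by auto
    have "p = (\<Prod>j<Suc d. [:1, (\<alpha>(d := 0)) j:])"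
      using a by (simp add: one_pCons[symmetric])
    then show ?thesis by blast
  next
    case False
    then obtain r where r: "poly p r = 0" using alg_closed_imp_poly_has_root[of p] by auto
    have r0: "r ~= 0" using r Suc.prems by auto
    obtain q where q: "p = [:-r, 1:] * q" using r by (auto simp: poly_eq_0_iff_dvd elim: dvdE)
    have q0: "q ~= 0" using q Suc.prems by auto
    let ?q = "smult (- r) q"
    have "degree p = Suc (degree q)" unfolding q using q0 by (subst degree_mult_eq) auto
    then have "degree ?q <= d" using Suc.prems r0 by simp
    moreover have "poly ?q 0 = 1" using Suc.prems q by simp
    ultimately obtain \<alpha> where a: "?q = (\<Prod>j<d. [:1, \<alpha> j:])" using Suc.IH by blast
    have "p = ?q * [:1, - 1 / r:]" unfolding q using r0 by (simp add: mult.commute)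
    then have "p = (\<Prod>j<Suc d. [:1, (\<alpha>(d := - 1 / r)) j:])" unfolding a by simp
    then show ?thesis by blast
  qed
qed

lemma root_matching:
  assumes e: "(\<Prod>j<d. [:1, \<alpha> j:]) = (\<Prod>j<d. [:1, \<beta> j:])" and i: "i < (d::nat)"
  shows "\<exists>j<d. \<alpha> j = (\<beta> i :: complex)"
proof (cases "\<beta> i = 0")
  case True
  then have "(\<Prod>j<d. \<beta> j) = 0" using i by (auto simp: prod_zero_iff)
  then have "(\<Prod>j<d. \<alpha> j) = 0"
    using coeff_prod_1z_card(1)[of "{..<d}" \<alpha>] coeff_prod_1z_card(1)[of "{..<d}" \<beta>] e by simp
  then show ?thesis using True by (auto simp: prod_zero_iff)
next
  case False
  have "poly (\<Prod>j<d. [:1, \<beta> j:]) (- 1 / \<beta> i) = 0"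
    using i False by (auto simp: poly_prod prod_zero_iff intro!: bexI[of _ i])
  then have "poly (\<Prod>j<d. [:1, \<alpha> j:]) (- 1 / \<beta> i) = 0" using e by simp
  then obtain j where "j < d" "1 + \<alpha> j * (- 1 / \<beta> i) = 0" by (auto simp: poly_prod prod_zero_iff)
  then show ?thesis using False by (intro exI[of _ j]) (simp add: field_simps)
qed

section \<open>Eliminating the roots\<close>

locale root_setting =
  fixes d m :: nat and e u1 u2 p0 p1 p2 :: "complex^3"
  assumes m: "2 <= m" "m + 2 <= d" and D: "dual_basis e u1 u2 p0 p1 p2"
begin

definition ev0 :: "S => complex" where "ev0 f = eval_mpoly f (($) e)"

definition lz :: "(3 \<Rightarrow>\<^sub>0 nat) mpoly" where "lz = linform d (pmon (($) e))"

lemma lz: "lz \<in> homog 1" "f \<in> homog d ==> fev lz f = ev0 f"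
  by (simp_all add: lz_def linform_homog[simplified] fev_linform_eval ev0_def)

definition Reg :: "(S => complex) => bool" where
  "Reg \<rho> \<longleftrightarrow> (EX n. \<exists>F\<in>homog n. \<forall>f\<in>homog d. ev0 f ~= 0 --> \<rho> f * ev0 f ^ n = fev F f)"

lemma Reg_cong: "(!!f. f \<in> homog d ==> ev0 f ~= 0 ==> \<rho> f = \<rho>' f) ==> Reg \<rho> ==> Reg \<rho>'"
  unfolding Reg_def by metis

lemma fring_Reg: "fring Reg"
  unfolding fring_def
proof (intro conjI allI impI)
  fix c
  show "Reg (\<lambda>_. c)"
    unfolding Reg_def by (rule exI[of _ 0], rule bexI[of _ "sg 0 c"]) (auto simp: eval_simps homog_single)
next
  fix f g assume "Reg f" "Reg g"
  then obtain n F k G where F: "F \<in> homog n" "!!h. h \<in> homog d ==> ev0 h ~= 0 ==> f h * ev0 h ^ n = fev F h"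
    and G: "G \<in> homog k" "!!h. h \<in> homog d ==> ev0 h ~= 0 ==> g h * ev0 h ^ k = fev G h"
    unfolding Reg_def by metis
  have h1: "F * lz ^ k + G * lz ^ n \<in> homog (n + k)"
    using homog_mult[OF F(1) homog_power[OF lz(1), of k]] homog_mult[OF G(1) homog_power[OF lz(1), of n]]
    by (intro homog_add) (simp_all add: add.commute)
  have e1: "(f h + g h) * ev0 h ^ (n + k) = fev (F * lz ^ k + G * lz ^ n) h" if "h \<in> homog d" "ev0 h ~= 0" for h
  proof -
    have "(f h + g h) * ev0 h ^ (n + k) = (f h * ev0 h ^ n) * ev0 h ^ k + (g h * ev0 h ^ k) * ev0 h ^ n"
      by (simp add: power_add algebra_simps)
    then show ?thesis using F(2)[OF that] G(2)[OF that] lz(2)[OF that(1)] by (simp add: eval_simps)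
  qed
  show "Reg (\<lambda>s. f s + g s)" unfolding Reg_def using h1 e1 by blast
  have "f h * g h * ev0 h ^ (n + k) = fev (F * G) h" if "h \<in> homog d" "ev0 h ~= 0" for h
  proof -
    have "f h * g h * ev0 h ^ (n + k) = (f h * ev0 h ^ n) * (g h * ev0 h ^ k)"
      by (simp add: power_add algebra_simps)
    then show ?thesis using F(2)[OF that] G(2)[OF that] by (simp add: eval_simps)
  qed
  then show "Reg (\<lambda>s. f s * g s)" unfolding Reg_def using homog_mult[OF F(1) G(1)] by blast
qed

lemma Reg_linear: "Reg (\<lambda>f. (\<Sum>n\<in>{n. mdeg n = d}. \<xi> n * lk f n) / ev0 f)"
  unfolding Reg_def
  by (rule exI[of _ 1], rule bexI[of _ "linform d \<xi>"]) (simp_all add: linform_homog[simplified] fev_linform)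

lemma Reg_coeff: "mdeg n = d ==> Reg (\<lambda>f. lk f n / ev0 f)"
  unfolding Reg_def
  by (rule exI[of _ 1], rule bexI[of _ "sg (sg n 1) 1"]) (simp_all add: homog_single eval_simps)

definition Q :: "complex^3 => S => complex poly" where
  "Q u f = subst (\<lambda>c. [:c:]) (\<lambda>i. [:e $ i, u $ i:]) f"

lemma poly_Q: "poly (Q u f) t = eval_mpoly f (($) (e + t *s u))"
  unfolding Q_def poly_subst_pCons by (rule arg_cong[of _ _ "eval_mpoly f"]) auto

lemma degree_pmon: "degree (pmon (\<lambda>i::3. [:e $ i, u $ i:]) n) <= mdeg n"
proof (induction n rule: exponent_induct)
  case (step n j)
  have "degree (pmon (\<lambda>i::3. [:e $ i, u $ i:]) n * [:e $ j, u $ j:])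
     <= degree (pmon (\<lambda>i::3. [:e $ i, u $ i:]) n) + degree [:e $ j, u $ j:]" by (rule degree_mult_le)
  also have "\<dots> <= mdeg n + 1" using step by (intro add_mono) auto
  finally show ?case by (simp add: pmon_add mdeg_add)
qed simp

lemma Q_linear:
  assumes "f \<in> homog d"
  shows "Q u f = (\<Sum>n\<in>{n. mdeg n = d}. smult (lk f n) (pmon (\<lambda>i. [:e $ i, u $ i:]) n))"
  unfolding Q_def subst_def
  using homog_sum_monomials[OF assms, of "\<lambda>n c. [:c:] * pmon (\<lambda>i. [:e $ i, u $ i:]) n"] by simp

lemma degree_Q: "f \<in> homog d ==> degree (Q u f) <= d"
  unfolding Q_linear by (intro degree_sum_le order_trans[OF degree_smult_le] order_trans[OF degree_pmon]) (auto simp: finite_mdeg)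

lemma Reg_Q: "Reg (\<lambda>f. coeff (smult (1 / ev0 f) (Q u f)) k)"
  by (rule Reg_cong[OF _ Reg_linear[of "\<lambda>n. coeff (pmon (\<lambda>i. [:e $ i, u $ i:]) n) k"]])
     (simp add: Q_linear coeff_sum mult.commute)

lemma Q_roots:
  assumes "f \<in> homog d" "ev0 f ~= 0"
  shows "\<exists>\<alpha>. smult (1 / ev0 f) (Q u f) = (\<Prod>j<d. [:1, \<alpha> j:])"
proof (rule factor_at_1)
  show "degree (smult (1 / ev0 f) (Q u f)) <= d" using degree_Q[OF assms(1)] by simp
  show "poly (smult (1 / ev0 f) (Q u f)) 0 = 1" using assms(2) by (simp add: poly_Q ev0_def)
qed

definition rt :: "complex^3 => S => nat => complex" where
  "rt u f = (SOME \<alpha>. smult (1 / ev0 f) (Q u f) = (\<Prod>j<d. [:1, \<alpha> j:]))"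

lemma rt: "f \<in> homog d ==> ev0 f ~= 0 ==> smult (1 / ev0 f) (Q u f) = (\<Prod>j<d. [:1, rt u f j:])"
  unfolding rt_def by (rule someI_ex[OF Q_roots])

lemma Reg_power_sum: "Reg (\<lambda>f. \<Sum>j<d. rt u f j ^ k)"
proof (rule power_sums_in_ring[OF fring_Reg])
  fix k show "Reg (\<lambda>f. coeff (\<Prod>j<d. [:1, rt u f j:]) k)"
    by (rule Reg_cong[OF _ Reg_Q[of u k]]) (rule arg_cong[where f="\<lambda>p. coeff p k"], rule rt)
qed simp

definition tuples :: "(nat => nat) set" where "tuples = PiE {..<2 * d} (\<lambda>_. {..<d})"

definition val :: "S => (nat => nat) => nat => complex" where
  "val f \<tau> i = rt (if i < d then u1 else u2) f (\<tau> i)"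

lemma finite_tuples [simp]: "finite tuples"
  by (simp add: tuples_def finite_PiE)

inductive Hp :: "(S => (nat => complex) => complex) => bool" where
  Hp_mono: "Reg \<rho> ==> Hp (\<lambda>f x. \<rho> f * (\<Prod>i<2 * d. x i ^ k i))"
| Hp_add: "Hp g ==> Hp h ==> Hp (\<lambda>f x. g f x + h f x)"

lemma Hp_Reg: "Reg \<rho> ==> Hp (\<lambda>f x. \<rho> f)"
  using Hp_mono[of \<rho> "\<lambda>_. 0"] by simp

lemma Hp_const: "Hp (\<lambda>f x. c)"
  by (rule Hp_Reg) (rule fringD(1)[OF fring_Reg])

lemma Hp_var: "i < 2 * d ==> Hp (\<lambda>f x. x i)"
proof -
  assume "i < 2 * d"
  then have "(\<Prod>j<2 * d. x j ^ (if j = i then 1 else 0)) = x i" for x :: "nat => complex"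
    by (simp add: if_distrib[of "\<lambda>e. _ ^ e"] prod.delta cong: if_cong)
  then show ?thesis using Hp_mono[of "\<lambda>_. 1" "\<lambda>j. if j = i then 1 else 0"] fringD(1)[OF fring_Reg, of 1] by simp
qed

lemma Hp_mult_mono:
  assumes "Reg \<rho>" "Hp h"
  shows "Hp (\<lambda>f x. (\<rho> f * (\<Prod>i<2 * d. x i ^ k i)) * h f x)"
proof -
  define P where "P h \<longleftrightarrow> Hp (\<lambda>f x. (\<rho> f * (\<Prod>i<2 * d. x i ^ k i)) * h f x)" for h
  have "P h" using assms(2)
  proof (induction rule: Hp.induct)
    fix \<rho>' k' assume "Reg \<rho>'"
    have r: "Reg (\<lambda>f. \<rho> f * \<rho>' f)" by (rule fringD(3)[OF fring_Reg]) (fact assms(1), fact)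
    have "(\<lambda>f x. (\<rho> f * (\<Prod>i<2 * d. x i ^ k i)) * (\<rho>' f * (\<Prod>i<2 * d. x i ^ k' i)))
      = (\<lambda>f x. (\<rho> f * \<rho>' f) * (\<Prod>i<2 * d. x i ^ (k i + k' i)))"
      by (intro ext) (simp add: power_add prod.distrib mult_ac)
    then show "P (\<lambda>f x. \<rho>' f * (\<Prod>i<2 * d. x i ^ k' i))"
      unfolding P_def using Hp_mono[OF r, of "\<lambda>i. k i + k' i"] by (simp only:)
  next
    fix g h assume "P g" "P h"
    then show "P (\<lambda>f x. g f x + h f x)" unfolding P_def distrib_left by (rule Hp_add)
  qed
  then show ?thesis by (simp only: P_def)
qed

lemma Hp_mult:
  assumes "Hp g" "Hp h"
  shows "Hp (\<lambda>f x. g f x * h f x)"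
proof -
  define P where "P g \<longleftrightarrow> Hp (\<lambda>f x. g f x * h f x)" for g
  have "P g" using assms(1)
  proof (induction rule: Hp.induct)
    fix \<rho> k assume "Reg \<rho>"
    then show "P (\<lambda>f x. \<rho> f * (\<Prod>i<2 * d. x i ^ k i))"
      unfolding P_def using assms(2) by (rule Hp_mult_mono)
  next
    fix g g' assume "P g" "P g'"
    then show "P (\<lambda>f x. g f x + g' f x)" unfolding P_def distrib_right by (rule Hp_add)
  qed
  then show ?thesis by (simp only: P_def)
qed

lemma Hp_diff: "Hp g ==> Hp h ==> Hp (\<lambda>f x. g f x - h f x)"
  using Hp_add[of g "\<lambda>f x. (-1) * h f x"] Hp_mult[OF Hp_const, of h "-1"] by simp

lemma Hp_power: "Hp g ==> Hp (\<lambda>f x. g f x ^ k)"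
  by (induction k) (auto intro: Hp_const Hp_mult)

lemma Hp_sum: "(!!i. i \<in> A ==> Hp (g i)) ==> Hp (\<lambda>f x. \<Sum>i\<in>A. g i f x)"
  by (induction A rule: infinite_finite_induct) (auto intro: Hp_const Hp_add)

lemma Hp_prod: "(!!i. i \<in> A ==> Hp (g i)) ==> Hp (\<lambda>f x. \<Prod>i\<in>A. g i f x)"
  by (induction A rule: infinite_finite_induct) (auto intro: Hp_const Hp_mult)

lemma Reg_sum_tuples: "Hp h ==> Reg (\<lambda>f. \<Sum>\<tau>\<in>tuples. h f (val f \<tau>))"
proof (induction h rule: Hp.induct)
  case (Hp_mono \<rho> k)
  have eq: "(\<Sum>\<tau>\<in>tuples. \<rho> f * (\<Prod>i<2 * d. val f \<tau> i ^ k i))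
     = \<rho> f * (\<Prod>i<2 * d. \<Sum>j<d. rt (if i < d then u1 else u2) f j ^ k i)" for f
    unfolding sum_distrib_left[symmetric] tuples_def val_def
    by (subst prod_sum_PiE) simp_all
  show ?case
    unfolding eq by (intro fringD(3,7)[OF fring_Reg] Hp_mono Reg_power_sum)
next
  case (Hp_add g h)
  then show ?case using fringD(2)[OF fring_Reg] by (simp add: sum.distrib)
qed

text \<open>If for \<open>g\<close> no assignment of roots to the unknowns satisfies all the equations \<open>hs\<close>, then a combination of
  the equations with generic coefficients is nonzero for every assignment. The product over all assignments is symmetric in
  the roots, hence polynomial in the coefficients of the form.\<close>
lemma eliminate:
  assumes h: "!!h. h \<in> set hs ==> Hp h" and g: "g \<in> homog d" "ev0 g ~= 0"
    and nz: "!!\<tau>. \<tau> \<in> tuples ==> \<exists>h\<in>set hs. h g (val g \<tau>) ~= 0"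
  obtains r F where "F \<in> homog r" "fev F g ~= 0"
    "!!f \<tau>. f \<in> homog d ==> ev0 f ~= 0 ==> \<tau> \<in> tuples ==> (\<forall>h\<in>set hs. h f (val f \<tau>) = 0) ==> fev F f = 0"
proof -
  let ?c = "\<lambda>s f x. \<Sum>k<length hs. s ^ k * (hs ! k) f x"
  have "finite {s. ?c s g (val g \<tau>) = 0}" if t: "\<tau> \<in> tuples" for \<tau>
  proof -
    let ?p = "\<Sum>k<length hs. monom ((hs ! k) g (val g \<tau>)) k"
    obtain k where k: "k < length hs" "(hs ! k) g (val g \<tau>) ~= 0" using nz[OF t] by (metis in_set_conv_nth)
    have "coeff ?p k = (hs ! k) g (val g \<tau>)" using k(1) by (simp add: coeff_sum coeff_monom)
    then have "?p ~= 0" using k(2) by auto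
    then have "finite {s. poly ?p s = 0}" by (rule poly_roots_finite)
    then show ?thesis by (simp add: poly_sum poly_monom mult.commute)
  qed
  then have "finite (\<Union>\<tau>\<in>tuples. {s. ?c s g (val g \<tau>) = 0})" by simp
  then obtain s where s: "s \<notin> (\<Union>\<tau>\<in>tuples. {s. ?c s g (val g \<tau>) = 0})" by (rule avoid_finite)
  have Hc: "Hp (?c s)" by (intro Hp_sum Hp_mult Hp_const h) simp
  have "Reg (\<lambda>f. \<Prod>\<tau>\<in>tuples. ?c s f (val f \<tau>))"
    by (rule product_in_ring[OF fring_Reg finite_tuples]) (rule Reg_sum_tuples[OF Hp_power[OF Hc]])
  then obtain n F where F: "F \<in> homog n"
    "!!f. f \<in> homog d ==> ev0 f ~= 0 ==> (\<Prod>\<tau>\<in>tuples. ?c s f (val f \<tau>)) * ev0 f ^ n = fev F f"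
    unfolding Reg_def by blast
  show thesis
  proof (rule that[OF F(1)])
    have "(\<Prod>\<tau>\<in>tuples. ?c s g (val g \<tau>)) ~= 0" using s by (simp add: prod_zero_iff)
    then show "fev F g ~= 0" unfolding F(2)[OF g, symmetric] using g(2) by simp
    fix f \<tau> assume f: "f \<in> homog d" "ev0 f ~= 0" "\<tau> \<in> tuples" "\<forall>h\<in>set hs. h f (val f \<tau>) = 0"
    then have "?c s f (val f \<tau>) = 0" by (intro sum.neutral ballI) simp
    then have "(\<Prod>\<tau>\<in>tuples. ?c s f (val f \<tau>)) = 0" using f(3) by (auto simp: prod_zero_iff)
    then show "fev F f = 0" unfolding F(2)[OF f(1,2), symmetric] by simp
  qed
qed

definition ln :: "(nat => complex) => nat => complex^3" where
  "ln x i = p0 + x i *s p1 + x (d + i) *s p2"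

lemma dual: "dot e p0 = 1" "dot e p1 = 0" "dot e p2 = 0" "dot u1 p0 = 0" "dot u1 p1 = 1" "dot u1 p2 = 0"
  "dot u2 p0 = 0" "dot u2 p1 = 0" "dot u2 p2 = 1"
  using D by (simp_all add: dual_basis_def)

lemma dot_commute: "dot a b = dot b a"
  by (simp add: dot_def mult.commute)

lemma ln_eqI:
  assumes "dot v e = 1" "dot v u1 = x i" "dot v u2 = x (d + i)"
  shows "ln x i = v"
proof -
  have "v = dot e v *s p0 + dot u1 v *s p1 + dot u2 v *s p2" by (rule dual_basis_expand(1)[OF D])
  then show ?thesis using assms by (simp add: ln_def dot_commute[of _ v])
qed

definition conds :: "(S => (nat => complex) => complex) set" where
  "conds = (\<lambda>n f x. lk f n / ev0 f - lk (fm d (ln x)) n) ` {n. mdeg n = d} \<union>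
     (\<lambda>i f x. tri (ln x (bs m i)) (ln x (bs m i + 1)) (ln x i)) ` {..<d}"

lemma finite_conds: "finite conds"
  by (simp add: conds_def finite_mdeg)

lemma Hp_ln: "i < d ==> Hp (\<lambda>f x. ln x i $ j)"
  unfolding ln_def by (simp, intro Hp_add Hp_mult Hp_const Hp_var) auto

lemma Hp_tri: "i < d ==> j < d ==> k < d ==> Hp (\<lambda>f x. tri (ln x i) (ln x j) (ln x k))"
  unfolding tri_expand by (intro Hp_add Hp_mult Hp_diff Hp_ln)

lemma Hp_fm: "Hp (\<lambda>f x. lk (fm d (ln x)) n)"
proof -
  have "(\<lambda>_ h. Hp (\<lambda>f x. h (f, x))) (card {..<d}) (\<lambda>p. lk (\<Prod>i\<in>{..<d}. lin (ln (snd p) i)) n)"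
    by (rule lookup_prod_lin_graded[where Q="\<lambda>_ h. Hp (\<lambda>f x. h (f, x))"])
       (auto intro: Hp_const Hp_add Hp_mult Hp_ln)
  then show ?thesis by (simp add: fm_def)
qed

lemma Hp_conds: "h \<in> conds ==> Hp h"
proof -
  assume "h \<in> conds"
  then consider n where "mdeg n = d" "h = (\<lambda>f x. lk f n / ev0 f - lk (fm d (ln x)) n)"
    | i where "i < d" "h = (\<lambda>f x. tri (ln x (bs m i)) (ln x (bs m i + 1)) (ln x i))"
    by (auto simp: conds_def)
  then show "Hp h"
  proof cases
    case 1
    then show ?thesis using Hp_diff[OF Hp_Reg[OF Reg_coeff] Hp_fm] by simp
  next
    case 2
    then show ?thesis using Hp_tri m by (auto simp: bs_def)
  qed
qed

lemma Hp_nvp: "Hp (\<lambda>f x. nvp m d (ln x))"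
proof -
  have l: "ob m i < d" "ob m i + 1 < d" for i using m by (auto simp: ob_def)
  have "Hp (\<lambda>f x. if i ~= j & bs m i = bs m j then tri (ln x i) (ln x j) (ln x (ob m i)) else 1)" if "i < d" "j < d" for i j
    using that l Hp_tri Hp_const by (cases "i ~= j & bs m i = bs m j") auto
  then show ?thesis
    unfolding nvp_def using l by (intro Hp_mult Hp_prod Hp_tri) auto
qed

lemma conds_vanish:
  assumes "f \<in> homog d" "ev0 f ~= 0"
  shows "(\<forall>h\<in>conds. h f x = 0) \<longleftrightarrow> f = pscale (ev0 f) (fm d (ln x)) & pen m d (ln x)"
proof -
  have "(\<forall>n\<in>{n. mdeg n = d}. lk f n / ev0 f - lk (fm d (ln x)) n = 0) \<longleftrightarrow> f = pscale (ev0 f) (fm d (ln x))"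
  proof
    assume a: "\<forall>n\<in>{n. mdeg n = d}. lk f n / ev0 f - lk (fm d (ln x)) n = 0"
    show "f = pscale (ev0 f) (fm d (ln x))"
    proof (rule poly_mapping_eqI)
      fix n
      show "lk f n = lk (pscale (ev0 f) (fm d (ln x))) n"
      proof (cases "mdeg n = d")
        case True
        then have "lk f n / ev0 f = lk (fm d (ln x)) n" using a by simp
        then show ?thesis using assms(2) by (simp add: lookup_pscale field_simps)
      next
        case False
        then show ?thesis using homog_lookup[OF assms(1)] homog_lookup[OF fm_homog[of d "ln x"]] by (simp add: lookup_pscale)
      qed
    qed
  next
    assume a: "f = pscale (ev0 f) (fm d (ln x))"
    have "lk f n = ev0 f * lk (fm d (ln x)) n" for n
      using arg_cong[OF a, of "\<lambda>p. lk p n"] by (simp add: lookup_pscale)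
    then show "\<forall>n\<in>{n. mdeg n = d}. lk f n / ev0 f - lk (fm d (ln x)) n = 0" using assms(2) by simp
  qed
  then show ?thesis unfolding conds_def pen_def by (auto simp: ball_Un)
qed

lemma arrangement_has_tuple:
  assumes g: "gt m d L" and nz: "ev0 (fm d L) ~= 0"
  obtains \<tau> where "\<tau> \<in> tuples" "\<forall>h\<in>conds. h (fm d L) (val (fm d L) \<tau>) = 0"
proof -
  let ?f = "fm d L"
  have ev: "ev0 ?f = (\<Prod>i<d. dot (L i) e)" by (simp add: ev0_def eval_fm)
  then have de: "dot (L i) e ~= 0" if "i < d" for i using nz that by (auto simp: prod_zero_iff)
  define L' where "L' i = (1 / dot (L i) e) *s L i" for i
  have fL: "?f = pscale (ev0 ?f) (fm d L')"
  proof -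
    have "fm d L' = pscale (\<Prod>i<d. 1 / dot (L i) e) ?f" by (rule fm_rescale) (simp add: L'_def)
    then show ?thesis using nz by (simp add: ev prod_dividef)
  qed
  have gL': "gt m d L'" by (rule gt_rescale[OF g m, of "\<lambda>i. 1 / dot (L i) e"]) (use de in \<open>auto simp: L'_def\<close>)
  have roots: "\<exists>j<d. rt u ?f j = dot (L' i) u" if i: "i < d" for i u
  proof -
    have "(\<Prod>j<d. [:1, rt u ?f j:]) = smult (1 / ev0 ?f) (Q u ?f)" by (rule rt[OF fm_homog nz, symmetric])
    also have "\<dots> = (\<Prod>j<d. [:1, dot (L' j) u:])"
    proof (rule poly_ext)
      fix t
      have "dot (L j) (e + t *s u) / dot (L j) e = 1 + dot (L' j) u * t" if "j < d" for j
        using de[OF that] by (simp add: L'_def dot_add_scale dot_scale field_simps)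
      then have "(\<Prod>j<d. dot (L j) (e + t *s u) / dot (L j) e) = (\<Prod>j<d. 1 + dot (L' j) u * t)"
        by (intro prod.cong) auto
      then show "poly (smult (1 / ev0 ?f) (Q u ?f)) t = poly (\<Prod>j<d. [:1, dot (L' j) u:]) t"
        by (simp add: poly_Q eval_fm ev poly_prod prod_dividef mult.commute)
    qed
    finally show ?thesis by (rule root_matching[OF _ i])
  qed
  have "ALL i. EX j. i < 2 * d --> j < d & rt (if i < d then u1 else u2) ?f j = dot (L' (if i < d then i else i - d)) (if i < d then u1 else u2)"
    using roots by auto
  from choice[OF this] obtain \<tau>0 where \<tau>0: "!!i. i < 2 * d ==> \<tau>0 i < d &
     rt (if i < d then u1 else u2) ?f (\<tau>0 i) = dot (L' (if i < d then i else i - d)) (if i < d then u1 else u2)" by blast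
  define \<tau> where "\<tau> = restrict \<tau>0 {..<2 * d}"
  have t: "\<tau> \<in> tuples" using \<tau>0 by (auto simp: tuples_def \<tau>_def)
  have "ln (val ?f \<tau>) i = L' i" if i: "i < d" for i
  proof (rule ln_eqI)
    show "dot (L' i) e = 1" using de[OF i] by (simp add: L'_def dot_scale)
    show "dot (L' i) u1 = val ?f \<tau> i" using \<tau>0[of i] i by (simp add: val_def \<tau>_def)
    show "dot (L' i) u2 = val ?f \<tau> (d + i)" using \<tau>0[of "d + i"] i by (simp add: val_def \<tau>_def)
  qed
  then have c: "fm d (ln (val ?f \<tau>)) = fm d L'" "pen m d (ln (val ?f \<tau>)) \<longleftrightarrow> pen m d L'"
    using m by (auto intro!: fm_cong simp: pen_def bs_def)
  show thesis
    by (rule that[OF t]) (unfold conds_vanish[OF fm_homog nz] c, use fL gL' in \<open>simp add: gt_def\<close>)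
qed

end

subsection \<open>Concurrent triples in a generic union of two pencils\<close>

lemma dot_lincomb: "dot n (x *s u + y *s v) = x * dot n u + y * dot n v"
  by (simp add: dot_def algebra_simps)

lemma gt_concurrent_same:
  assumes g: "gt m d L" and m: "2 <= m" "m + 2 <= d" and ijk: "i < d" "j < d" "k < d" "i ~= j"
    and t: "tri (L i) (L j) (L k) = 0" and b: "bs m i = bs m j"
  shows "bs m k = bs m i"
proof (rule ccontr)
  assume n: "bs m k ~= bs m i"
  then have o: "ob m k = bs m i" by (auto simp: ob_def bs_def split: if_splits)
  let ?n = "cr (L (bs m i)) (L (bs m i + 1))"
  have "dot ?n (L i) = 0" "dot ?n (L j) = 0"
    using gt_pen[OF g m ijk(1)] gt_pen[OF g m ijk(2)] b by (simp_all add: tri_def)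
  moreover obtain x y where "L k = x *s L i + y *s L j"
    using span_if_tri[OF gt_cr[OF g m ijk(1,2,4)] t] .
  ultimately have "dot ?n (L k) = 0" by (simp add: dot_lincomb)
  then show False using gt_tri[OF g m ijk(3)] o by (simp add: tri_def)
qed

lemma gt_concurrent_diff:
  assumes g: "gt m d L" and m: "2 <= m" "m + 2 <= d" and ijk: "i < d" "j < d" "k < d"
    and t: "tri (L i) (L j) (L k) = 0" and b: "bs m i ~= bs m j"
  shows "k = i \<or> k = j"
proof (rule ccontr)
  assume n: "\<not> ?thesis"
  have "bs m k = bs m i \<or> bs m k = bs m j" using b by (auto simp: bs_def split: if_splits)
  then show False
  proof
    assume k: "bs m k = bs m i"
    have "tri (L i) (L k) (L j) = 0" using t by (simp add: tri_expand algebra_simps)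
    then show False using gt_concurrent_same[OF g m ijk(1,3,2)] n k b by auto
  next
    assume k: "bs m k = bs m j"
    have "tri (L j) (L k) (L i) = 0" using t by (simp add: tri_expand algebra_simps)
    then show False using gt_concurrent_same[OF g m ijk(2,3,1)] n k b by auto
  qed
qed

text \<open>A second description of the same lines by two concurrent families is the same splitting.\<close>
lemma pencils_unique:
  assumes g: "gt m d L" and m: "2 <= m" "m + 2 <= d"
    and \<pi>: "bij_betw \<pi> {..<d} {..<d}"
    and pe: "!!i. i < d ==> tri (L (\<pi> (bs m i))) (L (\<pi> (bs m i + 1))) (L (\<pi> i)) = 0"
  shows "nvp m d (\<lambda>i. L (\<pi> i)) ~= 0"
proof -
  have lt: "\<pi> i < d" if "i < d" for i using \<pi> that by (auto simp: bij_betw_def)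
  have inj: "\<pi> i ~= \<pi> j" if "i < d" "j < d" "i ~= j" for i j
    using \<pi> that by (auto simp: bij_betw_def inj_on_def)
  have lb: "bs m i < d" "bs m i + 1 < d" "ob m i < d" "ob m i + 1 < d" for i
    using m by (auto simp: bs_def ob_def)
  have two: "EX r r'. r < d & r' < d & r ~= r' & bs m (\<pi> r) ~= R & bs m (\<pi> r') ~= R" for R
  proof -
    have "EX s s'. s < d & s' < d & s ~= s' & bs m s ~= R & bs m s' ~= R"
    proof (cases "R = 0")
      case True
      then show ?thesis using m by (intro exI[of _ m] exI[of _ "m + 1"]) (auto simp: bs_def)
    next
      case False
      then show ?thesis using m by (intro exI[of _ 0] exI[of _ 1]) (auto simp: bs_def)
    qed
    then obtain s s' where s: "s < d" "s' < d" "s ~= s'" "bs m s ~= R" "bs m s' ~= R" by blast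
    have im: "\<pi> ` {..<d} = {..<d}" using \<pi> by (simp add: bij_betw_def)
    obtain r where "r < d" "\<pi> r = s" using im s(1) by (metis imageE lessThan_iff)
    moreover obtain r' where "r' < d" "\<pi> r' = s'" using im s(2) by (metis imageE lessThan_iff)
    ultimately show ?thesis using s by blast
  qed
  have key: False if x: "x < d" and P: "!!k. k < d ==> bs m k ~= bs m x ==> bs m (\<pi> k) = bs m (\<pi> x)" for x
  proof -
    obtain r r' where r: "r < d" "r' < d" "r ~= r'" "bs m (\<pi> r) ~= bs m (\<pi> x)" "bs m (\<pi> r') ~= bs m (\<pi> x)"
      using two by blast
    then have br: "bs m r = bs m x" "bs m r' = bs m x" using P by blast+
    let ?z0 = "\<pi> (bs m x)" and ?z1 = "\<pi> (bs m x + 1)"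
    have z: "?z0 < d" "?z1 < d" "?z0 ~= ?z1" using lt lb inj[of "bs m x" "bs m x + 1"] by auto
    have t: "tri (L ?z0) (L ?z1) (L (\<pi> k)) = 0" if "k < d" "bs m k = bs m x" for k
      using pe[OF that(1)] that(2) by simp
    show False
    proof (cases "bs m ?z0 = bs m ?z1")
      case True
      have "bs m (\<pi> x) = bs m ?z0" by (rule gt_concurrent_same[OF g m z(1,2) lt[OF x] z(3) t[OF x refl] True])
      moreover have "bs m (\<pi> r) = bs m ?z0" by (rule gt_concurrent_same[OF g m z(1,2) lt[OF r(1)] z(3) t[OF r(1) br(1)] True])
      ultimately show False using r(4) by simp
    next
      case False
      have "\<pi> x = ?z0 \<or> \<pi> x = ?z1" by (rule gt_concurrent_diff[OF g m z(1,2) lt[OF x] t[OF x refl] False])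
      moreover have "\<pi> r = ?z0 \<or> \<pi> r = ?z1" by (rule gt_concurrent_diff[OF g m z(1,2) lt[OF r(1)] t[OF r(1) br(1)] False])
      moreover have "\<pi> r' = ?z0 \<or> \<pi> r' = ?z1" by (rule gt_concurrent_diff[OF g m z(1,2) lt[OF r(2)] t[OF r(2) br(2)] False])
      moreover have "\<pi> r ~= \<pi> r'" "\<pi> r ~= \<pi> x" "\<pi> r' ~= \<pi> x" using inj r x by auto
      ultimately show False by metis
    qed
  qed
  have bo: "bs m k = ob m x" if "bs m k ~= bs m x" for k x
    using that by (auto simp: bs_def ob_def split: if_splits)
  have ob2: "bs m (ob m x) = ob m x" "bs m (ob m x + 1) = ob m x" for x
    using m by (auto simp: bs_def ob_def)
  have obne: "bs m (ob m x) ~= bs m x" for x using m by (auto simp: bs_def ob_def)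
  show ?thesis
    unfolding nvp_nz
  proof (intro conjI allI impI notI)
    fix x assume x: "x < d" and t: "tri (L (\<pi> (ob m x))) (L (\<pi> (ob m x + 1))) (L (\<pi> x)) = 0"
    let ?y0 = "\<pi> (ob m x)" and ?y1 = "\<pi> (ob m x + 1)"
    have y: "?y0 < d" "?y1 < d" "?y0 ~= ?y1" using lt lb inj[of "ob m x" "ob m x + 1"] by auto
    have xn: "\<pi> x ~= ?y0" "\<pi> x ~= ?y1"
      using inj x lb obne[of x] ob2[of x] by metis+
    have same: "bs m ?y0 = bs m ?y1"
      using gt_concurrent_diff[OF g m y(1,2) lt[OF x] t] xn by blast
    have bx: "bs m (\<pi> x) = bs m ?y0" by (rule gt_concurrent_same[OF g m y(1,2) lt[OF x] y(3) t same])
    show False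
    proof (rule key[OF x])
      fix k assume k: "k < d" "bs m k ~= bs m x"
      have "tri (L ?y0) (L ?y1) (L (\<pi> k)) = 0" using pe[OF k(1)] bo[OF k(2)] by simp
      then have "bs m (\<pi> k) = bs m ?y0" by (rule gt_concurrent_same[OF g m y(1,2) lt[OF k(1)] y(3) _ same])
      then show "bs m (\<pi> k) = bs m (\<pi> x)" using bx by simp
    qed
  next
    fix i j assume i: "i < d" and j: "j < d" and ij: "i ~= j" "bs m i = bs m j"
      and t: "tri (L (\<pi> i)) (L (\<pi> j)) (L (\<pi> (ob m i))) = 0"
    let ?x = "ob m i"
    have x: "?x < d" by (rule lb)
    have ne: "\<pi> ?x ~= \<pi> i" "\<pi> ?x ~= \<pi> j" "\<pi> i ~= \<pi> j" using inj i j x obne[of i] ij by metis+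
    have same: "bs m (\<pi> i) = bs m (\<pi> j)"
      using gt_concurrent_diff[OF g m lt[OF i] lt[OF j] lt[OF x] t] ne by blast
    have bx: "bs m (\<pi> ?x) = bs m (\<pi> i)" by (rule gt_concurrent_same[OF g m lt[OF i] lt[OF j] lt[OF x] ne(3) t same])
    let ?z0 = "\<pi> (bs m i)" and ?z1 = "\<pi> (bs m i + 1)"
    have z: "?z0 < d" "?z1 < d" "?z0 ~= ?z1" using lt lb inj[of "bs m i" "bs m i + 1"] by auto
    have ti: "tri (L ?z0) (L ?z1) (L (\<pi> k)) = 0" if "k < d" "bs m k = bs m i" for k
      using pe[OF that(1)] that(2) by simp
    have zs: "bs m ?z0 = bs m ?z1"
    proof (rule ccontr)
      assume n: "bs m ?z0 ~= bs m ?z1"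
      have "\<pi> i = ?z0 \<or> \<pi> i = ?z1" by (rule gt_concurrent_diff[OF g m z(1,2) lt[OF i] ti[OF i refl] n])
      moreover have "\<pi> j = ?z0 \<or> \<pi> j = ?z1" by (rule gt_concurrent_diff[OF g m z(1,2) lt[OF j] ti[OF j ij(2)[symmetric]] n])
      ultimately show False using same ne(3) n by metis
    qed
    have zi: "bs m (\<pi> k) = bs m ?z0" if "k < d" "bs m k = bs m i" for k
      by (rule gt_concurrent_same[OF g m z(1,2) lt[OF that(1)] z(3) ti[OF that] zs])
    show False
    proof (rule key[OF x])
      fix k assume k: "k < d" "bs m k ~= bs m ?x"
      have "bs m k = bs m i" using k obne[of i] bo by metis
      then show "bs m (\<pi> k) = bs m (\<pi> ?x)" using zi[OF k(1)] zi[OF i refl] bx by simp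
    qed
  qed
qed


text \<open>Unique factorisation for products of linear forms.\<close>
lemma tuple_rearrangement:
  assumes g: "gt m d L" and m: "2 <= m" "m + 2 <= d" and c: "c ~= 0"
    and e: "fm d L = pscale c (fm d K)"
  obtains \<pi> k where "bij_betw \<pi> {..<d} {..<d}" "!!i. i < d ==> k i ~= 0 & K i = k i *s L (\<pi> i)"
proof -
  have "fm d K ~= 0" using fm_nz[OF g m] unfolding e by auto
  then have Kz: "K i ~= 0" if "i < d" for i using that by (auto simp: fm_def prod_zero_iff)
  have Lz: "L i ~= 0" if "i < d" for i by (rule gt_nz[OF g m that])
  have eK: "fm d L = sg 0 c * fm d K" using e by (simp add: pscale_conv_mult)
  have "EX j k. j < d & k ~= 0 & K i = k *s L j" if i: "i < d" for i
  proof -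
    have "lin (K i) dvd fm d K" unfolding fm_def using i by (intro dvd_prodI) auto
    then have "lin (K i) dvd (\<Prod>j\<in>{..<d}. lin (L j))" using eK by (simp add: fm_def)
    then obtain j where j: "j < d" "cr (K i) (L j) = 0"
      using lin_dvd_prod_lin[of "{..<d}" "K i" L] Kz[OF i] Lz by (metis finite_lessThan lessThan_iff)
    obtain k where k: "L j = k *s K i" using proportional_if_cr[OF Kz[OF i] j(2)] .
    have "k ~= 0" using k Lz[OF j(1)] by (auto simp: vec3_eq_iff)
    then have "K i = (1 / k) *s L j" by (simp add: k vscale_mult)
    then show ?thesis using j(1) \<open>k ~= 0\<close> by (intro exI[of _ j] exI[of _ "1 / k"]) simp
  qed
  then have "ALL i. EX p. i < d --> fst p < d & snd p ~= 0 & K i = snd p *s L (fst p)" by (metis fst_conv snd_conv)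
  from choice[OF this] obtain p where p: "!!i. i < d ==> fst (p i) < d & snd (p i) ~= 0 & K i = snd (p i) *s L (fst (p i))" by blast
  have inj: "inj_on (\<lambda>i. fst (p i)) {..<d}"
  proof (rule inj_onI, rule ccontr)
    fix i i' assume i: "i \<in> {..<d}" "i' \<in> {..<d}" "fst (p i) = fst (p i')" "i ~= i'"
    let ?j = "fst (p i)" and ?l = "lin (L (fst (p i)))"
    have lK: "lin (K i) = sg 0 (snd (p i)) * ?l" "lin (K i') = sg 0 (snd (p i')) * ?l"
      using p[of i] p[of i'] i by (metis lessThan_iff lin_scale pscale_conv_mult)+
    have "fm d K = lin (K i) * (lin (K i') * (\<Prod>j\<in>{..<d} - {i} - {i'}. lin (K j)))"
      unfolding fm_def using i by (simp add: prod.remove[of _ i] prod.remove[of _ i'])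
    then have "fm d L = ?l * (?l * (sg 0 c * sg 0 (snd (p i)) * sg 0 (snd (p i')) * (\<Prod>j\<in>{..<d} - {i} - {i'}. lin (K j))))"
      unfolding eK lK by (simp only: mult_ac)
    moreover have "fm d L = ?l * (\<Prod>j\<in>{..<d} - {?j}. lin (L j))"
      unfolding fm_def using p[of i] i by (intro prod.remove) auto
    moreover have "?l ~= 0" using p[of i] i Lz by auto
    ultimately have "?l dvd (\<Prod>j\<in>{..<d} - {?j}. lin (L j))" by (metis dvdI mult_left_cancel)
    then obtain j where "j \<in> {..<d} - {?j}" "cr (L ?j) (L j) = 0"
      using lin_dvd_prod_lin[of "{..<d} - {?j}" "L ?j" L] p[of i] i Lz by (metis DiffD1 finite_Diff finite_lessThan lessThan_iff)
    then show False using gt_cr[OF g m, of ?j j] p[of i] i by auto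
  qed
  have "(\<lambda>i. fst (p i)) ` {..<d} \<subseteq> {..<d}" using p by auto
  then have "bij_betw (\<lambda>i. fst (p i)) {..<d} {..<d}"
    using inj by (simp add: bij_betw_def endo_inj_surj)
  then show thesis using that[of "\<lambda>i. fst (p i)" "\<lambda>i. snd (p i)"] p by blast
qed

lemma pen_tuple_generic:
  assumes g: "gt m d L" and m: "2 <= m" "m + 2 <= d" and c: "c ~= 0"
    and e: "fm d L = pscale c (fm d K)" and pK: "pen m d K"
  shows "nvp m d K ~= 0"
proof -
  obtain \<pi> k where \<pi>: "bij_betw \<pi> {..<d} {..<d}" and k: "!!i. i < d ==> k i ~= 0 & K i = k i *s L (\<pi> i)"
    using tuple_rearrangement[OF g m c e] by metis
  have lb: "bs m i < d" "bs m i + 1 < d" for i using m by (auto simp: bs_def)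
  define M where "M i = L (\<pi> i)" for i
  have kM: "k i ~= 0 & K i = k i *s M i" if "i < d" for i using k[OF that] by (simp add: M_def)
  have pM: "tri (M (bs m i)) (M (bs m i + 1)) (M i) = 0" if i: "i < d" for i
  proof -
    have "tri (K (bs m i)) (K (bs m i + 1)) (K i) = 0" using pK i by (simp add: pen_def)
    then have "k (bs m i) * k (bs m i + 1) * k i * tri (M (bs m i)) (M (bs m i + 1)) (M i) = 0"
      using kM[OF i] kM[OF lb(1)[of i]] kM[OF lb(2)[of i]] by (metis tri_scale)
    then show ?thesis using kM[OF i] kM[OF lb(1)[of i]] kM[OF lb(2)[of i]] by simp
  qed
  have "nvp m d M ~= 0"
    using pencils_unique[OF g m \<pi>] pM by (simp add: M_def[abs_def])
  then have "gt m d M" using pM by (simp add: gt_def pen_def)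
  then have "gt m d K" by (rule gt_rescale[OF _ m kM])
  then show ?thesis by (simp add: gt_def)
qed

section \<open>The family is locally closed\<close>

lemma point_off_lines:
  assumes "!!i. i < d ==> L i ~= 0"
  obtains e where "!!i. i < (d::nat) ==> dot (L i) e ~= 0"
proof -
  let ?e = "\<lambda>t. vector [1, t, t^2] :: complex^3"
  have "finite {t. dot (L i) (?e t) = 0}" if i: "i < d" for i
  proof -
    let ?p = "[:L i $ 1, L i $ 2, L i $ 3:]"
    have "?p ~= 0" using assms[OF i] by (auto simp: vec3_eq_iff)
    then have "finite {t. poly ?p t = 0}" by (rule poly_roots_finite)
    then show ?thesis by (simp add: dot_def power2_eq_square algebra_simps)
  qed
  then have "finite (\<Union>i<d. {t. dot (L i) (?e t) = 0})" by simp
  then obtain t where "t \<notin> (\<Union>i<d. {t. dot (L i) (?e t) = 0})" by (rule avoid_finite)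
  then show thesis using that[of "?e t"] by auto
qed

lemma locally_closed_at:
  assumes m: "2 <= m" "m + 2 <= d" and g: "gt m d L"
  obtains r u where "u \<in> homog r" "fev u (fm d L) ~= 0"
    "!!h. h \<in> homog d ==> fev u h ~= 0 ==> proj_pt h \<notin> XX m d ==>
       EX k. \<exists>F\<in>homog k. fev F h ~= 0 & vanish F (XX m d)"
proof -
  obtain e where e: "!!i. i < d ==> dot (L i) e ~= 0" using point_off_lines gt_nz[OF g m] by metis
  have "e ~= 0" using e[of 0] m by (auto simp: dot_def)
  then obtain a b where "dot e a = 0" "dot e b = 0" and ab: "cr a b ~= 0" using plane_basis by metis
  obtain u1 where u1: "cr e u1 ~= 0"
  proof -
    have "EX u1. cr e u1 ~= 0"
    proof (rule ccontr)
      assume "\<not> ?thesis"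
      then have "cr e (vector [1,0,0]) = 0" "cr e (vector [0,1,0]) = 0" by auto
      then show False using \<open>e ~= 0\<close> by (auto simp: vec3_eq_iff)
    qed
    then show thesis using that by blast
  qed
  then obtain u2 where "tri e u1 u2 ~= 0" using cr_zero_iff by blast
  then obtain p0 p1 p2 where D: "dual_basis e u1 u2 p0 p1 p2" by (rule dual_basis_exists)
  interpret root_setting d m e u1 u2 p0 p1 p2 by unfold_locales (use m D in auto)
  obtain cs where cs: "set cs = conds" using finite_list[OF finite_conds] by blast
  let ?f = "fm d L"
  have ev: "ev0 ?f ~= 0" using e by (simp add: ev0_def eval_fm prod_zero_iff)
  let ?nv = "\<lambda>f x. nvp m d (ln x)"
  have nz: "\<exists>h\<in>set (?nv # cs). h ?f (val ?f \<tau>) ~= 0" if "\<tau> \<in> tuples" for \<tau>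
  proof (rule ccontr)
    assume n: "\<not> ?thesis"
    then have "\<forall>h\<in>conds. h ?f (val ?f \<tau>) = 0" using cs by auto
    then have "?f = pscale (ev0 ?f) (fm d (ln (val ?f \<tau>)))" "pen m d (ln (val ?f \<tau>))"
      unfolding conds_vanish[OF fm_homog ev] by blast+
    then have "nvp m d (ln (val ?f \<tau>)) ~= 0" by (rule pen_tuple_generic[OF g m ev])
    then show False using n by auto
  qed
  have Hps: "Hp h" if "h \<in> set (?nv # cs)" for h using that Hp_nvp Hp_conds cs by auto
  obtain r1 F1 where F1: "F1 \<in> homog r1" "fev F1 ?f ~= 0"
    "!!f \<tau>. f \<in> homog d ==> ev0 f ~= 0 ==> \<tau> \<in> tuples ==> (\<forall>h\<in>set (?nv # cs). h f (val f \<tau>) = 0) ==> fev F1 f = 0"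
    using eliminate[OF Hps fm_homog ev nz] by metis
  show thesis
  proof (rule that[of "lz * F1" "1 + r1"])
    show "lz * F1 \<in> homog (1 + r1)" by (rule homog_mult[OF lz(1) F1(1)])
    show "fev (lz * F1) ?f ~= 0" using F1(2) ev lz(2)[OF fm_homog, of L] by (simp add: eval_simps)
    fix h assume h: "h \<in> homog d" "fev (lz * F1) h ~= 0" "proj_pt h \<notin> XX m d"
    have hz: "ev0 h ~= 0" "fev F1 h ~= 0" using h lz(2)[OF h(1)] by (auto simp: eval_simps)
    have nz2: "\<exists>q\<in>set cs. q h (val h \<tau>) ~= 0" if t: "\<tau> \<in> tuples" for \<tau>
    proof (rule ccontr)
      assume n: "\<not> ?thesis"
      then have c: "\<forall>q\<in>conds. q h (val h \<tau>) = 0" using cs by auto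
      then have hp: "h = pscale (ev0 h) (fm d (ln (val h \<tau>)))" "pen m d (ln (val h \<tau>))"
        unfolding conds_vanish[OF h(1) hz(1)] by blast+
      have "nvp m d (ln (val h \<tau>)) ~= 0"
      proof
        assume "nvp m d (ln (val h \<tau>)) = 0"
        then have "fev F1 h = 0" using F1(3)[OF h(1) hz(1) t] c cs by simp
        then show False using hz by simp
      qed
      then have "gt m d (ln (val h \<tau>))" using hp by (simp add: gt_def)
      then have "proj_pt (fm d (ln (val h \<tau>))) \<in> XX m d" by (auto simp: XX_def)
      then show False using h(3) proj_pt_scale[OF hz(1), of "fm d (ln (val h \<tau>))"] hp(1) by simp
    qed
    have Hps2: "Hp q" if "q \<in> set cs" for q using that Hp_conds cs by auto
    obtain r2 F2 where F2: "F2 \<in> homog r2" "fev F2 h ~= 0"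
      "!!f \<tau>. f \<in> homog d ==> ev0 f ~= 0 ==> \<tau> \<in> tuples ==> (\<forall>q\<in>set cs. q f (val f \<tau>) = 0) ==> fev F2 f = 0"
      using eliminate[OF Hps2 h(1) hz(1) nz2] by metis
    have "vanish (lz * F2) (XX m d)"
      unfolding vanish_def XX_mem[OF m]
    proof (intro allI impI, elim exE conjE)
      fix q K assume K: "gt m d K" "q = fm d K"
      show "fev (lz * F2) q = 0"
      proof (cases "ev0 q = 0")
        case True
        then show ?thesis using lz(2)[OF fm_homog, of K] K by (simp add: eval_simps)
      next
        case False
        obtain \<tau> where "\<tau> \<in> tuples" "\<forall>h\<in>conds. h (fm d K) (val (fm d K) \<tau>) = 0"
          using arrangement_has_tuple[OF K(1)] False K(2) by blast
        then have "fev F2 q = 0" using F2(3)[of q \<tau>] False K(2) fm_homog cs by simp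
        then show ?thesis by (simp add: eval_simps)
      qed
    qed
    moreover have "fev (lz * F2) h ~= 0" using F2(2) hz(1) lz(2)[OF h(1)] by (simp add: eval_simps)
    ultimately show "EX k. \<exists>F\<in>homog k. fev F h ~= 0 & vanish F (XX m d)"
      using homog_mult[OF lz(1) F2(1)] by blast
  qed
qed

lemma XX_locally_closed:
  assumes m: "2 <= m" "m + 2 <= d"
  shows "locally_closed_in (zariski (homog d)) (XX m d)"
proof -
  note W = cone_homog[of d] and X = XX_sub[OF m]
  let ?P = "proj_space (homog d) :: S set set"
  let ?good = "\<lambda>u. ALL h. h \<in> homog d --> fev u h ~= 0 --> proj_pt h \<notin> XX m d -->
       (EX k. \<exists>F\<in>homog k. fev F h ~= 0 & vanish F (XX m d))"
  let ?U = "\<Union>{basic_open (homog d) u | u r. u \<in> homog r & ?good u}"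
  let ?C = "zclosure ?P (XX m d)"
  have op: "openin (zariski (homog d)) ?U" using openin_basic[OF W] by (intro openin_Union) auto
  have cl: "closedin (zariski (homog d)) ?C"
    using closedin_zclosure[OF W order_refl X] unfolding zariski_as_subtopology[OF W] .
  have "XX m d = ?U \<inter> ?C"
  proof (intro equalityI subsetI)
    fix x assume x: "x \<in> XX m d"
    then obtain L where L: "gt m d L" "x = proj_pt (fm d L)" by (auto simp: XX_def)
    obtain r u where u: "u \<in> homog r" "fev u (fm d L) ~= 0" "?good u"
      using locally_closed_at[OF m L(1)] by metis
    have "x \<in> basic_open (homog d) u"
      using basic_open_mem[OF W u(1)] u(2) fm_homog fm_nz[OF L(1) m] L(2) by blast
    then have "x \<in> ?U" using u by blast
    then show "x \<in> ?U \<inter> ?C" using x subset_zclosure[OF X] by blast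
  next
    fix x assume x: "x \<in> ?U \<inter> ?C"
    then obtain u r where u: "u \<in> homog r" "?good u" "x \<in> basic_open (homog d) u" by blast
    have "x \<in> ?P" using x by (simp add: zclosure_def)
    then obtain h where h: "x = proj_pt h" using proj_space_ex by blast
    have hu: "h \<in> homog d" "fev u h ~= 0" using u(3) unfolding h basic_open_mem[OF W u(1)] by blast+
    show "x \<in> XX m d"
    proof (rule ccontr)
      assume "x \<notin> XX m d"
      then obtain k F where "F \<in> homog k" "fev F h ~= 0" "vanish F (XX m d)" using u(2) hu h by blast
      moreover have "vanish F {x}" if "F \<in> homog k" "vanish F (XX m d)" for F k using x that by (auto simp: zclosure_def)
      ultimately show False using h by (auto simp: vanish_def)
    qed
  qed
  then show ?thesis unfolding locally_closed_in_def using op cl by blast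
qed

section \<open>Intersection lattices and incidences\<close>

lemma Field_lattice: "Field (intersection_lattice \<A>) = {\<Inter>\<B> | \<B>. \<B> \<subseteq> \<A>}"
  unfolding intersection_lattice_def Field_def by (auto simp: Domain_iff Range_iff)

lemma mem_lattice: "(x, y) \<in> intersection_lattice \<A> \<longleftrightarrow>
    x \<in> Field (intersection_lattice \<A>) & y \<in> Field (intersection_lattice \<A>) & y \<subseteq> x"
  unfolding Field_lattice by (auto simp: intersection_lattice_def)

lemma lattice_iso_if_bij:
  assumes \<psi>: "bij_betw \<psi> \<A> \<B>"
    and c: "!!S M. S \<subseteq> \<A> ==> M \<in> \<A> ==> \<Inter>S \<subseteq> M \<longleftrightarrow> \<Inter>(\<psi> ` S) \<subseteq> \<psi> M"
  shows "lattice_iso (intersection_lattice \<A>) (intersection_lattice \<B>)"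
proof -
  let ?F = "Field (intersection_lattice \<A>)" and ?G = "Field (intersection_lattice \<B>)"
  define \<phi> where "\<phi> x = \<Inter>(\<psi> ` {M\<in>\<A>. x \<subseteq> M})" for x
  have \<phi>: "\<phi> (\<Inter>S) = \<Inter>(\<psi> ` S)" if S: "S \<subseteq> \<A>" for S
  proof
    show "\<phi> (\<Inter>S) \<subseteq> \<Inter>(\<psi> ` S)" unfolding \<phi>_def using S by blast
    show "\<Inter>(\<psi> ` S) \<subseteq> \<phi> (\<Inter>S)" unfolding \<phi>_def using c[OF S] by blast
  qed
  have im: "\<psi> ` \<A> = \<B>" using \<psi> by (simp add: bij_betw_def)
  have ord: "y \<subseteq> x \<longleftrightarrow> \<phi> y \<subseteq> \<phi> x" if x: "x \<in> ?F" and y: "y \<in> ?F" for x y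
  proof -
    obtain S T where S: "x = \<Inter>S" "S \<subseteq> \<A>" and T: "y = \<Inter>T" "T \<subseteq> \<A>" using x y unfolding Field_lattice by blast
    have "y \<subseteq> x \<longleftrightarrow> (\<forall>M\<in>S. \<Inter>T \<subseteq> M)" using S T by blast
    also have "\<dots> \<longleftrightarrow> (\<forall>M\<in>S. \<Inter>(\<psi> ` T) \<subseteq> \<psi> M)" by (intro ball_cong refl c[OF T(2)]) (use S(2) in auto)
    also have "\<dots> \<longleftrightarrow> \<phi> y \<subseteq> \<phi> x" unfolding S(1) T(1) \<phi>[OF S(2)] \<phi>[OF T(2)] by blast
    finally show ?thesis .
  qed
  have fim: "\<phi> ` ?F = ?G"
  proof
    show "\<phi> ` ?F \<subseteq> ?G"
    proof
      fix z assume "z \<in> \<phi> ` ?F"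
      then obtain S where S: "S \<subseteq> \<A>" "z = \<phi> (\<Inter>S)" unfolding Field_lattice by blast
      have "z = \<Inter>(\<psi> ` S)" "\<psi> ` S \<subseteq> \<B>" using S \<phi>[OF S(1)] im by auto
      then show "z \<in> ?G" unfolding Field_lattice by blast
    qed
    show "?G \<subseteq> \<phi> ` ?F"
    proof
      fix z assume "z \<in> ?G"
      then obtain T where T: "T \<subseteq> \<B>" "z = \<Inter>T" unfolding Field_lattice by blast
      then obtain S where S: "S \<subseteq> \<A>" "T = \<psi> ` S" using im by (metis subset_imageE)
      then have "z = \<phi> (\<Inter>S)" using \<phi>[OF S(1)] T by simp
      moreover have "\<Inter>S \<in> ?F" unfolding Field_lattice using S(1) by blast
      ultimately show "z \<in> \<phi> ` ?F" by (rule image_eqI)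
    qed
  qed
  have inj: "inj_on \<phi> ?F" by (rule inj_onI) (metis ord subset_antisym order_refl)
  show ?thesis
    unfolding lattice_iso_def
  proof (intro exI conjI ballI)
    show "bij_betw \<phi> ?F ?G" using inj fim by (simp add: bij_betw_def)
    fix x y assume xy: "x \<in> ?F" "y \<in> ?F"
    then have "\<phi> x \<in> ?G" "\<phi> y \<in> ?G" using fim by (metis imageI)+
    then show "(x, y) \<in> intersection_lattice \<A> \<longleftrightarrow> (\<phi> x, \<phi> y) \<in> intersection_lattice \<B>"
      using xy mem_lattice ord[OF xy] by (metis (no_types))
  qed
qed

definition proper :: "'a set set => bool" where
  "proper \<A> \<longleftrightarrow> UNIV \<notin> \<A> & (\<forall>H\<in>\<A>. \<forall>K\<in>\<A>. H \<subseteq> K --> H = K)"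

lemma lattice_atoms:
  assumes "proper \<A>"
  shows "a \<in> \<A> \<longleftrightarrow> a \<in> Field (intersection_lattice \<A>) & a ~= UNIV &
    (\<forall>x\<in>Field (intersection_lattice \<A>). a \<subseteq> x --> x = UNIV \<or> x = a)" (is "_ \<longleftrightarrow> ?R")
proof
  assume a: "a \<in> \<A>"
  have "x = UNIV \<or> x = a" if x: "x \<in> Field (intersection_lattice \<A>)" "a \<subseteq> x" for x
  proof -
    obtain S where S: "x = \<Inter>S" "S \<subseteq> \<A>" using x unfolding Field_lattice by blast
    show ?thesis
    proof (cases "S = {}")
      case False
      then obtain M where M: "M \<in> S" by blast
      then have "a = M" using S x a assms unfolding proper_def by blast
      then show ?thesis using S M x by blast
    qed (use S in simp)
  qed
  moreover have "a \<in> Field (intersection_lattice \<A>)" unfolding Field_lattice using a by (intro CollectI exI[of _ "{a}"]) simp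
  ultimately show ?R using a assms by (auto simp: proper_def)
next
  assume R: ?R
  then obtain S where S: "a = \<Inter>S" "S \<subseteq> \<A>" unfolding Field_lattice by blast
  then have "S ~= {}" using R by auto
  then obtain M where M: "M \<in> S" by blast
  then have "M \<in> Field (intersection_lattice \<A>)" unfolding Field_lattice using S by (intro CollectI exI[of _ "{M}"]) auto
  then have "M = UNIV \<or> M = a" using R S M by blast
  then show "a \<in> \<A>" using M S assms by (auto simp: proper_def)
qed

text \<open>The lines are the atoms of the lattice, and the lattice is generated by them; since an order isomorphism preserves
  atoms and least upper bounds, its restriction to lines determines when a line contains an intersection of others.\<close>
lemma bij_if_lattice_iso:
  assumes A: "proper \<A>" and B: "proper \<B>"
    and iso: "lattice_iso (intersection_lattice \<A>) (intersection_lattice \<B>)"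
  obtains \<psi> where "bij_betw \<psi> \<A> \<B>"
    "!!S M. S \<subseteq> \<A> ==> M \<in> \<A> ==> \<Inter>S \<subseteq> M \<longleftrightarrow> \<Inter>(\<psi> ` S) \<subseteq> \<psi> M"
proof -
  let ?F = "Field (intersection_lattice \<A>)" and ?G = "Field (intersection_lattice \<B>)"
  obtain \<phi> where bij: "bij_betw \<phi> ?F ?G"
    and o: "\<forall>x\<in>?F. \<forall>y\<in>?F. (x, y) \<in> intersection_lattice \<A> \<longleftrightarrow> (\<phi> x, \<phi> y) \<in> intersection_lattice \<B>"
    using iso unfolding lattice_iso_def by blast
  have im: "\<phi> ` ?F = ?G" and inj: "inj_on \<phi> ?F" using bij by (simp_all add: bij_betw_def)
  have ord: "y \<subseteq> x \<longleftrightarrow> \<phi> y \<subseteq> \<phi> x" if "x \<in> ?F" "y \<in> ?F" for x y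
    using o that im unfolding mem_lattice by blast
  have UF: "UNIV \<in> ?F" "UNIV \<in> ?G" unfolding Field_lattice by (metis (mono_tags, lifting) Inter_empty empty_subsetI mem_Collect_eq)+
  have U: "\<phi> UNIV = UNIV"
  proof -
    obtain z where "z \<in> ?F" "\<phi> z = UNIV" using UF im by (metis imageE)
    then show ?thesis using ord[OF UF(1)] by (metis top.extremum_uniqueI subset_UNIV)
  qed
  have at: "\<phi> a \<in> \<B> \<longleftrightarrow> a \<in> \<A>" if a: "a \<in> ?F" for a
  proof -
    have "\<phi> a ~= UNIV \<longleftrightarrow> a ~= UNIV" using U inj a UF by (metis inj_onD)
    moreover have "(\<forall>x\<in>?G. \<phi> a \<subseteq> x --> x = UNIV \<or> x = \<phi> a) \<longleftrightarrow> (\<forall>x\<in>?F. a \<subseteq> x --> x = UNIV \<or> x = a)"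
    proof -
      have "(\<forall>x\<in>?G. \<phi> a \<subseteq> x --> x = UNIV \<or> x = \<phi> a) \<longleftrightarrow> (\<forall>x\<in>?F. \<phi> a \<subseteq> \<phi> x --> \<phi> x = UNIV \<or> \<phi> x = \<phi> a)"
        unfolding im[symmetric] by blast
      also have "\<dots> \<longleftrightarrow> (\<forall>x\<in>?F. a \<subseteq> x --> x = UNIV \<or> x = a)"
        using ord[OF _ a] U inj a UF unfolding inj_on_def by metis
      finally show ?thesis .
    qed
    moreover have "\<phi> a \<in> ?G" using a im by (metis imageI)
    ultimately show ?thesis using a by (simp only: lattice_atoms[OF A, of a] lattice_atoms[OF B, of "\<phi> a"] simp_thms)
  qed
  have AF: "\<A> \<subseteq> ?F" "\<B> \<subseteq> ?G" using lattice_atoms[OF A] lattice_atoms[OF B] by blast+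
  have "\<phi> ` \<A> = \<B>"
  proof
    show "\<phi> ` \<A> \<subseteq> \<B>" using at AF by blast
    show "\<B> \<subseteq> \<phi> ` \<A>"
    proof
      fix b assume b: "b \<in> \<B>"
      then have "b \<in> ?G" using AF(2) by (metis subsetD)
      then obtain a where a: "a \<in> ?F" "\<phi> a = b" using im by (metis imageE)
      then have "a \<in> \<A>" using at[of a] b by blast
      then show "b \<in> \<phi> ` \<A>" using a by (metis imageI)
    qed
  qed
  then have bA: "bij_betw \<phi> \<A> \<B>" using inj AF by (auto simp: bij_betw_def intro: inj_on_subset)
  have lub: "\<phi> (\<Inter>S) = \<Inter>(\<phi> ` S)" if S: "S \<subseteq> \<A>" for S
  proof
    have SF: "\<Inter>S \<in> ?F" unfolding Field_lattice using S by blast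
    show "\<phi> (\<Inter>S) \<subseteq> \<Inter>(\<phi> ` S)"
    proof
      fix u assume u: "u \<in> \<phi> (\<Inter>S)"
      show "u \<in> \<Inter>(\<phi> ` S)"
      proof (rule InterI)
        fix X assume "X \<in> \<phi> ` S"
        then obtain M where M: "M \<in> S" "X = \<phi> M" by blast
        have "M \<in> ?F" using M S AF by blast
        moreover have "\<Inter>S \<subseteq> M" using M by blast
        ultimately have "\<phi> (\<Inter>S) \<subseteq> \<phi> M" using ord[of M "\<Inter>S"] SF by blast
        then show "u \<in> X" using u M by blast
      qed
    qed
    have "\<phi> ` S \<subseteq> \<B>" using S \<open>\<phi> ` \<A> = \<B>\<close> by blast
    then have "\<Inter>(\<phi> ` S) \<in> ?G" unfolding Field_lattice by blast
    then obtain z where z: "z \<in> ?F" "\<phi> z = \<Inter>(\<phi> ` S)" using im by (metis imageE)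
    have "z \<subseteq> M" if "M \<in> S" for M
    proof -
      have "M \<in> ?F" using that S AF by blast
      moreover have "\<phi> z \<subseteq> \<phi> M" using z(2) that by blast
      ultimately show ?thesis using ord z(1) by blast
    qed
    then have "z \<subseteq> \<Inter>S" by blast
    then show "\<Inter>(\<phi> ` S) \<subseteq> \<phi> (\<Inter>S)" using ord[OF SF z(1)] z(2) by simp
  qed
  show thesis
  proof (rule that[OF bA])
    fix S M assume S: "S \<subseteq> \<A>" "M \<in> \<A>"
    have "\<Inter>S \<in> ?F" unfolding Field_lattice using S by blast
    then have "\<Inter>S \<subseteq> M \<longleftrightarrow> \<phi> (\<Inter>S) \<subseteq> \<phi> M" using ord[of M "\<Inter>S"] S AF by blast
    then show "\<Inter>S \<subseteq> M \<longleftrightarrow> \<Inter>(\<phi> ` S) \<subseteq> \<phi> M" by (simp only: lub[OF S(1)])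
  qed
qed

section \<open>Lines as planes through the origin\<close>

definition plane :: "complex^3 => (complex^3) set" where
  "plane v = {u. dot v u = 0}"

lemma line_of_lin: "line_of (lin v) = plane v"
  by (simp add: line_of_def plane_def eval_lin)

lemma is_line_plane: "is_line H \<longleftrightarrow> (EX v. v ~= 0 & H = plane v)"
proof
  assume "is_line H"
  then obtain l where l: "l \<in> homog 1" "l ~= 0" "H = line_of l" by (auto simp: is_line_def)
  then obtain v where "l = lin v" using homog_1_lin by blast
  then show "EX v. v ~= 0 & H = plane v" using l by (auto simp: line_of_lin)
next
  assume "EX v. v ~= 0 & H = plane v"
  then obtain v where v: "v ~= 0" "H = plane v" by blast
  then show "is_line H" unfolding is_line_def using homog_lin[of v] by (intro bexI[of _ "lin v"]) (simp_all add: line_of_lin)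
qed

lemma plane_scale: "c ~= 0 ==> plane (c *s v) = plane v"
  by (simp add: plane_def dot_scale)

lemma plane_subset: "v ~= 0 ==> plane v \<subseteq> plane w ==> cr v w = 0"
proof -
  assume v: "v ~= 0" "plane v \<subseteq> plane w"
  obtain u1 u2 where u: "dot v u1 = 0" "dot v u2 = 0" "!!w. dot w u1 = 0 ==> dot w u2 = 0 ==> cr v w = 0"
    using plane_basis[OF v(1)] by metis
  then show ?thesis using v(2) by (auto simp: plane_def)
qed

lemma plane_eq:
  assumes "v ~= 0" "w ~= 0" "cr v w = 0"
  shows "plane v = plane w"
proof -
  obtain c where c: "w = c *s v" using proportional_if_cr[OF assms(1,3)] .
  then have "c ~= 0" using assms(2) by (auto simp: vec3_eq_iff)
  then show ?thesis using c plane_scale by simp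
qed

lemma cr_0 [simp]: "cr 0 v = 0" "cr v 0 = 0"
  by (simp_all add: vec3_eq_iff)

lemma perp_two:
  assumes "cr u v ~= 0" "dot u x = 0" "dot v x = 0"
  obtains c where "x = c *s cr u v"
proof -
  obtain z where z: "tri u v z ~= 0" using assms(1) cr_zero_iff by blast
  have e: "tri u v z *s x = dot z x *s cr u v + dot u x *s cr v z + dot v x *s cr z u"
    by (simp add: vec3_eq_iff tri_expand dot_def algebra_simps)
  then have "x = (dot z x / tri u v z) *s cr u v"
    using z assms by (simp add: vec3_eq_iff field_simps)
  then show thesis by (rule that)
qed

lemma plane_inter: "cr u v ~= 0 ==> plane u \<inter> plane v = {c *s cr u v | c. True}"
proof (intro equalityI subsetI)
  fix x assume "cr u v ~= 0" "x \<in> plane u \<inter> plane v"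
  then show "x \<in> {c *s cr u v | c. True}" using perp_two[of u v x] by (auto simp: plane_def)
next
  fix x assume "x \<in> {c *s cr u v | c. True}"
  then obtain c where "x = c *s cr u v" by blast
  then show "x \<in> plane u \<inter> plane v"
    by (simp add: plane_def dot_scale del: cr_nth)
qed

lemma plane_inter_subset:
  assumes "cr u v ~= 0"
  shows "plane u \<inter> plane v \<subseteq> plane w \<longleftrightarrow> tri u v w = 0"
proof -
  have "plane u \<inter> plane v \<subseteq> plane w \<longleftrightarrow> dot w (cr u v) = 0"
    unfolding plane_inter[OF assms] by (auto simp: plane_def dot_scale simp del: cr_nth)
  then show ?thesis by (simp add: tri_def dot_def mult.commute)
qed

lemma tri_nonzero_inter:
  assumes "tri u v w ~= 0"
  shows "plane u \<inter> plane v \<inter> plane w = {0}"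
proof (intro equalityI subsetI)
  fix x assume x: "x \<in> plane u \<inter> plane v \<inter> plane w"
  obtain c d e where D: "dual_basis u v w c d e" using dual_basis_exists[OF assms] .
  have "x = 0" using dual_basis_expand(1)[OF D, of x] x by (simp add: plane_def vec3_eq_iff)
  then show "x \<in> {0}" by simp
qed (simp add: plane_def dot_def)

definition distinct_lines :: "nat => (nat => complex^3) => bool" where
  "distinct_lines d L \<longleftrightarrow> (\<forall>i<d. L i ~= 0) & (\<forall>i<d. \<forall>j<d. i ~= j --> cr (L i) (L j) ~= 0)"

definition planes :: "nat => (nat => complex^3) => (complex^3) set set" where
  "planes d L = (\<lambda>i. plane (L i)) ` {..<d}"

lemma plane_subset_iff:
  assumes "distinct_lines d L" "i < d" "j < d"
  shows "plane (L i) \<subseteq> plane (L j) \<longleftrightarrow> i = j"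
  using assms plane_subset[of "L i" "L j"] unfolding distinct_lines_def by blast

lemma plane_inj: "distinct_lines d L ==> inj_on (\<lambda>i. plane (L i)) {..<d}"
  by (rule inj_onI) (metis lessThan_iff order_refl plane_subset_iff)

lemma proper_planes:
  assumes "distinct_lines d L" shows "proper (planes d L)"
proof -
  have "plane (L i) ~= UNIV" if i: "i < d" for i
  proof
    assume U: "plane (L i) = UNIV"
    have "L i ~= 0" using assms i by (simp add: distinct_lines_def)
    moreover have "dot (L i) u = 0" for u using U by (auto simp: plane_def)
    from this[of "vector [1,0,0]"] this[of "vector [0,1,0]"] this[of "vector [0,0,1]"]
    have "L i = 0" by (simp add: dot_def vec3_eq_iff)
    ultimately show False by simp
  qed
  then show ?thesis using plane_subset_iff[OF assms] by (auto simp: proper_def planes_def)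
qed

lemma inter_cases:
  assumes L: "distinct_lines d L" and S: "S \<subseteq> {..<d}" and ij: "i \<in> S" "j \<in> S" "i ~= j"
  shows "\<forall>l\<in>S. tri (L i) (L j) (L l) = 0 ==> (\<Inter>l\<in>S. plane (L l)) = plane (L i) \<inter> plane (L j)"
    and "l \<in> S ==> tri (L i) (L j) (L l) ~= 0 ==> (\<Inter>l\<in>S. plane (L l)) = {0}"
proof -
  have c: "cr (L i) (L j) ~= 0" using L S ij by (auto simp: distinct_lines_def)
  show "(\<Inter>l\<in>S. plane (L l)) = plane (L i) \<inter> plane (L j)" if "\<forall>l\<in>S. tri (L i) (L j) (L l) = 0"
    using that plane_inter_subset[OF c] ij by blast
  have "0 \<in> plane v" for v by (simp add: plane_def dot_def)
  then show "(\<Inter>l\<in>S. plane (L l)) = {0}" if "l \<in> S" "tri (L i) (L j) (L l) ~= 0"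
    using tri_nonzero_inter[OF that(2)] ij that(1) by blast
qed

lemma inter_subset_plane:
  assumes L: "distinct_lines d L" and S: "S \<subseteq> {..<d}" and k: "k < d"
  shows "(\<Inter>l\<in>S. plane (L l)) \<subseteq> plane (L k) \<longleftrightarrow> S = {k} \<or>
    (\<exists>i\<in>S. \<exists>j\<in>S. i ~= j & (tri (L i) (L j) (L k) = 0 \<or> (\<exists>l\<in>S. tri (L i) (L j) (L l) ~= 0)))"
proof -
  have zk: "0 \<in> plane v" for v by (simp add: plane_def dot_def)
  consider "S = {}" | i where "S = {i}" | i j where "i \<in> S" "j \<in> S" "i ~= j" by blast
  then show ?thesis
  proof cases
    case 1
    have "plane (L k) ~= UNIV" using proper_planes[OF L] k by (auto simp: proper_def planes_def)
    then show ?thesis using 1 by auto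
  next
    case 2
    then show ?thesis using plane_subset_iff[OF L _ k, of i] S by auto
  next
    case 3
    show ?thesis
    proof (cases "\<forall>l\<in>S. tri (L i) (L j) (L l) = 0")
      case True
      have c: "cr (L a) (L b) ~= 0" if "a \<in> S" "b \<in> S" "a ~= b" for a b using L S that by (auto simp: distinct_lines_def)
      have e: "(\<Inter>l\<in>S. plane (L l)) = plane (L i) \<inter> plane (L j)" by (rule inter_cases(1)[OF L S 3 True])
      have "\<not> (\<exists>l\<in>S. tri (L a) (L b) (L l) ~= 0)" if ab: "a \<in> S" "b \<in> S" "a ~= b" for a b
      proof
        assume "\<exists>l\<in>S. tri (L a) (L b) (L l) ~= 0"
        then have "(\<Inter>l\<in>S. plane (L l)) = {0}" using inter_cases(2)[OF L S ab] by blast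
        moreover have "cr (L i) (L j) \<in> plane (L i) \<inter> plane (L j)" by (simp add: plane_def del: cr_nth)
        ultimately show False using e c[OF 3] by auto
      qed
      moreover have "(\<Inter>l\<in>S. plane (L l)) \<subseteq> plane (L k) \<longleftrightarrow> tri (L a) (L b) (L k) = 0" if ab: "a \<in> S" "b \<in> S" "a ~= b" for a b
        using inter_cases(1)[OF L S ab] calculation[OF ab] plane_inter_subset[OF c[OF ab]] by simp
      moreover have "S ~= {k}" using 3 by auto
      ultimately show ?thesis using 3 by metis
    next
      case False
      then obtain l where l: "l \<in> S" "tri (L i) (L j) (L l) ~= 0" by blast
      then have "(\<Inter>l\<in>S. plane (L l)) = {0}" by (rule inter_cases(2)[OF L S 3])
      then have "(\<Inter>l\<in>S. plane (L l)) \<subseteq> plane (L k)" using zk by simp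
      moreover have "\<exists>i\<in>S. \<exists>j\<in>S. i ~= j & (tri (L i) (L j) (L k) = 0 \<or> (\<exists>l\<in>S. tri (L i) (L j) (L l) ~= 0))"
        using l 3 by blast
      ultimately show ?thesis by blast
    qed
  qed
qed

lemma same_pattern_iso:
  assumes L: "distinct_lines d L" and K: "distinct_lines d K"
    and p: "!!i j k. i < d ==> j < d ==> k < d ==> i ~= j ==> tri (L i) (L j) (L k) = 0 \<longleftrightarrow> tri (K i) (K j) (K k) = 0"
  shows "lattice_iso (intersection_lattice (planes d L)) (intersection_lattice (planes d K))"
proof -
  define ix where "ix H = (THE i. i < d & H = plane (L i))" for H
  have ix: "ix (plane (L i)) = i" if "i < d" for i
    unfolding ix_def by (rule the_equality) (use that plane_inj[OF L] in \<open>auto simp: inj_on_def\<close>)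
  let ?\<psi> = "\<lambda>H. plane (K (ix H))"
  have im: "?\<psi> ` (\<lambda>i. plane (L i)) ` S = (\<lambda>i. plane (K i)) ` S" if "S \<subseteq> {..<d}" for S
    unfolding image_image by (rule image_cong) (use that ix in auto)
  show ?thesis
  proof (rule lattice_iso_if_bij[of ?\<psi>])
    show "bij_betw ?\<psi> (planes d L) (planes d K)"
      unfolding bij_betw_def planes_def
    proof
      show "?\<psi> ` (\<lambda>i. plane (L i)) ` {..<d} = (\<lambda>i. plane (K i)) ` {..<d}" by (rule im) simp
      show "inj_on ?\<psi> ((\<lambda>i. plane (L i)) ` {..<d})"
      proof (rule inj_onI)
        fix H H' assume H: "H \<in> (\<lambda>i. plane (L i)) ` {..<d}" "H' \<in> (\<lambda>i. plane (L i)) ` {..<d}" "?\<psi> H = ?\<psi> H'"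
        then obtain i i' where i: "i < d" "H = plane (L i)" "i' < d" "H' = plane (L i')" by auto
        then have "plane (K i) = plane (K i')" using H(3) ix by simp
        then have "i = i'" using inj_onD[OF plane_inj[OF K]] i by simp
        then show "H = H'" using i by simp
      qed
    qed
    fix S M assume "S \<subseteq> planes d L" "M \<in> planes d L"
    then obtain T k where T: "T \<subseteq> {..<d}" "S = (\<lambda>i. plane (L i)) ` T" and k: "k < d" "M = plane (L k)"
      unfolding planes_def by (metis (no_types, lifting) imageE lessThan_iff subset_imageE)
    have "\<Inter>S \<subseteq> M \<longleftrightarrow> (\<Inter>l\<in>T. plane (L l)) \<subseteq> plane (L k)" using T k by simp
    also have "\<dots> \<longleftrightarrow> (\<Inter>l\<in>T. plane (K l)) \<subseteq> plane (K k)"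
      unfolding inter_subset_plane[OF L T(1) k(1)] inter_subset_plane[OF K T(1) k(1)]
      using p T(1) k(1) by (metis (no_types, lifting) lessThan_iff subsetD)
    also have "\<dots> \<longleftrightarrow> \<Inter>(?\<psi> ` S) \<subseteq> ?\<psi> M" using im[OF T(1)] T k ix by simp
    finally show "\<Inter>S \<subseteq> M \<longleftrightarrow> \<Inter>(?\<psi> ` S) \<subseteq> ?\<psi> M" .
  qed
qed


lemma same_pattern_if_iso:
  assumes L: "distinct_lines d L" and K: "distinct_lines d K"
    and iso: "lattice_iso (intersection_lattice (planes d L)) (intersection_lattice (planes d K))"
  obtains \<pi> where "bij_betw \<pi> {..<d} {..<d}" "!!i j k. i < d ==> j < d ==> k < d ==> i ~= j ==>
      tri (L i) (L j) (L k) = 0 \<longleftrightarrow> tri (K (\<pi> i)) (K (\<pi> j)) (K (\<pi> k)) = 0"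
proof -
  obtain \<psi> where \<psi>: "bij_betw \<psi> (planes d L) (planes d K)"
    and c: "!!S M. S \<subseteq> planes d L ==> M \<in> planes d L ==> \<Inter>S \<subseteq> M \<longleftrightarrow> \<Inter>(\<psi> ` S) \<subseteq> \<psi> M"
    using bij_if_lattice_iso[OF proper_planes[OF L] proper_planes[OF K] iso] by metis
  have mem: "plane (L i) \<in> planes d L" if "i < d" for i using that by (simp add: planes_def)
  have "EX j. j < d & \<psi> (plane (L i)) = plane (K j)" if i: "i < d" for i
  proof -
    have "\<psi> (plane (L i)) \<in> planes d K" using \<psi> mem[OF i] by (auto simp: bij_betw_def)
    then show ?thesis by (auto simp: planes_def)
  qed
  then have "ALL i. EX j. i < d --> j < d & \<psi> (plane (L i)) = plane (K j)" by blast
  from choice[OF this] obtain \<pi> where \<pi>: "!!i. i < d ==> \<pi> i < d & \<psi> (plane (L i)) = plane (K (\<pi> i))" by blast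
  have inj: "inj_on \<pi> {..<d}"
  proof (rule inj_onI)
    fix i j assume ij: "i \<in> {..<d}" "j \<in> {..<d}" "\<pi> i = \<pi> j"
    then have "\<psi> (plane (L i)) = \<psi> (plane (L j))" using \<pi> by simp
    then have "plane (L i) = plane (L j)" using \<psi> mem ij by (auto simp: bij_betw_def dest: inj_onD)
    then show "i = j" using inj_onD[OF plane_inj[OF L]] ij by simp
  qed
  have "\<pi> ` {..<d} \<subseteq> {..<d}" using \<pi> by auto
  then have bij: "bij_betw \<pi> {..<d} {..<d}" using inj by (simp add: bij_betw_def endo_inj_surj)
  show thesis
  proof (rule that[OF bij])
    fix i j k assume ijk: "i < d" "j < d" "k < d" "i ~= j"
    have ne: "\<pi> i ~= \<pi> j" using inj ijk by (auto dest: inj_onD)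
    have c1: "cr (L i) (L j) ~= 0" using L ijk by (simp add: distinct_lines_def)
    have c2: "cr (K (\<pi> i)) (K (\<pi> j)) ~= 0" using K \<pi> ijk ne by (simp add: distinct_lines_def)
    have "tri (L i) (L j) (L k) = 0 \<longleftrightarrow> \<Inter>{plane (L i), plane (L j)} \<subseteq> plane (L k)"
      using plane_inter_subset[OF c1] by simp
    also have "\<dots> \<longleftrightarrow> \<Inter>(\<psi> ` {plane (L i), plane (L j)}) \<subseteq> \<psi> (plane (L k))"
      by (rule c) (use mem ijk in auto)
    also have "\<dots> \<longleftrightarrow> tri (K (\<pi> i)) (K (\<pi> j)) (K (\<pi> k)) = 0"
      using plane_inter_subset[OF c2] \<pi> ijk by simp
    finally show "tri (L i) (L j) (L k) = 0 \<longleftrightarrow> tri (K (\<pi> i)) (K (\<pi> j)) (K (\<pi> k)) = 0" .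
  qed
qed

section \<open>Generic unions of two pencils as tuples\<close>

lemma gt_distinct: "gt m d L ==> 2 <= m ==> m + 2 <= d ==> distinct_lines d L"
  unfolding distinct_lines_def using gt_nz gt_cr by blast

definition pattern :: "nat => nat => nat => nat => bool" where
  "pattern m i j k \<longleftrightarrow> (if bs m i = bs m j then bs m k = bs m i else k = i \<or> k = j)"

lemma gt_pattern:
  assumes g: "gt m d L" and m: "2 <= m" "m + 2 <= d" and ijk: "i < d" "j < d" "k < d" "i ~= j"
  shows "tri (L i) (L j) (L k) = 0 \<longleftrightarrow> pattern m i j k"
proof
  assume t: "tri (L i) (L j) (L k) = 0"
  show "pattern m i j k"
    using gt_concurrent_same[OF g m ijk t] gt_concurrent_diff[OF g m ijk(1-3) t] by (auto simp: pattern_def)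
next
  assume p: "pattern m i j k"
  show "tri (L i) (L j) (L k) = 0"
  proof (cases "bs m i = bs m j")
    case True
    then have bk: "bs m k = bs m i" using p by (simp add: pattern_def)
    let ?n = "cr (L (bs m i)) (L (bs m i + 1))"
    have "?n ~= 0" by (rule gt_cr[OF g m]) (use m in \<open>auto simp: bs_def\<close>)
    moreover have "dot ?n (L i) = 0" "dot ?n (L j) = 0" "dot ?n (L k) = 0"
      using gt_pen[OF g m ijk(1)] gt_pen[OF g m ijk(2)] gt_pen[OF g m ijk(3)] True bk by (simp_all add: tri_def)
    ultimately show ?thesis by (rule coplanar)
  next
    case False
    then show ?thesis using p by (auto simp: pattern_def)
  qed
qed

lemma gt_if_pattern:
  assumes m: "2 <= m" "m + 2 <= d"
    and p: "!!i j k. i < d ==> j < d ==> k < d ==> i ~= j ==> tri (L i) (L j) (L k) = 0 \<longleftrightarrow> pattern m i j k"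
  shows "gt m d L"
proof -
  have l: "bs m i < d" "bs m i + 1 < d" "ob m i < d" "ob m i + 1 < d" for i
    using m by (auto simp: bs_def ob_def)
  show ?thesis
    unfolding gt_def pen_def nvp_nz
  proof (intro conjI allI impI)
    fix i assume i: "i < d"
    show "tri (L (bs m i)) (L (bs m i + 1)) (L i) = 0"
      using p[OF l(1,2)[of i] i] m by (simp add: pattern_def)
    show "tri (L (ob m i)) (L (ob m i + 1)) (L i) ~= 0"
      using p[OF l(3,4)[of i] i] m by (auto simp: pattern_def bs_def ob_def)
    fix j assume j: "j < d" "i ~= j" "bs m i = bs m j"
    show "tri (L i) (L j) (L (ob m i)) ~= 0"
      using p[OF i j(1) l(3)[of i] j(2)] m j(3)
      by (cases "i < m"; cases "j < m") (auto simp: pattern_def bs_def ob_def)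
  qed
qed

lemma gt_lattice_iso:
  assumes m: "2 <= m" "m + 2 <= d" and g: "gt m d L" "gt m d K"
  shows "lattice_iso (intersection_lattice (planes d L)) (intersection_lattice (planes d K))"
  by (rule same_pattern_iso) (use gt_distinct[OF _ m] gt_pattern[OF _ m] g in auto)

text \<open>Enumerate one pencil before the other; genericity excludes the coincidences forbidden by \<open>gt\<close>.\<close>
lemma two_pencils_tuple:
  assumes m: "2 <= m1" "2 <= m2" and G: "generic_two_pencils m1 m2 \<A>"
  obtains L where "gt m1 (m1 + m2) L" "\<A> = planes (m1 + m2) L"
proof -
  let ?d = "m1 + m2"
  obtain P Q p q where A: "\<A> = P \<union> Q" "P \<inter> Q = {}" "finite \<A>" "\<forall>H\<in>\<A>. is_line H"
      "card P = m1" "card Q = m2" "p ~= 0" "q ~= 0" "{H\<in>\<A>. p \<in> H} = P" "{H\<in>\<A>. q \<in> H} = Q"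
      "\<forall>H\<in>P. \<forall>K\<in>Q. {M\<in>\<A>. H \<inter> K \<subseteq> M} = {H, K}"
    using G unfolding generic_two_pencils_def by (elim exE conjE) (rule that)
  have fin: "finite P" "finite Q" using A by auto
  obtain f1 where f1: "bij_betw f1 {..<m1} P" using ex_bij_betw_nat_finite[OF fin(1)] A(5) by (auto simp: atLeast0LessThan)
  obtain f2 where f2: "bij_betw f2 {..<m2} Q" using ex_bij_betw_nat_finite[OF fin(2)] A(6) by (auto simp: atLeast0LessThan)
  define f where "f i = (if i < m1 then f1 i else f2 (i - m1))" for i
  have fP: "f i \<in> P \<longleftrightarrow> i < m1" "f i \<in> \<A>" if "i < ?d" for i
  proof -
    have 1: "i < m1 ==> f1 i \<in> P" using f1 by (auto simp: bij_betw_def)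
    have 2: "\<not> i < m1 ==> f2 (i - m1) \<in> Q" using f2 that by (auto simp: bij_betw_def)
    show "f i \<in> P \<longleftrightarrow> i < m1" "f i \<in> \<A>" using 1 2 A(1,2) by (auto simp: f_def)
  qed
  have fQ: "f i \<in> Q \<longleftrightarrow> \<not> i < m1" if "i < ?d" for i using fP[OF that] A(1,2) by blast
  have finj: "f i ~= f j" if ij: "i < ?d" "j < ?d" "i ~= j" for i j
  proof
    assume e: "f i = f j"
    then have b: "i < m1 \<longleftrightarrow> j < m1" using fP ij by metis
    show False
    proof (cases "i < m1")
      case True
      then have "f1 i = f1 j" using e b by (simp add: f_def)
      then show False using f1 True b ij by (auto simp: bij_betw_def dest: inj_onD)
    next
      case False
      then have "f2 (i - m1) = f2 (j - m1)" using e b by (simp add: f_def)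
      moreover have "i - m1 < m2" "j - m1 < m2" using False b ij by auto
      ultimately have "i - m1 = j - m1" using f2 by (auto simp: bij_betw_def dest: inj_onD)
      then show False using False b ij by auto
    qed
  qed
  have "ALL i. EX v. i < ?d --> v ~= 0 & f i = plane v" using fP(2) A(4) unfolding is_line_plane by blast
  from choice[OF this] obtain L where L: "!!i. i < ?d ==> L i ~= 0 & f i = plane (L i)" by blast
  have cr: "cr (L i) (L j) ~= 0" if ij: "i < ?d" "j < ?d" "i ~= j" for i j
    using plane_eq[of "L i" "L j"] L[OF ij(1)] L[OF ij(2)] finj[OF ij] by auto
  have pmem: "dot (L i) p = 0 \<longleftrightarrow> i < m1" if "i < ?d" for i
    using fP[OF that] A(9) L[OF that] by (auto simp: plane_def)
  have qmem: "dot (L i) q = 0 \<longleftrightarrow> \<not> i < m1" if "i < ?d" for i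
    using fP(2)[OF that] fQ[OF that] A(10) L[OF that] by (auto simp: plane_def)
  have key: "tri (L i) (L j) (L k) = 0 \<longleftrightarrow> dot (L k) x = 0"
    if ij: "i < ?d" "j < ?d" "i ~= j" and x: "x ~= 0" "dot (L i) x = 0" "dot (L j) x = 0" for i j k x
  proof -
    obtain c where c: "x = c *s cr (L i) (L j)" using perp_two[OF cr[OF ij] x(2,3)] .
    then have "c ~= 0" using x(1) by (auto simp: vec3_eq_iff)
    have "dot (L k) x = c * tri (L i) (L j) (L k)" unfolding c by (simp add: dot_def tri_expand algebra_simps)
    then show ?thesis using \<open>c ~= 0\<close> by simp
  qed
  have same: "tri (L i) (L j) (L k) = 0 \<longleftrightarrow> bs m1 k = bs m1 i"
    if ijk: "i < ?d" "j < ?d" "k < ?d" "i ~= j" "bs m1 i = bs m1 j" for i j k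
  proof (cases "i < m1")
    case True
    then have "j < m1" using ijk m by (auto simp: bs_def split: if_splits)
    then show ?thesis using key[OF ijk(1,2,4) A(7), of k] pmem ijk True m by (auto simp: bs_def)
  next
    case False
    then have "\<not> j < m1" using ijk m by (auto simp: bs_def split: if_splits)
    then show ?thesis using key[OF ijk(1,2,4) A(8), of k] qmem ijk False m by (auto simp: bs_def)
  qed
  have l: "bs m1 i < ?d" "bs m1 i + 1 < ?d" "ob m1 i < ?d" "ob m1 i + 1 < ?d" for i
    using m by (auto simp: bs_def ob_def)
  have g: "gt m1 ?d L"
    unfolding gt_def pen_def nvp_nz
  proof (intro conjI allI impI)
    fix i assume i: "i < ?d"
    show "tri (L (bs m1 i)) (L (bs m1 i + 1)) (L i) = 0"
      using same[OF l(1,2)[of i] i] m by simp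
    show "tri (L (ob m1 i)) (L (ob m1 i + 1)) (L i) ~= 0"
      using same[OF l(3,4)[of i] i] m by (auto simp: bs_def ob_def)
    fix j assume j: "j < ?d" "i ~= j" "bs m1 i = bs m1 j"
    show "tri (L i) (L j) (L (ob m1 i)) ~= 0"
      using same[OF i j(1) l(3)[of i] j(2,3)] m by (auto simp: bs_def ob_def)
  qed
  have "\<A> = f ` {..<?d}"
  proof
    show "f ` {..<?d} \<subseteq> \<A>" using fP(2) by auto
    show "\<A> \<subseteq> f ` {..<?d}"
    proof
      fix H assume "H \<in> \<A>"
      then consider "H \<in> P" | "H \<in> Q" using A(1) by blast
      then show "H \<in> f ` {..<?d}"
      proof cases
        case 1
        then obtain i where "i < m1" "H = f1 i" using f1 by (auto simp: bij_betw_def)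
        then show ?thesis by (intro image_eqI[of _ _ i]) (auto simp: f_def)
      next
        case 2
        then obtain i where "i < m2" "H = f2 i" using f2 by (auto simp: bij_betw_def)
        then show ?thesis by (intro image_eqI[of _ _ "m1 + i"]) (auto simp: f_def)
      qed
    qed
  qed
  also have "\<dots> = planes ?d L" unfolding planes_def using L by auto
  finally show thesis using that g by blast
qed

lemma tuple_two_pencils:
  assumes m: "2 <= m1" "2 <= m2" and g: "gt m1 (m1 + m2) L"
  shows "generic_two_pencils m1 m2 (planes (m1 + m2) L)"
proof -
  let ?d = "m1 + m2" and ?P = "\<lambda>i. plane (L i)"
  have m': "m1 + 2 <= ?d" using m by simp
  note D = gt_distinct[OF g m(1) m']
  have inj: "inj_on ?P {..<?d}" by (rule plane_inj[OF D])
  let ?p = "cr (L 0) (L 1)" and ?q = "cr (L m1) (L (m1 + 1))"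
  have pk: "?p \<in> plane (L k) \<longleftrightarrow> k < m1" if k: "k < ?d" for k
  proof -
    have "dot (L k) ?p = tri (L 0) (L 1) (L k)" by (simp add: tri_def dot_def mult.commute)
    then show ?thesis using gt_pattern[OF g m(1) m' _ _ k, of 0 1] m by (auto simp: plane_def pattern_def bs_def)
  qed
  have qk: "?q \<in> plane (L k) \<longleftrightarrow> \<not> k < m1" if k: "k < ?d" for k
  proof -
    have "dot (L k) ?q = tri (L m1) (L (m1 + 1)) (L k)" by (simp add: tri_def dot_def mult.commute)
    then show ?thesis using gt_pattern[OF g m(1) m' _ _ k, of m1 "m1 + 1"] m by (auto simp: plane_def pattern_def bs_def)
  qed
  show ?thesis
    unfolding generic_two_pencils_def
  proof (intro exI conjI)
    show "planes ?d L = ?P ` {..<m1} \<union> ?P ` {m1..<?d}"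
      unfolding planes_def image_Un[symmetric] by (rule arg_cong[where f="(`) ?P"]) auto
    show "?P ` {..<m1} \<inter> ?P ` {m1..<?d} = {}"
      using inj by (subst inj_on_image_Int[OF inj, symmetric]) auto
    show "finite (planes ?d L)" by (simp add: planes_def)
    show "\<forall>H\<in>planes ?d L. is_line H" using gt_nz[OF g m(1) m'] by (auto simp: planes_def is_line_plane)
    show "card (?P ` {..<m1}) = m1" by (subst card_image) (auto intro: inj_on_subset[OF inj])
    show "card (?P ` {m1..<?d}) = m2" by (subst card_image) (auto intro: inj_on_subset[OF inj])
    show "?p ~= 0" "?q ~= 0" by (rule gt_cr[OF g m(1) m']; use m in simp)+
    show "{H \<in> planes ?d L. ?p \<in> H} = ?P ` {..<m1}" using pk by (auto simp: planes_def simp del: cr_nth)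
    show "{H \<in> planes ?d L. ?q \<in> H} = ?P ` {m1..<?d}" using qk by (auto simp: planes_def simp del: cr_nth)
    show "\<forall>H\<in>?P ` {..<m1}. \<forall>K\<in>?P ` {m1..<?d}. {M \<in> planes ?d L. H \<inter> K \<subseteq> M} = {H, K}"
    proof (intro ballI)
      fix H K assume "H \<in> ?P ` {..<m1}" "K \<in> ?P ` {m1..<?d}"
      then obtain i j where ij: "i < m1" "m1 <= j" "j < ?d" "H = ?P i" "K = ?P j" by auto
      have "H \<inter> K \<subseteq> ?P k \<longleftrightarrow> k = i \<or> k = j" if k: "k < ?d" for k
      proof -
        have "i < ?d" "i ~= j" using ij m by auto
        then have "H \<inter> K \<subseteq> ?P k \<longleftrightarrow> pattern m1 i j k"
          using plane_inter_subset[of "L i" "L j" "L k"] gt_cr[OF g m(1) m', of i j] gt_pattern[OF g m(1) m', of i j k] ij k by simp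
        then show ?thesis using ij m by (auto simp: pattern_def bs_def)
      qed
      then show "{M \<in> planes ?d L. H \<inter> K \<subseteq> M} = {H, K}"
        using ij m by (auto simp: planes_def)
    qed
  qed
qed

lemma L_tilde_tuple:
  assumes m: "2 <= m1" "2 <= m2"
  obtains L where "gt m1 (m1 + m2) L" "L_tilde m1 m2 = intersection_lattice (planes (m1 + m2) L)"
proof -
  have "gt m1 (m1 + m2) (PL m1 std_par)" using gt_std[of m1 "m1 + m2"] m by simp
  then have "generic_two_pencils m1 m2 (planes (m1 + m2) (PL m1 std_par))" by (rule tuple_two_pencils[OF m])
  then have "generic_two_pencils m1 m2 (SOME \<A>. generic_two_pencils m1 m2 \<A>)" by (rule someI)
  then show thesis using two_pencils_tuple[OF m] that unfolding L_tilde_def by metis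
qed

lemma lines_fm:
  assumes "distinct_lines d L"
  shows "lines (fm d L) = planes d L"
proof
  show "lines (fm d L) \<subseteq> planes d L"
  proof
    fix H assume "H \<in> lines (fm d L)"
    then obtain l where l: "l \<in> homog 1" "l ~= 0" "l dvd fm d L" "H = line_of l" by (auto simp: lines_def)
    obtain v where v: "l = lin v" using homog_1_lin[OF l(1)] .
    have vz: "v ~= 0" using l(2) v by auto
    have nz: "L i ~= 0" if "i \<in> {..<d}" for i using assms that by (auto simp: distinct_lines_def)
    have "lin v dvd (\<Prod>i\<in>{..<d}. lin (L i))" using l(3) v by (simp add: fm_def)
    then obtain i where i: "i \<in> {..<d}" "cr v (L i) = 0"
      using lin_dvd_prod_lin[of "{..<d}" v L] vz nz by (metis finite_lessThan)
    have "plane v = plane (L i)" by (rule plane_eq[OF vz nz[OF i(1)] i(2)])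
    then show "H \<in> planes d L" using i l(4) v by (auto simp: planes_def line_of_lin)
  qed
  show "planes d L \<subseteq> lines (fm d L)"
  proof
    fix H assume "H \<in> planes d L"
    then obtain i where i: "i < d" "H = plane (L i)" by (auto simp: planes_def)
    have "lin (L i) dvd fm d L" unfolding fm_def by (rule dvd_prodI) (use i in auto)
    moreover have "lin (L i) ~= 0" using assms i by (simp add: distinct_lines_def)
    ultimately show "H \<in> lines (fm d L)"
      using i homog_lin[of "L i"] unfolding lines_def by (intro image_eqI[of _ _ "lin (L i)"]) (simp_all add: line_of_lin)
  qed
qed

lemma arrangement_poly_tuple: "arrangement_poly d f \<longleftrightarrow> (EX L. distinct_lines d L & f = fm d L)"
proof
  assume "arrangement_poly d f"
  then obtain l where l: "\<forall>i<d. l i \<in> homog 1 & l i ~= 0"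
    "\<forall>i<d. \<forall>j<d. i ~= j --> (\<nexists>c. l i = pscale c (l j))" "f = (\<Prod>i<d. l i)"
    unfolding arrangement_poly_def by blast
  have "ALL i. EX v. i < d --> l i = lin v" using l(1) homog_1_lin by metis
  from choice[OF this] obtain L where L: "!!i. i < d ==> l i = lin (L i)" by blast
  have nz: "L i ~= 0" if "i < d" for i using l(1) L[OF that] that by auto
  have "cr (L i) (L j) ~= 0" if ij: "i < d" "j < d" "i ~= j" for i j
  proof
    assume "cr (L i) (L j) = 0"
    then obtain c where "L j = c *s L i" using proportional_if_cr[OF nz[OF ij(1)]] by blast
    then have "l j = pscale c (l i)" using L ij by (simp add: lin_scale)
    then show False using l(2) ij by metis
  qed
  then have "distinct_lines d L" using nz by (simp add: distinct_lines_def)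
  moreover have "f = fm d L" unfolding l(3) fm_def by (rule prod.cong) (auto simp: L)
  ultimately show "EX L. distinct_lines d L & f = fm d L" by blast
next
  assume "EX L. distinct_lines d L & f = fm d L"
  then obtain L where L: "distinct_lines d L" "f = fm d L" by blast
  show "arrangement_poly d f"
    unfolding arrangement_poly_def
  proof (intro exI conjI allI impI notI)
    fix i assume i: "i < d"
    show "lin (L i) \<in> homog 1" by (rule homog_lin)
    show "lin (L i) = 0 ==> False" using L(1) i by (simp add: distinct_lines_def)
    fix j assume j: "j < d" "i ~= j" "EX c. lin (L i) = pscale c (lin (L j))"
    then obtain c where "L i = c *s L j" by (auto simp: lin_scale[symmetric] lin_eq_iff)
    then have "cr (L i) (L j) = 0" by (simp add: vec3_eq_iff)
    then show False using L(1) i j by (simp add: distinct_lines_def)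
  next
    show "f = (\<Prod>i<d. lin (L i))" using L by (simp add: fm_def)
  qed
qed

lemma arr_space_eq_XX:
  assumes m: "2 <= m1" "2 <= m2"
  shows "arr_space_lattice (m1 + m2) (L_tilde m1 m2) = XX m1 (m1 + m2)"
proof -
  let ?d = "m1 + m2"
  have m': "m1 + 2 <= ?d" using m by simp
  obtain K where K: "gt m1 ?d K" "L_tilde m1 m2 = intersection_lattice (planes ?d K)" using L_tilde_tuple[OF m] .
  note DK = gt_distinct[OF K(1) m(1) m']
  have "arrangement_poly ?d f & lattice_iso (intersection_lattice (lines f)) (L_tilde m1 m2) \<longleftrightarrow> (EX L. gt m1 ?d L & f = fm ?d L)" for f
  proof
    assume a: "arrangement_poly ?d f & lattice_iso (intersection_lattice (lines f)) (L_tilde m1 m2)"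
    then obtain L where L: "distinct_lines ?d L" "f = fm ?d L" by (auto simp: arrangement_poly_tuple)
    have iso: "lattice_iso (intersection_lattice (planes ?d L)) (intersection_lattice (planes ?d K))"
      using a lines_fm[OF L(1)] L(2) K(2) by simp
    obtain \<pi> where \<pi>: "bij_betw \<pi> {..<?d} {..<?d}" and p: "!!i j k. i < ?d ==> j < ?d ==> k < ?d ==> i ~= j ==>
      tri (L i) (L j) (L k) = 0 \<longleftrightarrow> tri (K (\<pi> i)) (K (\<pi> j)) (K (\<pi> k)) = 0"
      using same_pattern_if_iso[OF L(1) DK iso] by metis
    define \<sigma> where "\<sigma> = inv_into {..<?d} \<pi>"
    have \<sigma>: "bij_betw \<sigma> {..<?d} {..<?d}" unfolding \<sigma>_def by (rule bij_betw_inv_into[OF \<pi>])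
    have \<sigma>lt: "\<sigma> i < ?d" "\<pi> (\<sigma> i) = i" if "i < ?d" for i
      using \<sigma> \<pi> that by (auto simp: bij_betw_def \<sigma>_def f_inv_into_f)
    have "gt m1 ?d (\<lambda>i. L (\<sigma> i))"
    proof (rule gt_if_pattern[OF m(1) m'])
      fix i j k assume ijk: "i < ?d" "j < ?d" "k < ?d" "i ~= j"
      then have "\<sigma> i ~= \<sigma> j" using \<sigma>lt by metis
      then have "tri (L (\<sigma> i)) (L (\<sigma> j)) (L (\<sigma> k)) = 0 \<longleftrightarrow> tri (K i) (K j) (K k) = 0"
        using p[OF \<sigma>lt(1)[OF ijk(1)] \<sigma>lt(1)[OF ijk(2)] \<sigma>lt(1)[OF ijk(3)]] \<sigma>lt(2) ijk by simp
      then show "tri (L (\<sigma> i)) (L (\<sigma> j)) (L (\<sigma> k)) = 0 \<longleftrightarrow> pattern m1 i j k"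
        using gt_pattern[OF K(1) m(1) m' ijk] by simp
    qed
    moreover have "fm ?d L = fm ?d (\<lambda>i. L (\<sigma> i))"
      unfolding fm_def by (rule prod.reindex_bij_betw[OF \<sigma>, symmetric])
    ultimately show "EX L. gt m1 ?d L & f = fm ?d L" using L(2) by blast
  next
    assume "EX L. gt m1 ?d L & f = fm ?d L"
    then obtain L where L: "gt m1 ?d L" "f = fm ?d L" by blast
    note DL = gt_distinct[OF L(1) m(1) m']
    show "arrangement_poly ?d f & lattice_iso (intersection_lattice (lines f)) (L_tilde m1 m2)"
      using DL L(2) gt_lattice_iso[OF m(1) m' L(1) K(1)] K(2) lines_fm[OF DL] by (auto simp: arrangement_poly_tuple)
  qed
  then have "{f. arrangement_poly ?d f & lattice_iso (intersection_lattice (lines f)) (L_tilde m1 m2)} = fm ?d ` {L. gt m1 ?d L}"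
    by auto
  then show ?thesis by (simp add: arr_space_lattice_def XX_def)
qed


section \<open>The global Tjurina number\<close>

lemma lat_rank_eqI:
  assumes h: "!!y z. (y, z) \<in> R ==> y ~= z ==> h y < h z"
    and Ch: "Ch \<in> Chains R" "Ch \<subseteq> underS R x" "card Ch = h x"
  shows "lat_rank R x = (h x :: nat)"
  unfolding lat_rank_def
proof (rule Max_eqI)
  have le: "finite C & card C <= h x" if C: "C \<in> Chains R" "C \<subseteq> underS R x" for C
  proof -
    have "inj_on h C"
    proof (rule inj_onI, rule ccontr)
      fix a b assume ab: "a \<in> C" "b \<in> C" "h a = h b" "a ~= b"
      then have "(a, b) \<in> R \<or> (b, a) \<in> R" using C(1) by (auto simp: Chains_def)
      then show False using h[of a b] h[of b a] ab by auto
    qed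
    moreover have "h ` C \<subseteq> {..<h x}" using C(2) h by (auto simp: underS_def)
    ultimately show ?thesis
      by (metis card_inj_on_le card_lessThan finite_lessThan inj_on_finite)
  qed
  have "card ` {C \<in> Chains R. C \<subseteq> underS R x} \<subseteq> {..h x}" using le by auto
  then show "finite (card ` {C \<in> Chains R. C \<subseteq> underS R x})" by (rule finite_subset) simp
  show "y <= h x" if "y \<in> card ` {C \<in> Chains R. C \<subseteq> underS R x}" for y using that le by auto
  show "h x \<in> card ` {C \<in> Chains R. C \<subseteq> underS R x}" using Ch by (intro image_eqI[of _ _ Ch]) auto
qed

locale line_lattice =
  fixes d :: nat and L :: "nat => complex^3"
  assumes D: "distinct_lines d L"
begin

abbreviation "P i \<equiv> plane (L i)"
abbreviation "R \<equiv> intersection_lattice (planes d L)"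

lemma zero_P: "0 \<in> P i"
  by (simp add: plane_def dot_def)

lemma crD: "i < d ==> j < d ==> i ~= j ==> cr (L i) (L j) ~= 0"
  using D by (simp add: distinct_lines_def)

lemma field_cases:
  assumes "x \<in> Field R"
  obtains "x = UNIV" | i where "i < d" "x = P i" | i j where "i < d" "j < d" "i ~= j" "x = P i \<inter> P j" | "x = {0}"
proof -
  obtain B where B: "B \<subseteq> planes d L" "x = \<Inter>B" using assms unfolding Field_lattice by blast
  then obtain S where S: "S \<subseteq> {..<d}" "B = P ` S" unfolding planes_def by (metis subset_imageE)
  consider "S = {}" | i where "S = {i}" | i j where "i \<in> S" "j \<in> S" "i ~= j" by blast
  then show thesis
  proof cases
    case 1 then show thesis using that(1) S B by simp
  next
    case 2 then show thesis using that(2)[of i] S B by simp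
  next
    case 3
    show thesis
    proof (cases "\<forall>l\<in>S. tri (L i) (L j) (L l) = 0")
      case True
      have "x = P i \<inter> P j" using inter_cases(1)[OF D S(1) 3 True] S B by simp
      then show thesis using that(3)[of i j] 3 S by auto
    next
      case False
      then show thesis using inter_cases(2)[OF D S(1) 3] that(4) S B by auto
    qed
  qed
qed

lemma fieldI: "UNIV \<in> Field R" "i < d ==> P i \<in> Field R" "i < d ==> j < d ==> P i \<inter> P j \<in> Field R"
proof -
  show "UNIV \<in> Field R" unfolding Field_lattice by (intro CollectI exI[of _ "{}"]) simp
  show "i < d ==> P i \<in> Field R" unfolding Field_lattice by (intro CollectI exI[of _ "{P i}"]) (simp add: planes_def)
  show "i < d ==> j < d ==> P i \<inter> P j \<in> Field R"
    unfolding Field_lattice by (intro CollectI exI[of _ "{P i, P j}"]) (simp add: planes_def)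
qed

lemma P_not_UNIV: "i < d ==> P i ~= UNIV"
  using proper_planes[OF D] by (auto simp: proper_def planes_def)

lemma point_nz: "i < d ==> j < d ==> i ~= j ==> P i \<inter> P j ~= {0}"
proof
  assume ij: "i < d" "j < d" "i ~= j" and "P i \<inter> P j = {0}"
  moreover have "cr (L i) (L j) \<in> P i \<inter> P j" by (simp add: plane_def del: cr_nth)
  ultimately show False using crD[OF ij] by simp
qed

lemma point_not_plane:
  assumes ij: "i < d" "j < d" "i ~= j" and k: "k < d"
  shows "P i \<inter> P j ~= P k"
proof
  assume e: "P i \<inter> P j = P k"
  then have "k = i" "k = j" using plane_subset_iff[OF D k ij(1)] plane_subset_iff[OF D k ij(2)] by auto
  then show False using ij by simp
qed

lemma point_sub_point:
  assumes ij: "i < d" "j < d" "i ~= j" and kl: "k < d" "l < d" "k ~= l" and s: "P i \<inter> P j \<subseteq> P k \<inter> P l"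
  shows "P i \<inter> P j = P k \<inter> P l"
proof -
  let ?c = "cr (L i) (L j)" and ?e = "cr (L k) (L l)"
  have "?c \<in> P i \<inter> P j" by (simp add: plane_def del: cr_nth)
  then obtain a where a: "?c = a *s ?e" using s unfolding plane_inter[OF crD[OF kl]] by blast
  have "a ~= 0" using a crD[OF ij] by (auto simp: vec3_eq_iff)
  then have e: "b *s ?e = (b / a) *s ?c" for b unfolding a by (simp add: vscale_mult)
  show ?thesis
  proof (rule equalityI[OF s])
    show "P k \<inter> P l \<subseteq> P i \<inter> P j"
      unfolding plane_inter[OF crD[OF kl]] plane_inter[OF crD[OF ij]] using e by blast
  qed
qed

definition ht :: "(complex^3) set => nat" where
  "ht x = (if x = UNIV then 0 else if x \<in> planes d L then 1 else if x = {0} then 3 else 2)"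

lemma ht_plane: "i < d ==> ht (P i) = 1"
  using P_not_UNIV by (auto simp: ht_def planes_def)

lemma ht_point: "i < d ==> j < d ==> i ~= j ==> ht (P i \<inter> P j) = 2"
  using P_not_UNIV point_nz point_not_plane by (auto simp: ht_def planes_def)

lemma ht_zero: "1 < d ==> ht {0} = 3"
proof -
  assume d: "1 < d"
  have "(vector [1,0,0] :: complex^3) ~= 0" by (simp add: vec3_eq_iff)
  then have "({0} :: (complex^3) set) ~= UNIV" by blast
  moreover have "{0} \<notin> planes d L"
  proof
    assume "{0} \<in> planes d L"
    then obtain i where i: "i < d" "P i = {0}" by (auto simp: planes_def)
    obtain j where j: "j < d" "j ~= i" using d by (metis One_nat_def less_numeral_extra(4) nat_neq_iff not_less_eq gr0_implies_Suc zero_less_Suc less_trans)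
    then have "P i \<subseteq> P j" using i zero_P by simp
    then show False using plane_subset_iff[OF D i(1) j(1)] j by simp
  qed
  ultimately show ?thesis by (simp add: ht_def)
qed

lemma ht_mono:
  assumes d: "1 < d" and yz: "(y, z) \<in> R" "y ~= z"
  shows "ht y < ht z"
proof -
  have F: "y \<in> Field R" "z \<in> Field R" "z \<subseteq> y" using yz(1) unfolding mem_lattice by auto
  have at: "z = UNIV \<or> z = a" if "a \<subseteq> z" "a \<in> planes d L" for a
    using that F(2) lattice_atoms[OF proper_planes[OF D], of a] by blast
  show ?thesis
    using F(1)
  proof (cases rule: field_cases)
    case 1
    then show ?thesis using yz(2) by (auto simp: ht_def)
  next
    case (2 i)
    have "z ~= UNIV" using F(3) 2 P_not_UNIV by auto
    moreover have "z \<notin> planes d L"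
    proof
      assume "z \<in> planes d L"
      then obtain k where "k < d" "z = P k" by (auto simp: planes_def)
      then show False using F(3) 2 plane_subset_iff[OF D] yz(2) by metis
    qed
    ultimately show ?thesis using 2 ht_plane by (simp add: ht_def)
  next
    case (3 i j)
    show ?thesis
      using F(2)
    proof (cases rule: field_cases)
      case 1
      then show ?thesis using F(3) 3 P_not_UNIV by auto
    next
      case (2 k)
      then have "k = i" "k = j" using F(3) 3 plane_subset_iff[OF D 2(1) 3(1)] plane_subset_iff[OF D 2(1) 3(2)] by auto
      then show ?thesis using 3 by simp
    next
      case c: (3 k l)
      then show ?thesis using point_sub_point[OF c(1-3) 3(1-3)] F(3) 3(4) c(4) yz(2) by simp
    next
      case 4
      then show ?thesis using ht_point 3 ht_zero[OF d] by simp
    qed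
  next
    case 4
    have "0 \<in> z"
      using F(2) by (cases rule: field_cases) (use zero_P in auto)
    then show ?thesis using F(3) 4 yz(2) by auto
  qed
qed

lemma rank_eq_ht:
  assumes d: "1 < d" and x: "x \<in> Field R"
  shows "lat_rank R x = ht x"
proof -
  note hm = ht_mono[OF d]
  have U: "UNIV \<in> Field R" by (rule fieldI)
  show ?thesis
    using x
  proof (cases rule: field_cases)
    case 1
    show ?thesis by (rule lat_rank_eqI[OF hm, where Ch="{}"]) (auto simp: Chains_def 1 ht_def)
  next
    case (2 i)
    show ?thesis
      by (rule lat_rank_eqI[OF hm, where Ch="{UNIV}"])
         (use 2 U x P_not_UNIV ht_plane in \<open>auto simp: Chains_def mem_lattice underS_def\<close>)
  next
    case (3 i j)
    have n: "P i ~= UNIV" "P i \<inter> P j ~= P i" using P_not_UNIV 3 point_not_plane by auto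
    show ?thesis
    proof (rule lat_rank_eqI[OF hm, where Ch="{UNIV, P i}"])
      show "{UNIV, P i} \<in> Chains R" using U fieldI(2)[OF 3(1)] by (auto simp: Chains_def mem_lattice)
      show "{UNIV, P i} \<subseteq> underS R x" using U fieldI(2)[OF 3(1)] x 3 n by (auto simp: underS_def mem_lattice)
      show "card {UNIV, P i} = ht x" using n 3 ht_point by simp
    qed
  next
    case 4
    have ij: "0 < d" "1 < d" "(0::nat) ~= 1" using d by auto
    let ?q = "P 0 \<inter> P 1"
    have n: "P 0 ~= UNIV" "?q ~= P 0" "?q ~= {0}" "P 0 ~= {0}" "?q ~= UNIV"
      using P_not_UNIV[OF ij(1)] point_not_plane[OF ij ij(1)] point_nz[OF ij] zero_P by auto
    have U0: "({0} :: (complex^3) set) ~= UNIV" using ht_zero[OF d] by (auto simp: ht_def)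
    show ?thesis
    proof (rule lat_rank_eqI[OF hm, where Ch="{UNIV, P 0, ?q}"])
      show "{UNIV, P 0, ?q} \<in> Chains R" using U fieldI(2)[OF ij(1)] fieldI(3)[OF ij(1,2)] by (auto simp: Chains_def mem_lattice)
      show "{UNIV, P 0, ?q} \<subseteq> underS R x" using U fieldI(2)[OF ij(1)] fieldI(3)[OF ij(1,2)] x 4 n U0 zero_P by (auto simp: underS_def mem_lattice)
      show "card {UNIV, P 0, ?q} = ht x" using n 4 ht_zero[OF d] by auto
    qed
  qed
qed

lemma rank2_points:
  assumes d: "1 < d"
  shows "{p \<in> Field R. lat_rank R p = 2} = {P i \<inter> P j | i j. i < d & j < d & i ~= j}"
proof (intro equalityI subsetI)
  fix p assume "p \<in> {p \<in> Field R. lat_rank R p = 2}"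
  then have p: "p \<in> Field R" "ht p = 2" using rank_eq_ht[OF d] by auto
  show "p \<in> {P i \<inter> P j | i j. i < d & j < d & i ~= j}"
    using p(1) by (cases rule: field_cases) (use p(2) ht_plane ht_zero[OF d] in \<open>auto simp: ht_def\<close>)
next
  fix p assume "p \<in> {P i \<inter> P j | i j. i < d & j < d & i ~= j}"
  then show "p \<in> {p \<in> Field R. lat_rank R p = 2}"
    using rank_eq_ht[OF d] fieldI(3) ht_point by auto
qed

lemma rank1_lines:
  assumes d: "1 < d"
  shows "{a \<in> Field R. lat_rank R a = 1 & (a, p) \<in> R} = {a \<in> planes d L. (a, p) \<in> R}"
proof (intro equalityI subsetI)
  fix a assume "a \<in> {a \<in> Field R. lat_rank R a = 1 & (a, p) \<in> R}"
  then have a: "a \<in> Field R" "ht a = 1" "(a, p) \<in> R" using rank_eq_ht[OF d] by auto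
  show "a \<in> {a \<in> planes d L. (a, p) \<in> R}"
    using a(1) by (cases rule: field_cases) (use a(2,3) ht_point ht_zero[OF d] in \<open>auto simp: ht_def planes_def split: if_splits\<close>)
next
  fix a assume "a \<in> {a \<in> planes d L. (a, p) \<in> R}"
  then show "a \<in> {a \<in> Field R. lat_rank R a = 1 & (a, p) \<in> R}"
    using rank_eq_ht[OF d] fieldI(2) ht_plane by (auto simp: planes_def)
qed

lemma mult_point:
  assumes d: "1 < d" and ij: "i < d" "j < d" "i ~= j"
  shows "lat_mult R (P i \<inter> P j) = card {k. k < d & tri (L i) (L j) (L k) = 0}"
proof -
  have "lat_mult R (P i \<inter> P j) = card {a \<in> planes d L. (a, P i \<inter> P j) \<in> R}"
    unfolding lat_mult_def rank1_lines[OF d] ..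
  also have "{a \<in> planes d L. (a, P i \<inter> P j) \<in> R} = P ` {k. k < d & tri (L i) (L j) (L k) = 0}"
    using plane_inter_subset[OF crD[OF ij]] fieldI(2) fieldI(3)[OF ij(1,2)] by (auto simp: planes_def mem_lattice)
  also have "card \<dots> = card {k. k < d & tri (L i) (L j) (L k) = 0}"
    by (rule card_image) (rule inj_on_subset[OF plane_inj[OF D]], auto)
  finally show ?thesis .
qed

lemma point_eq:
  assumes ij: "i < d" "j < d" "i ~= j" and kl: "k < d" "l < d" "k ~= l"
    and t: "tri (L i) (L j) (L k) = 0" "tri (L i) (L j) (L l) = 0"
  shows "P i \<inter> P j = P k \<inter> P l"
  using point_sub_point[OF ij kl] plane_inter_subset[OF crD[OF ij]] t by blast

end

lemma tau_two_pencils: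
  assumes g: "gt m d L" and m: "2 <= m" "m + 2 <= d"
  shows "tau (intersection_lattice (planes d L)) = (m - 1)\<^sup>2 + (d - m - 1)\<^sup>2 + m * (d - m)"
proof -
  interpret line_lattice d L by unfold_locales (rule gt_distinct[OF g m])
  have d1: "1 < d" using m by simp
  note pat = gt_pattern[OF g m]
  let ?p = "P 0 \<inter> P 1" and ?q = "P m \<inter> P (m + 1)"
  let ?N = "(\<lambda>(i, j). P i \<inter> P j) ` ({..<m} \<times> {m..<d})"
  have inc: "P i \<inter> P j \<subseteq> P k \<longleftrightarrow> pattern m i j k" if "i < d" "j < d" "i ~= j" "k < d" for i j k
    using plane_inter_subset[OF crD[OF that(1-3)]] pat[OF that(1,2,4,3)] by simp
  have eqp: "P i \<inter> P j = P 0 \<inter> P 1" if "i < m" "j < m" "i ~= j" for i j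
    by (rule point_eq[symmetric]) (use that m pat in \<open>auto simp: pattern_def bs_def\<close>)
  have eqq: "P i \<inter> P j = P m \<inter> P (m + 1)" if "m <= i" "m <= j" "i < d" "j < d" "i ~= j" for i j
    by (rule point_eq[symmetric]) (use that m pat in \<open>auto simp: pattern_def bs_def\<close>)
  have pts: "{P i \<inter> P j | i j. i < d & j < d & i ~= j} = insert ?p (insert ?q ?N)"
  proof (intro equalityI subsetI)
    fix x assume "x \<in> {P i \<inter> P j | i j. i < d & j < d & i ~= j}"
    then obtain i j where ij: "i < d" "j < d" "i ~= j" "x = P i \<inter> P j" by blast
    consider "i < m" "j < m" | "m <= i" "m <= j" | "i < m" "m <= j" | "m <= i" "j < m" by linarith
    then show "x \<in> insert ?p (insert ?q ?N)"
    proof cases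
      case 1
      then have "x = ?p" using eqp[OF _ _ ij(3)] ij(4) by metis
      then show ?thesis by blast
    next
      case 2
      then have "x = ?q" using eqq[OF _ _ ij(1-3)] ij(4) by metis
      then show ?thesis by blast
    next
      case 3 then show ?thesis using ij by (intro insertI2 image_eqI[of _ _ "(i, j)"]) auto
    next
      case 4 then show ?thesis using ij by (intro insertI2 image_eqI[of _ _ "(j, i)"]) auto
    qed
  next
    fix x assume "x \<in> insert ?p (insert ?q ?N)"
    then consider "x = P 0 \<inter> P 1" | "x = P m \<inter> P (m + 1)" | i j where "i < m" "m <= j" "j < d" "x = P i \<inter> P j" by auto
    then show "x \<in> {P i \<inter> P j | i j. i < d & j < d & i ~= j}"
    proof cases
      case 1 then show ?thesis using m by (intro CollectI exI[of _ 0] exI[of _ 1]) auto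
    next
      case 2 then show ?thesis using m by (intro CollectI exI[of _ m] exI[of _ "m + 1"]) auto
    next
      case 3 then show ?thesis using m by (intro CollectI exI[of _ i] exI[of _ j]) auto
    qed
  qed
  have ms: "m < d" "m + 1 < d" "0 < d" "1 < d" using m by auto
  have pq: "?p ~= ?q"
    using inc[of 0 1 0] inc[of m "m + 1" 0] m by (auto simp: pattern_def bs_def)
  have pN: "?p \<notin> ?N"
  proof
    assume "?p \<in> ?N"
    then obtain i j where ij: "i < m" "m <= j" "j < d" "?p = P i \<inter> P j" by auto
    have "pattern m 0 1 j" using inc[of 0 1 j] ij ms by auto
    then show False using ij m by (auto simp: pattern_def bs_def)
  qed
  have qN: "?q \<notin> ?N"
  proof
    assume "?q \<in> ?N"
    then obtain i j where ij: "i < m" "m <= j" "j < d" "?q = P i \<inter> P j" by auto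
    have "pattern m m (m + 1) i" using inc[of m "m + 1" i] ij ms by auto
    then show False using ij m by (auto simp: pattern_def bs_def)
  qed
  have Ninj: "inj_on (\<lambda>(i, j). P i \<inter> P j) ({..<m} \<times> {m..<d})"
  proof (rule inj_onI)
    fix x y assume xy: "x \<in> {..<m} \<times> {m..<d}" "y \<in> {..<m} \<times> {m..<d}"
      "(case x of (i, j) => P i \<inter> P j) = (case y of (i, j) => P i \<inter> P j)"
    obtain i j k l where e: "x = (i, j)" "y = (k, l)" by (metis surj_pair)
    have ij: "i < m" "m <= j" "j < d" "k < m" "m <= l" "l < d" "P i \<inter> P j = P k \<inter> P l" using xy e by auto
    have "P i \<inter> P j \<subseteq> P k" "P i \<inter> P j \<subseteq> P l" using ij(7) by auto
    then have "pattern m i j k" "pattern m i j l" using inc[of i j k] inc[of i j l] ij by auto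
    then show "x = y" using ij e by (auto simp: pattern_def bs_def)
  qed
  have mul: "lat_mult R (P i \<inter> P j) = card {k. k < d & pattern m i j k}" if ij: "i < d" "j < d" "i ~= j" for i j
  proof -
    have "{k. k < d & tri (L i) (L j) (L k) = 0} = {k. k < d & pattern m i j k}" using pat[OF ij(1,2) _ ij(3)] by auto
    then show ?thesis using mult_point[OF d1 ij] by simp
  qed
  have mp: "lat_mult R ?p = m"
  proof -
    have "{k. k < d & pattern m 0 1 k} = {..<m}" using m by (auto simp: pattern_def bs_def)
    then show ?thesis using mul[of 0 1] ms by simp
  qed
  have mq: "lat_mult R ?q = d - m"
  proof -
    have "{k. k < d & pattern m m (m + 1) k} = {m..<d}" using m by (auto simp: pattern_def bs_def)
    then show ?thesis using mul[of m "m + 1"] ms by simp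
  qed
  have mN: "lat_mult R (P i \<inter> P j) = 2" if "i < m" "m <= j" "j < d" for i j
  proof -
    have "{k. k < d & pattern m i j k} = {i, j}" using m that by (auto simp: pattern_def bs_def)
    then show ?thesis using mul[of i j] that by simp
  qed
  have "tau R = (\<Sum>p\<in>insert ?p (insert ?q ?N). (lat_mult R p - 1)\<^sup>2)"
    unfolding tau_def rank2_points[OF d1] pts ..
  also have "\<dots> = (m - 1)\<^sup>2 + ((d - m - 1)\<^sup>2 + (\<Sum>p\<in>?N. (lat_mult R p - 1)\<^sup>2))"
    using pq pN qN mp mq by (simp add: sum.insert)
  also have "(\<Sum>p\<in>?N. (lat_mult R p - 1)\<^sup>2) = (\<Sum>(i, j)\<in>{..<m} \<times> {m..<d}. 1)"
    by (subst sum.reindex[OF Ninj]) (rule sum.cong, auto simp: mN)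
  also have "\<dots> = m * (d - m)" by (simp add: split_def)
  finally show ?thesis by simp
qed

lemma tau_value:
  assumes m: "2 <= m1" "2 <= m2"
  shows "int (tau (L_tilde m1 m2)) = (int (m1 + m2) - 1)\<^sup>2 - int m1 * int m2 + 1"
proof -
  obtain K where K: "gt m1 (m1 + m2) K" "L_tilde m1 m2 = intersection_lattice (planes (m1 + m2) K)"
    using L_tilde_tuple[OF m] .
  have "tau (L_tilde m1 m2) = (m1 - 1)\<^sup>2 + (m2 - 1)\<^sup>2 + m1 * m2"
    using tau_two_pencils[OF K(1)] m K(2) by simp
  moreover have "int ((m1 - 1)\<^sup>2) = (int m1 - 1)\<^sup>2" "int ((m2 - 1)\<^sup>2) = (int m2 - 1)\<^sup>2"
    using m by (simp_all add: of_nat_diff)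
  ultimately show ?thesis by (simp only: of_nat_add of_nat_mult) (simp add: power2_eq_square algebra_simps)
qed

section \<open>Bivariate polynomials\<close>

type_synonym bp = "complex poly poly"

definition cst :: "complex => bp" where "cst c = [:[:c:]:]"
definition xv :: bp where "xv = [:[:0, 1:]:]"
definition yv :: bp where "yv = [:0, 1:]"
definition Dx :: "bp => bp" where "Dx P = map_poly pderiv P"

abbreviation cf :: "bp => nat => nat => complex" where "cf P i j \<equiv> coeff (coeff P j) i"

lemma chom_cst: "chom cst"
  unfolding cst_def by (rule chom_poly2)

lemma bp_eqI: "(!!i j. cf P i j = cf Q i j) ==> P = Q"
  by (intro poly_eqI) auto

lemma cf_mult: "cf (P * Q) i j = (\<Sum>j'\<le>j. \<Sum>i'\<le>i. cf P i' j' * cf Q (i - i') (j - j'))"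
  by (simp add: coeff_mult coeff_sum)

lemma cf_cst_mult: "cf (cst c * P) i j = c * cf P i j"
  by (simp add: cst_def)

lemma cf_Dx: "cf (Dx P) i j = of_nat (Suc i) * cf P (Suc i) j"
  by (simp add: Dx_def coeff_map_poly coeff_pderiv)

lemma cf_Dy: "cf (pderiv P) i j = of_nat (Suc j) * cf P i (Suc j)"
proof -
  have "coeff (of_nat n * q) i = of_nat n * coeff q i" for n and q :: "complex poly"
    by (simp add: of_nat_poly)
  then show ?thesis by (simp only: coeff_pderiv)
qed

lemma Dx_add: "Dx (P + Q) = Dx P + Dx Q"
  by (rule bp_eqI) (simp add: cf_Dx distrib_left)

lemma pderiv_sum_poly: "pderiv (\<Sum>i\<in>A. f i) = (\<Sum>i\<in>A. pderiv (f i))"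
  by (induction A rule: infinite_finite_induct) (simp_all add: pderiv_add)

lemma Dx_mult: "Dx (P * Q) = Dx P * Q + P * Dx Q"
proof (rule poly_eqI)
  fix j
  have "coeff (Dx (P * Q)) j = pderiv (\<Sum>i\<le>j. coeff P i * coeff Q (j - i))"
    by (simp add: Dx_def coeff_map_poly coeff_mult)
  also have "\<dots> = coeff (Dx P * Q + P * Dx Q) j"
    by (simp add: coeff_mult Dx_def coeff_map_poly pderiv_sum_poly pderiv_mult sum.distrib) (simp add: add.commute mult.commute)
  finally show "coeff (Dx (P * Q)) j = coeff (Dx P * Q + P * Dx Q) j" .
qed

lemma Dx_cst [simp]: "Dx (cst c) = 0"
  by (simp add: Dx_def cst_def map_poly_pCons pderiv_pCons)

lemma Dy_cst [simp]: "pderiv (cst c) = 0"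
  by (simp add: cst_def pderiv_pCons)

subsection \<open>Total degree\<close>

text \<open>Total degree at most \<open>n\<close>; an integer bound allows subtraction.\<close>
definition bdi :: "int => bp => bool" where
  "bdi n P \<longleftrightarrow> (ALL i j. int (i + j) > n --> cf P i j = 0)"

lemma bdi_0 [simp]: "bdi n 0"
  by (simp add: bdi_def)

lemma bdi_add: "bdi n P ==> bdi n Q ==> bdi n (P + Q)"
  by (simp add: bdi_def)

lemma bdi_diff: "bdi n P ==> bdi n Q ==> bdi n (P - Q)"
  by (simp add: bdi_def)

lemma bdi_sum: "(!!i. i \<in> A ==> bdi n (F i)) ==> bdi n (\<Sum>i\<in>A. F i)"
  by (induction A rule: infinite_finite_induct) (auto intro: bdi_add)

lemma bdi_mono: "bdi n P ==> n <= k ==> bdi k P"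
  by (auto simp: bdi_def)

lemma bdi_mult: "bdi n P ==> bdi k Q ==> bdi (n + k) (P * Q)"
  unfolding bdi_def cf_mult
proof (intro allI impI sum.neutral ballI)
  fix i j i' j' assume P: "ALL i j. int (i + j) > n --> cf P i j = 0" and Q: "ALL i j. int (i + j) > k --> cf Q i j = 0"
    and ij: "int (i + j) > n + k" "j' \<in> {..j}" "i' \<in> {..i}"
  have "int (i' + j') > n \<or> int ((i - i') + (j - j')) > k" using ij by auto
  then show "cf P i' j' * cf Q (i - i') (j - j') = 0" using P Q by (metis mult_eq_0_iff)
qed

lemma bdi_cst: "0 <= n ==> bdi n (cst c)"
  by (auto simp: bdi_def cst_def coeff_pCons split: nat.splits)

lemma bdi_cst_mult: "bdi n P ==> bdi n (cst c * P)"
  by (simp add: bdi_def cf_cst_mult)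

lemma bdi_1: "0 <= n ==> bdi n 1"
  using bdi_cst[of n 1] by (simp add: cst_def one_pCons)

lemma bdi_xv: "bdi 1 xv" and bdi_yv: "bdi 1 yv"
  by (auto simp: bdi_def xv_def yv_def coeff_pCons split: nat.splits)

lemma bdi_power: "bdi n P ==> bdi (int k * n) (P ^ k)"
  by (induction k) (auto intro: bdi_1 dest: bdi_mult simp: algebra_simps)

lemma bdi_Dx: "bdi n P ==> bdi (n - 1) (Dx P)"
  by (auto simp: bdi_def cf_Dx)

lemma bdi_Dy: "bdi n P ==> bdi (n - 1) (pderiv P)"
  unfolding bdi_def cf_Dy by auto

text \<open>Exact division by a polynomial that is monic in one variable lowers the total degree.\<close>
lemma bdi_finite: "\<exists>n\<ge>0. bdi n P"
proof -
  let ?N = "\<Sum>j\<le>degree P. degree (coeff P j) + j"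
  have "cf P i j = 0" if "int (i + j) > int ?N" for i j
  proof (cases "j <= degree P")
    case True
    have "degree (coeff P j) + j <= ?N" by (rule member_le_sum[of j "{..degree P}" "\<lambda>j. degree (coeff P j) + j"]) (use True in auto)
    moreover have "?N < i + j" using that by (simp only: of_nat_less_iff)
    ultimately show ?thesis by (intro coeff_eq_0) linarith
  next
    case False
    then show ?thesis by (simp add: coeff_eq_0)
  qed
  then have "bdi (int ?N) P" unfolding bdi_def by blast
  then show ?thesis by (metis of_nat_0_le_iff)
qed

text \<open>The coefficients of top total degree of the product see those of the factor, so the degree of the factor can be
  lowered step by step.\<close>
lemma bdi_cancel:
  assumes top: "!!N i j. bdi N P ==> int (i + j) = N ==> EX i' j'. int (i' + j') = N + k & cf (P * Q) i' j' = cf P i j"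
    and "bdi n (P * Q)"
  shows "bdi (n - k) P"
proof -
  obtain N where N: "bdi N P" using bdi_finite by blast
  have "bdi (N - int r) P \<or> bdi (n - k) P" for r
  proof (induction r)
    case 0
    then show ?case using N by simp
  next
    case (Suc r)
    show ?case
    proof (cases "bdi (n - k) P")
      case False
      then have b: "bdi (N - int r) P" using Suc by simp
      then have gt: "N - int r > n - k" using False bdi_mono by (metis linorder_not_le)
      have "cf P i j = 0" if ij: "int (i + j) > N - int (Suc r)" for i j
      proof (cases "int (i + j) = N - int r")
        case True
        obtain i' j' where ij': "int (i' + j') = N - int r + k" "cf (P * Q) i' j' = cf P i j"
          using top[OF b True] by blast
        then show ?thesis using assms(2) gt unfolding bdi_def by (metis add.commute less_diff_eq diff_less_eq)
      next
        case False
        then have "int (i + j) > N - int r" using ij by simp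
        then show ?thesis using b by (simp add: bdi_def)
      qed
      then show ?thesis by (simp add: bdi_def)
    qed simp
  qed
  from this[of "nat (N - (n - k))"] show ?thesis
    using N bdi_mono by (metis diff_diff_eq2 diff_le_eq int_nat_eq le_add_same_cancel1 nat_le_iff order_refl add.commute diff_add_cancel nle_le)
qed

definition lx :: "complex poly => bp" where "lx p = [:p:]"
definition ly :: "complex poly => bp" where "ly p = map_poly (\<lambda>c. [:c:]) p"

lemma cf_lx: "cf (lx p) i j = (if j = 0 then coeff p i else 0)"
  by (cases j) (simp_all add: lx_def)

lemma cf_ly: "cf (ly p) i j = (if i = 0 then coeff p j else 0)"
  by (cases i) (simp_all add: ly_def coeff_map_poly)

lemma cf_mult_lx: "cf (P * lx p) i j = (\<Sum>i'\<le>i. cf P i' j * coeff p (i - i'))"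
proof -
  have "coeff (P * lx p) j = coeff P j * p" by (simp add: lx_def mult.commute)
  then show ?thesis by (simp add: coeff_mult)
qed

lemma cf_mult_ly: "cf (P * ly p) i j = (\<Sum>j'\<le>j. cf P i j' * coeff p (j - j'))"
proof -
  have "coeff (coeff P j' * coeff (ly p) (j - j')) i = cf P i j' * coeff p (j - j')" for j'
    by (simp add: ly_def coeff_map_poly mult.commute)
  then show ?thesis by (simp add: coeff_mult[of P] coeff_sum)
qed

lemma bdi_cancel_lx:
  assumes p: "degree p = k" "lead_coeff p = 1" and b: "bdi n (P * lx p)"
  shows "bdi (n - int k) P"
proof (rule bdi_cancel[OF _ b])
  fix N i j assume N: "bdi N P" "int (i + j) = N"
  have "cf (P * lx p) (i + k) j = (\<Sum>i'\<in>{i}. cf P i' j * coeff p (i + k - i'))"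
    unfolding cf_mult_lx
  proof (rule sum.mono_neutral_right)
    show "\<forall>i'\<in>{..i + k} - {i}. cf P i' j * coeff p (i + k - i') = 0"
    proof
      fix i' assume i': "i' \<in> {..i + k} - {i}"
      show "cf P i' j * coeff p (i + k - i') = 0"
      proof (cases "i' < i")
        case True
        then show ?thesis using p by (simp add: coeff_eq_0)
      next
        case False
        then have "int (i' + j) > N" using i' N(2) by auto
        then show ?thesis using N(1) by (simp add: bdi_def)
      qed
    qed
  qed auto
  then have "cf (P * lx p) (i + k) j = cf P i j" using p by simp
  then show "EX i' j'. int (i' + j') = N + int k & cf (P * lx p) i' j' = cf P i j"
    using N(2) by (intro exI[of _ "i + k"] exI[of _ j]) auto
qed

lemma bdi_cancel_ly:
  assumes p: "degree p = k" "lead_coeff p = 1" and b: "bdi n (P * ly p)"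
  shows "bdi (n - int k) P"
proof (rule bdi_cancel[OF _ b])
  fix N i j assume N: "bdi N P" "int (i + j) = N"
  have "cf (P * ly p) i (j + k) = (\<Sum>j'\<in>{j}. cf P i j' * coeff p (j + k - j'))"
    unfolding cf_mult_ly
  proof (rule sum.mono_neutral_right)
    show "\<forall>j'\<in>{..j + k} - {j}. cf P i j' * coeff p (j + k - j') = 0"
    proof
      fix j' assume j': "j' \<in> {..j + k} - {j}"
      show "cf P i j' * coeff p (j + k - j') = 0"
      proof (cases "j' < j")
        case True
        then show ?thesis using p by (simp add: coeff_eq_0)
      next
        case False
        then have "int (i + j') > N" using j' N(2) by auto
        then show ?thesis using N(1) by (simp add: bdi_def)
      qed
    qed
  qed auto
  then have "cf (P * ly p) i (j + k) = cf P i j" using p by simp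
  then show "EX i' j'. int (i' + j') = N + int k & cf (P * ly p) i' j' = cf P i j"
    using N(2) by (intro exI[of _ i] exI[of _ "j + k"]) auto
qed

lemma bdi_lx: "degree p <= k ==> bdi (int k) (lx p)"
  by (auto simp: bdi_def cf_lx coeff_eq_0)

lemma bdi_ly: "degree p <= k ==> bdi (int k) (ly p)"
  by (auto simp: bdi_def cf_ly coeff_eq_0)

lemma lx_mult: "lx (p * q) = lx p * lx q" and lx_add: "lx (p + q) = lx p + lx q" and lx_diff: "lx (p - q) = lx p - lx q"
  by (simp_all add: lx_def)

lemma lx_prod: "lx (\<Prod>i\<in>A. f i) = (\<Prod>i\<in>A. lx (f i))"
  by (induction A rule: infinite_finite_induct) (simp_all add: lx_mult, simp_all add: lx_def one_pCons)

lemma ly_add: "ly (p + q) = ly p + ly q" and ly_diff: "ly (p - q) = ly p - ly q"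
  by (rule bp_eqI, simp add: cf_ly)+

lemma ly_mult: "ly (p * q) = ly p * ly q"
proof (rule bp_eqI)
  fix i j
  show "cf (ly (p * q)) i j = cf (ly p * ly q) i j"
    unfolding cf_mult_ly cf_ly by (simp add: coeff_mult)
qed

lemma ly_1: "ly 1 = 1"
  by (rule bp_eqI) (simp add: cf_ly one_pCons coeff_pCons split: nat.splits)

lemma ly_prod: "ly (\<Prod>i\<in>A. f i) = (\<Prod>i\<in>A. ly (f i))"
  by (induction A rule: infinite_finite_induct) (simp_all add: ly_mult ly_1)

lemma Dx_lx: "Dx (lx p) = lx (pderiv p)"
  by (rule bp_eqI) (simp add: cf_Dx cf_lx coeff_pderiv)

lemma Dx_ly: "Dx (ly p) = 0"
  by (rule bp_eqI) (simp add: cf_Dx cf_ly)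

lemma Dy_lx: "pderiv (lx p) = 0"
  by (rule bp_eqI) (simp only: cf_Dy, simp add: cf_lx)

lemma Dy_ly: "pderiv (ly p) = ly (pderiv p)"
  by (rule bp_eqI) (simp only: cf_Dy, simp add: cf_ly coeff_pderiv)

subsection \<open>Divisibility by products of distinct linear factors\<close>

lemma distinct_roots_dvd:
  fixes p :: "'a::idom poly"
  assumes "finite I" "inj_on r I" "!!i. i \<in> I ==> poly p (r i) = 0"
  shows "(\<Prod>i\<in>I. [:- r i, 1:]) dvd p"
  using assms
proof (induction I arbitrary: p)
  case (insert a I)
  obtain q where q: "p = [:- r a, 1:] * q"
    using insert.prems(2)[of a] by (auto simp: poly_eq_0_iff_dvd elim: dvdE)
  have "poly q (r i) = 0" if i: "i \<in> I" for i
  proof -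
    have "r i ~= r a" using insert.prems(1) insert.hyps i by (auto simp: inj_on_def)
    moreover have "poly p (r i) = (r i - r a) * poly q (r i)" by (simp add: q algebra_simps)
    ultimately show ?thesis using insert.prems(2)[of i] i by simp
  qed
  then have "(\<Prod>i\<in>I. [:- r i, 1:]) dvd q" using insert by (simp add: inj_on_def)
  then show ?case using q insert by (simp add: mult_dvd_mono del: mult_pCons_left)
qed simp

lemma lx_dvd:
  assumes "!!j. p dvd coeff P j"
  shows "EX Q. P = Q * lx p"
proof -
  have "[:p:] dvd P" using assms by (simp add: const_poly_dvd_iff)
  then show ?thesis by (metis dvdE lx_def mult.commute)
qed

section \<open>Affine coordinates adapted to the two pencils\<close>

lemma cst_simps: "cst (x + y) = cst x + cst y" "cst (x * y) = cst x * cst y" "cst 0 = 0" "cst 1 = 1"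
    "cst (- x) = - cst x" "cst (x - y) = cst x - cst y"
  using chom_simps[OF chom_cst] by simp_all

lemma Dx_xv [simp]: "Dx xv = 1" and Dx_yv [simp]: "Dx yv = 0" and Dy_xv [simp]: "pderiv xv = 0" and Dy_yv [simp]: "pderiv yv = 1"
  by (simp_all add: Dx_def xv_def yv_def map_poly_pCons pderiv_pCons one_pCons)

lemma xv_power: "xv ^ i = [:monom 1 i:]"
  by (induction i) (simp_all add: xv_def one_pCons[symmetric] monom_Suc)

lemma yv_power: "yv ^ j = monom 1 j"
  by (induction j) (simp_all add: yv_def one_pCons[symmetric] monom_Suc)

lemma cf_term: "cf (cst c * (xv ^ i * yv ^ j)) k l = (if k = i & l = j then c else 0)"
  by (simp add: cf_cst_mult xv_power yv_power smult_monom)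

lemma double_delta_sum:
  fixes g :: "nat => nat => complex"
  shows "(\<Sum>i\<le>r. \<Sum>j\<le>r - i. if k = i & l = j then g i j else 0) = (if k + l <= r then g k l else 0)"
proof -
  have "(\<Sum>j\<le>r - i. if k = i & l = j then g i j else 0) = (if k = i then (if l <= r - k then g k l else 0) else 0)" for i
    by (cases "k = i") (simp_all add: sum.delta')
  then have "(\<Sum>i\<le>r. \<Sum>j\<le>r - i. if k = i & l = j then g i j else 0)
      = (\<Sum>i\<le>r. if k = i then (if l <= r - k then g k l else 0) else 0)" by simp
  also have "\<dots> = (if k + l <= r then g k l else 0)" by (auto simp: sum.delta')
  finally show ?thesis .
qed

lemma euler:
  fixes F :: S
  assumes "F \<in> homog r"
  shows "(\<Sum>i\<in>UNIV. sg (sg i 1) 1 * pderiv_mpoly i F) = pscale (of_nat r) F"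
proof -
  have e: "sg (sg i 1) 1 * pderiv_mpoly i F = (\<Sum>m\<in>kys F. sg m (of_nat (lk m i) * lk F m))" for i :: 3
  proof -
    have "sg (sg i 1 + (m - sg i 1)) (of_nat (lk m i) * lk F m) = sg m (of_nat (lk m i) * lk F m)" for m
    proof (cases "lk m i = 0")
      case False
      then show ?thesis using exponent_split[of m i] by (metis add.commute)
    qed simp
    then show ?thesis by (simp add: pderiv_mpoly_def sum_distrib_left mult_single)
  qed
  have "(\<Sum>i\<in>UNIV. sg (sg i 1) 1 * pderiv_mpoly i F) = (\<Sum>m\<in>kys F. \<Sum>i\<in>UNIV. sg m (of_nat (lk m i) * lk F m))"
    unfolding e by (rule sum.swap)
  also have "\<dots> = (\<Sum>m\<in>kys F. sg m (of_nat r * lk F m))"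
  proof (rule sum.cong[OF refl])
    fix m assume "m \<in> kys F"
    then have "r = (\<Sum>i\<in>UNIV. lk m i)" using assms mdeg_superset[of UNIV m] by (auto simp: homog_def)
    then have "(\<Sum>i\<in>UNIV. of_nat (lk m i) * lk F m) = of_nat r * lk F m" by (simp add: sum_distrib_right)
    moreover have "(\<Sum>i\<in>UNIV. sg m (of_nat (lk m i) * lk F m)) = sg m (\<Sum>i\<in>UNIV. of_nat (lk m i) * lk F m)"
      by (simp add: sum_3 single_add)
    ultimately show "(\<Sum>i\<in>UNIV. sg m (of_nat (lk m i) * lk F m)) = sg m (of_nat r * lk F m)" by (simp only:)
  qed
  also have "\<dots> = pscale (of_nat r) (\<Sum>m\<in>kys F. sg m (lk F m))"
  proof -
    have "(\<Sum>m\<in>kys F. sg m (c * lk F m)) = pscale c (\<Sum>m\<in>kys F. sg m (lk F m))" for c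
      by (simp add: pscale_conv_mult sum_distrib_left mult_single)
    then show ?thesis .
  qed
  finally show ?thesis using poly_mapping_decompose[of F] by simp
qed

definition jac :: "S => S^3 => S" where
  "jac F \<theta> = (\<Sum>i\<in>UNIV. \<theta> $ i * pderiv_mpoly i F)"

definition hom3 :: "nat => S^3 => bool" where
  "hom3 k \<theta> \<longleftrightarrow> (ALL i. \<theta> $ i \<in> homog k)"

locale frame =
  fixes a b w ca cb cw :: "complex^3"
  assumes db: "dual_basis a b w ca cb cw"
begin

definition dvar :: "3 => bp" where
  "dvar i = cst (cw $ i) + cst (ca $ i) * xv + cst (cb $ i) * yv"

definition dh :: "S => bp" where
  "dh F = subst cst dvar F"

lemmas dh_simps =
  subst_add[OF chom_cst, of dvar, folded dh_def] subst_mult[OF chom_cst, of dvar, folded dh_def]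
  subst_sum[OF chom_cst, of dvar, folded dh_def] subst_prod[OF chom_cst, of dvar, folded dh_def]
  subst_power[OF chom_cst, of dvar, folded dh_def] subst_1[OF chom_cst, of dvar, folded dh_def]
  subst_pscale[OF chom_cst, of dvar, folded dh_def] subst_uminus[OF chom_cst, of dvar, folded dh_def]
  subst_diff[OF chom_cst, of dvar, folded dh_def] subst_0[of cst dvar, folded dh_def]

lemma dh_lin: "dh (lin v) = cst (dot v cw) + cst (dot v ca) * xv + cst (dot v cb) * yv"
  unfolding dh_def subst_lin[OF chom_cst] dvar_def dot_def by (simp add: cst_simps algebra_simps)

lemma dh_basis: "dh (lin a) = xv" "dh (lin b) = yv" "dh (lin w) = 1"
  using db by (simp_all add: dh_lin dual_basis_def cst_simps)

lemma bdi_dvar: "bdi 1 (dvar i)"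
  unfolding dvar_def by (intro bdi_add bdi_cst bdi_cst_mult bdi_xv bdi_yv) simp

lemma bdi_pmon: "bdi (int (mdeg m)) (pmon dvar m)"
proof (induction m rule: exponent_induct)
  case zero
  show ?case using bdi_1[of 0] by simp
next
  case (step m j)
  show ?case using bdi_mult[OF step bdi_dvar[of j]] by (simp add: pmon_add mdeg_add add.commute)
qed

lemma bdi_dh:
  assumes "F \<in> homog r"
  shows "bdi (int r) (dh F)"
  unfolding dh_def subst_def
proof (rule bdi_sum, rule bdi_cst_mult)
  fix m assume "m \<in> kys F"
  then have "mdeg m = r" using assms by (simp add: homog_def)
  then show "bdi (int r) (pmon dvar m)" using bdi_pmon[of m] by simp
qed

lemma eval_dh: "poly (poly (dh F) [:y0:]) x0 = eval_mpoly F (\<lambda>i. cw $ i + ca $ i * x0 + cb $ i * y0)"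
proof -
  have "poly (poly (subst cst dvar F) [:y0:]) x0 = subst (\<lambda>c. c) (\<lambda>i. poly (poly (dvar i) [:y0:]) x0) F"
    by (rule subst_comp[where h = "\<lambda>P. poly (poly P [:y0:]) x0", OF chom_cst chom_id]) (simp_all add: cst_def)
  then show ?thesis by (simp add: dh_def eval_mpoly_subst dvar_def cst_def xv_def yv_def ac_simps)
qed

lemma lin_w_nz: "lin w ~= 0"
proof
  assume "lin w = 0"
  then have "w = 0" by simp
  then show False using db by (simp add: dual_basis_def dot_def)
qed

text \<open>A form that vanishes off the line at infinity vanishes everywhere after multiplication with that line.\<close>
lemma dh_inj:
  assumes F: "F \<in> homog r" and z: "dh F = 0"
  shows "F = 0"
proof -
  have "F * lin w = 0"
  proof (rule eval_zero_imp_zero)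
    fix u :: "complex^3"
    show "eval_mpoly (F * lin w) (($) u) = 0"
    proof (cases "dot w u = 0")
      case True
      then show ?thesis by (simp add: eval_simps eval_lin)
    next
      case False
      let ?z = "dot w u"
      have "u $ i = ?z * (cw $ i + ca $ i * (dot a u / ?z) + cb $ i * (dot b u / ?z))" for i
        using arg_cong[OF dual_basis_expand(1)[OF db, of u], of "\<lambda>v. v $ i"] False
        by (simp add: field_simps)
      then have u: "($) u = (\<lambda>i. ?z * (cw $ i + ca $ i * (dot a u / ?z) + cb $ i * (dot b u / ?z)))" by (rule ext)
      have "eval_mpoly F (($) u) = ?z ^ r * eval_mpoly F (\<lambda>i. cw $ i + ca $ i * (dot a u / ?z) + cb $ i * (dot b u / ?z))"
        by (subst u) (rule eval_homog_scale[OF F])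
      also have "\<dots> = 0" unfolding eval_dh[symmetric] z by simp
      finally show ?thesis by (simp add: eval_simps)
    qed
  qed
  then show ?thesis using lin_w_nz by simp
qed

definition hz :: "nat => bp => S" where
  "hz r P = (\<Sum>i\<le>r. \<Sum>j\<le>r - i. pscale (cf P i j) (lin a ^ i * lin b ^ j * lin w ^ (r - i - j)))"

lemma hz_homog: "hz r P \<in> homog r"
  unfolding hz_def
proof (intro homog_sum homog_pscale)
  fix i j assume ij: "i \<in> {..r}" "j \<in> {..r - i}"
  have "lin a ^ i * lin b ^ j * lin w ^ (r - i - j) \<in> homog (i * 1 + j * 1 + (r - i - j) * 1)"
    by (intro homog_mult homog_power homog_lin)
  then show "lin a ^ i * lin b ^ j * lin w ^ (r - i - j) \<in> homog r" using ij by simp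
qed

lemma dh_hz:
  assumes "bdi (int r) P"
  shows "dh (hz r P) = P"
proof (rule bp_eqI)
  fix k l
  have "dh (hz r P) = (\<Sum>i\<le>r. \<Sum>j\<le>r - i. cst (cf P i j) * (xv ^ i * yv ^ j))"
    by (simp add: hz_def dh_simps dh_basis)
  then have "cf (dh (hz r P)) k l = (\<Sum>i\<le>r. \<Sum>j\<le>r - i. if k = i & l = j then cf P i j else 0)"
    by (simp only: coeff_sum cf_term)
  also have "\<dots> = cf P k l" unfolding double_delta_sum using assms by (auto simp: bdi_def)
  finally show "cf (dh (hz r P)) k l = cf P k l" .
qed

lemma hz_dh:
  assumes "F \<in> homog r"
  shows "hz r (dh F) = F"
proof -
  have "dh (hz r (dh F) - F) = 0" by (simp add: dh_simps dh_hz bdi_dh assms)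
  then have "hz r (dh F) - F = 0" by (rule dh_inj[OF homog_diff[OF hz_homog assms]])
  then show ?thesis by simp
qed

lemma dh_eq_iff: "F \<in> homog r ==> G \<in> homog r ==> dh F = dh G \<longleftrightarrow> F = G"
  by (metis hz_dh)

lemma Dx_dh: "Dx (dh F) = (\<Sum>i\<in>UNIV. dh (pderiv_mpoly i F) * cst (ca $ i))"
proof -
  have "Dx (subst cst dvar F) = (\<Sum>i\<in>UNIV. subst cst dvar (pderiv_mpoly i F) * Dx (dvar i))"
    by (rule derivation_subst[OF chom_cst]) (simp_all add: Dx_add Dx_mult)
  moreover have "Dx (dvar i) = cst (ca $ i)" for i by (simp add: dvar_def Dx_add Dx_mult)
  ultimately show ?thesis by (simp add: dh_def)
qed

lemma Dy_dh: "pderiv (dh F) = (\<Sum>i\<in>UNIV. dh (pderiv_mpoly i F) * cst (cb $ i))"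
proof -
  have "pderiv (subst cst dvar F) = (\<Sum>i\<in>UNIV. subst cst dvar (pderiv_mpoly i F) * pderiv (dvar i))"
    by (rule derivation_subst[OF chom_cst]) (simp_all add: pderiv_add pderiv_mult mult.commute add.commute)
  moreover have "pderiv (dvar i) = cst (cb $ i)" for i by (simp add: dvar_def pderiv_add pderiv_mult)
  ultimately show ?thesis by (simp add: dh_def)
qed

text \<open>The dehomogenised derivative in the third direction, as given by Euler's relation.\<close>
definition Dw :: "nat => bp => bp" where
  "Dw r G = cst (of_nat r) * G - xv * Dx G - yv * pderiv G"

lemma Dw_dh:
  assumes "F \<in> homog r"
  shows "Dw r (dh F) = (\<Sum>i\<in>UNIV. dh (pderiv_mpoly i F) * cst (cw $ i))"
proof -
  have v: "dh (sg (sg i 1) 1) = dvar i" for i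
    using subst_single[OF chom_cst, of dvar "sg i 1" 1] by (simp add: dh_def cst_simps)
  have "cst (of_nat r) * dh F = dh (\<Sum>i\<in>UNIV. sg (sg i 1) 1 * pderiv_mpoly i F)"
    unfolding euler[OF assms] dh_simps ..
  also have "\<dots> = (\<Sum>i\<in>UNIV. dvar i * dh (pderiv_mpoly i F))"
    by (simp only: dh_simps v)
  also have "\<dots> = (\<Sum>i\<in>UNIV. dh (pderiv_mpoly i F) * cst (cw $ i)) + xv * Dx (dh F) + yv * pderiv (dh F)"
    unfolding Dx_dh Dy_dh dvar_def sum_3 by (simp add: algebra_simps)
  finally show ?thesis by (simp add: Dw_def)
qed

lemma delta: "a $ i * ca $ j + b $ i * cb $ j + w $ i * cw $ j = (if i = j then 1 else 0)"
proof -
  have d: "dot v (axis i 1) = v $ i" for v :: "complex^3"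
    using exhaust_3[of i] by (auto simp: dot_def axis_def)
  show ?thesis
    using arg_cong[OF dual_basis_expand(1)[OF db, of "axis i 1"], of "\<lambda>v. v $ j"]
    unfolding d by (auto simp: axis_def)
qed

lemma dual_sum: "cst (a $ i) * (\<Sum>j\<in>UNIV. z j * cst (ca $ j)) + cst (b $ i) * (\<Sum>j\<in>UNIV. z j * cst (cb $ j))
   + cst (w $ i) * (\<Sum>j\<in>UNIV. z j * cst (cw $ j)) = z i"
proof -
  have "cst (a $ i) * (\<Sum>j\<in>UNIV. z j * cst (ca $ j)) + cst (b $ i) * (\<Sum>j\<in>UNIV. z j * cst (cb $ j))
   + cst (w $ i) * (\<Sum>j\<in>UNIV. z j * cst (cw $ j)) = (\<Sum>j\<in>UNIV. z j * cst (a $ i * ca $ j + b $ i * cb $ j + w $ i * cw $ j))"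
    by (simp add: sum_3 cst_simps algebra_simps)
  also have "\<dots> = (\<Sum>j\<in>UNIV. if j = i then z j else 0)"
    unfolding delta by (intro sum.cong) (auto simp: cst_simps)
  finally show ?thesis by simp
qed

lemma dual_sum': "cst (ca $ i) * (\<Sum>j\<in>UNIV. cst (a $ j) * z j) + cst (cb $ i) * (\<Sum>j\<in>UNIV. cst (b $ j) * z j)
   + cst (cw $ i) * (\<Sum>j\<in>UNIV. cst (w $ j) * z j) = z i"
proof -
  have "cst (ca $ i) * (\<Sum>j\<in>UNIV. cst (a $ j) * z j) + cst (cb $ i) * (\<Sum>j\<in>UNIV. cst (b $ j) * z j)
   + cst (cw $ i) * (\<Sum>j\<in>UNIV. cst (w $ j) * z j) = (\<Sum>j\<in>UNIV. z j * cst (a $ j * ca $ i + b $ j * cb $ i + w $ j * cw $ i))"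
    by (simp add: sum_3 cst_simps algebra_simps)
  also have "\<dots> = (\<Sum>j\<in>UNIV. if j = i then z j else 0)"
    unfolding delta by (intro sum.cong) (auto simp: cst_simps)
  finally show ?thesis by simp
qed

definition co :: "complex^3 => S^3 => bp" where
  "co v \<theta> = (\<Sum>i\<in>UNIV. cst (v $ i) * dh (\<theta> $ i))"

lemma dh_jac:
  assumes "F \<in> homog r"
  shows "dh (jac F \<theta>) = co a \<theta> * Dx (dh F) + co b \<theta> * pderiv (dh F) + co w \<theta> * Dw r (dh F)"
proof -
  have z: "dh (pderiv_mpoly i F) = cst (a $ i) * Dx (dh F) + cst (b $ i) * pderiv (dh F) + cst (w $ i) * Dw r (dh F)" for i
    unfolding Dx_dh Dy_dh Dw_dh[OF assms] using dual_sum[of i "\<lambda>j. dh (pderiv_mpoly j F)"] by simp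
  have "dh (jac F \<theta>) = (\<Sum>i\<in>UNIV. dh (\<theta> $ i) * dh (pderiv_mpoly i F))" by (simp add: jac_def dh_simps)
  also have "\<dots> = co a \<theta> * Dx (dh F) + co b \<theta> * pderiv (dh F) + co w \<theta> * Dw r (dh F)"
    unfolding z co_def sum_3 by (simp add: algebra_simps)
  finally show ?thesis .
qed

lemma dh_component: "dh (\<theta> $ i) = cst (ca $ i) * co a \<theta> + cst (cb $ i) * co b \<theta> + cst (cw $ i) * co w \<theta>"
  unfolding co_def using dual_sum'[of i "\<lambda>j. dh (\<theta> $ j)"] by simp

lemma hom3_eqI:
  assumes "hom3 k \<theta>" "hom3 k \<theta>'" "co a \<theta> = co a \<theta>'" "co b \<theta> = co b \<theta>'" "co w \<theta> = co w \<theta>'"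
  shows "\<theta> = \<theta>'"
proof -
  have "\<theta> $ i = \<theta>' $ i" for i
  proof -
    have "dh (\<theta> $ i) = dh (\<theta>' $ i)" using assms(3-5) by (simp add: dh_component)
    then show ?thesis using assms(1,2) dh_eq_iff[of "\<theta> $ i" k "\<theta>' $ i"] by (simp add: hom3_def)
  qed
  then show ?thesis by (simp add: vec_ext)
qed

lemma bdi_co: "hom3 k \<theta> ==> bdi (int k) (co v \<theta>)"
  unfolding co_def hom3_def by (intro bdi_sum bdi_cst_mult bdi_dh) simp

definition mk :: "nat => bp => bp => bp => S^3" where
  "mk k P1 P2 P3 = (\<chi> i. hz k (cst (ca $ i) * P1 + cst (cb $ i) * P2 + cst (cw $ i) * P3))"

lemma hom3_mk: "hom3 k (mk k P1 P2 P3)"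
  by (simp add: hom3_def mk_def hz_homog)

lemma co_mk:
  assumes "bdi (int k) P1" "bdi (int k) P2" "bdi (int k) P3"
  shows "co a (mk k P1 P2 P3) = P1" "co b (mk k P1 P2 P3) = P2" "co w (mk k P1 P2 P3) = P3"
proof -
  have "dh (mk k P1 P2 P3 $ i) = cst (ca $ i) * P1 + cst (cb $ i) * P2 + cst (cw $ i) * P3" for i
    unfolding mk_def by (simp, rule dh_hz, intro bdi_add bdi_cst_mult assms)
  then have c: "co v (mk k P1 P2 P3) = cst (dot v ca) * P1 + cst (dot v cb) * P2 + cst (dot v cw) * P3" for v
    unfolding co_def sum_3 dot_def by (simp add: cst_simps algebra_simps)
  show "co a (mk k P1 P2 P3) = P1" "co b (mk k P1 P2 P3) = P2" "co w (mk k P1 P2 P3) = P3"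
    using db by (simp_all add: c dual_basis_def cst_simps)
qed

lemma frame_swap: "frame b a w cb ca cw"
  using db by unfold_locales (simp add: dual_basis_def)

lemma dh_swap:
  assumes "F \<in> homog r"
  shows "cf (frame.dh cb ca cw F) l k = cf (dh F) k l"
proof -
  interpret sw: frame b a w cb ca cw by (rule frame_swap)
  have "sw.dh F = sw.dh (hz r (dh F))" by (simp add: hz_dh assms)
  also have "\<dots> = (\<Sum>i\<le>r. \<Sum>j\<le>r - i. cst (cf (dh F) i j) * (xv ^ j * yv ^ i))"
    by (simp add: hz_def sw.dh_simps sw.dh_basis mult.commute)
  finally have "cf (sw.dh F) l k = (\<Sum>i\<le>r. \<Sum>j\<le>r - i. if k = i & l = j then cf (dh F) i j else 0)"
    by (simp only: coeff_sum cf_term conj_commute)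
  also have "\<dots> = cf (dh F) k l" unfolding double_delta_sum using bdi_dh[OF assms] by (auto simp: bdi_def)
  finally show ?thesis .
qed

end

section \<open>Polynomials with prescribed simple roots\<close>

definition pr :: "nat => (nat => complex) => complex poly" where
  "pr m r = (\<Prod>i<m. [:- r i, 1:])"

lemma pr_Suc: "pr (Suc m) r = pr m r * [:- r m, 1:]"
  by (simp add: pr_def mult.commute)

lemma pr_monic: "degree (pr m r) = m & coeff (pr m r) m = 1"
proof (induction m)
  case 0
  show ?case by (simp add: pr_def)
next
  case (Suc m)
  then have nz: "pr m r ~= 0" and l: "lead_coeff (pr m r) = 1" by auto
  have d: "degree (pr (Suc m) r) = Suc m" unfolding pr_Suc using Suc nz by (subst degree_mult_eq) auto
  have "lead_coeff (pr (Suc m) r) = 1" unfolding pr_Suc lead_coeff_mult l by simp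
  then show ?case unfolding d by simp
qed

lemma degree_pr: "degree (pr m r) = m" and coeff_pr: "coeff (pr m r) m = 1" and lead_pr: "lead_coeff (pr m r) = 1"
  using pr_monic[of m r] by auto

lemma pr_nz [simp]: "pr m r ~= 0"
  using lead_pr[of m r] by auto

lemma pr_root: "i < m ==> poly (pr m r) (r i) = 0"
  by (auto simp: pr_def poly_prod)

lemma pderiv_pr: "pderiv (pr m r) = (\<Sum>i<m. \<Prod>j\<in>{..<m} - {i}. [:- r j, 1:])"
  unfolding pr_def by (simp add: pderiv_prod pderiv_pCons)

lemma pr_simple:
  assumes "inj_on r {..<m}" "i < m"
  shows "poly (pderiv (pr m r)) (r i) ~= 0"
proof -
  have "poly (pderiv (pr m r)) (r i) = (\<Sum>k<m. \<Prod>j\<in>{..<m} - {k}. r i - r j)"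
    by (simp add: pderiv_pr poly_sum poly_prod)
  also have "\<dots> = (\<Sum>k\<in>{i}. \<Prod>j\<in>{..<m} - {k}. r i - r j)"
    using assms(2) by (intro sum.mono_neutral_right) auto
  also have "\<dots> ~= 0" using assms by (auto simp: inj_on_def)
  finally show ?thesis .
qed

definition ax :: "complex => bp => complex poly" where
  "ax x P = map_poly (\<lambda>p. poly p x) P"

lemma coeff_ax: "coeff (ax x P) j = poly (coeff P j) x"
  by (simp add: ax_def coeff_map_poly)

lemma ax_mult: "ax x (P * Q) = ax x P * ax x Q"
  by (rule poly_eqI) (simp add: coeff_ax coeff_mult poly_sum)

lemma ax_add: "ax x (P + Q) = ax x P + ax x Q" and ax_diff: "ax x (P - Q) = ax x P - ax x Q"
  by (rule poly_eqI, simp add: coeff_ax)+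

lemma ax_lx: "ax x (lx p) = [:poly p x:]"
  by (rule poly_eqI) (simp add: coeff_ax lx_def coeff_pCons split: nat.splits)

lemma ax_ly: "ax x (ly p) = p"
  by (rule poly_eqI) (simp add: coeff_ax ly_def coeff_map_poly)

lemma ay_lx: "poly (lx p) q = p"
  by (simp add: lx_def)

lemma ay_ly: "poly (ly p) [:y:] = [:poly p y:]"
proof (induction p)
  case 0
  show ?case by (simp add: ly_def)
next
  case (pCons c p)
  have "ly (pCons c p) = pCons [:c:] (ly p)" by (simp add: ly_def map_poly_pCons)
  then show ?case using pCons by (simp add: mult.commute)
qed

lemma dvd_lx_pr:
  assumes "inj_on r {..<m}" "!!i. i < m ==> ax (r i) P = 0"
  shows "EX Q. P = Q * lx (pr m r)"
proof (rule lx_dvd)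
  fix j
  have "poly (coeff P j) (r i) = 0" if "i < m" for i
    using arg_cong[OF assms(2)[OF that], of "\<lambda>p. coeff p j"] by (simp add: coeff_ax)
  then show "pr m r dvd coeff P j" unfolding pr_def
    by (intro distinct_roots_dvd) (use assms(1) in auto)
qed

lemma dvd_ly_pr:
  assumes "inj_on s {..<n}" "!!j. j < n ==> poly P [:s j:] = 0"
  shows "EX Q. P = Q * ly (pr n s)"
proof -
  have "ly [:- s j, 1:] = [:- [:s j:], 1:]" for j by (simp add: ly_def map_poly_pCons one_pCons)
  then have "ly (pr n s) = (\<Prod>j<n. [:- [:s j:], 1:])" by (simp add: pr_def ly_prod)
  moreover have "(\<Prod>j<n. [:- [:s j:], 1:]) dvd P"
    by (rule distinct_roots_dvd) (use assms in \<open>auto simp: inj_on_def\<close>)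
  ultimately show ?thesis by (metis dvdE mult.commute)
qed

lemma lx_nz [simp]: "lx p = 0 \<longleftrightarrow> p = 0"
  by (simp add: lx_def)

lemma ly_nz [simp]: "ly p = 0 \<longleftrightarrow> p = 0"
  by (metis ax_ly bp_eqI cf_ly coeff_0 ax_def map_poly_0)

lemma bdi_pr_diff: "bdi (int m - 1) (lx (pr m r) - lx (pr m r'))" "bdi (int m - 1) (ly (pr m r) - ly (pr m r'))"
proof -
  have z: "coeff (pr m r) i = coeff (pr m r') i" if "m <= i" for i
    using that coeff_pr[of m r] coeff_pr[of m r'] degree_pr[of m r] degree_pr[of m r']
    by (cases "i = m") (simp_all add: coeff_eq_0)
  show "bdi (int m - 1) (lx (pr m r) - lx (pr m r'))" "bdi (int m - 1) (ly (pr m r) - ly (pr m r'))"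
    unfolding bdi_def by (auto simp: cf_lx cf_ly intro!: z)
qed

section \<open>Jacobian syzygies\<close>

text \<open>The third component of a syzygy in terms of its two cofactors.\<close>
definition gam :: "nat => nat => (nat => complex) => (nat => complex) => bp => bp => bp" where
  "gam m n r s \<alpha> \<beta> = cst (- 1 / of_nat (m + n)) * (\<alpha> * lx (pderiv (pr m r)) + \<beta> * ly (pderiv (pr n s)))"

text \<open>Pairs of cofactors whose syzygy has degree at most \<open>k\<close>.\<close>
definition KK :: "nat => nat => (nat => complex) => (nat => complex) => nat => (bp \<times> bp) set" where
  "KK m n r s k = {(\<alpha>, \<beta>). bdi (int k) (gam m n r s \<alpha> \<beta>) &
     bdi (int k) (xv * gam m n r s \<alpha> \<beta> + \<alpha> * lx (pr m r)) & bdi (int k) (yv * gam m n r s \<alpha> \<beta> + \<beta> * ly (pr n s))}"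

lemma KK_bdi:
  assumes "(\<alpha>, \<beta>) \<in> KK m n r s k"
  shows "bdi (int k + 1 - int m) \<alpha>" "bdi (int k + 1 - int n) \<beta>"
proof -
  let ?g = "gam m n r s \<alpha> \<beta>"
  have g: "bdi (int k) ?g" and a: "bdi (int k) (xv * ?g + \<alpha> * lx (pr m r))" and b: "bdi (int k) (yv * ?g + \<beta> * ly (pr n s))"
    using assms by (simp_all add: KK_def)
  have x: "bdi (int k + 1) (xv * ?g)" "bdi (int k + 1) (yv * ?g)"
    using bdi_mult[OF bdi_xv g] bdi_mult[OF bdi_yv g] by (simp_all add: add.commute)
  have "bdi (int k + 1) (\<alpha> * lx (pr m r))" "bdi (int k + 1) (\<beta> * ly (pr n s))"
    using bdi_diff[OF bdi_mono[OF a, of "int k + 1"] x(1)] bdi_diff[OF bdi_mono[OF b, of "int k + 1"] x(2)] by simp_all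
  then show "bdi (int k + 1 - int m) \<alpha>" "bdi (int k + 1 - int n) \<beta>"
    using bdi_cancel_lx[OF degree_pr lead_pr] bdi_cancel_ly[OF degree_pr lead_pr] by blast+
qed

text \<open>Monic polynomials of the same degree differ in lower order, which the degree bounds on the cofactors absorb. So the
  space of syzygies of a given degree does not depend on the position of the lines.\<close>
lemma KK_indep: "KK m n r s k \<subseteq> KK m n r' s' k"
proof safe
  fix \<alpha> \<beta> assume K: "(\<alpha>, \<beta>) \<in> KK m n r s k"
  let ?g = "gam m n r s \<alpha> \<beta>" and ?h = "gam m n r' s' \<alpha> \<beta>"
  have g: "bdi (int k) ?g" and a: "bdi (int k) (xv * ?g + \<alpha> * lx (pr m r))" and b: "bdi (int k) (yv * ?g + \<beta> * ly (pr n s))"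
    using K by (simp_all add: KK_def)
  note ab = KK_bdi[OF K]
  define E where "E = lx (pr m r') - lx (pr m r)"
  define F where "F = ly (pr n s') - ly (pr n s)"
  have E: "bdi (int m - 1) E" "bdi (int m - 1 - 1) (Dx E)" and F: "bdi (int n - 1) F" "bdi (int n - 1 - 1) (pderiv F)"
    unfolding E_def F_def by (intro bdi_pr_diff bdi_Dx bdi_Dy)+
  have dE: "lx (pderiv (pr m r')) - lx (pderiv (pr m r)) = Dx E" and dF: "ly (pderiv (pr n s')) - ly (pderiv (pr n s)) = pderiv F"
    unfolding E_def F_def lx_diff[symmetric] ly_diff[symmetric] Dx_lx Dy_ly by (simp_all add: pderiv_diff)
  have "bdi (int k + 1 - int m + (int m - 1 - 1)) (\<alpha> * Dx E)" "bdi (int k + 1 - int n + (int n - 1 - 1)) (\<beta> * pderiv F)"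
    by (intro bdi_mult ab E F)+
  then have "bdi (int k - 1) (\<alpha> * Dx E + \<beta> * pderiv F)" by (auto intro!: bdi_add)
  then have H: "bdi (int k - 1) (cst (- 1 / of_nat (m + n)) * (\<alpha> * Dx E + \<beta> * pderiv F))" (is "bdi _ ?H") by (rule bdi_cst_mult)
  have h: "?h = ?g + ?H" unfolding gam_def dE[symmetric] dF[symmetric] by (simp add: algebra_simps)
  have xH: "bdi (int k) (xv * ?H)" "bdi (int k) (yv * ?H)" using bdi_mult[OF bdi_xv H] bdi_mult[OF bdi_yv H] by simp_all
  have "bdi (int k + 1 - int m + (int m - 1)) (\<alpha> * E)" "bdi (int k + 1 - int n + (int n - 1)) (\<beta> * F)"
    by (intro bdi_mult ab E F)+
  then have ae: "bdi (int k) (\<alpha> * E)" "bdi (int k) (\<beta> * F)" by simp_all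
  have "bdi (int k) ?h" unfolding h using bdi_add[OF g bdi_mono[OF H, of "int k"]] by simp
  moreover have "xv * ?h + \<alpha> * lx (pr m r') = (xv * ?g + \<alpha> * lx (pr m r)) + xv * ?H + \<alpha> * E"
    unfolding h E_def by (simp add: algebra_simps)
  moreover have "yv * ?h + \<beta> * ly (pr n s') = (yv * ?g + \<beta> * ly (pr n s)) + yv * ?H + \<beta> * F"
    unfolding h F_def by (simp add: algebra_simps)
  ultimately show "(\<alpha>, \<beta>) \<in> KK m n r' s' k"
    unfolding KK_def using bdi_add[OF bdi_add[OF a xH(1)] ae(1)] bdi_add[OF bdi_add[OF b xH(2)] ae(2)] by simp
qed

lemma lx_pr_0: "lx (pr m (\<lambda>_. 0)) = xv ^ m"
  unfolding pr_def lx_prod by (simp add: lx_def xv_def)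

lemma ly_pr_0: "ly (pr m (\<lambda>_. 0)) = yv ^ m"
  unfolding pr_def ly_prod by (simp add: ly_def yv_def map_poly_pCons one_pCons)

lemma lx_dpr_0: "0 < m ==> lx (pderiv (pr m (\<lambda>_. 0))) = cst (of_nat m) * xv ^ (m - 1)"
proof -
  assume m: "0 < m"
  have "cf (Dx (xv ^ m)) i j = cf (cst (of_nat m) * (xv ^ (m - 1) * yv ^ 0)) i j" for i j
    unfolding cf_Dx cf_term using cf_term[of 1 m 0 j "Suc i"] m by (auto simp: cst_simps)
  then show ?thesis unfolding Dx_lx[symmetric] lx_pr_0 by (intro bp_eqI) simp
qed

lemma ly_dpr_0: "0 < n ==> ly (pderiv (pr n (\<lambda>_. 0))) = cst (of_nat n) * yv ^ (n - 1)"
  unfolding Dy_ly[symmetric] ly_pr_0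
  by (rule bp_eqI) (simp only: cf_Dy, auto simp: cf_cst_mult yv_power)

lemma KK_first: "2 <= m ==> 2 <= n ==> (1, 0) \<in> KK m n r s m"
  and KK_second: "2 <= m ==> 2 <= n ==> (0, 1) \<in> KK m n r s n"
proof -
  assume mn: "2 <= m" "2 <= n"
  have x: "bdi (int m - 1) (lx (pderiv (pr m r)))" "bdi (int n - 1) (ly (pderiv (pr n s)))"
    unfolding Dx_lx[symmetric] Dy_ly[symmetric] by (intro bdi_Dx bdi_Dy bdi_lx bdi_ly, simp add: degree_pr)+
  have g: "bdi (int m - 1) (gam m n r s 1 0)" "bdi (int n - 1) (gam m n r s 0 1)"
    unfolding gam_def by (simp_all add: x bdi_cst_mult)
  have p: "bdi (int m) (lx (pr m r))" "bdi (int n) (ly (pr n s))" by (intro bdi_lx bdi_ly, simp add: degree_pr)+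
  have "bdi (int m) (xv * gam m n r s 1 0)" "bdi (int m) (yv * gam m n r s 1 0)"
    "bdi (int n) (xv * gam m n r s 0 1)" "bdi (int n) (yv * gam m n r s 0 1)"
    using bdi_mult[OF bdi_xv g(1)] bdi_mult[OF bdi_yv g(1)] bdi_mult[OF bdi_xv g(2)] bdi_mult[OF bdi_yv g(2)] by simp_all
  then show "(1, 0) \<in> KK m n r s m" "(0, 1) \<in> KK m n r s n"
    unfolding KK_def using g p by (auto intro: bdi_add bdi_mono)
qed

text \<open>For \<open>A = x^m\<close>, \<open>B = y^n\<close> the terms of degree \<open>d - 1\<close> cancel, and the general case reduces to this one.\<close>
lemma KK_third:
  assumes mn: "2 <= m" "2 <= n"
  shows "(yv ^ (n - 1), xv ^ (m - 1)) \<in> KK m n r s (m + n - 2)"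
proof -
  let ?z = "\<lambda>_::nat. 0::complex"
  have "gam m n ?z ?z (yv ^ (n - 1)) (xv ^ (m - 1))
      = cst (- 1 / of_nat (m + n)) * (cst (of_nat m + of_nat n) * (xv ^ (m - 1) * yv ^ (n - 1)))"
    using mn by (simp add: gam_def lx_dpr_0 ly_dpr_0 cst_simps algebra_simps)
  also have "\<dots> = cst (- 1 / of_nat (m + n) * (of_nat m + of_nat n)) * (xv ^ (m - 1) * yv ^ (n - 1))"
    by (simp only: cst_simps mult.assoc)
  also have "- 1 / of_nat (m + n) * (of_nat m + of_nat n) = (- 1 :: complex)"
  proof -
    have "of_nat (m + n) ~= (0 :: complex)" using mn by (simp only: of_nat_eq_0_iff)
    then show ?thesis by (simp add: field_simps)
  qed
  finally have g: "gam m n ?z ?z (yv ^ (n - 1)) (xv ^ (m - 1)) = - (xv ^ (m - 1) * yv ^ (n - 1))"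
    by (simp add: cst_simps)
  have xx: "xv * xv ^ (m - 1) = xv ^ m" "yv * yv ^ (n - 1) = yv ^ n"
    using mn by (simp_all add: power_Suc[symmetric] del: power_Suc)
  have z: "xv * gam m n ?z ?z (yv ^ (n - 1)) (xv ^ (m - 1)) + yv ^ (n - 1) * lx (pr m ?z) = 0"
    "yv * gam m n ?z ?z (yv ^ (n - 1)) (xv ^ (m - 1)) + xv ^ (m - 1) * ly (pr n ?z) = 0"
    unfolding g lx_pr_0 ly_pr_0 xx[symmetric] by (simp_all add: algebra_simps)
  have "bdi (int (m - 1) * 1 + int (n - 1) * 1) (xv ^ (m - 1) * yv ^ (n - 1))"
    by (intro bdi_mult bdi_power bdi_xv bdi_yv)
  moreover have "int (m - 1) * 1 + int (n - 1) * 1 = int (m + n - 2)" using mn by (simp add: of_nat_diff)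
  ultimately have "bdi (int (m + n - 2)) (- (xv ^ (m - 1) * yv ^ (n - 1)))"
    using bdi_diff[OF bdi_0] by (metis diff_0)
  then have "(yv ^ (n - 1), xv ^ (m - 1)) \<in> KK m n ?z ?z (m + n - 2)"
    unfolding KK_def mem_Collect_eq case_prod_conv z by (simp only: g bdi_0 simp_thms)
  then show ?thesis using KK_indep by blast
qed

text \<open>The cofactors are constants, and they occur with nonzero factors as coefficients of \<open>x^m\<close> and \<open>y^n\<close>.\<close>
lemma KK_low:
  assumes mn: "2 <= m" "m <= n" "k < m" and K: "(\<alpha>, \<beta>) \<in> KK m n r s k"
  shows "\<alpha> = 0 & \<beta> = 0"
proof -
  let ?z = "\<lambda>_::nat. 0::complex"
  have K0: "(\<alpha>, \<beta>) \<in> KK m n ?z ?z k" using K KK_indep by blast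
  have "bdi 0 \<alpha>" "bdi 0 \<beta>" using KK_bdi[OF K] mn by (auto elim: bdi_mono)
  then have "cf \<alpha> i j = (if i = 0 & j = 0 then cf \<alpha> 0 0 else 0)" "cf \<beta> i j = (if i = 0 & j = 0 then cf \<beta> 0 0 else 0)" for i j
    by (auto simp: bdi_def)
  moreover have "cf (cst c) i j = (if i = 0 & j = 0 then c else 0)" for c i j
    by (auto simp: cst_def coeff_pCons split: nat.splits)
  ultimately have c: "\<alpha> = cst (cf \<alpha> 0 0)" "\<beta> = cst (cf \<beta> 0 0)" by (intro bp_eqI, metis)+
  define u where "u = cf \<alpha> 0 0"
  define v where "v = cf \<beta> 0 0"
  let ?d = "of_nat (m + n) :: complex"
  have d: "?d ~= 0" using mn by (simp only: of_nat_eq_0_iff)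
  have xx: "xv * xv ^ (m - 1) = xv ^ m" "yv * yv ^ (n - 1) = yv ^ n"
    using mn by (simp_all add: power_Suc[symmetric] del: power_Suc)
  have g: "gam m n ?z ?z \<alpha> \<beta> = cst (- u * of_nat m / ?d) * xv ^ (m - 1) + cst (- v * of_nat n / ?d) * yv ^ (n - 1)"
  proof -
    have "- u * of_nat m / ?d = - 1 / ?d * (u * of_nat m)" "- v * of_nat n / ?d = - 1 / ?d * (v * of_nat n)" by simp_all
    then show ?thesis using mn
      by (simp only: gam_def c(1)[folded u_def] c(2)[folded v_def] lx_dpr_0 ly_dpr_0 cst_simps) (simp add: lx_dpr_0 ly_dpr_0 algebra_simps)
  qed
  have "xv * gam m n ?z ?z \<alpha> \<beta> + \<alpha> * lx (pr m ?z)
      = cst (- u * of_nat m / ?d) * (xv ^ m * yv ^ 0) + cst (- v * of_nat n / ?d) * (xv ^ 1 * yv ^ (n - 1)) + cst u * (xv ^ m * yv ^ 0)"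
    unfolding g lx_pr_0 xx[symmetric] using c(1)[folded u_def] by (simp add: algebra_simps)
  then have x: "cf (xv * gam m n ?z ?z \<alpha> \<beta> + \<alpha> * lx (pr m ?z)) m 0 = - u * of_nat m / ?d + u"
    using mn by (simp only: coeff_add cf_term) simp
  have "yv * gam m n ?z ?z \<alpha> \<beta> + \<beta> * ly (pr n ?z)
      = cst (- u * of_nat m / ?d) * (xv ^ (m - 1) * yv ^ 1) + cst (- v * of_nat n / ?d) * (xv ^ 0 * yv ^ n) + cst v * (xv ^ 0 * yv ^ n)"
    unfolding g ly_pr_0 xx[symmetric] using c(2)[folded v_def] by (simp add: algebra_simps)
  then have y: "cf (yv * gam m n ?z ?z \<alpha> \<beta> + \<beta> * ly (pr n ?z)) 0 n = - v * of_nat n / ?d + v"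
    using mn by (simp only: coeff_add cf_term) simp
  have "- u * of_nat m / ?d + u = 0" "- v * of_nat n / ?d + v = 0"
    using K0 mn unfolding x[symmetric] y[symmetric] KK_def bdi_def by auto
  then have "u * of_nat n = 0" "v * of_nat m = 0" using d by (simp_all add: field_simps)
  then show ?thesis using c mn by (simp add: u_def v_def cst_simps)
qed

locale two_pencil_form = frame +
  fixes m n :: nat and r s :: "nat => complex" and C :: complex and f :: S
  assumes mn: "2 <= m" "2 <= n" and r: "inj_on r {..<m}" and s: "inj_on s {..<n}" and C: "C ~= 0"
    and fh: "f \<in> homog (m + n)" and df: "dh f = cst C * (lx (pr m r) * ly (pr n s))"
begin

abbreviation "AA \<equiv> lx (pr m r)"
abbreviation "BB \<equiv> ly (pr n s)"
abbreviation "A1 \<equiv> lx (pderiv (pr m r))"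
abbreviation "B1 \<equiv> ly (pderiv (pr n s))"
abbreviation "dd \<equiv> cst (of_nat (m + n))"

lemma dh_jac_f: "dh (jac f \<theta>) = cst C * (co a \<theta> * (A1 * BB) + co b \<theta> * (AA * B1)
    + co w \<theta> * (dd * (AA * BB) - xv * (A1 * BB) - yv * (AA * B1)))"
proof -
  have 1: "Dx (dh f) = cst C * (A1 * BB)" by (simp add: df Dx_mult Dx_lx Dx_ly)
  have 2: "pderiv (dh f) = cst C * (AA * B1)" by (simp add: df pderiv_mult Dy_lx Dy_ly mult.commute)
  show ?thesis unfolding dh_jac[OF fh] Dw_def 1 2 unfolding df by (simp add: algebra_simps)
qed

lemma homog_jac:
  assumes "F \<in> homog q" "hom3 k \<theta>"
  shows "jac F \<theta> \<in> homog (k + (q - 1))"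
  unfolding jac_def using assms by (intro homog_sum homog_mult homog_pderiv) (simp_all add: hom3_def)

lemma jac_zero_iff: "hom3 k \<theta> ==> jac f \<theta> = 0 \<longleftrightarrow> dh (jac f \<theta>) = 0"
  using dh_inj[OF homog_jac[OF fh]] by (auto simp: dh_simps)

definition Psi :: "nat => bp => bp => S^3" where
  "Psi k \<alpha> \<beta> = mk k (xv * gam m n r s \<alpha> \<beta> + \<alpha> * AA) (yv * gam m n r s \<alpha> \<beta> + \<beta> * BB) (gam m n r s \<alpha> \<beta>)"

lemma hom3_Psi: "hom3 k (Psi k \<alpha> \<beta>)"
  by (simp add: Psi_def hom3_mk)

lemma co_Psi:
  assumes "(\<alpha>, \<beta>) \<in> KK m n r s k"
  shows "co a (Psi k \<alpha> \<beta>) = xv * gam m n r s \<alpha> \<beta> + \<alpha> * AA"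
    "co b (Psi k \<alpha> \<beta>) = yv * gam m n r s \<alpha> \<beta> + \<beta> * BB" "co w (Psi k \<alpha> \<beta>) = gam m n r s \<alpha> \<beta>"
  unfolding Psi_def using assms by (auto simp: KK_def intro: co_mk)

lemma dd_gam: "dd * gam m n r s \<alpha> \<beta> = - (\<alpha> * A1 + \<beta> * B1)"
proof -
  have "of_nat (m + n) * (- 1 / of_nat (m + n)) = (- 1 :: complex)"
    using mn by (simp del: of_nat_add)
  then have "cst (of_nat (m + n)) * cst (- 1 / of_nat (m + n)) = - 1" by (simp only: cst_simps(2)[symmetric]) (simp add: cst_simps)
  then show ?thesis unfolding gam_def mult.assoc[symmetric] by simp
qed

lemma Psi_syzygy:
  assumes "(\<alpha>, \<beta>) \<in> KK m n r s k"
  shows "jac f (Psi k \<alpha> \<beta>) = 0"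
proof -
  let ?g = "gam m n r s \<alpha> \<beta>"
  have "dh (jac f (Psi k \<alpha> \<beta>)) = cst C * (AA * BB * (\<alpha> * A1 + \<beta> * B1 + dd * ?g))"
    unfolding dh_jac_f co_Psi[OF assms] by (simp add: algebra_simps)
  then show ?thesis unfolding dd_gam jac_zero_iff[OF hom3_Psi] by simp
qed

lemma div_A:
  assumes "E * (A1 * BB) = X * AA"
  shows "\<exists>\<alpha>. E = \<alpha> * AA"
proof (rule dvd_lx_pr[OF r])
  fix i assume i: "i < m"
  have "ax (r i) E * ([:poly (pderiv (pr m r)) (r i):] * pr n s) = 0"
    using arg_cong[OF assms, of "ax (r i)"] i by (simp add: ax_mult ax_lx ax_ly pr_root)
  then show "ax (r i) E = 0" using pr_simple[OF r i] by auto
qed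

lemma div_B:
  assumes "E * (AA * B1) = X * BB"
  shows "\<exists>\<beta>. E = \<beta> * BB"
proof (rule dvd_ly_pr[OF s])
  fix j assume j: "j < n"
  have "poly E [:s j:] * (pr m r * [:poly (pderiv (pr n s)) (s j):]) = 0"
    using arg_cong[OF assms, of "\<lambda>P. poly P [:s j:]"] j by (simp add: ay_lx ay_ly pr_root)
  then show "poly E [:s j:] = 0" using pr_simple[OF s j] by auto
qed

lemma AA_nz: "AA ~= 0" "BB ~= 0"
  by simp_all

lemma cst_nz: "c ~= 0 ==> cst c ~= 0"
  by (simp add: cst_def)

lemma syzygy_Psi:
  assumes h: "hom3 k \<theta>" and z: "jac f \<theta> = 0"
  obtains \<alpha> \<beta> where "(\<alpha>, \<beta>) \<in> KK m n r s k" "\<theta> = Psi k \<alpha> \<beta>"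
proof -
  let ?c = "co w \<theta>"
  have "cst C * (co a \<theta> * (A1 * BB) + co b \<theta> * (AA * B1) + ?c * (dd * (AA * BB) - xv * (A1 * BB) - yv * (AA * B1))) = 0"
    using z dh_jac_f[of \<theta>] by (simp add: dh_simps)
  then have e: "co a \<theta> * (A1 * BB) + co b \<theta> * (AA * B1) + ?c * (dd * (AA * BB) - xv * (A1 * BB) - yv * (AA * B1)) = 0"
    using cst_nz[OF C] by simp
  have "(co a \<theta> - xv * ?c) * (A1 * BB) = (- ((co b \<theta> - yv * ?c) * B1 + dd * ?c * BB)) * AA"
    using e by (simp add: algebra_simps add_eq_0_iff)
  then obtain \<alpha> where al: "co a \<theta> - xv * ?c = \<alpha> * AA" using div_A by blast
  have "(co b \<theta> - yv * ?c) * (AA * B1) = (- ((co a \<theta> - xv * ?c) * A1 + dd * ?c * AA)) * BB"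
    using e by (simp add: algebra_simps add_eq_0_iff)
  then obtain \<beta> where be: "co b \<theta> - yv * ?c = \<beta> * BB" using div_B by blast
  have a': "co a \<theta> = xv * ?c + \<alpha> * AA" and b': "co b \<theta> = yv * ?c + \<beta> * BB" using al be by (simp_all add: algebra_simps)
  have "AA * BB * (\<alpha> * A1 + \<beta> * B1 + dd * ?c) = 0"
    using e unfolding a' b' by (simp add: algebra_simps)
  then have "\<alpha> * A1 + \<beta> * B1 + dd * ?c = 0" using AA_nz by (simp only: mult_eq_0_iff) simp
  then have "dd * ?c = - (\<alpha> * A1 + \<beta> * B1)" by (metis add.commute eq_neg_iff_add_eq_0)
  then have "dd * ?c = dd * gam m n r s \<alpha> \<beta>" unfolding dd_gam .
  moreover have "dd ~= 0" using mn by (intro cst_nz) (simp del: of_nat_add)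
  ultimately have c: "?c = gam m n r s \<alpha> \<beta>" by simp
  have K: "(\<alpha>, \<beta>) \<in> KK m n r s k"
    unfolding KK_def mem_Collect_eq case_prod_conv c[symmetric] a'[symmetric] b'[symmetric] by (intro conjI bdi_co[OF h])
  moreover have "\<theta> = Psi k \<alpha> \<beta>"
    by (rule hom3_eqI[OF h hom3_Psi]) (simp_all add: co_Psi[OF K] c a' b')
  ultimately show thesis by (rule that)
qed

lemma Psi_inj:
  assumes "(\<alpha>, \<beta>) \<in> KK m n r s k" "Psi k \<alpha> \<beta> = 0"
  shows "\<alpha> = 0" "\<beta> = 0"
proof -
  have z: "co v 0 = 0" for v by (simp add: co_def dh_simps)
  have "gam m n r s \<alpha> \<beta> = 0" "xv * gam m n r s \<alpha> \<beta> + \<alpha> * AA = 0" "yv * gam m n r s \<alpha> \<beta> + \<beta> * BB = 0"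
    using co_Psi[OF assms(1)] by (simp_all add: assms(2) z)
  then show "\<alpha> = 0" "\<beta> = 0" by simp_all
qed

lemma no_small_syzygy:
  assumes "m <= n" "k < m" "hom3 k \<theta>" "jac f \<theta> = 0"
  shows "\<theta> = 0"
proof -
  obtain \<alpha> \<beta> where K: "(\<alpha>, \<beta>) \<in> KK m n r s k" "\<theta> = Psi k \<alpha> \<beta>" using syzygy_Psi[OF assms(3,4)] .
  have "\<alpha> = 0" "\<beta> = 0" using KK_low[OF mn(1) assms(1,2) K(1)] by simp_all
  then show ?thesis
    unfolding K(2) Psi_def by (simp add: gam_def mk_def hz_def vec_ext)
qed

lemma AR_jac: "AR f = {\<theta>. jac f \<theta> = 0}"
  by (simp add: AR_def jac_def)

lemma mdr_value:
  assumes "m <= n"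
  shows "mdr f = m"
  unfolding mdr_def
proof (rule Least_equality)
  have K: "(1, 0) \<in> KK m n r s m" using KK_first mn by blast
  show "\<exists>\<theta>\<in>AR f. \<theta> ~= 0 & (ALL i. \<theta> $ i \<in> homog m)"
    using Psi_syzygy[OF K] Psi_inj(1)[OF K] hom3_Psi[of m 1 0]
    by (intro bexI[of _ "Psi m 1 0"]) (auto simp: AR_jac hom3_def)
next
  fix k assume "\<exists>\<theta>\<in>AR f. \<theta> ~= 0 & (ALL i. \<theta> $ i \<in> homog k)"
  then show "m <= k" using no_small_syzygy[OF assms, of k] by (auto simp: AR_jac hom3_def not_less[symmetric])
qed

end

section \<open>Reduction modulo a linear form, homogeneous components\<close>

text \<open>Substitution along the projection with centre \<open>c\<close> onto the plane \<open>v = 0\<close>; for \<open>v(c) = 1\<close> its kernel is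
  the ideal generated by the linear form \<open>v\<close>.\<close>
definition kill :: "complex^3 => complex^3 => S => S" where
  "kill v c F = subst (sg 0) (\<lambda>i. sg (sg i 1) 1 - pscale (c $ i) (lin v)) F"

lemmas kill_simps = subst_add[OF chom_S, of "\<lambda>i. sg (sg i 1) 1 - pscale (c $ i) (lin v)", folded kill_def]
    subst_mult[OF chom_S, of "\<lambda>i. sg (sg i 1) 1 - pscale (c $ i) (lin v)", folded kill_def]
    subst_power[OF chom_S, of "\<lambda>i. sg (sg i 1) 1 - pscale (c $ i) (lin v)", folded kill_def]
  for c v

lemma lin_expand: "lin u = pscale (u $ 1) (sg (sg 1 1) 1) + pscale (u $ 2) (sg (sg 2 1) 1) + pscale (u $ 3) (sg (sg 3 1) 1)"
  by (simp add: lin_def sum_3 pscale_conv_mult mult_single)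

lemma kill_lin: "kill v c (lin u) = lin u - pscale (dot u c) (lin v)"
proof -
  have "kill v c (lin u) = sg 0 (u $ 1) * (sg (sg 1 1) 1 - sg 0 (c $ 1) * lin v)
     + sg 0 (u $ 2) * (sg (sg 2 1) 1 - sg 0 (c $ 2) * lin v) + sg 0 (u $ 3) * (sg (sg 3 1) 1 - sg 0 (c $ 3) * lin v)"
    unfolding kill_def subst_lin[OF chom_S] pscale_conv_mult ..
  also have "\<dots> = (sg 0 (u $ 1) * sg (sg 1 1) 1 + sg 0 (u $ 2) * sg (sg 2 1) 1 + sg 0 (u $ 3) * sg (sg 3 1) 1)
      - (sg 0 (u $ 1) * sg 0 (c $ 1) + sg 0 (u $ 2) * sg 0 (c $ 2) + sg 0 (u $ 3) * sg 0 (c $ 3)) * lin v"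
    by (simp only: algebra_simps)
  also have "\<dots> = lin u - sg 0 (dot u c) * lin v"
    by (simp add: lin_expand[of u] pscale_conv_mult dot_def mult_single single_add)
  finally show ?thesis by (simp only: pscale_conv_mult)
qed

lemma lin_dvd_minus_kill: "lin v dvd F - kill v c F"
proof -
  let ?x = "\<lambda>i. sg (sg i 1) 1 :: S" and ?k = "\<lambda>i. sg (sg i 1) 1 - pscale (c $ i) (lin v)"
  have x: "pmon ?x m = sg m 1" for m
    by (induction m rule: exponent_induct) (simp_all add: pmon_add mult_single)
  have d: "lin v dvd pmon ?x m - pmon ?k m" for m
  proof (induction m rule: exponent_induct)
    case (step m j)
    have "pmon ?x (m + sg j 1) - pmon ?k (m + sg j 1) = (pmon ?x m - pmon ?k m) * ?x j + pmon ?k m * (sg 0 (c $ j) * lin v)"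
      by (simp add: pmon_add pscale_conv_mult algebra_simps)
    then show ?case using step by (simp add: dvd_add dvd_mult dvd_mult2)
  qed simp
  have "F = (\<Sum>m\<in>kys F. sg 0 (lk F m) * pmon ?x m)"
    unfolding x by (subst poly_mapping_decompose) (simp add: mult_single)
  then have "F - kill v c F = (\<Sum>m\<in>kys F. sg 0 (lk F m) * (pmon ?x m - pmon ?k m))"
    unfolding kill_def subst_def by (simp add: right_diff_distrib sum_subtractf)
  then show ?thesis using d by (simp add: dvd_sum)
qed

lemma lin_dvd_iff_kill:
  assumes "dot v c = 1"
  shows "lin v dvd F \<longleftrightarrow> kill v c F = 0"
proof
  assume "lin v dvd F"
  then obtain G where "F = lin v * G" by (auto elim: dvdE)
  then show "kill v c F = 0" by (simp add: kill_simps kill_lin assms)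
next
  assume "kill v c F = 0"
  then show "lin v dvd F" using lin_dvd_minus_kill[of v F c] by simp
qed

lemma lin_power_dvd_cancel:
  assumes v: "dot v c = 1" and u: "dot u c = 0" "u ~= 0" and d: "lin v ^ k dvd lin u ^ l * F"
  shows "lin v ^ k dvd F"
  using d
proof (induction k arbitrary: F)
  case (Suc k)
  have "lin v dvd lin u ^ l * F" using Suc.prems by (rule dvd_trans[rotated]) simp
  then have "kill v c (lin u) ^ l * kill v c F = 0" unfolding lin_dvd_iff_kill[OF v] by (simp add: kill_simps)
  then have "kill v c F = 0" using u by (simp add: kill_lin)
  then obtain G where G: "F = lin v * G" using lin_dvd_iff_kill[OF v] by (auto elim: dvdE)
  have "lin v ~= 0" using v by (auto simp: dot_def)
  moreover have "lin v * lin v ^ k dvd lin v * (lin u ^ l * G)" using Suc.prems unfolding G by (simp add: mult.left_commute)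
  ultimately have "lin v ^ k dvd lin u ^ l * G" by simp
  then have "lin v ^ k dvd G" by (rule Suc.IH)
  then show ?case unfolding G power_Suc by (rule mult_dvd_mono[OF dvd_refl])
qed simp

definition hc :: "nat => S => S" where
  "hc k F = (\<Sum>m\<in>{m\<in>kys F. mdeg m = k}. sg m (lk F m))"

lemma lookup_hc: "lk (hc k F) m = (if mdeg m = k then lk F m else 0)"
proof -
  have "lk (hc k F) m = (\<Sum>n\<in>{n\<in>kys F. mdeg n = k}. if n = m then lk F m else 0)"
    unfolding hc_def lookup_sum by (intro sum.cong) (auto simp: lookup_single when_def)
  also have "\<dots> = (if mdeg m = k then lk F m else 0)" by (simp add: in_keys_iff)
  finally show ?thesis .
qed

lemma hc_homog: "hc k F \<in> homog k"
  by (rule homogI) (auto simp: lookup_hc split: if_splits)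

lemma hc_add: "hc k (F + G) = hc k F + hc k G"
  by (rule poly_mapping_eqI) (simp add: lookup_hc lookup_add)

lemma hc_id: "F \<in> homog k ==> hc k F = F"
  by (rule poly_mapping_eqI) (auto simp: lookup_hc dest: homog_lookup)

lemma hc_sum: "hc k (\<Sum>i\<in>A. F i) = (\<Sum>i\<in>A. hc k (F i))"
  by (rule poly_mapping_eqI) (simp add: lookup_hc lookup_sum)

lemma hc_mult:
  assumes G: "G \<in> homog e"
  shows "hc (k + e) (F * G) = hc k F * G"
proof -
  define R where "R = F - hc k F"
  have R: "mdeg n ~= k" if "n \<in> kys R" for n
    using that by (auto simp: R_def in_keys_iff lookup_minus lookup_hc)
  have "hc (k + e) (R * G) = 0"
  proof (rule poly_mapping_eqI)
    fix p
    have "mdeg p ~= k + e" if p: "p \<in> kys (R * G)"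
    proof -
      have "p \<in> {x + y | x y. x \<in> kys R & y \<in> kys G}" using p keys_mult[of R G] by blast
      then obtain x y where "p = x + y" "x \<in> kys R" "y \<in> kys G" by blast
      then show ?thesis using R G by (auto simp: mdeg_add homog_def)
    qed
    then show "lk (hc (k + e) (R * G)) p = lk 0 p" by (auto simp: lookup_hc in_keys_iff)
  qed
  moreover have "F * G = hc k F * G + R * G" by (simp add: R_def algebra_simps)
  moreover have "hc (k + e) (hc k F * G) = hc k F * G" by (rule hc_id[OF homog_mult[OF hc_homog G]])
  ultimately show ?thesis by (simp add: hc_add)
qed

section \<open>Non-freeness\<close>

context two_pencil_form
begin

lemma hc_syzygy:
  assumes "jac f \<theta> = 0"
  shows "jac f (\<chi> i. hc k (\<theta> $ i)) = 0"
proof -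
  have p: "pderiv_mpoly i f \<in> homog (m + n - 1)" for i by (rule homog_pderiv[OF fh])
  have "jac f (\<chi> i. hc k (\<theta> $ i)) = hc (k + (m + n - 1)) (jac f \<theta>)"
    unfolding jac_def hc_sum hc_mult[OF p] by simp
  then show ?thesis using assms by (simp add: hc_def)
qed

lemma co_smult: "co v (G *s \<theta>) = dh G * co v \<theta>"
  by (simp add: co_def dh_simps sum_distrib_left algebra_simps)

lemma co_add: "co v (\<theta> + \<theta>') = co v \<theta> + co v \<theta>'"
  by (simp add: co_def dh_simps sum.distrib algebra_simps)

lemma syzygy_relation:
  "lin w *s Psi (m + n - 2) (yv ^ (n - 1)) (xv ^ (m - 1))
     = lin b ^ (n - 1) *s Psi m 1 0 + lin a ^ (m - 1) *s Psi n 0 1"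
proof (rule hom3_eqI)
  have e: "m + n - 2 + 1 = m + n - 1" "n - 1 + m = m + n - 1" "m - 1 + n = m + n - 1" using mn by simp_all
  have pw: "lin b ^ (n - 1) \<in> homog (n - 1)" "lin a ^ (m - 1) \<in> homog (m - 1)"
    using homog_power[OF homog_lin, of b "n - 1"] homog_power[OF homog_lin, of a "m - 1"] by simp_all
  note h = hom3_Psi[unfolded hom3_def, rule_format]
  show "hom3 (m + n - 1) (lin w *s Psi (m + n - 2) (yv ^ (n - 1)) (xv ^ (m - 1)))"
    unfolding hom3_def using homog_mult[OF h[of "m + n - 2"] homog_lin[of w]] by (simp add: e[simplified] mult.commute)
  show "hom3 (m + n - 1) (lin b ^ (n - 1) *s Psi m 1 0 + lin a ^ (m - 1) *s Psi n 0 1)"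
    unfolding hom3_def using homog_mult[OF pw(1) h[of m]] homog_mult[OF pw(2) h[of n]]
    by (auto intro!: homog_add simp: e[simplified])
  have g: "gam m n r s (yv ^ (n - 1)) (xv ^ (m - 1)) = yv ^ (n - 1) * gam m n r s 1 0 + xv ^ (m - 1) * gam m n r s 0 1"
    by (simp add: gam_def algebra_simps)
  note K = co_Psi[OF KK_third[OF mn]] co_Psi[OF KK_first[OF mn]] co_Psi[OF KK_second[OF mn]]
  show "co a (lin w *s Psi (m + n - 2) (yv ^ (n - 1)) (xv ^ (m - 1))) = co a (lin b ^ (n - 1) *s Psi m 1 0 + lin a ^ (m - 1) *s Psi n 0 1)"
    "co b (lin w *s Psi (m + n - 2) (yv ^ (n - 1)) (xv ^ (m - 1))) = co b (lin b ^ (n - 1) *s Psi m 1 0 + lin a ^ (m - 1) *s Psi n 0 1)"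
    "co w (lin w *s Psi (m + n - 2) (yv ^ (n - 1)) (xv ^ (m - 1))) = co w (lin b ^ (n - 1) *s Psi m 1 0 + lin a ^ (m - 1) *s Psi n 0 1)"
    unfolding co_smult co_add K dh_simps dh_basis g by (simp_all add: algebra_simps)
qed

text \<open>Reducing the relation between the three syzygies modulo \<open>w\<close> shows that \<open>a^(m - 1)\<close> divides each
  coordinate of \<open>\<theta>1\<close> modulo \<open>w\<close>. Mapping back and comparing components of degree \<open>m\<close> expresses
  \<open>\<theta>1\<close> by syzygies of degrees \<open>1\<close> and \<open>m - 1\<close>, which vanish; this is where \<open>m \<ge> 2\<close> enters.\<close>
lemma not_free:
  assumes "m <= n"
  shows "\<not> free_arrangement f"
proof
  assume "free_arrangement f"
  then obtain \<phi> :: "S^2 => S^3" where hom: "module_hom (*s) (*s) \<phi>" and bij: "bij_betw \<phi> UNIV (AR f)"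
    unfolding free_arrangement_def by blast
  have ad: "\<phi> (x + y) = \<phi> x + \<phi> y" and sc: "\<phi> (G *s x) = G *s \<phi> x" for x y G
    using module_hom.add[OF hom] module_hom.scale[OF hom] by auto
  have inj: "\<phi> x = \<phi> y ==> x = y" for x y using bij by (auto simp: bij_betw_def inj_on_def)
  have img: "EX x. \<phi> x = \<theta>" if "jac f \<theta> = 0" for \<theta>
  proof -
    have "\<theta> \<in> range \<phi>" using bij that by (simp add: bij_betw_def AR_jac)
    then show ?thesis by auto
  qed
  have syz: "jac f (\<phi> x) = 0" for x
  proof -
    have "\<phi> x \<in> AR f" using bij by (auto simp: bij_betw_def)
    then show ?thesis by (simp add: AR_jac)
  qed
  obtain u1 where u1: "\<phi> u1 = Psi m 1 0" using img[OF Psi_syzygy[OF KK_first[OF mn]]] by blast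
  obtain u2 where u2: "\<phi> u2 = Psi n 0 1" using img[OF Psi_syzygy[OF KK_second[OF mn]]] by blast
  obtain u3 where u3: "\<phi> u3 = Psi (m + n - 2) (yv ^ (n - 1)) (xv ^ (m - 1))"
    using img[OF Psi_syzygy[OF KK_third[OF mn]]] by blast
  have "\<phi> (lin w *s u3) = \<phi> (lin b ^ (n - 1) *s u1 + lin a ^ (m - 1) *s u2)"
    unfolding ad sc u1 u2 u3 by (rule syzygy_relation)
  then have rel: "lin w *s u3 = lin b ^ (n - 1) *s u1 + lin a ^ (m - 1) *s u2" by (rule inj)
  have dots: "dot w cw = 1" "dot a cw = 0" "dot b cw = 0" "dot a ca = 1" "dot b ca = 0" "dot b cb = 1"
    using db by (simp_all add: dual_basis_def)
  have bnz: "b ~= 0" using dots by (auto simp: dot_def)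
  have "EX p q. u1 $ c = lin a ^ (m - 1) * p + lin w * q" for c
  proof -
    have "lin w * u3 $ c = lin b ^ (n - 1) * u1 $ c + lin a ^ (m - 1) * u2 $ c"
      using arg_cong[OF rel, of "\<lambda>x. x $ c"] by simp
    then have "kill w cw (lin w * u3 $ c) = kill w cw (lin b ^ (n - 1) * u1 $ c + lin a ^ (m - 1) * u2 $ c)" by (rule arg_cong)
    then have "0 = lin b ^ (n - 1) * kill w cw (u1 $ c) + lin a ^ (m - 1) * kill w cw (u2 $ c)"
      by (simp add: kill_simps kill_lin dots)
    then have "lin b ^ (n - 1) * kill w cw (u1 $ c) = lin a ^ (m - 1) * (- kill w cw (u2 $ c))"
      by (simp add: eq_neg_iff_add_eq_0)
    then have "lin a ^ (m - 1) dvd lin b ^ (n - 1) * kill w cw (u1 $ c)" by simp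
    then have "lin a ^ (m - 1) dvd kill w cw (u1 $ c)" by (rule lin_power_dvd_cancel[OF dots(4,5) bnz])
    then obtain p where p: "kill w cw (u1 $ c) = lin a ^ (m - 1) * p" by (auto elim: dvdE)
    obtain q where q: "u1 $ c - kill w cw (u1 $ c) = lin w * q" using lin_dvd_minus_kill[of w "u1 $ c" cw] by (auto elim: dvdE)
    have "u1 $ c = lin a ^ (m - 1) * p + lin w * q" using p q by (simp add: algebra_simps)
    then show ?thesis by blast
  qed
  then obtain p q where pq: "!!c. u1 $ c = lin a ^ (m - 1) * p c + lin w * q c" by metis
  define P where "P = \<phi> (\<chi> c. p c)"
  define Q where "Q = \<phi> (\<chi> c. q c)"
  have "u1 = lin a ^ (m - 1) *s (\<chi> c. p c) + lin w *s (\<chi> c. q c)"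
    using pq by (simp add: vec_ext)
  then have t1: "Psi m 1 0 = lin a ^ (m - 1) *s P + lin w *s Q" using u1 by (simp add: ad sc P_def Q_def)
  have P0: "hc 1 (P $ i) = 0" for i
  proof -
    have "(\<chi> i. hc 1 (P $ i)) = 0"
      by (rule no_small_syzygy[OF assms, of 1]) (use mn hc_syzygy[OF syz] in \<open>auto simp: hom3_def hc_homog P_def\<close>)
    then show ?thesis by (simp add: vec_ext)
  qed
  have Q0: "hc (m - 1) (Q $ i) = 0" for i
  proof -
    have "(\<chi> i. hc (m - 1) (Q $ i)) = 0"
      by (rule no_small_syzygy[OF assms, of "m - 1"]) (use mn hc_syzygy[OF syz] in \<open>auto simp: hom3_def hc_homog Q_def\<close>)
    then show ?thesis by (simp add: vec_ext)
  qed
  have "Psi m 1 0 $ i = 0" for i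
  proof -
    have h: "Psi m 1 0 $ i \<in> homog m" using hom3_Psi by (simp add: hom3_def)
    have pw: "lin a ^ (m - 1) \<in> homog (m - 1)" using homog_power[OF homog_lin, of a "m - 1"] by simp
    have "Psi m 1 0 $ i = hc m (P $ i * lin a ^ (m - 1) + Q $ i * lin w)"
      using hc_id[OF h] by (simp add: t1 mult.commute)
    also have "\<dots> = hc (1 + (m - 1)) (P $ i * lin a ^ (m - 1)) + hc (m - 1 + 1) (Q $ i * lin w)"
      using mn by (simp add: hc_add)
    also have "\<dots> = hc 1 (P $ i) * lin a ^ (m - 1) + hc (m - 1) (Q $ i) * lin w"
      by (simp only: hc_mult[OF pw] hc_mult[OF homog_lin])
    also have "\<dots> = 0" unfolding P0 Q0 by simp
    finally show ?thesis .
  qed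
  then have "Psi m 1 0 = 0" by (simp add: vec_ext)
  then show False using Psi_inj(1)[OF KK_first[OF mn]] by auto
qed

end

section \<open>Linear algebra\<close>

context vector_space
begin

lemma finite_frame:
  assumes T: "finite T" "H \<subseteq> span T" and H: "subspace H"
  shows "\<exists>(N :: nat) (e :: nat => 'b). (\<forall>i<N. e i \<in> H) & (\<forall>z\<in>H. EX x. z = (\<Sum>i<N. scale (x i) (e i))) &
    (ALL x. (\<Sum>i<N. scale (x i) (e i)) = 0 --> (\<forall>i<N. x i = 0))"
proof -
  obtain B where B: "B \<subseteq> H" "independent B" "H \<subseteq> span B" using basis_exists[of H] by metis
  have fin: "finite B" using independent_span_bound[OF T(1) B(2)] B(1) T(2) by blast
  obtain e where e: "bij_betw e {..<card B} B" using ex_bij_betw_nat_finite[OF fin] by (auto simp: atLeast0LessThan)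
  show ?thesis
  proof (intro exI[of _ "card B"] exI[of _ e] conjI)
    show "\<forall>i<card B. e i \<in> H" using e B(1) by (auto simp: bij_betw_def)
    show "\<forall>z\<in>H. EX x. z = (\<Sum>i<card B. scale (x i) (e i))"
    proof
      fix z assume "z \<in> H"
      then have "z \<in> span B" using B(3) by blast
      then obtain u where u: "z = (\<Sum>v\<in>B. scale (u v) v)" unfolding span_finite[OF fin] by auto
      have "z = (\<Sum>i<card B. scale (u (e i)) (e i))" unfolding u by (rule sum.reindex_bij_betw[OF e, symmetric])
      then show "EX x. z = (\<Sum>i<card B. scale (x i) (e i))" by (rule exI[of _ "\<lambda>i. u (e i)"])
    qed
    show "ALL x. (\<Sum>i<card B. scale (x i) (e i)) = 0 --> (\<forall>i<card B. x i = 0)"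
    proof (intro allI impI)
      fix x i assume s: "(\<Sum>i<card B. scale (x i) (e i)) = 0" and i: "i < card B"
      define u where "u v = x (the_inv_into {..<card B} e v)" for v
      have inj: "inj_on e {..<card B}" using e by (simp add: bij_betw_def)
      have ue: "u (e j) = x j" if "j < card B" for j using that by (simp add: u_def the_inv_into_f_f[OF inj])
      have "(\<Sum>v\<in>B. scale (u v) v) = (\<Sum>i<card B. scale (u (e i)) (e i))" by (rule sum.reindex_bij_betw[OF e, symmetric])
      also have "\<dots> = 0" using s by (simp add: ue)
      finally have "\<forall>v\<in>B. u v = 0" using B(2) dependent_finite[OF fin] by blast
      moreover have "e i \<in> B" using bij_betwE[OF e] i by simp
      ultimately show "x i = 0" using ue[OF i] by simp
    qed
  qed
qed

lemma family_independent:
  fixes q :: nat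
  assumes ind: "!!x. (\<Sum>i<q. scale (x i) (y i)) = 0 ==> \<forall>i<q. x i = 0"
  shows "inj_on y {..<q}" "independent (y ` {..<q})"
proof -
  show inj: "inj_on y {..<q}"
  proof (rule inj_onI, rule ccontr)
    fix i j assume ij: "i \<in> {..<q}" "j \<in> {..<q}" "y i = y j" "i ~= j"
    have d: "(\<Sum>k<q. scale (if k = i then 1 else 0) (y k)) = y i" if "i < q" for i
      using that by (simp add: if_distrib[of "\<lambda>c. scale c _"] cong: if_cong)
    have "(\<Sum>k<q. scale ((if k = i then 1 else 0) - (if k = j then 1 else 0)) (y k)) = 0"
      using d[of i] d[of j] ij by (simp add: scale_left_diff_distrib sum_subtractf)
    from ind[OF this] ij show False by auto
  qed
  show "independent (y ` {..<q})"
  proof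
    assume "dependent (y ` {..<q})"
    then obtain u where u: "\<exists>v\<in>(y ` {..<q}). u v ~= 0" "(\<Sum>v\<in>(y ` {..<q}). scale (u v) v) = 0" using dependent_finite[of "y ` {..<q}"] by auto
    have "(\<Sum>i<q. scale (u (y i)) (y i)) = 0" using u(2) by (simp add: sum.reindex[OF inj])
    from ind[OF this] u(1) show False by auto
  qed
qed

lemma dual_functionals:
  assumes ind: "!!x. (\<Sum>i<q. scale (x i) (y i)) = 0 ==> \<forall>i<q. x i = 0"
  obtains l :: "nat => 'b => 'a" where "!!a u v. l a (u + v) = l a u + l a v" "!!a c u. l a (scale c u) = c * l a u"
    "!!a b. a < q ==> b < q ==> l a (y b) = (if a = b then 1 else 0)"
proof -
  let ?Y = "y ` {..<q}"
  have inj: "inj_on y {..<q}" and indep: "independent ?Y" using family_independent[where q = q and y = y] ind by auto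
  note E = independent_extend_basis[OF indep] span_extend_basis[OF indep]
  have mem: "y i \<in> extend_basis ?Y" if "i < q" for i using extend_basis_superset[OF indep] that by blast
  show thesis
  proof (rule that[of "\<lambda>a u. representation (extend_basis ?Y) u (y a)"])
    show "representation (extend_basis ?Y) (u + v) (y a) = representation (extend_basis ?Y) u (y a) + representation (extend_basis ?Y) v (y a)" for a u v
      by (subst representation_add[OF E(1)]) (simp_all add: E(2))
    show "representation (extend_basis ?Y) (scale c u) (y a) = c * representation (extend_basis ?Y) u (y a)" for a c u
      by (subst representation_scale[OF E(1)]) (simp_all add: E(2))
    show "representation (extend_basis ?Y) (y b) (y a) = (if a = b then 1 else 0)" if ab: "a < q" "b < q" for a b
      using inj ab by (auto simp: representation_basis[OF E(1) mem[OF ab(2)]] inj_on_def)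
  qed
qed

lemma dim_of_frame:
  fixes N :: nat
  assumes H: "subspace H" and e: "!!i. i < N ==> e i \<in> H"
    and ind: "!!x. (\<Sum>i<N. scale (x i) (e i)) = 0 ==> \<forall>i<N. x i = 0"
    and span: "!!v. v \<in> H ==> EX x c. c ~= 0 & scale c v = (\<Sum>i<N. scale (x i) (e i))"
  shows "dim H = N"
proof -
  have inj: "inj_on e {..<N}" and indep: "independent (e ` {..<N})"
    using family_independent[where q = N and y = e] ind by auto
  have "H \<subseteq> local.span (e ` {..<N})"
  proof
    fix v assume "v \<in> H"
    then obtain x c where c: "c ~= 0" "scale c v = (\<Sum>i<N. scale (x i) (e i))" using span by blast
    have "scale c v \<in> local.span (e ` {..<N})" unfolding c(2) by (intro span_sum span_scale span_base) auto
    then have "scale (inverse c) (scale c v) \<in> local.span (e ` {..<N})" by (rule span_scale)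
    then show "v \<in> local.span (e ` {..<N})" using c(1) by simp
  qed
  then have "dim H = card (e ` {..<N})" using e indep by (intro dim_unique[of "e ` {..<N}"]) auto
  then show ?thesis by (simp add: card_image[OF inj])
qed

end

definition smul :: "complex => S^3 => S^3" where
  "smul c \<eta> = (\<chi> i. pscale c (\<eta> $ i))"

definition pmul :: "complex => bp \<times> bp => bp \<times> bp" where
  "pmul c z = (cst c * fst z, cst c * snd z)"

interpretation VS: vector_space "pscale :: complex => S => S"
  by (rule vector_space_pscale)

interpretation V3: vector_space smul
  by unfold_locales
    (simp_all add: smul_def vec_ext VS.scale_right_distrib VS.scale_left_distrib)

interpretation VP: vector_space pmul
  by unfold_locales (simp_all add: pmul_def prod_eq_iff cst_simps algebra_simps)

section \<open>Linearity of the Jacobian operator\<close>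

lemma pderiv_mpoly_sg: "pderiv_mpoly i (sg m c) = sg (m - sg i 1) (of_nat (lk m i) * c)"
  by (cases "c = 0") (simp_all add: pderiv_mpoly_def)

lemma pderiv_mpoly_sum: "pderiv_mpoly i (\<Sum>x\<in>A. F x) = (\<Sum>x\<in>A. pderiv_mpoly i (F x))"
  by (induction A rule: infinite_finite_induct) (simp_all add: pderiv_mpoly_add, simp_all add: pderiv_mpoly_def)

lemma pderiv_mpoly_pscale: "pderiv_mpoly i (pscale c F) = pscale c (pderiv_mpoly i F)"
  by (simp add: pscale_conv_mult pderiv_mpoly_mult pderiv_mpoly_sg)

lemma jac_add_left: "jac (F + G) \<eta> = jac F \<eta> + jac G \<eta>"
  by (simp add: jac_def pderiv_mpoly_add distrib_left sum.distrib)

lemma jac_pscale_left: "jac (pscale c F) \<eta> = pscale c (jac F \<eta>)"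
  unfolding jac_def pderiv_mpoly_pscale by (simp add: pscale_conv_mult sum_distrib_left mult.left_commute)

lemma jac_0_left: "jac 0 \<eta> = 0"
  using jac_pscale_left[of 0 0 \<eta>] by simp

lemma jac_sum_left: "jac (\<Sum>x\<in>A. F x) \<eta> = (\<Sum>x\<in>A. jac (F x) \<eta>)"
  by (induction A rule: infinite_finite_induct) (simp_all add: jac_add_left jac_0_left)

lemma jac_add: "jac F (\<eta> + \<eta>') = jac F \<eta> + jac F \<eta>'"
  by (simp add: jac_def distrib_right sum.distrib)

lemma jac_smul: "jac F (smul c \<eta>) = pscale c (jac F \<eta>)"
  by (simp add: jac_def smul_def pscale_conv_mult sum_distrib_left mult.assoc)

lemma jac_0: "jac F 0 = 0"
  by (simp add: jac_def)

lemma jac_lincomb: "jac F (\<Sum>i\<in>A. smul (c i) (x i)) = (\<Sum>i\<in>A. pscale (c i) (jac F (x i)))"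
  by (induction A rule: infinite_finite_induct) (simp_all add: jac_add jac_smul jac_0)

lemma hom3_lincomb: "(!!i. i \<in> A ==> hom3 k (x i)) ==> hom3 k (\<Sum>i\<in>A. smul (c i) (x i))"
  by (auto simp: hom3_def smul_def intro!: homog_sum homog_pscale)

lemma jac_expand:
  assumes "h \<in> homog d"
  shows "jac h \<eta> = (\<Sum>m\<in>{m. mdeg m = d}. pscale (lk h m) (jac (sg m 1) \<eta>))"
proof -
  have "h = (\<Sum>m\<in>kys h. pscale (lk h m) (sg m 1))"
    by (subst poly_mapping_decompose) (simp add: pscale_conv_mult mult_single)
  also have "\<dots> = (\<Sum>m\<in>{m. mdeg m = d}. pscale (lk h m) (sg m 1))"
    by (rule homog_sum_monomials[OF assms, of "\<lambda>m c. pscale c (sg m 1)"]) simp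
  finally have "jac h \<eta> = jac (\<Sum>m\<in>{m. mdeg m = d}. pscale (lk h m) (sg m 1)) \<eta>" by simp
  then show ?thesis by (simp only: jac_sum_left jac_pscale_left)
qed

section \<open>A determinantal equation and its differential\<close>

definition ddir :: "S => S => (3 \<Rightarrow>\<^sub>0 nat) mpoly => complex" where
  "ddir f v F = (\<Sum>i\<in>kys v. fev (pderiv_mpoly i F) f * lk v i)"

lemma ddir_sum: "ddir f v (\<Sum>x\<in>A. F x) = (\<Sum>x\<in>A. ddir f v (F x))"
  unfolding ddir_def pderiv_mpoly_sum eval_simps sum_distrib_right by (rule sum.swap)

lemma ddir_mult: "ddir f v (F * G) = ddir f v F * fev G f + fev F f * ddir f v G"
  by (simp add: ddir_def pderiv_mpoly_mult eval_simps sum.distrib sum_distrib_left sum_distrib_right algebra_simps)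

lemma ddir_pscale: "ddir f v (pscale c F) = c * ddir f v F"
  by (simp add: ddir_def pderiv_mpoly_pscale eval_simps sum_distrib_left algebra_simps)

lemma ddir_prod:
  "finite A ==> ddir f v (\<Prod>x\<in>A. F x) = (\<Sum>x\<in>A. ddir f v (F x) * (\<Prod>y\<in>A - {x}. fev (F y) f))"
proof (induction A rule: finite_induct)
  case empty
  show ?case by (simp add: ddir_def pderiv_mpoly_sg[of _ 0 1, simplified] eval_simps)
next
  case (insert a A)
  have "(\<Prod>y\<in>insert a A - {x}. fev (F y) f) = fev (F a) f * (\<Prod>y\<in>A - {x}. fev (F y) f)" if "x \<in> A" for x
  proof -
    have "insert a A - {x} = insert a (A - {x})" using that insert.hyps by auto
    then show ?thesis using insert.hyps by simp
  qed
  moreover have "insert a A - {a} = A" using insert.hyps by auto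
  ultimately show ?case using insert
    by (simp add: ddir_mult eval_simps sum_distrib_left algebra_simps)
qed

lemma ddir_linform:
  assumes "v \<in> homog d"
  shows "ddir f v (linform d \<xi>) = fev (linform d \<xi>) v"
proof -
  have "fev (pderiv_mpoly i (linform d \<xi>)) f = (\<Sum>m\<in>{m. mdeg m = d}. if m = i then \<xi> m else 0)" for i
    unfolding linform_def pderiv_mpoly_sum eval_simps
    by (intro sum.cong) (auto simp: pderiv_mpoly_sg eval_simps lookup_single)
  then have p: "fev (pderiv_mpoly i (linform d \<xi>)) f = (if mdeg i = d then \<xi> i else 0)" for i
    by (simp add: finite_mdeg)
  have "ddir f v (linform d \<xi>) = (\<Sum>i\<in>kys v. \<xi> i * lk v i)"
    unfolding ddir_def p by (rule sum.cong) (use assms in \<open>auto simp: homog_def\<close>)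
  also have "\<dots> = (\<Sum>i\<in>{m. mdeg m = d}. \<xi> i * lk v i)" by (rule homog_sum_monomials[OF assms, of "\<lambda>m c. \<xi> m * c"]) simp
  finally show ?thesis by (simp only: fev_linform)
qed

lemma tangent_ddir: "tangent_cone_space W X f = {v\<in>W. ALL r. \<forall>F\<in>homog r. vanish F X --> ddir f v F = 0}"
  by (simp add: tangent_cone_space_def vanish_def ddir_def)

definition detform :: "nat => (nat => nat => 'v mpoly) => 'v mpoly" where
  "detform q N = (\<Sum>p\<in>{p. p permutes {0..<q}}. pscale (signof p) (\<Prod>i = 0..<q. N i (p i)))"

lemma detform_homog:
  assumes "!!i j. N i j \<in> homog 1"
  shows "detform q N \<in> homog q"
proof -
  have "(\<Prod>i = 0..<q. N i (p i)) \<in> homog (\<Sum>i = 0..<q. 1)" for p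
    by (intro homog_prod) (use assms in simp)
  then show ?thesis unfolding detform_def by (intro homog_sum homog_pscale) simp
qed

lemma detform_eval: "eval_mpoly (detform q N) x = Determinant.det (Matrix.mat q q (\<lambda>(i, j). eval_mpoly (N i j) x))"
proof -
  have c: "Matrix.mat q q (\<lambda>(i, j). eval_mpoly (N i j) x) \<in> carrier_mat q q" by simp
  have "(\<Prod>i = 0..<q. Matrix.mat q q (\<lambda>(i, j). eval_mpoly (N i j) x) $$ (i, p i)) = (\<Prod>i = 0..<q. eval_mpoly (N i (p i)) x)"
    if "p permutes {0..<q}" for p
    by (rule prod.cong) (use permutes_in_image[OF that] in auto)
  then show ?thesis unfolding Determinant.det_def'[OF c] detform_def eval_simps by (intro sum.cong) auto
qed

lemma detform_vanish:
  assumes x: "\<exists>b<q. c b ~= 0" and z: "!!i. i < q ==> (\<Sum>b<q. eval_mpoly (N i b) x * c b) = 0"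
  shows "eval_mpoly (detform q N) x = 0"
proof -
  let ?A = "Matrix.mat q q (\<lambda>(i, j). eval_mpoly (N i j) x)" and ?v = "Matrix.vec q c"
  have "?v ~= 0\<^sub>v q" using x by (auto simp: Matrix.vec_eq_iff)
  moreover have "?A *\<^sub>v ?v = 0\<^sub>v q"
    using z by (auto simp: Matrix.vec_eq_iff mult_mat_vec_def scalar_prod_def atLeast0LessThan)
  ultimately show ?thesis unfolding detform_eval
    by (subst Determinant.det_0_iff_vec_prod_zero[of _ q]) (auto intro!: exI[of _ ?v])
qed

text \<open>At \<open>f\<close> the matrix is diagonal with a single zero in the corner, so only the identity permutation contributes.\<close>
lemma ddir_detform:
  assumes q: "0 < q" and N: "!!i j. i < q ==> j < q ==> fev (N i j) f = (if i = j & 0 < j then 1 else 0)"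
    and D: "!!i. i < q ==> ddir f v (N i 0) = (if i = 0 then 1 else 0)"
  shows "ddir f v (detform q N) = 1"
proof -
  have t: "ddir f v (\<Prod>i = 0..<q. N i (p i)) = (if p = id then 1 else 0)" if p: "p permutes {0..<q}" for p
  proof -
    have e: "ddir f v (\<Prod>i = 0..<q. N i (p i)) = (\<Sum>i = 0..<q. ddir f v (N i (p i)) * (\<Prod>j\<in>{0..<q} - {i}. fev (N j (p j)) f))"
      by (rule ddir_prod) simp
    have pl: "p j < q" if "j < q" for j using permutes_in_image[OF p, of j] that by simp
    show ?thesis
    proof (cases "p = id")
      case True
      have "ddir f v (N i (p i)) * (\<Prod>j\<in>{0..<q} - {i}. fev (N j (p j)) f) = (if i = 0 then 1 else 0)" if i: "i \<in> {0..<q}" for i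
      proof (cases "i = 0")
        case False
        have "fev (N 0 (p 0)) f = 0" using N[of 0 0] q True by simp
        then have "(\<Prod>j\<in>{0..<q} - {i}. fev (N j (p j)) f) = 0" using False q by (intro prod_zero) auto
        then show ?thesis using False by simp
      next
        case i0: True
        have "(\<Prod>j\<in>{0..<q} - {i}. fev (N j (p j)) f) = 1" using N True i0 by (intro prod.neutral) auto
        then show ?thesis using D[of 0] q True i0 by simp
      qed
      then show ?thesis unfolding e using True q by simp
    next
      case False
      have z: "(\<Prod>j\<in>{0..<q} - {i}. fev (N j (p j)) f) = 0" if i: "i \<in> {0..<q}" for i
      proof -
        have "\<exists>j\<in>{0..<q} - {i}. p j ~= j"
        proof (rule ccontr)
          assume n: "\<not> ?thesis"
          have fx: "p j = j" if "j ~= i" for j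
            using n that permutes_not_in[OF p, of j] by (cases "j \<in> {0..<q}") auto
          have "p i = i"
          proof (rule ccontr)
            assume pi: "p i ~= i"
            then have "p (p i) = p i" by (rule fx)
            then show False using pi permutes_inj[OF p] by (auto dest: injD)
          qed
          then have "p = id" using fx by (metis eq_id_iff)
          then show False using False by simp
        qed
        then obtain j where j: "j \<in> {0..<q} - {i}" "p j ~= j" by blast
        then have "fev (N j (p j)) f = 0" using N[of j "p j"] pl[of j] by auto
        then show ?thesis using j by (intro prod_zero) auto
      qed
      have "(\<Sum>i = 0..<q. ddir f v (N i (p i)) * (\<Prod>j\<in>{0..<q} - {i}. fev (N j (p j)) f)) = 0"
        by (intro sum.neutral ballI) (simp only: z mult_zero_right)
      then show ?thesis unfolding e using False by simp
    qed
  qed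
  have "ddir f v (detform q N) = (\<Sum>p\<in>{p. p permutes {0..<q}}. signof p * (if p = id then 1 else 0))"
    unfolding detform_def ddir_sum ddir_pscale by (intro sum.cong) (auto simp: t)
  also have "\<dots> = (\<Sum>p\<in>{id}. signof p * (if p = id then 1 else 0))"
    by (rule sum.mono_neutral_right) (auto simp: finite_permutations permutes_id)
  finally show ?thesis by simp
qed

section \<open>Syzygies deform along tangent vectors\<close>

lemma sum_split: "(\<Sum>i<N + K. F i) = (\<Sum>i<N. F i) + (\<Sum>i<K. F (N + i))" for F :: "nat => 'a::comm_monoid_add"
  by (induction K) (simp_all add: add.assoc)

lemma hom3_smul: "hom3 k \<eta> ==> hom3 k (smul c \<eta>)"
  by (simp add: hom3_def smul_def homog_pscale)

lemma homog_span: "homog q \<subseteq> VS.span ((\<lambda>m. sg m 1) ` {m :: 3 \<Rightarrow>\<^sub>0 nat. mdeg m = q})"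
proof
  fix h :: S assume h: "h \<in> homog q"
  have "h = (\<Sum>m\<in>kys h. pscale (lk h m) (sg m 1))"
    by (subst poly_mapping_decompose) (simp add: pscale_conv_mult mult_single)
  moreover have "\<dots> \<in> VS.span ((\<lambda>m. sg m 1) ` {m. mdeg m = q})"
    by (intro VS.span_sum VS.span_scale VS.span_base) (use h in \<open>auto simp: homog_def\<close>)
  ultimately show "h \<in> VS.span ((\<lambda>m. sg m 1) ` {m. mdeg m = q})" by simp
qed

lemma bp_expand:
  assumes "bdi (int N) P"
  shows "P = (\<Sum>i\<le>N. \<Sum>j\<le>N - i. cst (cf P i j) * (xv ^ i * yv ^ j))"
proof (rule bp_eqI)
  fix k l
  show "cf P k l = cf (\<Sum>i\<le>N. \<Sum>j\<le>N - i. cst (cf P i j) * (xv ^ i * yv ^ j)) k l"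
    unfolding coeff_sum cf_term double_delta_sum
    using assms by (auto simp: bdi_def)
qed

lemma pair_expand:
  "pmul c (P, 0) = (cst c * P, 0)" "pmul c (0, P) = (0, cst c * P)"
  by (simp_all add: pmul_def)

lemma KK_span: "KK m n r s k \<subseteq> VP.span ((\<lambda>(i, j). (xv ^ i * yv ^ j, 0)) ` ({..k + 1} \<times> {..k + 1}) \<union> (\<lambda>(i, j). (0, xv ^ i * yv ^ j)) ` ({..k + 1} \<times> {..k + 1}))"
    (is "_ \<subseteq> VP.span ?T")
proof safe
  fix \<alpha> \<beta> assume K: "(\<alpha>, \<beta>) \<in> KK m n r s k"
  have b: "bdi (int (k + 1)) \<alpha>" "bdi (int (k + 1)) \<beta>"
    using bdi_mono[OF KK_bdi(1)[OF K], of "int (k + 1)"] bdi_mono[OF KK_bdi(2)[OF K], of "int (k + 1)"] by simp_all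
  have s1: "(\<Sum>x\<in>A. F x, 0) = (\<Sum>x\<in>A. (F x, 0 :: bp))" "(0 :: bp, \<Sum>x\<in>A. F x) = (\<Sum>x\<in>A. (0, F x))" for A :: "nat set" and F :: "nat => bp"
    by (simp_all add: prod_eq_iff fst_sum snd_sum)
  have "(\<alpha>, \<beta>) = (\<alpha>, 0) + (0, \<beta>)" by simp
  also have "\<dots> = (\<Sum>i\<le>k + 1. \<Sum>j\<le>k + 1 - i. pmul (cf \<alpha> i j) (xv ^ i * yv ^ j, 0)) + (\<Sum>i\<le>k + 1. \<Sum>j\<le>k + 1 - i. pmul (cf \<beta> i j) (0, xv ^ i * yv ^ j))"
    unfolding pair_expand s1[symmetric] bp_expand[OF b(1), symmetric] bp_expand[OF b(2), symmetric] ..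
  also have "\<dots> \<in> VP.span ?T"
    by (intro VP.span_add VP.span_sum VP.span_scale VP.span_base) force+
  finally show "(\<alpha>, \<beta>) \<in> VP.span ?T" .
qed

lemma gam_add: "gam m n r s (\<alpha> + \<alpha>') (\<beta> + \<beta>') = gam m n r s \<alpha> \<beta> + gam m n r s \<alpha>' \<beta>'"
  by (simp add: gam_def algebra_simps)

lemma gam_cst: "gam m n r s (cst c * \<alpha>) (cst c * \<beta>) = cst c * gam m n r s \<alpha> \<beta>"
  by (simp add: gam_def algebra_simps)

lemma KK_subspace: "VP.subspace (KK m n r s k)"
proof (rule VP.subspaceI)
  show "0 \<in> KK m n r s k" by (simp add: KK_def zero_prod_def gam_def)
next
  fix x y assume "x \<in> KK m n r s k" "y \<in> KK m n r s k"
  then obtain \<alpha> \<beta> \<alpha>' \<beta>' where xy: "x = (\<alpha>, \<beta>)" "y = (\<alpha>', \<beta>')" and K: "(\<alpha>, \<beta>) \<in> KK m n r s k" "(\<alpha>', \<beta>') \<in> KK m n r s k"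
    by (metis surj_pair)
  have "xv * (gam m n r s \<alpha> \<beta> + gam m n r s \<alpha>' \<beta>') + (\<alpha> + \<alpha>') * lx (pr m r)
      = (xv * gam m n r s \<alpha> \<beta> + \<alpha> * lx (pr m r)) + (xv * gam m n r s \<alpha>' \<beta>' + \<alpha>' * lx (pr m r))"
    "yv * (gam m n r s \<alpha> \<beta> + gam m n r s \<alpha>' \<beta>') + (\<beta> + \<beta>') * ly (pr n s)
      = (yv * gam m n r s \<alpha> \<beta> + \<beta> * ly (pr n s)) + (yv * gam m n r s \<alpha>' \<beta>' + \<beta>' * ly (pr n s))"
    by (simp_all add: algebra_simps)
  then show "x + y \<in> KK m n r s k" using K by (auto simp: xy KK_def gam_add intro: bdi_add)
next
  fix c x assume "x \<in> KK m n r s k"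
  then obtain \<alpha> \<beta> where x: "x = (\<alpha>, \<beta>)" and K: "(\<alpha>, \<beta>) \<in> KK m n r s k" by (metis surj_pair)
  have "xv * (cst c * gam m n r s \<alpha> \<beta>) + cst c * \<alpha> * lx (pr m r) = cst c * (xv * gam m n r s \<alpha> \<beta> + \<alpha> * lx (pr m r))"
    "yv * (cst c * gam m n r s \<alpha> \<beta>) + cst c * \<beta> * ly (pr n s) = cst c * (yv * gam m n r s \<alpha> \<beta> + \<beta> * ly (pr n s))"
    by (simp_all add: algebra_simps)
  then show "pmul c x \<in> KK m n r s k" using K by (auto simp: x pmul_def KK_def gam_cst intro: bdi_cst_mult)
qed

context frame
begin

lemma hz_add: "hz k (P + Q) = hz k P + hz k Q"
  by (simp add: hz_def VS.scale_left_distrib sum.distrib)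

lemma hz_cst: "hz k (cst c * P) = pscale c (hz k P)"
  by (simp add: hz_def cf_cst_mult VS.scale_sum_right)

lemma mk_add: "mk k (P1 + Q1) (P2 + Q2) (P3 + Q3) = mk k P1 P2 P3 + mk k Q1 Q2 Q3"
  by (simp add: mk_def vec_ext hz_add[symmetric] algebra_simps)

lemma mk_cst: "mk k (cst c * P1) (cst c * P2) (cst c * P3) = smul c (mk k P1 P2 P3)"
  by (simp add: mk_def smul_def vec_ext hz_cst[symmetric] algebra_simps)

end

context two_pencil_form
begin

definition Psi2 :: "nat => bp \<times> bp => S^3" where
  "Psi2 k z = Psi k (fst z) (snd z)"

lemma Psi2_add: "Psi2 k (z + z') = Psi2 k z + Psi2 k z'"
  unfolding Psi2_def Psi_def mk_add[symmetric] by (simp add: gam_add algebra_simps)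

lemma Psi2_pmul: "Psi2 k (pmul c z) = smul c (Psi2 k z)"
  unfolding Psi2_def Psi_def mk_cst[symmetric] pmul_def fst_conv snd_conv gam_cst by (simp add: algebra_simps)

lemma Psi2_inj:
  assumes "z \<in> KK m n r s k" "Psi2 k z = 0"
  shows "z = 0"
proof (cases z)
  case (Pair \<alpha> \<beta>)
  then have "(\<alpha>, \<beta>) \<in> KK m n r s k" "Psi k \<alpha> \<beta> = 0" using assms by (simp_all add: Psi2_def)
  then have "\<alpha> = 0" "\<beta> = 0" using Psi_inj by blast+
  then show ?thesis using Pair by (simp add: zero_prod_def)
qed

lemma Psi2_lincomb: "Psi2 k (\<Sum>i\<in>A. pmul (c i) (x i)) = (\<Sum>i\<in>A. smul (c i) (Psi2 k (x i)))"
proof (induction A rule: infinite_finite_induct)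
  case empty
  show ?case using Psi2_pmul[of k 0 0] by simp
next
  case (infinite A)
  then show ?case using Psi2_pmul[of k 0 0] by simp
qed (simp_all add: Psi2_add Psi2_pmul)

text \<open>Along the whole family the space of syzygies of a given degree has the same dimension, so the rank of
  \<open>jac\<close> cannot exceed its value at \<open>f\<close>; differentiating the resulting determinantal equations
  shows that a syzygy of \<open>f\<close> extends to first order along every tangent vector.\<close>
lemma tangent_syzygy:
  assumes X: "!!g. proj_pt g \<in> X ==> EX a b w ca cb cw r s C. two_pencil_form a b w ca cb cw m n r s C g"
    and v: "v \<in> tangent_cone_space (homog (m + n)) X f"
    and \<theta>: "hom3 k \<theta>" "jac f \<theta> = 0"
  shows "\<exists>\<eta>. hom3 k \<eta> & jac v \<theta> = jac f \<eta>"
proof (rule ccontr)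
  assume no: "\<not> ?thesis"
  have vh: "v \<in> homog (m + n)" using v by (simp add: tangent_ddir)
  define K where "K = KK m n r s k"
  have "finite ((\<lambda>(i, j). (xv ^ i * yv ^ j, 0 :: bp)) ` ({..k + 1} \<times> {..k + 1}) \<union> (\<lambda>(i, j). (0 :: bp, xv ^ i * yv ^ j)) ` ({..k + 1} \<times> {..k + 1}))"
    by simp
  from VP.finite_frame[OF this KK_span KK_subspace[of m n r s k]]
  obtain N :: nat and e :: "nat => bp \<times> bp" where "(\<forall>i<N. e i \<in> K) & (\<forall>z\<in>K. EX x. z = (\<Sum>i<N. pmul (x i) (e i))) &
      (ALL x. (\<Sum>i<N. pmul (x i) (e i)) = 0 --> (\<forall>i<N. x i = 0))"
    unfolding K_def by (elim exE)
  then have e: "!!i. i < N ==> e i \<in> K"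
    and e_span: "!!z. z \<in> K ==> EX x. z = (\<Sum>i<N. pmul (x i) (e i))"
    and e_ind: "!!x. (\<Sum>i<N. pmul (x i) (e i)) = 0 ==> \<forall>i<N. x i = 0"
    by simp_all
  define Im where "Im = {jac f \<eta> | \<eta>. hom3 k \<eta>}"
  have Im_sub: "VS.subspace Im"
  proof (rule VS.subspaceI)
    show "0 \<in> Im" unfolding Im_def using jac_0[of f] by (metis (mono_tags, lifting) CollectI hom3_def homog_0 zero_index)
    show "x + y \<in> Im" if xy: "x \<in> Im" "y \<in> Im" for x y
    proof -
      obtain \<eta> \<eta>' where "x = jac f \<eta>" "y = jac f \<eta>'" "hom3 k \<eta>" "hom3 k \<eta>'" using xy unfolding Im_def by blast
      then have "x + y = jac f (\<eta> + \<eta>')" "hom3 k (\<eta> + \<eta>')" by (auto simp: jac_add hom3_def intro: homog_add)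
      then show ?thesis unfolding Im_def by blast
    qed
    show "pscale c x \<in> Im" if x: "x \<in> Im" for c x
    proof -
      obtain \<eta> where "x = jac f \<eta>" "hom3 k \<eta>" using x unfolding Im_def by blast
      then have "pscale c x = jac f (smul c \<eta>)" "hom3 k (smul c \<eta>)"
        by (simp_all only: jac_smul) (simp add: hom3_def smul_def homog_pscale)
      then show ?thesis unfolding Im_def by blast
    qed
  qed
  have "Im \<subseteq> homog (k + (m + n - 1))" unfolding Im_def using homog_jac[OF fh] by blast
  then have Im_span: "Im \<subseteq> VS.span ((\<lambda>p. sg p 1) ` {p. mdeg p = k + (m + n - 1)})" using homog_span by blast
  have "finite ((\<lambda>p. sg p 1 :: S) ` {p. mdeg p = k + (m + n - 1)})" by (simp add: finite_mdeg)
  from VS.finite_frame[OF this Im_span Im_sub]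
  obtain \<rho> :: nat and g :: "nat => S" where "(\<forall>i<\<rho>. g i \<in> Im) & (\<forall>z\<in>Im. EX x. z = (\<Sum>i<\<rho>. pscale (x i) (g i))) &
      (ALL x. (\<Sum>i<\<rho>. pscale (x i) (g i)) = 0 --> (\<forall>i<\<rho>. x i = 0))"
    by (elim exE)
  then have g: "!!i. i < \<rho> ==> g i \<in> Im"
    and g_span: "!!z. z \<in> Im ==> EX x. z = (\<Sum>i<\<rho>. pscale (x i) (g i))"
    and g_ind: "!!x. (\<Sum>i<\<rho>. pscale (x i) (g i)) = 0 ==> \<forall>i<\<rho>. x i = 0"
    by simp_all
  have "\<exists>\<eta>. hom3 k \<eta> & jac f \<eta> = g i" if "i < \<rho>" for i using g[OF that] by (auto simp: Im_def)
  then obtain c where c: "!!i. i < \<rho> ==> hom3 k (c i)" "!!i. i < \<rho> ==> jac f (c i) = g i" by metis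
  define cc where "cc b = (case b of 0 => \<theta> | Suc i => c i)" for b
  define y where "y b = (case b of 0 => jac v \<theta> | Suc i => g i)" for b
  have cch: "hom3 k (cc b)" if "b < Suc \<rho>" for b using that c \<theta> by (auto simp: cc_def split: nat.splits)
  have y_ind: "\<forall>i<Suc \<rho>. x i = 0" if s: "(\<Sum>i<Suc \<rho>. pscale (x i) (y i)) = 0" for x
  proof -
    have s': "pscale (x 0) (jac v \<theta>) + (\<Sum>i<\<rho>. pscale (x (Suc i)) (g i)) = 0"
      using s unfolding sum.lessThan_Suc_shift by (simp add: y_def)
    have x0: "x 0 = 0"
    proof (rule ccontr)
      assume nz: "x 0 ~= 0"
      let ?\<eta> = "\<Sum>i<\<rho>. smul (x (Suc i)) (c i)"
      have "pscale (x 0) (jac v \<theta>) + jac f ?\<eta> = 0" using s' c by (simp add: jac_lincomb)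
      then have "pscale (x 0) (jac v \<theta>) = pscale (- 1) (jac f ?\<eta>)" by (simp add: eq_neg_iff_add_eq_0)
      then have "pscale (inverse (x 0)) (pscale (x 0) (jac v \<theta>)) = pscale (inverse (x 0)) (pscale (- 1) (jac f ?\<eta>))" by (rule arg_cong)
      then have "jac v \<theta> = pscale (inverse (x 0) * - 1) (jac f ?\<eta>)" using nz by simp
      then have "jac v \<theta> = jac f (smul (inverse (x 0) * - 1) ?\<eta>)" by (simp only: jac_smul)
      moreover have "hom3 k (smul (inverse (x 0) * - 1) ?\<eta>)"
        using c(1) by (intro hom3_smul hom3_lincomb) simp
      ultimately show False using no by blast
    qed
    then have "\<forall>i<\<rho>. x (Suc i) = 0" using g_ind[of "\<lambda>i. x (Suc i)"] s' by simp
    then show ?thesis using x0 by (metis less_Suc_eq_0_disj)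
  qed
  obtain l :: "nat => S => complex" where l_add: "!!p u u'. l p (u + u') = l p u + l p u'"
    and l_scale: "!!p c u. l p (pscale c u) = c * l p u"
    and l_y: "!!p b. p < Suc \<rho> ==> b < Suc \<rho> ==> l p (y b) = (if p = b then 1 else 0)"
    using VS.dual_functionals[where q = "Suc \<rho>" and y = y] y_ind by blast
  have l0: "l p 0 = 0" for p using l_scale[of p 0 0] by simp
  have l_sum: "l p (\<Sum>i\<in>A. F i) = (\<Sum>i\<in>A. l p (F i))" for p and A :: "'i set" and F
    by (induction A rule: infinite_finite_induct) (simp_all add: l0 l_add)
  define NN where "NN p b = linform (m + n) (\<lambda>q. l p (jac (sg q 1) (cc b)))" for p b
  have NN: "fev (NN p b) h = l p (jac h (cc b))" if "h \<in> homog (m + n)" for p b h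
    unfolding NN_def fev_linform jac_expand[OF that] l_sum l_scale by (simp add: mult.commute)
  let ?D = "detform (Suc \<rho>) NN"
  have "vanish ?D X"
    unfolding vanish_def
  proof (intro allI impI)
    fix h assume "proj_pt h \<in> X"
    then obtain a' b' w' ca' cb' cw' r' s' C' where "two_pencil_form a' b' w' ca' cb' cw' m n r' s' C' h" using X by blast
    then interpret G: two_pencil_form a' b' w' ca' cb' cw' m n r' s' C' h .
    have K': "K \<subseteq> KK m n r' s' k" unfolding K_def by (rule KK_indep)
    define bas where "bas j = (if j < N then Psi2 k (e j) else c (j - N))" for j
    define x where "x i = (if i < N then G.Psi2 k (e i) else cc (i - N))" for i
    have span: "EX t. u = (\<Sum>j<N + \<rho>. smul (t j) (bas j))" if u: "hom3 k u" for u
    proof -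
      have "jac f u \<in> Im" using u unfolding Im_def by blast
      then obtain z where z: "jac f u = (\<Sum>i<\<rho>. pscale (z i) (g i))" using g_span by blast
      let ?u = "u - (\<Sum>i<\<rho>. smul (z i) (c i))"
      have zu: "jac f ?u = 0"
      proof -
        have "jac f u = jac f ?u + jac f (\<Sum>i<\<rho>. smul (z i) (c i))" unfolding jac_add[symmetric] by simp
        then show ?thesis unfolding jac_lincomb z using c(2) by simp
      qed
      have hu: "hom3 k ?u"
        using u hom3_lincomb[of "{..<\<rho>}" k c z] c(1) by (auto simp: hom3_def intro: homog_diff)
      obtain \<alpha> \<beta> where ab: "(\<alpha>, \<beta>) \<in> KK m n r s k" "?u = Psi k \<alpha> \<beta>"
        using syzygy_Psi[OF hu zu] .
      obtain t where t: "(\<alpha>, \<beta>) = (\<Sum>i<N. pmul (t i) (e i))" using e_span[OF ab(1)[folded K_def]] by blast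
      have "?u = Psi2 k (\<Sum>i<N. pmul (t i) (e i))" unfolding t[symmetric] ab(2) Psi2_def by simp
      then have u': "?u = (\<Sum>i<N. smul (t i) (Psi2 k (e i)))" by (simp only: Psi2_lincomb)
      define t' where "t' j = (if j < N then t j else z (j - N))" for j
      have "(\<Sum>j<N + \<rho>. smul (t' j) (bas j)) = (\<Sum>j<N. smul (t' j) (bas j)) + (\<Sum>j<\<rho>. smul (t' (N + j)) (bas (N + j)))"
        by (rule sum_split)
      also have "\<dots> = ?u + (\<Sum>j<\<rho>. smul (z j) (c j))" unfolding u' by (simp add: t'_def bas_def)
      finally show ?thesis by (intro exI[of _ t']) simp
    qed
    have xh: "hom3 k (x i)" if "i < N + Suc \<rho>" for i
      using that cch[of "i - N"] G.hom3_Psi by (auto simp: x_def G.Psi2_def)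
    have "ALL i. EX t. i < N + Suc \<rho> --> x i = (\<Sum>j<N + \<rho>. smul (t j) (bas j))" using span xh by blast
    then obtain t where t: "!!i. i < N + Suc \<rho> ==> x i = (\<Sum>j<N + \<rho>. smul (t i j) (bas j))" by metis
    obtain z where z: "\<exists>i\<in>{..<N + Suc \<rho>}. z i ~= 0" "\<forall>j\<in>{..<N + \<rho>}. (\<Sum>i<N + Suc \<rho>. z i * t i j) = 0"
      using linear_dependence[of "{..<N + Suc \<rho>}" "{..<N + \<rho>}" t] by auto
    have "(\<Sum>i<N + Suc \<rho>. smul (z i) (x i)) = (\<Sum>i<N + Suc \<rho>. \<Sum>j<N + \<rho>. smul (z i * t i j) (bas j))"
      by (intro sum.cong refl) (simp add: t V3.scale_sum_right)
    also have "\<dots> = (\<Sum>j<N + \<rho>. \<Sum>i<N + Suc \<rho>. smul (z i * t i j) (bas j))" by (rule sum.swap)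
    also have "\<dots> = (\<Sum>j<N + \<rho>. smul (\<Sum>i<N + Suc \<rho>. z i * t i j) (bas j))" by (simp only: V3.scale_sum_left)
    also have "\<dots> = 0" using z(2) by (intro sum.neutral) simp
    finally have rel: "(\<Sum>i<N + Suc \<rho>. smul (z i) (x i)) = 0" .
    have sp: "(\<Sum>i<N + Suc \<rho>. F i) = (\<Sum>i<N. F i) + (\<Sum>i<Suc \<rho>. F (N + i))" for F :: "nat => S^3"
      by (rule sum_split)
    have rel': "(\<Sum>i<N. smul (z i) (G.Psi2 k (e i))) + (\<Sum>b<Suc \<rho>. smul (z (N + b)) (cc b)) = 0"
      using rel unfolding sp by (simp only: x_def lessThan_iff) (simp add: x_def)
    have nz: "\<exists>b<Suc \<rho>. z (N + b) ~= 0"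
    proof (rule ccontr)
      assume n: "\<not> ?thesis"
      then have "G.Psi2 k (\<Sum>i<N. pmul (z i) (e i)) = 0" using rel' unfolding G.Psi2_lincomb by simp
      moreover have "(\<Sum>i<N. pmul (z i) (e i)) \<in> K"
        using KK_subspace[of m n r s k] e unfolding K_def by (intro VP.subspace_sum VP.subspace_scale) auto
      then have "(\<Sum>i<N. pmul (z i) (e i)) \<in> KK m n r' s' k" using K' by blast
      ultimately have "(\<Sum>i<N. pmul (z i) (e i)) = 0"
        by (intro G.Psi2_inj)
      then have zN: "\<forall>i<N. z i = 0" by (rule e_ind)
      obtain i where i: "i < N + Suc \<rho>" "z i ~= 0" using z(1) by auto
      then have "\<not> i < N" using zN by blast
      then have "i - N < Suc \<rho>" "N + (i - N) = i" using i by auto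
      then show False using n i by metis
    qed
    have kill: "jac h (G.Psi2 k (e i)) = 0" if "i < N" for i
      using G.Psi_syzygy[of "fst (e i)" "snd (e i)" k] e[OF that] K' by (auto simp: G.Psi2_def)
    have "jac h ((\<Sum>i<N. smul (z i) (G.Psi2 k (e i))) + (\<Sum>b<Suc \<rho>. smul (z (N + b)) (cc b))) = 0"
      unfolding rel' by (rule jac_0)
    then have "(\<Sum>i<N. pscale (z i) (jac h (G.Psi2 k (e i)))) + (\<Sum>b<Suc \<rho>. pscale (z (N + b)) (jac h (cc b))) = 0"
      by (simp only: jac_add jac_lincomb)
    then have J: "(\<Sum>b<Suc \<rho>. pscale (z (N + b)) (jac h (cc b))) = 0" using kill by simp
    have "(\<Sum>b<Suc \<rho>. fev (NN p b) h * z (N + b)) = 0" for p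
    proof -
      have "(\<Sum>b<Suc \<rho>. fev (NN p b) h * z (N + b)) = l p (\<Sum>b<Suc \<rho>. pscale (z (N + b)) (jac h (cc b)))"
        unfolding NN[OF G.fh] l_sum l_scale by (simp only: mult.commute)
      then show ?thesis unfolding J l0 .
    qed
    then show "fev ?D h = 0" by (intro detform_vanish[of "Suc \<rho>" "\<lambda>b. z (N + b)"] nz)
  qed
  moreover have "?D \<in> homog (Suc \<rho>)" by (rule detform_homog) (simp add: NN_def linform_homog[simplified])
  ultimately have "ddir f v ?D = 0" using v by (auto simp: tangent_ddir)
  moreover have "ddir f v ?D = 1"
  proof (rule ddir_detform)
    fix i j assume ij: "i < Suc \<rho>" "j < Suc \<rho>"
    show "fev (NN i j) f = (if i = j & 0 < j then 1 else 0)"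
    proof (cases j)
      case 0
      then show ?thesis by (simp add: NN[OF fh] cc_def \<theta> l0)
    next
      case (Suc j')
      then have "jac f (cc j) = y j" using c(2)[of j'] ij by (simp add: cc_def y_def)
      then show ?thesis using l_y[OF ij] Suc by (simp add: NN[OF fh])
    qed
  next
    fix i assume i: "i < Suc \<rho>"
    have "ddir f v (NN i 0) = fev (NN i 0) v" unfolding NN_def by (rule ddir_linform[OF vh])
    also have "\<dots> = l i (y 0)" by (simp add: NN[OF vh] cc_def y_def)
    finally show "ddir f v (NN i 0) = (if i = 0 then 1 else 0)" using l_y[OF i, of 0] by simp
  qed simp
  ultimately show False by simp
qed

end

section \<open>The upper bound for the tangent space\<close>

lemma bdi_degree: "bdi (int N) P ==> degree P <= N"
  by (rule degree_le) (auto simp: bdi_def intro!: poly_eqI)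

lemma degree_lx [simp]: "degree (lx p) = 0"
  by (simp add: lx_def)

lemma degree_ly: "degree (ly p) = degree p"
  unfolding ly_def by (rule degree_map_poly) simp

lemma coeff_lx_mult: "coeff (lx p * P) j = p * coeff P j"
  by (simp add: lx_def)

lemma coeff_cst_mult: "coeff (cst c * P) j = smult c (coeff P j)"
  by (simp add: cst_def)

lemma poly_zero_if_roots:
  fixes p :: "complex poly"
  assumes "inj_on r {..<m}" "!!i. i < m ==> poly p (r i) = 0" "!!i. m <= i ==> coeff p i = 0"
  shows "p = 0"
proof (rule ccontr)
  assume p: "p ~= 0"
  have "pr m r dvd p" unfolding pr_def by (rule distinct_roots_dvd) (use assms in auto)
  then have "m <= degree p" using dvd_imp_degree_le[of "pr m r" p] p by (simp add: degree_pr)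
  then have "lead_coeff p = 0" using assms(3) by blast
  then show False using p by simp
qed

lemma poly_ax: "poly (ax x P) y = poly (poly P [:y:]) x"
proof (induction P)
  case 0
  show ?case by (simp add: ax_def)
next
  case (pCons p P)
  have "ax x (pCons p P) = pCons (poly p x) (ax x P)" by (simp add: ax_def map_poly_pCons)
  then show ?case using pCons by simp
qed

context two_pencil_form
begin

text \<open>Modulo \<open>B\<close> the equation reads \<open>(V - A q) B' = 0\<close>, whence \<open>V = A q + Z B\<close>. Substituting back
  leaves an equation for the \<open>y\<close>-derivative of \<open>Z\<close> which shows that \<open>Z\<close> is linear in \<open>y\<close>.\<close>
lemma tangent_shape:
  assumes V: "bdi (int (m + n)) V" and R: "bdi (int n) R1" "bdi (int n) R2" "bdi (int n) R3"
    and eq: "BB * pderiv V - B1 * V = R1 * (A1 * BB) + R2 * (AA * B1) + R3 * (dd * (AA * BB) - xv * (A1 * BB) - yv * (AA * B1))"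
  shows "!!j. n + 1 < j ==> coeff V j = 0"
    and "\<exists>\<rho> \<rho>'. coeff V (n + 1) = smult \<rho> (pderiv (pr m r)) + smult \<rho>' (smult (of_nat m) (pr m r) - [:0, 1:] * pderiv (pr m r))"
    and "!!i j. i < m ==> j < n ==> poly (poly V [:s j:]) (r i) = 0"
proof -
  define q where "q = yv * R3 - R2"
  have "bdi (1 + int n) (yv * R3)" by (rule bdi_mult[OF bdi_yv R(3)])
  then have q: "bdi (int (n + 1)) q" unfolding q_def using bdi_mono[OF R(2), of "int (n + 1)"] by (auto intro!: bdi_diff simp: add.commute)
  have "(V - AA * q) * (AA * B1) = (AA * (pderiv V - R1 * A1 - R3 * (dd * AA - xv * A1))) * BB"
  proof -
    have "(V - AA * q) * (AA * B1) - (AA * (pderiv V - R1 * A1 - R3 * (dd * AA - xv * A1))) * BB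
      = AA * (R1 * (A1 * BB) + R2 * (AA * B1) + R3 * (dd * (AA * BB) - xv * (A1 * BB) - yv * (AA * B1)) - (BB * pderiv V - B1 * V))"
      unfolding q_def by (simp add: algebra_simps)
    then show ?thesis unfolding eq by simp
  qed
  then obtain Z where Z: "V - AA * q = Z * BB" using div_B by blast
  then have VZ: "V = AA * q + Z * BB" by (simp add: algebra_simps)
  have dV: "pderiv V = AA * pderiv q + (pderiv Z * BB + Z * B1)"
    unfolding VZ by (simp add: pderiv_add pderiv_mult Dy_lx Dy_ly algebra_simps)
  have "BB * (BB * pderiv Z) = BB * (R1 * A1 + R3 * (dd * AA - xv * A1) - AA * pderiv q)"
  proof -
    have "BB * (BB * pderiv Z) - BB * (R1 * A1 + R3 * (dd * AA - xv * A1) - AA * pderiv q)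
      = (BB * pderiv V - B1 * V) - (R1 * (A1 * BB) + R2 * (AA * B1) + R3 * (dd * (AA * BB) - xv * (A1 * BB) - yv * (AA * B1)))"
      unfolding dV unfolding VZ q_def by (simp add: algebra_simps)
    then show ?thesis unfolding eq by simp
  qed
  then have H: "BB * pderiv Z = R1 * A1 + R3 * (dd * AA - xv * A1) - AA * pderiv q" (is "_ = ?H") by simp
  have dA: "dd * AA - xv * A1 = lx (smult (of_nat (m + n)) (pr m r) - [:0, 1:] * pderiv (pr m r))" (is "_ = lx ?a")
    by (simp add: lx_def cst_def xv_def)
  have dq: "degree (pderiv q) <= n" using bdi_degree[OF q] by (simp add: degree_pderiv)
  have "degree (R1 * A1) <= n" "degree (R3 * lx ?a) <= n" "degree (AA * pderiv q) <= n"
    using degree_mult_le[of R1 A1] degree_mult_le[of R3 "lx ?a"] degree_mult_le[of AA "pderiv q"]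
      bdi_degree[OF R(1)] bdi_degree[OF R(3)] dq by simp_all
  then have "degree ?H <= n" unfolding dA by (intro degree_diff_le degree_add_le)
  then have dZ: "degree (pderiv Z) = 0"
  proof (cases "pderiv Z = 0")
    case False
    then have "degree (BB * pderiv Z) = n + degree (pderiv Z)" by (simp add: degree_mult_eq degree_ly degree_pr)
    then show ?thesis using \<open>degree ?H <= n\<close> unfolding H[symmetric] by simp
  qed simp
  then have dZ1: "degree Z <= 1" by (simp add: degree_pderiv)
  have "degree (AA * q) <= n + 1" "degree (Z * BB) <= n + 1"
    using degree_mult_le[of AA q] degree_mult_le[of Z BB] bdi_degree[OF q] dZ1 by (simp_all add: degree_ly degree_pr)
  then have "degree V <= n + 1" unfolding VZ by (rule degree_add_le)
  then show "coeff V j = 0" if "n + 1 < j" for j using that by (simp add: coeff_eq_0)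
  have lead: "coeff BB n = 1"
    using coeff_pr[of n s] by (simp add: ly_def coeff_map_poly one_pCons)
  have cZ: "coeff (Z * BB) (n + 1) = coeff Z 1"
  proof -
    have "coeff (Z * BB) (1 + n) = coeff Z 1 * coeff BB n"
      using coeff_mult_degree_sum[of Z BB] dZ1
      by (cases "degree Z = 1") (auto simp: degree_ly degree_pr coeff_eq_0 degree_mult_le intro!: coeff_eq_0 le_less_trans[OF degree_mult_le])
    then show ?thesis using lead by simp
  qed
  have zeta: "coeff (pderiv Z) 0 = coeff Z 1" by (simp add: coeff_pderiv)
  have "pderiv Z = [:coeff Z 1:]" using dZ zeta by (metis degree_eq_zeroE coeff_pCons_0)
  then have "coeff (BB * pderiv Z) n = coeff Z 1" using lead by simp
  then have z1: "coeff Z 1 = coeff ?H n" unfolding H[symmetric] by simp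
  define \<rho> where "\<rho> = cf R1 0 n"
  define \<rho>' where "\<rho>' = cf R3 0 n"
  have c: "coeff R1 n = [:\<rho>:]" "coeff R3 n = [:\<rho>':]"
    using R(1,3) unfolding \<rho>_def \<rho>'_def bdi_def by (auto intro!: poly_eqI simp: coeff_pCons split: nat.splits)
  have "coeff R2 (n + 1) = 0" using bdi_degree[OF R(2)] by (simp add: coeff_eq_0)
  then have cq: "coeff q (n + 1) = [:\<rho>':]" unfolding q_def by (simp add: yv_def c)
  then have cq': "coeff (pderiv q) n = smult (of_nat (n + 1)) [:\<rho>':]"
    by (simp add: coeff_pderiv of_nat_poly)
  have "coeff ?H n = [:\<rho>:] * pderiv (pr m r) + [:\<rho>':] * ?a - pr m r * (smult (of_nat (n + 1)) [:\<rho>':])"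
    unfolding dA coeff_diff coeff_add coeff_lx_mult cq' mult.commute[of R1] mult.commute[of R3] c by (simp only: mult.commute)
  then have "coeff V (n + 1) = pr m r * [:\<rho>':] + ([:\<rho>:] * pderiv (pr m r) + [:\<rho>':] * ?a - pr m r * (smult (of_nat (n + 1)) [:\<rho>':]))"
    unfolding VZ coeff_add cZ coeff_lx_mult cq z1 by simp
  also have "\<dots> = smult \<rho> (pderiv (pr m r)) + smult \<rho>' (smult (of_nat m) (pr m r) - [:0, 1:] * pderiv (pr m r))"
    by (rule poly_eqI) (auto simp: algebra_simps coeff_pCons split: nat.splits)
  finally show "\<exists>\<rho> \<rho>'. coeff V (n + 1) = smult \<rho> (pderiv (pr m r)) + smult \<rho>' (smult (of_nat m) (pr m r) - [:0, 1:] * pderiv (pr m r))"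
    by blast
  show "poly (poly V [:s j:]) (r i) = 0" if "i < m" "j < n" for i j
    unfolding VZ using that by (simp add: ay_lx ay_ly pr_root)
qed

lemma tangent_top_zero:
  assumes "p = smult \<rho> (pderiv (pr m r)) + smult \<rho>' (smult (of_nat m) (pr m r) - [:0, 1:] * pderiv (pr m r))"
    and z: "poly p (r 0) = 0" "poly p (r 1) = 0"
  shows "p = 0"
proof -
  have e: "\<rho> - \<rho>' * r i = 0" if i: "i < m" "poly p (r i) = 0" for i
  proof -
    have "(\<rho> - \<rho>' * r i) * poly (pderiv (pr m r)) (r i) = 0"
      using i(2) unfolding assms(1) by (simp add: pr_root[OF i(1)] algebra_simps)
    then show ?thesis using pr_simple[OF r i(1)] by simp
  qed
  have "\<rho> - \<rho>' * r 0 = 0" "\<rho> - \<rho>' * r 1 = 0" using e[of 0] e[of 1] z mn by simp_all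
  moreover have "r 0 ~= r 1" using inj_onD[OF r, of 0 1] mn by auto
  ultimately have "\<rho>' = 0" "\<rho> = 0" by auto
  then show ?thesis unfolding assms(1) by simp
qed

lemma tangent_form:
  assumes X: "!!g. proj_pt g \<in> X ==> EX a b w ca cb cw r s C. two_pencil_form a b w ca cb cw m n r s C g"
    and v: "v \<in> tangent_cone_space (homog (m + n)) X f"
  shows "!!j. n + 1 < j ==> coeff (dh v) j = 0"
    and "poly (coeff (dh v) (n + 1)) (r 0) = 0 ==> poly (coeff (dh v) (n + 1)) (r 1) = 0 ==> coeff (dh v) (n + 1) = 0"
    and "!!i j. i < m ==> j < n ==> poly (poly (dh v) [:s j:]) (r i) = 0"
proof -
  have vh: "v \<in> homog (m + n)" using v by (simp add: tangent_ddir)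
  note K = KK_second[OF mn, of r s]
  obtain \<eta> where \<eta>: "hom3 n \<eta>" "jac v (Psi n 0 1) = jac f \<eta>"
    using tangent_syzygy[OF X v hom3_Psi Psi_syzygy[OF K]] by blast
  let ?g = "gam m n r s 0 1"
  have g: "dd * ?g = - B1" using dd_gam[of 0 1] by simp
  have "dh (jac v (Psi n 0 1)) = dd * ?g * dh v + BB * pderiv (dh v)"
    unfolding dh_jac[OF vh] co_Psi[OF K] Dw_def by (simp add: algebra_simps)
  then have l: "dh (jac v (Psi n 0 1)) = BB * pderiv (dh v) - B1 * dh v" unfolding g by simp
  have eq: "BB * pderiv (dh v) - B1 * dh v = (cst C * co a \<eta>) * (A1 * BB) + (cst C * co b \<eta>) * (AA * B1)
      + (cst C * co w \<eta>) * (dd * (AA * BB) - xv * (A1 * BB) - yv * (AA * B1))"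
    unfolding l[symmetric] \<eta>(2) dh_jac_f by (simp only: algebra_simps)
  note S = tangent_shape[OF bdi_dh[OF vh] bdi_cst_mult[OF bdi_co[OF \<eta>(1)]] bdi_cst_mult[OF bdi_co[OF \<eta>(1)]]
      bdi_cst_mult[OF bdi_co[OF \<eta>(1)]] eq]
  show "coeff (dh v) j = 0" if "n + 1 < j" for j using S(1)[OF that] .
  obtain \<rho> \<rho>' where p: "coeff (dh v) (n + 1) = smult \<rho> (pderiv (pr m r)) + smult \<rho>' (smult (of_nat m) (pr m r) - [:0, 1:] * pderiv (pr m r))"
    using S(2) by blast
  show "coeff (dh v) (n + 1) = 0" if "poly (coeff (dh v) (n + 1)) (r 0) = 0" "poly (coeff (dh v) (n + 1)) (r 1) = 0"
    by (rule tangent_top_zero[OF p that])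
  show "poly (poly (dh v) [:s j:]) (r i) = 0" if "i < m" "j < n" for i j by (rule S(3)[OF that])
qed

lemma form_swap: "two_pencil_form b a w cb ca cw n m s r C f"
proof -
  interpret sw: frame b a w cb ca cw by (rule frame_swap)
  have p: "cf (lx p * ly q) i j = coeff p i * coeff q j" for p q :: "complex poly" and i j
    by (simp add: coeff_lx_mult) (simp add: ly_def coeff_map_poly mult.commute)
  have "sw.dh f = cst C * (lx (pr n s) * ly (pr m r))"
  proof (rule bp_eqI)
    fix i j
    have "cf (sw.dh f) i j = cf (dh f) j i" by (rule dh_swap[OF fh])
    then show "cf (sw.dh f) i j = cf (cst C * (lx (pr n s) * ly (pr m r))) i j"
      unfolding df cf_cst_mult p by simp
  qed
  then show ?thesis using mn r s C fh by unfold_locales (simp_all add: add.commute)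
qed

text \<open>Coordinates on the tangent space: the entries just outside and on the boundary of the Newton rectangle of the
  affine equation, the former at two roots, the latter at all roots, and the corner coefficient.\<close>
definition Phi :: "nat => S => complex" where
  "Phi k v = (let V = dh v; V' = frame.dh cb ca cw v in
     if k < m then poly (coeff V n) (r k) else if k < m + n then poly (coeff V' m) (s (k - m))
     else if k = m + n then poly (coeff V (n + 1)) (r 0) else if k = m + n + 1 then poly (coeff V (n + 1)) (r 1)
     else if k = m + n + 2 then poly (coeff V' (m + 1)) (s 0) else if k = m + n + 3 then poly (coeff V' (m + 1)) (s 1)
     else cf V m n)"

lemma Phi_add: "Phi k (u + v) = Phi k u + Phi k v"
proof -
  interpret sw: frame b a w cb ca cw by (rule frame_swap)
  show ?thesis by (simp add: Phi_def Let_def dh_simps sw.dh_simps)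
qed

lemma Phi_pscale: "Phi k (pscale c v) = c * Phi k v"
proof -
  interpret sw: frame b a w cb ca cw by (rule frame_swap)
  show ?thesis by (simp add: Phi_def Let_def dh_simps sw.dh_simps coeff_cst_mult)
qed

text \<open>By \<open>tangent_shape\<close>, applied also with the pencils exchanged, the affine equation of \<open>v\<close> is confined to
  bidegree \<open>(m - 1, n - 1)\<close> once the coordinates vanish; as it vanishes at all double points, it is zero.\<close>
lemma Phi_injective:
  assumes X: "!!g. proj_pt g \<in> X ==> EX a b w ca cb cw r s C. two_pencil_form a b w ca cb cw m n r s C g"
    and v: "v \<in> tangent_cone_space (homog (m + n)) X f" and z: "!!k. k < m + n + 5 ==> Phi k v = 0"
  shows "v = 0"
proof -
  interpret sw: two_pencil_form b a w cb ca cw n m s r C f by (rule form_swap)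
  have X': "EX a b w ca cb cw s r C. two_pencil_form a b w ca cb cw n m s r C g" if "proj_pt g \<in> X" for g
    using X[OF that] two_pencil_form.form_swap by metis
  have vh: "v \<in> homog (m + n)" using v by (simp add: tangent_ddir)
  have v': "v \<in> tangent_cone_space (homog (n + m)) X f" using v by (simp add: add.commute)
  note S = tangent_form[OF X v] and S' = sw.tangent_form[OF X' v']
  have S3: "poly (poly (dh v) [:s j:]) (r i) = 0" if "i < m" "j < n" for i j
    using tangent_form(3)[OF X v] that by blast
  define V where "V = dh v"
  define V' where "V' = sw.dh v"
  have sw: "cf V' l k = cf V k l" for k l unfolding V_def V'_def by (rule dh_swap[OF vh])
  have z1: "poly (coeff V n) (r k) = 0" if "k < m" for k using z[of k] that by (simp add: Phi_def V_def Let_def)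
  have z2: "poly (coeff V' m) (s k) = 0" if "k < n" for k using z[of "m + k"] that by (simp add: Phi_def V'_def Let_def)
  have z3: "poly (coeff V (n + 1)) (r 0) = 0" "poly (coeff V (n + 1)) (r 1) = 0"
    "poly (coeff V' (m + 1)) (s 0) = 0" "poly (coeff V' (m + 1)) (s 1) = 0" "cf V m n = 0"
    using z[of "m + n"] z[of "m + n + 1"] z[of "m + n + 2"] z[of "m + n + 3"] z[of "m + n + 4"]
    by (simp_all add: Phi_def V_def V'_def Let_def)
  have hi: "coeff V j = 0" if "n < j" for j
    using S(1)[of j] S(2) z3(1,2) that unfolding V_def by (cases "j = n + 1") auto
  have hi': "coeff V' j = 0" if "m < j" for j
    using S'(1)[of j] S'(2) z3(3,4) that unfolding V'_def by (cases "j = m + 1") auto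
  have b1: "cf V i n = 0" if "m <= i" for i using hi'[of i] sw[where k = i and l = n] z3(5) that by (cases "i = m") auto
  have b2: "cf V' i m = 0" if "n <= i" for i using hi[of i] sw[where k = m and l = i] z3(5) that by (cases "i = n") auto
  have "coeff V n = 0" by (rule poly_zero_if_roots[OF r]) (use z1 b1 in auto)
  moreover have "coeff V' m = 0" by (rule poly_zero_if_roots[OF s]) (use z2 b2 in auto)
  ultimately have lo: "cf V i j = 0" if "m <= i \<or> n <= j" for i j
    using that hi[of j] hi'[of i] sw[where k = i and l = j] by (cases "i = m"; cases "j = n") auto
  have root: "ax (r i) V = 0" if i: "i < m" for i
  proof (rule poly_zero_if_roots[OF s])
    show "poly (ax (r i) V) (s j) = 0" if "j < n" for j unfolding poly_ax V_def by (rule S3[OF i that])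
    show "coeff (ax (r i) V) j = 0" if "n <= j" for j
    proof -
      have "coeff V j = 0" by (rule poly_eqI) (use lo that in auto)
      then show ?thesis by (simp add: coeff_ax)
    qed
  qed
  have "coeff V j = 0" for j
  proof (rule poly_zero_if_roots[OF r])
    show "poly (coeff V j) (r i) = 0" if "i < m" for i
      using arg_cong[OF root[OF that], of "\<lambda>p. coeff p j"] by (simp add: coeff_ax)
  qed (use lo in auto)
  then have "V = 0" by (intro poly_eqI) simp
  then show ?thesis using dh_inj[OF vh] by (simp add: V_def)
qed

end

section \<open>First order deformations of a tuple of lines\<close>

definition der :: "nat => (nat => complex^3) => (nat => complex^3) => S" where
  "der d L M = (\<Sum>i<d. (\<Prod>j\<in>{..<d} - {i}. lin (L j)) * lin (M i))"

lemma der_homog: "der d L M \<in> homog d"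
  unfolding der_def
proof (rule homog_sum)
  fix i assume "i \<in> {..<d}"
  then have c: "card ({..<d} - {i}) + 1 = d" by simp
  show "(\<Prod>j\<in>{..<d} - {i}. lin (L j)) * lin (M i) \<in> homog d"
    using homog_mult[OF homog_prod_lin[of "{..<d} - {i}" L] homog_lin[of "M i"]] unfolding c by simp
qed

lemma der_add: "der d L (\<lambda>i. M i + M' i) = der d L M + der d L M'"
  by (simp add: der_def lin_add distrib_left sum.distrib)

lemma der_scale: "der d L (\<lambda>i. c *s M i) = pscale c (der d L M)"
  by (simp add: der_def lin_scale pscale_conv_mult sum_distrib_left mult.left_commute)

lemma der_0: "der d L (\<lambda>i. 0) = 0"
  by (simp add: der_def)

lemma der_lincomb: "(\<Sum>k<N. pscale (t k) (der d L (M k))) = der d L (\<lambda>i. \<Sum>k<N. t k *s M k i)"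
  for N :: nat
  by (induction N) (simp_all add: der_0 der_add der_scale)

lemma lookup_poly_const:
  fixes P :: "S poly"
  shows "poly (map_poly (\<lambda>F. lk F n) P) \<epsilon> = lk (poly P (sg 0 \<epsilon>)) n"
proof (induction P)
  case 0
  show ?case by simp
next
  case (pCons F P)
  have "map_poly (\<lambda>F. lk F n) (pCons F P) = pCons (lk F n) (map_poly (\<lambda>F. lk F n) P)" by (simp add: map_poly_pCons)
  then show ?case using pCons by (simp add: lookup_add pscale_conv_mult[symmetric] lookup_pscale)
qed

text \<open>The velocity of a polynomial curve of products of linear forms is a tangent vector as soon as almost all
  points of the curve lie in the given set.\<close>
lemma der_tangent:
  assumes fin: "finite {\<epsilon>. proj_pt (fm d (\<lambda>i. L i + \<epsilon> *s M i)) \<notin> X}"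
  shows "der d L M \<in> tangent_cone_space (homog d) X (fm d L)"
  unfolding tangent_ddir
proof (intro CollectI conjI allI ballI impI der_homog)
  fix r and F :: "(3 \<Rightarrow>\<^sub>0 nat) mpoly" assume F: "F \<in> homog r" and v: "vanish F X"
  define P :: "S poly" where "P = (\<Prod>i<d. [:lin (L i), lin (M i):])"
  define q where "q n = map_poly (\<lambda>F. lk F n) P" for n
  have Pe: "poly P (sg 0 \<epsilon>) = fm d (\<lambda>i. L i + \<epsilon> *s M i)" for \<epsilon>
    by (simp add: P_def fm_def poly_prod lin_add lin_scale pscale_conv_mult mult.commute)
  have P0: "poly P 0 = fm d L" using Pe[of 0] by simp
  have P1: "coeff P 1 = der d L M"
  proof -
    have "coeff P 1 = poly (pderiv P) 0" by (simp add: poly_0_coeff_0 coeff_pderiv)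
    also have "\<dots> = der d L M" by (simp add: P_def pderiv_prod pderiv_pCons poly_sum poly_prod der_def mult.commute)
    finally show ?thesis .
  qed
  have ev: "poly (q n) \<epsilon> = lk (fm d (\<lambda>i. L i + \<epsilon> *s M i)) n" for n \<epsilon>
    unfolding q_def lookup_poly_const Pe ..
  let ?\<Phi> = "subst (\<lambda>c. [:c:]) q F"
  have \<Phi>: "poly ?\<Phi> \<epsilon> = fev F (fm d (\<lambda>i. L i + \<epsilon> *s M i))" for \<epsilon>
    unfolding poly_subst_pCons ev by simp
  have "finite {\<epsilon>. poly ?\<Phi> \<epsilon> ~= 0}"
    by (rule finite_subset[OF _ fin]) (use v \<Phi> in \<open>auto simp: vanish_def\<close>)
  moreover have "pfun (poly ?\<Phi>)" unfolding pfun_def by blast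
  ultimately have "poly ?\<Phi> \<epsilon> = 0" for \<epsilon> using pfun_cofinite_zero by blast
  then have \<Phi>0: "?\<Phi> = 0" using poly_all_0_iff_0 by blast
  define I where "I = kys (der d L M) \<union> (\<Union>k\<le>degree P. kys (coeff P k))"
  have "q n = 0" if "n \<notin> I" for n
  proof (rule poly_eqI)
    fix k
    have "lk (coeff P k) n = 0" using that by (cases "k <= degree P") (auto simp: I_def in_keys_iff coeff_eq_0)
    then show "coeff (q n) k = coeff 0 k" by (simp add: q_def coeff_map_poly)
  qed
  then have "pderiv ?\<Phi> = (\<Sum>n\<in>I. subst (\<lambda>c. [:c:]) q (pderiv_mpoly n F) * pderiv (q n))"
    by (intro derivation_subst[OF chom_poly]) (simp_all add: pderiv_add pderiv_mult pderiv_pCons I_def mult.commute add.commute)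
  then have "0 = (\<Sum>n\<in>I. poly (subst (\<lambda>c. [:c:]) q (pderiv_mpoly n F)) 0 * poly (pderiv (q n)) 0)"
    unfolding \<Phi>0 by (simp add: poly_sum[symmetric] flip: poly_mult)
  also have "\<dots> = (\<Sum>n\<in>I. fev (pderiv_mpoly n F) (fm d L) * lk (der d L M) n)"
  proof (rule sum.cong[OF refl])
    fix n
    have "poly (pderiv (q n)) 0 = lk (der d L M) n"
      using P1 by (simp add: poly_0_coeff_0 coeff_pderiv q_def coeff_map_poly)
    then show "poly (subst (\<lambda>c. [:c:]) q (pderiv_mpoly n F)) 0 * poly (pderiv (q n)) 0 = fev (pderiv_mpoly n F) (fm d L) * lk (der d L M) n"
      unfolding poly_subst_pCons ev by simp
  qed
  also have "\<dots> = ddir (fm d L) (der d L M) F"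
    unfolding ddir_def by (rule sum.mono_neutral_right) (auto simp: I_def in_keys_iff)
  finally show "ddir (fm d L) (der d L M) F = 0" by simp
qed

section \<open>Adapted coordinates for a pair of pencils\<close>

lemma tri_join: "tri u v (cr (cr u u') (cr v v')) = - (tri u u' v * tri v v' u)"
  by (simp add: tri_expand algebra_simps)

lemma pen_two_parameter:
  assumes "2 <= m" "m + 2 <= d" and K: "!!i. i < d ==> K i = x i *s (if i < m then u else v) + y i *s w"
  shows "pen m d K"
  unfolding pen_def
proof (intro allI impI)
  fix i assume i: "i < d"
  have t: "tri (x1 *s u + y1 *s w) (x2 *s u + y2 *s w) (x3 *s u + y3 *s w) = 0" for x1 x2 x3 y1 y2 y3 and u :: "complex^3"
    by (simp add: tri_expand algebra_simps)
  have "bs m i < d" "bs m i + 1 < d" "(bs m i < m) = (i < m)" "(bs m i + 1 < m) = (i < m)" using assms(1,2) i by (auto simp: bs_def)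
  then show "tri (K (bs m i)) (K (bs m i + 1)) (K i) = 0" using t i by (simp add: K)
qed

locale pencil_frame = frame +
  fixes m d :: nat and L :: "nat => complex^3" and \<kappa> \<sigma> :: "nat => complex"
  assumes md: "2 <= m" "m + 2 <= d" and gL: "gt m d L"
    and L: "!!i. i < d ==> \<kappa> i ~= 0 & L i = \<kappa> i *s ((if i < m then a else b) + \<sigma> i *s w)"

lemma pencil_frame_exists:
  assumes g: "gt m d L" and md: "2 <= m" "m + 2 <= d"
  obtains a b w ca cb cw \<kappa> \<sigma> where "pencil_frame a b w ca cb cw m d L \<kappa> \<sigma>"
proof -
  define w where "w = axis_w m L"
  note T = gt_tri[OF g md]
  have t: "tri (L 0) (L 1) (L m) ~= 0" "tri (L m) (L (m + 1)) (L 0) ~= 0"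
    using T[of m] T[of 0] md by (simp_all add: ob_def)
  have tw: "tri (L 0) (L m) w ~= 0" unfolding w_def axis_w_def tri_join using t by simp
  have nz: "cr (L 0) (L 1) ~= 0" "cr (L m) (L (m + 1)) ~= 0" using t cr_zero_iff[of "L 0" "L 1"] cr_zero_iff[of "L m" "L (m + 1)"] by blast+
  have ob: "\<exists>\<kappa> \<sigma>. \<kappa> ~= 0 & L i = \<kappa> *s ((if i < m then L 0 else L m) + \<sigma> *s w)" if i: "i < d" for i
  proof -
    let ?p = "if i < m then L 0 else L m" and ?n = "cr (L (bs m i)) (L (bs m i + 1))"
    have n: "?n ~= 0" using nz by (simp add: bs_def)
    have "dot ?n ?p = 0" by (simp add: bs_def dot_def algebra_simps)
    moreover have dw: "dot ?n w = 0" unfolding w_def axis_w_def by (simp add: bs_def)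
    moreover have "dot ?n (L i) = 0" using gt_pen[OF g md i] by (simp add: tri_def)
    ultimately have tz: "tri ?p w (L i) = 0" by (rule coplanar[OF n])
    have cz: "cr ?p w ~= 0"
    proof
      assume "cr ?p w = 0"
      then have "tri ?p w (if i < m then L m else L 0) = 0" by (simp add: tri_def dot_def)
      then have "tri (L 0) (L m) w = 0" using tri_cyc tri_swap by (metis neg_equal_0_iff_equal)
      then show False using tw by simp
    qed
    obtain \<alpha> \<beta> where ab: "L i = \<alpha> *s ?p + \<beta> *s w" using span_if_tri[OF cz tz] .
    have dwo: "dot (cr (L (ob m i)) (L (ob m i + 1))) w = 0" unfolding w_def axis_w_def by (simp add: ob_def)
    have "\<alpha> ~= 0"
    proof
      assume "\<alpha> = 0"
      then have "tri (L (ob m i)) (L (ob m i + 1)) (L i) = \<beta> * dot (cr (L (ob m i)) (L (ob m i + 1))) w"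
        unfolding tri_def ab by (simp add: dot_scale)
      then show False using T[OF i] dwo by simp
    qed
    then have "L i = \<alpha> *s (?p + (\<beta> / \<alpha>) *s w)" unfolding ab by (simp add: vec3_eq_iff field_simps)
    then show ?thesis using \<open>\<alpha> ~= 0\<close> by blast
  qed
  then have "ALL i. \<exists>\<kappa> \<sigma>. i < d --> \<kappa> ~= 0 & L i = \<kappa> *s ((if i < m then L 0 else L m) + \<sigma> *s w)" by blast
  then obtain \<kappa> \<sigma> where ks: "!!i. i < d ==> \<kappa> i ~= 0 & L i = \<kappa> i *s ((if i < m then L 0 else L m) + \<sigma> i *s w)" by metis
  obtain ca cb cw where dbs: "dual_basis (L 0) (L m) w ca cb cw" using dual_basis_exists[OF tw] .
  then have "pencil_frame (L 0) (L m) w ca cb cw m d L \<kappa> \<sigma>"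
    unfolding pencil_frame_def pencil_frame_axioms_def frame_def using dbs md g ks by blast
  then show thesis by (rule that)
qed

context pencil_frame
begin

definition lf :: "nat => bp" where
  "lf i = (if i < m then lx [:\<sigma> i, 1:] else ly [:\<sigma> i, 1:])"

lemma dh_L: "i < d ==> dh (lin (L i)) = cst (\<kappa> i) * lf i"
proof -
  assume "i < d"
  then have "dh (lin (L i)) = cst (\<kappa> i) * ((if i < m then xv else yv) + cst (\<sigma> i))"
    using L by (simp add: lin_scale lin_add dh_simps dh_basis cst_simps algebra_simps)
  also have "(if i < m then xv else yv) + cst (\<sigma> i) = lf i"
    by (simp add: lf_def lx_def ly_def map_poly_pCons xv_def yv_def cst_def one_pCons)
  finally show ?thesis .
qed

lemma sigma_distinct:
  assumes "i < d" "j < d" "i ~= j" "(i < m) = (j < m)"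
  shows "\<sigma> i ~= \<sigma> j"
proof
  assume e: "\<sigma> i = \<sigma> j"
  have "cr (c *s u) (c' *s u) = 0" for c c' and u :: "complex^3" by (simp add: vec3_eq_iff algebra_simps)
  moreover have "L i = \<kappa> i *s ((if j < m then a else b) + \<sigma> j *s w)" "L j = \<kappa> j *s ((if j < m then a else b) + \<sigma> j *s w)"
    using L[OF assms(1)] L[OF assms(2)] assms(4) e by simp_all
  ultimately have "cr (L i) (L j) = 0" by metis
  then show False using gt_cr[OF gL md assms(1-3)] by simp
qed

abbreviation "rr \<equiv> \<lambda>i. - \<sigma> i"
abbreviation "ss \<equiv> \<lambda>j. - \<sigma> (m + j)"

lemma lf_prod: "(\<Prod>i<d. lf i) = lx (pr m rr) * ly (pr (d - m) ss)"
proof -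
  have "{..<d} = {..<m} \<union> {m..<d}" "{..<m} \<inter> {m..<d} = {}" using md by auto
  then have "(\<Prod>i<d. lf i) = (\<Prod>i<m. lf i) * (\<Prod>i\<in>{m..<d}. lf i)" by (simp add: prod.union_disjoint)
  also have "(\<Prod>i<m. lf i) = lx (pr m rr)" by (simp add: pr_def lx_prod lf_def)
  also have "(\<Prod>i\<in>{m..<d}. lf i) = (\<Prod>j<d - m. lf (m + j))"
    using prod.shift_bounds_nat_ivl[of lf 0 m "d - m"] md by (simp add: lessThan_atLeast0 add.commute)
  also have "\<dots> = ly (pr (d - m) ss)" by (simp add: pr_def ly_prod lf_def)
  finally show ?thesis .
qed

definition CC :: complex where "CC = (\<Prod>i<d. \<kappa> i)"

lemma cst_prod: "cst (\<Prod>i\<in>A. c i) = (\<Prod>i\<in>A. cst (c i))"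
  by (induction A rule: infinite_finite_induct) (simp_all add: cst_simps)

lemma CC_nz: "CC ~= 0"
  using L by (simp add: CC_def)

lemma form: "two_pencil_form a b w ca cb cw m (d - m) rr ss CC (fm d L)"
proof -
  have "dh (fm d L) = (\<Prod>i<d. cst (\<kappa> i) * lf i)" unfolding fm_def dh_simps by (intro prod.cong) (simp_all add: dh_L)
  also have "\<dots> = cst CC * (lx (pr m rr) * ly (pr (d - m) ss))"
    by (simp add: prod.distrib lf_prod CC_def cst_prod)
  finally have e: "dh (fm d L) = cst CC * (lx (pr m rr) * ly (pr (d - m) ss))" .
  have "inj_on rr {..<m}"
  proof (rule inj_onI, rule ccontr)
    fix x y assume "x \<in> {..<m}" "y \<in> {..<m}" "- \<sigma> x = - \<sigma> y" "x ~= y"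
    then show False using sigma_distinct[of x y] md by simp
  qed
  moreover have "inj_on ss {..<d - m}"
  proof (rule inj_onI, rule ccontr)
    fix x y assume "x \<in> {..<d - m}" "y \<in> {..<d - m}" "- \<sigma> (m + x) = - \<sigma> (m + y)" "x ~= y"
    then show False using sigma_distinct[of "m + x" "m + y"] md by simp
  qed
  ultimately show ?thesis using md CC_nz e fm_homog[of d L] by unfold_locales simp_all
qed

lemma dh_der:
  "dh (der d L (\<lambda>i. \<kappa> i *s q i)) = cst CC * (\<Sum>i<d. (\<Prod>j\<in>{..<d} - {i}. lf j) * dh (lin (q i)))"
proof -
  have "dh ((\<Prod>j\<in>{..<d} - {i}. lin (L j)) * lin (\<kappa> i *s q i)) = cst CC * ((\<Prod>j\<in>{..<d} - {i}. lf j) * dh (lin (q i)))" if i: "i < d" for i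
  proof -
    have "dh (\<Prod>j\<in>{..<d} - {i}. lin (L j)) = (\<Prod>j\<in>{..<d} - {i}. cst (\<kappa> j)) * (\<Prod>j\<in>{..<d} - {i}. lf j)"
      unfolding dh_simps prod.distrib[symmetric] by (intro prod.cong) (simp_all add: dh_L)
    moreover have "cst CC = cst (\<kappa> i) * (\<Prod>j\<in>{..<d} - {i}. cst (\<kappa> j))"
      unfolding CC_def cst_prod using i by (subst prod.remove[of _ i]) auto
    ultimately show ?thesis by (simp add: dh_simps lin_scale algebra_simps)
  qed
  then show ?thesis unfolding der_def dh_simps sum_distrib_left by (intro sum.cong) auto
qed

text \<open>The directions of the deformations: tilting the two pencils, moving the common line, moving the single
  lines inside their pencils, and rescaling.\<close>
definition mv :: "nat => nat => complex^3" where
  "mv k i = (if k < d then (if i = k then w else 0)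
     else if k = d then (if i < m then b else 0) else if k = d + 1 then (if i < m then 0 else a)
     else if k = d + 2 then \<sigma> i *s b else if k = d + 3 then \<sigma> i *s a
     else (if i = 0 then a + \<sigma> 0 *s w else 0))"

definition ee :: "nat => S" where
  "ee k = der d L (\<lambda>i. \<kappa> i *s mv k i)"

lemma mv_pen: "pen m d (\<lambda>i. L i + \<epsilon> *s (\<kappa> i *s mv k i))"
proof -
  let ?K = "\<lambda>i. L i + \<epsilon> *s (\<kappa> i *s mv k i)"
  have l: "?K i = \<kappa> i *s ((if i < m then a else b) + \<sigma> i *s w + \<epsilon> *s mv k i)" if "i < d" for i
    using L[OF that] by (simp add: vec3_eq_iff algebra_simps)
  note P = pen_two_parameter[OF md]
  consider "k < d" | "k = d" | "k = d + 1" | "k = d + 2" | "k = d + 3" | "k > d + 3" by linarith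
  then show ?thesis
  proof cases
    case 1
    show ?thesis
      by (rule P[of _ \<kappa> a b "\<lambda>i. \<kappa> i * (\<sigma> i + (if i = k then \<epsilon> else 0))" w])
         (simp only: l, use 1 in \<open>auto simp: mv_def vec3_eq_iff algebra_simps\<close>)
  next
    case 2
    show ?thesis by (rule P[of _ \<kappa> "a + \<epsilon> *s b" b "\<lambda>i. \<kappa> i * \<sigma> i" w]) (simp only: l, use 2 in \<open>auto simp: mv_def vec3_eq_iff algebra_simps\<close>)
  next
    case 3
    show ?thesis by (rule P[of _ \<kappa> a "b + \<epsilon> *s a" "\<lambda>i. \<kappa> i * \<sigma> i" w]) (simp only: l, use 3 in \<open>auto simp: mv_def vec3_eq_iff algebra_simps\<close>)
  next
    case 4
    show ?thesis by (rule P[of _ \<kappa> a b "\<lambda>i. \<kappa> i * \<sigma> i" "w + \<epsilon> *s b"]) (simp only: l, use 4 in \<open>auto simp: mv_def vec3_eq_iff algebra_simps\<close>)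
  next
    case 5
    show ?thesis by (rule P[of _ \<kappa> a b "\<lambda>i. \<kappa> i * \<sigma> i" "w + \<epsilon> *s a"]) (simp only: l, use 5 in \<open>auto simp: mv_def vec3_eq_iff algebra_simps\<close>)
  next
    case 6
    show ?thesis
      by (rule P[of _ "\<lambda>i. \<kappa> i * (if i = 0 then 1 + \<epsilon> else 1)" a b "\<lambda>i. \<kappa> i * \<sigma> i * (if i = 0 then 1 + \<epsilon> else 1)" w])
         (simp only: l, use 6 md in \<open>auto simp: mv_def vec3_eq_iff algebra_simps\<close>)
  qed
qed

lemma ee_tangent: "ee k \<in> tangent_cone_space (homog d) (XX m d) (fm d L)"
  unfolding ee_def
proof (rule der_tangent)
  let ?\<Lambda> = "\<lambda>\<epsilon> i. L i + \<epsilon> *s (\<kappa> i *s mv k i)"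
  have "vcurve d ?\<Lambda>" unfolding vcurve_def by (auto intro!: pfun_intros)
  then have "finite {\<epsilon>. \<not> gt m d (?\<Lambda> \<epsilon>)}"
  proof (rule finite_not_gt[OF _ md])
    show "pen m d (?\<Lambda> \<epsilon>)" for \<epsilon> by (rule mv_pen)
    show "gt m d (?\<Lambda> 0)" by (simp add: gL)
  qed
  then show "finite {\<epsilon>. proj_pt (fm d (?\<Lambda> \<epsilon>)) \<notin> XX m d}"
    by (rule rev_finite_subset) (use XX_mem[OF md] in auto)
qed

text \<open>Restricting a relation to a single line of the arrangement kills the deformations of all other lines.\<close>
lemma ee_independent:
  assumes z: "(\<Sum>k<d + 5. pscale (t k) (ee k)) = 0"
  shows "\<forall>k<d + 5. t k = 0"
proof -
  define q where "q i = (\<Sum>k<d + 5. t k *s mv k i)" for i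
  have swap: "(\<lambda>i. \<Sum>k<d + 5. t k *s (\<kappa> i *s mv k i)) = (\<lambda>i. \<kappa> i *s q i)"
    by (rule ext) (simp add: q_def vec3_eq_iff sum_distrib_left ac_simps)
  have "der d L (\<lambda>i. \<kappa> i *s q i) = 0" using z unfolding ee_def der_lincomb swap .
  then have "cst CC * (\<Sum>i<d. (\<Prod>j\<in>{..<d} - {i}. lf j) * dh (lin (q i))) = 0"
    unfolding dh_der[symmetric] by (simp add: dh_simps)
  then have G: "(\<Sum>i<d. (\<Prod>j\<in>{..<d} - {i}. lf j) * dh (lin (q i))) = 0" using CC_nz by (simp add: cst_def)
  have q: "q i = t i *s w + t d *s (if i < m then b else 0) + t (d + 1) *s (if i < m then 0 else a)
      + (t (d + 2) * \<sigma> i) *s b + (t (d + 3) * \<sigma> i) *s a + t (d + 4) *s (if i = 0 then a + \<sigma> 0 *s w else 0)" if i: "i < d" for i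
  proof -
    have "(\<Sum>k<d. t k *s mv k i) = (\<Sum>k\<in>{i}. t k *s mv k i)"
      by (rule sum.mono_neutral_right) (use i in \<open>auto simp: mv_def\<close>)
    then have "(\<Sum>k<d. t k *s mv k i) = t i *s w" using i by (simp add: mv_def)
    moreover have "q i = (\<Sum>k<d. t k *s mv k i) + t d *s mv d i + t (d + 1) *s mv (d + 1) i + t (d + 2) *s mv (d + 2) i
        + t (d + 3) *s mv (d + 3) i + t (d + 4) *s mv (d + 4) i"
      by (simp add: q_def eval_nat_numeral)
    ultimately show ?thesis by (simp add: mv_def vscale_mult)
  qed
  have dots: "dot w cw = 1" "dot a cw = 0" "dot b cw = 0" "dot a ca = 1" "dot b ca = 0" "dot w ca = 0" "dot b cb = 1" "dot a cb = 0" "dot w cb = 0"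
    using db by (simp_all add: dual_basis_def)
  have d0: "dot 0 u = 0" for u by (simp add: dot_def)
  define nx where "nx i = t (d + 3) * \<sigma> i + (if i < m then 0 else t (d + 1)) + (if i = 0 then t (d + 4) else 0)" for i
  define ny where "ny i = t (d + 2) * \<sigma> i + (if i < m then t d else 0)" for i
  define nw where "nw i = t i + (if i = 0 then t (d + 4) * \<sigma> 0 else 0)" for i
  have dq: "dh (lin (q i)) = cst (nw i) + cst (nx i) * xv + cst (ny i) * yv" if i: "i < d" for i
    unfolding dh_lin q[OF i] by (auto simp: dot_add dot_scale dots d0 nx_def ny_def nw_def ac_simps)
  have other: "(\<Sum>i<d. E i) = E k" if "k < d" "!!i. i < d ==> i ~= k ==> E i = 0" for k and E :: "nat => complex poly"
  proof -
    have "(\<Sum>i<d. E i) = (\<Sum>i\<in>{k}. E i)" by (rule sum.mono_neutral_right) (use that in auto)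
    then show ?thesis by simp
  qed
  have axs: "ax x (\<Sum>i\<in>A. E i) = (\<Sum>i\<in>A. ax x (E i))" "ax x (\<Prod>i\<in>A. E i) = (\<Prod>i\<in>A. ax x (E i))" for x and A :: "nat set" and E
    by (induction A rule: infinite_finite_induct) (simp_all add: ax_add ax_mult, simp_all add: ax_def one_pCons map_poly_pCons)
  have lin1: "ny k = 0 & nw k + nx k * rr k = 0" if k: "k < m" for k
  proof -
    have kd: "k < d" using k md by simp
    have lk0: "ax (rr k) (lf k) = 0" using k by (simp add: lf_def ax_lx)
    have lnz: "ax (rr k) (lf j) ~= 0" if "j < d" "j ~= k" for j
    proof (cases "j < m")
      case True
      then show ?thesis using sigma_distinct[OF that(1) kd that(2)] k by (simp add: lf_def ax_lx)
    qed (simp add: lf_def ax_ly)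
    have "0 = ax (rr k) (\<Sum>i<d. (\<Prod>j\<in>{..<d} - {i}. lf j) * dh (lin (q i)))" unfolding G by (simp add: ax_def)
    also have "\<dots> = (\<Sum>i<d. (\<Prod>j\<in>{..<d} - {i}. ax (rr k) (lf j)) * ax (rr k) (dh (lin (q i))))" by (simp add: axs ax_mult)
    also have "\<dots> = (\<Prod>j\<in>{..<d} - {k}. ax (rr k) (lf j)) * ax (rr k) (dh (lin (q k)))"
      by (rule other[OF kd]) (use lk0 kd in \<open>auto intro!: prod_zero\<close>)
    finally have "ax (rr k) (dh (lin (q k))) = 0" using lnz by auto
    moreover have "ax (rr k) (dh (lin (q k))) = [:nw k + nx k * rr k, ny k:]"
      unfolding dq[OF kd] by (rule poly_eqI) (auto simp: coeff_ax cst_def xv_def yv_def coeff_pCons split: nat.splits)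
    ultimately show ?thesis by simp
  qed
  have pys: "poly (\<Sum>i\<in>A. E i) y = (\<Sum>i\<in>A. poly (E i) y)" for y and A :: "nat set" and E :: "nat => bp"
    by (rule poly_sum)
  have lin2: "nx k = 0 & nw k + ny k * - \<sigma> k = 0" if k: "m <= k" "k < d" for k
  proof -
    let ?y = "[:- \<sigma> k:]"
    have lk0: "poly (lf k) ?y = 0" using k by (simp add: lf_def ay_ly)
    have lnz: "poly (lf j) ?y ~= 0" if "j < d" "j ~= k" for j
    proof (cases "j < m")
      case False
      then show ?thesis using sigma_distinct[OF that(1) k(2) that(2)] k by (simp add: lf_def ay_ly)
    qed (simp add: lf_def ay_lx)
    have "0 = poly (\<Sum>i<d. (\<Prod>j\<in>{..<d} - {i}. lf j) * dh (lin (q i))) ?y" unfolding G by simp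
    also have "\<dots> = (\<Sum>i<d. (\<Prod>j\<in>{..<d} - {i}. poly (lf j) ?y) * poly (dh (lin (q i))) ?y)" by (simp add: poly_sum poly_prod)
    also have "\<dots> = (\<Prod>j\<in>{..<d} - {k}. poly (lf j) ?y) * poly (dh (lin (q k))) ?y"
      by (rule other[OF k(2)]) (use lk0 k in \<open>auto intro!: prod_zero\<close>)
    finally have "poly (dh (lin (q k))) ?y = 0" using lnz by auto
    moreover have "poly (dh (lin (q k))) ?y = [:nw k + ny k * - \<sigma> k, nx k:]"
      unfolding dq[OF k(2)] by (simp add: cst_def xv_def yv_def)
    ultimately show ?thesis by simp
  qed
  have two: "x = 0 & y = 0" if "x * \<sigma> i + y = 0" "x * \<sigma> j + y = 0" "\<sigma> i ~= \<sigma> j" for x y :: complex and i j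
  proof -
    have "x * (\<sigma> i - \<sigma> j) = (x * \<sigma> i + y) - (x * \<sigma> j + y)" by (simp add: algebra_simps)
    then have "x = 0" using that by simp
    then show ?thesis using that(1) by simp
  qed
  have "t (d + 2) = 0 & t d = 0"
    by (rule two[of _ 0 _ 1]) (use lin1[of 0] lin1[of 1] md sigma_distinct[of 0 1] in \<open>auto simp: ny_def\<close>)
  moreover have "t (d + 3) = 0 & t (d + 1) = 0"
    by (rule two[of _ m _ "m + 1"]) (use lin2[of m] lin2[of "m + 1"] md sigma_distinct[of m "m + 1"] in \<open>auto simp: nx_def\<close>)
  ultimately have t4: "t (d + 2) = 0" "t d = 0" "t (d + 3) = 0" "t (d + 1) = 0" by simp_all
  have low: "t k = 0" if k: "k < d" for k
  proof (cases "k < m")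
    case True
    then show ?thesis using lin1[OF True] t4 by (auto simp: nx_def nw_def split: if_splits)
  next
    case False
    then show ?thesis using lin2[of k] k t4 md by (auto simp: ny_def nw_def split: if_splits)
  qed
  have e: "(\<Sum>k<d + 5. pscale (t k) (ee k)) = (\<Sum>k<d. pscale (t k) (ee k)) + pscale (t d) (ee d) + pscale (t (d + 1)) (ee (d + 1))
      + pscale (t (d + 2)) (ee (d + 2)) + pscale (t (d + 3)) (ee (d + 3)) + pscale (t (d + 4)) (ee (d + 4))"
    by (simp add: eval_nat_numeral)
  have "pscale (t (d + 4)) (ee (d + 4)) = 0" using z unfolding e t4 by (simp add: low)
  moreover have "ee (d + 4) = fm d L"
  proof -
    have "ee (d + 4) = (\<Sum>i\<in>{0}. (\<Prod>j\<in>{..<d} - {i}. lin (L j)) * lin (\<kappa> i *s mv (d + 4) i))"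
      unfolding ee_def der_def by (rule sum.mono_neutral_right) (use md in \<open>auto simp: mv_def\<close>)
    also have "\<kappa> 0 *s mv (d + 4) 0 = L 0" using L[of 0] md by (simp add: mv_def)
    then have "(\<Sum>i\<in>{0}. (\<Prod>j\<in>{..<d} - {i}. lin (L j)) * lin (\<kappa> i *s mv (d + 4) i)) = lin (L 0) * (\<Prod>j\<in>{..<d} - {0}. lin (L j))"
      by (simp add: mult.commute)
    also have "\<dots> = fm d L" unfolding fm_def by (rule prod.remove[symmetric]) (use md in auto)
    finally show ?thesis .
  qed
  ultimately have t5: "t (d + 4) = 0" using fm_nz[OF gL md] by simp
  show ?thesis
  proof (intro allI impI)
    fix k assume "k < d + 5"
    then have "k < d \<or> k = d \<or> k = d + 1 \<or> k = d + 2 \<or> k = d + 3 \<or> k = d + 4" by linarith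
    then show "t k = 0" using low t4 t5 by auto
  qed
qed

end

lemma XX_two_pencil_form:
  assumes md: "2 <= m" "m + 2 <= d" and x: "proj_pt g \<in> XX m d"
  shows "EX a b w ca cb cw r s C. two_pencil_form a b w ca cb cw m (d - m) r s C g"
proof -
  obtain K where K: "gt m d K" "g = fm d K" using x XX_mem[OF md] by blast
  obtain a b w ca cb cw \<kappa> \<sigma> where "pencil_frame a b w ca cb cw m d K \<kappa> \<sigma>" using pencil_frame_exists[OF K(1) md] .
  then interpret pencil_frame a b w ca cb cw m d K \<kappa> \<sigma> .
  show ?thesis unfolding K(2) using form by blast
qed

lemma ddir_add_dir:
  "ddir f (u + v) F = ddir f u F + ddir f v F" "ddir f (pscale c v) F = c * ddir f v F"
proof -
  have s: "ddir f v F = (\<Sum>i\<in>A. fev (pderiv_mpoly i F) f * lk v i)" if "finite A" "kys v \<subseteq> A" for A v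
    unfolding ddir_def by (rule sum.mono_neutral_left) (use that in \<open>auto simp: in_keys_iff\<close>)
  let ?A = "kys u \<union> kys v"
  have "kys (u + v) \<subseteq> ?A" by (rule keys_add)
  then show "ddir f (u + v) F = ddir f u F + ddir f v F"
    using s[of ?A "u + v"] s[of ?A u] s[of ?A v] by (simp add: lookup_add distrib_left sum.distrib)
  have "kys (pscale c v) \<subseteq> kys v" by (auto simp: in_keys_iff lookup_pscale)
  then show "ddir f (pscale c v) F = c * ddir f v F"
    using s[of "kys v" "pscale c v"] s[of "kys v" v]
    by (simp add: lookup_pscale sum_distrib_left mult.left_commute)
qed

lemma tangent_subspace: "VS.subspace (tangent_cone_space (homog d) X f)"
proof (rule VS.subspaceI)
  show "0 \<in> tangent_cone_space (homog d) X f" by (simp add: tangent_ddir ddir_def)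
qed (auto simp: tangent_ddir ddir_add_dir intro: homog_add homog_pscale)

text \<open>The \<open>d + 5\<close> coordinates bound the dimension from above, the \<open>d + 5\<close> deformations from below.\<close>
lemma tangent_dimension:
  assumes md: "2 <= m" "m + 2 <= d" and g: "gt m d L"
  shows "VS.dim (tangent_cone_space (homog d) (XX m d) (fm d L)) = d + 5"
proof -
  obtain a b w ca cb cw \<kappa> \<sigma> where "pencil_frame a b w ca cb cw m d L \<kappa> \<sigma>" using pencil_frame_exists[OF g md] .
  then interpret pencil_frame a b w ca cb cw m d L \<kappa> \<sigma> .
  interpret F: two_pencil_form a b w ca cb cw m "d - m" rr ss CC "fm d L" by (rule form)
  have dd: "m + (d - m) = d" using md by simp
  let ?T = "tangent_cone_space (homog d) (XX m d) (fm d L)"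
  show ?thesis
  proof (rule VS.dim_of_frame[OF tangent_subspace, of "d + 5" ee])
    show "ee i \<in> ?T" for i by (rule ee_tangent)
    show "(\<Sum>i<d + 5. pscale (x i) (ee i)) = 0 ==> \<forall>i<d + 5. x i = 0" for x by (rule ee_independent)
    fix v assume v: "v \<in> ?T"
    define y where "y i = (if i < d + 5 then ee i else v)" for i
    obtain c where c: "\<exists>i\<in>{..<Suc (d + 5)}. c i ~= 0" "\<forall>k\<in>{..<d + 5}. (\<Sum>i<Suc (d + 5). c i * F.Phi k (y i)) = 0"
      using linear_dependence[of "{..<Suc (d + 5)}" "{..<d + 5}" "\<lambda>i k. F.Phi k (y i)"] by auto
    let ?u = "\<Sum>i<Suc (d + 5). pscale (c i) (y i)"
    have P0: "F.Phi k 0 = 0" for k using F.Phi_pscale[of k 0 0] by simp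
    have Ps: "F.Phi k (\<Sum>i<N. pscale (c i) (y i)) = (\<Sum>i<N. c i * F.Phi k (y i))" for k and N :: nat
      by (induction N) (simp_all add: P0 F.Phi_add F.Phi_pscale)
    have "?u \<in> ?T"
      by (intro VS.subspace_sum[OF tangent_subspace] VS.subspace_scale[OF tangent_subspace]) (simp add: y_def v ee_tangent)
    then have "?u = 0"
      using F.Phi_injective[of "XX m d" ?u] XX_two_pencil_form[OF md] c(2) unfolding dd Ps by simp
    moreover have "(\<Sum>i<d + 5. pscale (c i) (y i)) = (\<Sum>i<d + 5. pscale (c i) (ee i))" "y (d + 5) = v"
      by (simp_all add: y_def)
    ultimately have e: "(\<Sum>i<d + 5. pscale (c i) (ee i)) + pscale (c (d + 5)) v = 0" by (simp only: sum.lessThan_Suc)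
    have "c (d + 5) ~= 0"
    proof
      assume z: "c (d + 5) = 0"
      then have "\<forall>i<d + 5. c i = 0" using e by (intro ee_independent) simp
      moreover obtain i where "i < Suc (d + 5)" "c i ~= 0" using c(1) by auto
      ultimately show False using z by (metis less_Suc_eq)
    qed
    moreover have "pscale (c (d + 5)) v = (\<Sum>i<d + 5. pscale (- c i) (ee i))"
      using e by (simp add: VS.scale_minus_left sum_negf eq_neg_iff_add_eq_0 add.commute)
    ultimately show "EX x c. c ~= 0 & pscale c v = (\<Sum>i<d + 5. pscale (x i) (ee i))"
      by (intro exI[of _ "\<lambda>i. - c i"] exI[of _ "c (d + 5)"] conjI)
  qed
qed

section \<open>Generic intersections of two pencils\<close>

theorem proposition4p9:
  fixes m1 m2 d :: nat
  assumes "2 \<le> m1" and "m1 \<le> m2" and "d = m1 + m2"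
  shows "(smooth_subvariety (homog d) (arr_space_lattice d (L_tilde m1 m2)) \<and>
          irreducible_in (zariski (homog d)) (arr_space_lattice d (L_tilde m1 m2)) \<and>
          krull_dim (subtopology (zariski (homog d)) (arr_space_lattice d (L_tilde m1 m2)))
            = enat (d + 4)) \<and>
         int (tau (L_tilde m1 m2)) = (int d - 1)\<^sup>2 - int m1 * int m2 + 1 \<and>
         (\<forall>f. proj_pt f \<in> arr_space_lattice d (L_tilde m1 m2) \<longrightarrow> mdr f = m1) \<and>
         free_arr_space d \<inter> arr_space_lattice d (L_tilde m1 m2) = {}"
proof -
  have md: "2 <= m1" "m1 + 2 <= d" and m2: "2 <= m2" "d - m1 = m2" using assms by simp_all
  let ?X = "XX m1 d"
  have X: "arr_space_lattice d (L_tilde m1 m2) = ?X"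
    unfolding assms(3) by (rule arr_space_eq_XX) (use assms in simp_all)
  note sub = XX_sub[OF md]
  have form: "EX a b w ca cb cw r s C. two_pencil_form a b w ca cb cw m1 m2 r s C g" if "proj_pt g \<in> ?X" for g
    using XX_two_pencil_form[OF md that] unfolding m2 .
  have smooth: "smooth_subvariety (homog d) ?X"
    unfolding smooth_subvariety_def
  proof (intro conjI allI impI XX_locally_closed[OF md])
    fix f assume f: "proj_pt f \<in> ?X"
    then obtain L where L: "gt m1 d L" "f = fm d L" using XX_mem[OF md] by blast
    have ld: "local_dim (subtopology (zariski (homog d)) ?X) (proj_pt f) = enat (d + 4)"
      by (rule XX_dimension(2)[OF md f])
    have td: "vector_space.dim pscale (tangent_cone_space (homog d) ?X f) = d + 5"
      unfolding L(2) by (rule tangent_dimension[OF md L(1)])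
    show "enat (vector_space.dim pscale (tangent_cone_space (homog d) ?X f))
        = local_dim (subtopology (zariski (homog d)) ?X) (proj_pt f) + 1"
      unfolding ld td by (simp add: one_enat_def)
  qed
  have "gt m1 d (PL m1 std_par)" by (rule gt_std[OF md])
  then have ne: "?X ~= {}" unfolding XX_def by blast
  have irr: "irreducible_in (zariski (homog d)) ?X"
    using irreducible_in_sub_zariski[OF cone_homog subset_refl sub] XX_prime[OF md] ne
    unfolding zariski_as_subtopology[OF cone_homog] by blast
  have mdr: "mdr f = m1" if "proj_pt f \<in> ?X" for f
    using form[OF that] two_pencil_form.mdr_value assms(2) by blast
  have "free_arr_space d \<inter> ?X = {}"
  proof (rule ccontr)
    assume "free_arr_space d \<inter> ?X ~= {}"
    then obtain f where f: "free_arrangement f" "proj_pt f \<in> ?X" unfolding free_arr_space_def by blast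
    then show False using form[OF f(2)] two_pencil_form.not_free assms(2) by blast
  qed
  then show ?thesis unfolding X using smooth irr XX_dimension(1)[OF md] mdr tau_value assms by simp
qed

end
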